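(* Let $\Omega=\mathbb R\times[0,H]$, let $u\in C^1(\Omega)$ be a percolating flow with tubes $D_j^\pm=\{\rho\in[c_j-h_j,c_j+h_j]\}$ as described in the context, and let $f$ be of either general KPP type or ignition type. Let $T(x,y,t)$ solve $$T_t+u\cdot\nabla T=\kappa\Delta T+\frac{v_0^2}{\kappa}f(T)\ \text{ in }\Omega,\qquad T(x,y,0)=T_0(x,y),$$ with $T\to1$ as $x\to-\infty$, $T\to0$ as $x\to+\infty$, and either Neumann or periodic boundary conditions in $y$, where for some $\lambda>0$ the initial data satisfies $T_0=1-O(e^{\lambda x})$ for $x<0$, $T_0=O(e^{-\lambda x})$ for $x>0$, $|\nabla T_0|=O(e^{-\lambda|x|})$. Then $$\lim_{t\to\infty}\langle V\rangle_t\ge C\left(v_0+\sum_j\left(1+\frac l{h_j}\right)^{-1}\int_{c_j-h_j}^{c_j+h_j}|u(\rho,\xi)|E_1(\rho,\xi)\frac{d\rho}H\right),\qquad l=\frac\kappa{v_0},$$ where the sum is over all tubes (with $c_j,h_j$ those of the corresponding tube) and the constant $C>0$ depends only on the nonlinearity $f$ and on the constant $K$ in the bounds on the streamline coordinates in the context. (The integrand is independent of $\xi$.)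
   Context: $\kappa,v_0,H>0$ are constants. The nonlinearity $f\in C^1[0,1]$ satisfies $f(0)=f(1)=0$, $f\ge0$ on $(0,1)$, $f\not\equiv0$. General KPP type: $f>0$ on $(0,1)$. Ignition type: for some $\theta_0\in(0,1)$, $f=0$ on $[0,\theta_0]$ and at $1$, $f>0$ on $(\theta_0,1)$. Neumann conditions: $T_y=0$ at $y=0,H$; periodic conditions: $T(x,y+H,t)=T(x,y,t)$. The temperature satisfies $0\le T\le1$. Bulk burning rate and time average: $V(t)=\int_\Omega T_t\frac{dx\,dy}{H}$, $\langle V\rangle_t=\frac1t\int_0^tV(s)\,ds$. Percolating flow: $u=(u_1,u_2)\in C^1(\Omega)$ is time independent, $\nabla\cdot u=0$, $\int_0^Hu_1(x,y)\,dy=0$, and $u$ is periodic in space. There are finitely many regions (tubes) $D_j^+$ and $D_j^-$, $j=1,\dots,N$, each bounded by streamlines of $u$, such that the projection onto the $x$-axis of each streamline contained in $D_j^\pm$ covers the whole real line (the projection need not be one-to-one). Inside each tube there is a one-to-one $C^2$ change of coordinates $(x,y)\to(\rho,\xi)$, with $\rho$ constant on streamlines and $\xi$ an orthogonal coordinate to $\rho$, $\rho\in[c_j-h_j,c_j+h_j]$ and $\xi\in(-\infty,\infty)$ ($c_j,h_j$ depending on the tube), with $u\cdot\nabla\xi>0$ in $D_j^+$ and $u\cdot\nabla\xi<0$ in $D_j^-$. Write $dx^2+dy^2=E_1^2(\rho,\xi)\,d\rho^2+E_2^2(\rho,\xi)\,d\xi^2$ and $\omega=E_2/E_1$. It is assumed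 that for some constant $K>0$, on all tubes, $$K^{-1}\le E_{1},E_2,\qquad K^{-1}\le|\omega|\le K,\qquad\left|\frac{\partial\omega}{\partial\xi}\right|,\left|\frac{\partial\omega}{\partial\rho}\right|\le\frac K{h_j},$$ and that on each tube $$\tfrac12\|E_1u\|_{\infty,j}\le E_1(\rho,\xi)|u(\rho,\xi)|\le\|E_1u\|_{\infty,j},\qquad\|E_1u\|_{\infty,j}=\sup_{D_j^\pm}E_1|u|.$$ The quantity $E_1(\rho,\xi)|u(\rho,\xi)|$ does not depend on $\xi$ by incompressibility. No assumption is made on the streamlines outside the tubes.
   Formalization: The limit of the time average is read as a lower limit (the limit need not exist); the tubes are assumed not to overlap; with Neumann conditions the walls are assumed impermeable (u_2=0 at y=0,H), without which the bound fails. *)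

theory Defs
  imports "HOL-Analysis.Analysis"
begin

section \<open>Calculus relative to a set\<close>

definition C1_on :: "'a::real_normed_vector set \<Rightarrow> ('a \<Rightarrow> 'b::real_normed_vector) \<Rightarrow> bool" where
  "C1_on S g \<longleftrightarrow> (\<exists>g' :: 'a \<Rightarrow> 'a \<Rightarrow>\<^sub>L 'b. continuous_on S g' \<and>
     (\<forall>p\<in>S. (g has_derivative blinfun_apply (g' p)) (at p within S)))"

definition C2_on :: "'a::real_normed_vector set \<Rightarrow> ('a \<Rightarrow> 'b::real_normed_vector) \<Rightarrow> bool" where
  "C2_on S g \<longleftrightarrow> (\<exists>g' :: 'a \<Rightarrow> 'a \<Rightarrow>\<^sub>L 'b. C1_on S g' \<and>
     (\<forall>p\<in>S. (g has_derivative blinfun_apply (g' p)) (at p within S)))"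

text \<open>Derivatives are taken within the domain \<open>S\<close>, hence are one-sided in the normal direction at
  points of the boundary. They are only used where the derivative exists and is unique.\<close>

definition ddir :: "'a::real_normed_vector set \<Rightarrow> 'a \<Rightarrow> ('a \<Rightarrow> 'b::real_normed_vector) \<Rightarrow> 'a \<Rightarrow> 'b" where
  "ddir S v g p = frechet_derivative g (at p within S) v"

definition grad :: "'a::euclidean_space set \<Rightarrow> ('a \<Rightarrow> real) \<Rightarrow> 'a \<Rightarrow> 'a" where
  "grad S g p = (\<Sum>i\<in>Basis. ddir S i g p *\<^sub>R i)"

definition divergence :: "'a::euclidean_space set \<Rightarrow> ('a \<Rightarrow> 'a) \<Rightarrow> 'a \<Rightarrow> real" where
  "divergence S w p = (\<Sum>i\<in>Basis. ddir S i w p \<bullet> i)"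

definition laplacian :: "'a::euclidean_space set \<Rightarrow> ('a \<Rightarrow> real) \<Rightarrow> 'a \<Rightarrow> real" where
  "laplacian S g p = (\<Sum>i\<in>Basis. ddir S i (ddir S i g) p)"


section \<open>The nonlinearity\<close>

text \<open>Only the values of \<open>f\<close> on \<open>[0,1]\<close> matter.\<close>

definition reaction :: "(real \<Rightarrow> real) \<Rightarrow> bool" where
  "reaction f \<longleftrightarrow> C1_on {0..1} f \<and> f 0 = 0 \<and> f 1 = 0 \<and>
     (\<forall>s\<in>{0<..<1}. f s \<ge> 0) \<and> (\<exists>s\<in>{0..1}. f s \<noteq> 0)"

definition KPP_type :: "(real \<Rightarrow> real) \<Rightarrow> bool" where
  "KPP_type f \<longleftrightarrow> (\<forall>s\<in>{0<..<1}. f s > 0)"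

definition ignition_type :: "(real \<Rightarrow> real) \<Rightarrow> bool" where
  "ignition_type f \<longleftrightarrow> (\<exists>\<theta>\<in>{0<..<1}. (\<forall>s\<in>{0..\<theta>}. f s = 0) \<and> f 1 = 0 \<and> (\<forall>s\<in>{\<theta><..<1}. f s > 0))"


section \<open>Domain and boundary conditions\<close>

datatype bdry = Neumann | Periodic

text \<open>In the periodic case all functions live on the universal cover \<open>\<real>\<^sup>2\<close> of the cylinder obtained
  by identifying \<open>y = 0\<close> with \<open>y = H\<close>, and are \<open>H\<close>-periodic in \<open>y\<close>; thus smoothness across the
  identified line is part of smoothness on the domain, and tubes may cross that line.\<close>

definition dom_of :: "bdry \<Rightarrow> real \<Rightarrow> (real \<times> real) set" where
  "dom_of b H = (case b of Neumann \<Rightarrow> UNIV \<times> {0..H} | Periodic \<Rightarrow> UNIV)"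


section \<open>Percolating flows\<close>

definition streamline :: "(real \<times> real) set \<Rightarrow> (real \<times> real \<Rightarrow> real \<times> real) \<Rightarrow> (real \<Rightarrow> real \<times> real) \<Rightarrow> bool" where
  "streamline S u \<gamma> \<longleftrightarrow> (\<forall>s. \<gamma> s \<in> S \<and> (\<gamma> has_vector_derivative u (\<gamma> s)) (at s))"

text \<open>\<open>chart\<close> is the coordinate map \<open>(x,y) \<mapsto> (\<rho>,\<xi>)\<close> and \<open>param\<close> is its inverse; the metric
  coefficients are functions of \<open>(\<rho>,\<xi>)\<close>.\<close>

record tube =
  region :: "(real \<times> real) set"
  ctr :: real
  hw :: real
  chart :: "real \<times> real \<Rightarrow> real \<times> real"
  param :: "real \<times> real \<Rightarrow> real \<times> real"
  E1 :: "real \<times> real \<Rightarrow> real"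
  E2 :: "real \<times> real \<Rightarrow> real"

definition coords :: "tube \<Rightarrow> (real \<times> real) set" where
  "coords D = {ctr D - hw D .. ctr D + hw D} \<times> UNIV"

definition core :: "tube \<Rightarrow> (real \<times> real) set" where
  "core D = param D ` ({ctr D - hw D <..< ctr D + hw D} \<times> UNIV)"

definition omega :: "tube \<Rightarrow> real \<times> real \<Rightarrow> real" where
  "omega D q = E2 D q / E1 D q"

definition speed :: "(real \<times> real \<Rightarrow> real \<times> real) \<Rightarrow> tube \<Rightarrow> real \<times> real \<Rightarrow> real" where
  "speed u D q = E1 D q * norm (u (param D q))"

definition flow_tube ::
  "(real \<times> real) set \<Rightarrow> real \<Rightarrow> (real \<times> real \<Rightarrow> real \<times> real) \<Rightarrow> bool \<Rightarrow> tube \<Rightarrow> bool" where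
  "flow_tube S K u pos D \<longleftrightarrow>
     region D \<subseteq> S \<and> hw D > 0 \<and>
     homeomorphism (region D) (coords D) (chart D) (param D) \<and>
     C2_on (region D) (chart D) \<and> C2_on (coords D) (param D) \<and>
     (\<forall>\<rho>\<in>{ctr D - hw D, ctr D + hw D}. \<exists>\<gamma>. streamline S u \<gamma> \<and> range \<gamma> = param D ` ({\<rho>} \<times> UNIV)) \<and>
     (\<forall>\<gamma> a b. streamline S u \<gamma> \<and> \<gamma> ` {a..b} \<subseteq> region D \<longrightarrow>
        (\<lambda>s. fst (chart D (\<gamma> s))) constant_on {a..b}) \<and>
     (\<forall>\<gamma>. streamline S u \<gamma> \<and> range \<gamma> \<subseteq> region D \<longrightarrow> fst ` range \<gamma> = UNIV) \<and>
     (\<forall>p\<in>region D. if pos then u p \<bullet> grad (region D) (\<lambda>p'. snd (chart D p')) p > 0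
                   else u p \<bullet> grad (region D) (\<lambda>p'. snd (chart D p')) p < 0) \<and>
     \<comment> \<open>\<open>dx\<^sup>2 + dy\<^sup>2 = E1\<^sup>2 d\<rho>\<^sup>2 + E2\<^sup>2 d\<xi>\<^sup>2\<close>; the absence of a mixed term is the orthogonality\<close>
     (\<forall>q\<in>coords D. \<forall>v. (norm (ddir (coords D) v (param D) q))\<^sup>2
        = (E1 D q)\<^sup>2 * (fst v)\<^sup>2 + (E2 D q)\<^sup>2 * (snd v)\<^sup>2) \<and>
     (\<forall>q\<in>coords D. inverse K \<le> E1 D q \<and> inverse K \<le> E2 D q \<and>
        inverse K \<le> \<bar>omega D q\<bar> \<and> \<bar>omega D q\<bar> \<le> K \<and>
        \<bar>ddir (coords D) (0, 1) (omega D) q\<bar> \<le> K / hw D \<and>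
        \<bar>ddir (coords D) (1, 0) (omega D) q\<bar> \<le> K / hw D) \<and>
     (\<forall>q\<in>coords D. (SUP q'\<in>coords D. speed u D q') / 2 \<le> speed u D q \<and>
        speed u D q \<le> (SUP q'\<in>coords D. speed u D q'))"

text \<open>\<open>D True j\<close> and \<open>D False j\<close> are the tubes \<open>D\<^sub>j\<^sup>+\<close> and \<open>D\<^sub>j\<^sup>-\<close>. Distinct tubes do not overlap
  (they may share a bounding streamline). The translates by multiples of \<open>(0,H)\<close> express this on the
  cylinder; in the Neumann case only \<open>k = 0\<close> is a restriction, since a core is open and so lies
  in \<open>0 < y < H\<close>. In the Neumann case the lines \<open>y = 0\<close> and \<open>y = H\<close> are impermeable walls.\<close>

definition percolating ::
  "bdry \<Rightarrow> real \<Rightarrow> real \<Rightarrow> (real \<times> real \<Rightarrow> real \<times> real) \<Rightarrow> nat \<Rightarrow> (bool \<Rightarrow> nat \<Rightarrow> tube) \<Rightarrow> bool" where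
  "percolating b H K u N D \<longleftrightarrow>
     C1_on (dom_of b H) u \<and>
     (\<forall>p\<in>dom_of b H. divergence (dom_of b H) u p = 0) \<and>
     (\<forall>x. integral {0..H} (\<lambda>y. fst (u (x, y))) = 0) \<and>
     (\<exists>L>0. \<forall>p\<in>dom_of b H. u (p + (L, 0)) = u p) \<and>
     (case b of
        Neumann \<Rightarrow> \<forall>x. snd (u (x, 0)) = 0 \<and> snd (u (x, H)) = 0
      | Periodic \<Rightarrow> \<forall>x y. u (x, y + H) = u (x, y)) \<and>
     (\<forall>\<sigma>. \<forall>j\<in>{1..N}. flow_tube (dom_of b H) K u \<sigma> (D \<sigma> j)) \<and>
     (\<forall>\<sigma> \<tau>. \<forall>i\<in>{1..N}. \<forall>j\<in>{1..N}. \<forall>k::int. (\<sigma>, i) \<noteq> (\<tau>, j) \<or> k \<noteq> 0 \<longrightarrow>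
        disjnt (core (D \<sigma> i)) ((+) (0, of_int k * H) ` core (D \<tau> j)))"

definition tube_flux :: "(real \<times> real \<Rightarrow> real \<times> real) \<Rightarrow> tube \<Rightarrow> real \<Rightarrow> real" where
  "tube_flux u D \<xi> =
     integral {ctr D - hw D .. ctr D + hw D} (\<lambda>\<rho>. norm (u (param D (\<rho>, \<xi>))) * E1 D (\<rho>, \<xi>))"


section \<open>The reaction-diffusion-advection problem\<close>

definition initial_data :: "(real \<times> real) set \<Rightarrow> real \<Rightarrow> (real \<times> real \<Rightarrow> real) \<Rightarrow> bool" where
  "initial_data S lam T0 \<longleftrightarrow> T0 differentiable_on S \<and>
     (\<exists>M. \<forall>(x, y)\<in>S.
        (x < 0 \<longrightarrow> \<bar>1 - T0 (x, y)\<bar> \<le> M * exp (lam * x)) \<and>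
        (x > 0 \<longrightarrow> \<bar>T0 (x, y)\<bar> \<le> M * exp (- lam * x)) \<and>
        norm (grad S T0 (x, y)) \<le> M * exp (- lam * \<bar>x\<bar>))"

definition C21_regular :: "(real \<times> real) set \<Rightarrow> (real \<times> real \<Rightarrow> real \<Rightarrow> real) \<Rightarrow> bool" where
  "C21_regular S T \<longleftrightarrow>
     continuous_on (S \<times> {0..}) (\<lambda>(p, t). T p t) \<and>
     C1_on (S \<times> {0<..}) (\<lambda>(p, t). T p t) \<and>
     (\<forall>t>0. C2_on S (\<lambda>p. T p t)) \<and>
     (\<forall>i\<in>Basis. \<forall>j\<in>Basis. continuous_on (S \<times> {0<..}) (\<lambda>(p, t). ddir S i (ddir S j (\<lambda>q. T q t)) p))"

definition solves ::
  "bdry \<Rightarrow> real \<Rightarrow> real \<Rightarrow> real \<Rightarrow> (real \<Rightarrow> real) \<Rightarrow> (real \<times> real \<Rightarrow> real \<times> real) \<Rightarrow>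
   (real \<times> real \<Rightarrow> real) \<Rightarrow> (real \<times> real \<Rightarrow> real \<Rightarrow> real) \<Rightarrow> bool" where
  "solves b H \<kappa> v0 f u T0 T \<longleftrightarrow> (let S = dom_of b H in
     C21_regular S T \<and>
     (\<forall>p\<in>S. \<forall>t\<ge>0. 0 \<le> T p t \<and> T p t \<le> 1) \<and>
     (\<forall>p\<in>S. \<forall>t>0. deriv (T p) t + u p \<bullet> grad S (\<lambda>q. T q t) p
        = \<kappa> * laplacian S (\<lambda>q. T q t) p + v0\<^sup>2 / \<kappa> * f (T p t)) \<and>
     (\<forall>p\<in>S. T p 0 = T0 p) \<and>
     (\<forall>t\<ge>0. \<forall>y. (0, y) \<in> S \<longrightarrow>
        ((\<lambda>x. T (x, y) t) \<longlongrightarrow> 1) at_bot \<and> ((\<lambda>x. T (x, y) t) \<longlongrightarrow> 0) at_top) \<and>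
     (case b of
        Neumann \<Rightarrow> \<forall>x. \<forall>t>0. ddir S (0, 1) (\<lambda>q. T q t) (x, 0) = 0 \<and>
                             ddir S (0, 1) (\<lambda>q. T q t) (x, H) = 0
      | Periodic \<Rightarrow> \<forall>x y. \<forall>t\<ge>0. T (x, y + H) t = T (x, y) t))"

definition burning_rate :: "real \<Rightarrow> (real \<times> real \<Rightarrow> real \<Rightarrow> real) \<Rightarrow> real \<Rightarrow> real" where
  "burning_rate H T t = set_lebesgue_integral lborel (UNIV \<times> {0..H}) (\<lambda>p. deriv (T p) t / H)"

definition time_average :: "(real \<Rightarrow> real) \<Rightarrow> real \<Rightarrow> real" where
  "time_average V t = 1 / t * integral {0..t} V"

end

theory Submission
  imports Defs
begin

text \<open>
  The bulk burning rate equals a constant times the integral of \<open>f(T)\<close>, so the total fuel burnt up to time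
  \<open>t\<close> controls the whole evolution. Exponentially weighted energies localise the front; with weight
  exponent \<open>1/sqrt t\<close> they show that the total cooling \<open>\<integral>(T(1) - T(t))\<^sub>+\<close> is sublinear, which replaces
  \<open>T\<^sub>t \<ge> 0\<close>. Testing the equation with \<open>\<Phi>(T)\<close>, \<open>\<Phi>' = f\<close>, bounds \<open>\<kappa>\<integral>\<integral>f(T)|\<nabla>T|\<^sup>2\<close> by the fuel. The term \<open>v0\<close>
  follows from \<open>\<Phi>(1) \<le> \<integral>f(T)|\<nabla>T| dx\<close> and the inequality of arithmetic and geometric means. In a tube, test with
  \<open>f(T)\<^sup>2\<close> times \<open>\<phi>(\<rho>)\<chi>(\<xi>/n)\<close>. Since \<open>u\<cdot>\<nabla>\<rho> = 0\<close>, the transport term is the flux through the tube, up to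
  terms that vanish for large \<open>n\<close>: along almost every streamline of a tube the area element times \<open>(1 + x\<^sup>2)\<^sup>-\<^sup>1\<close> is integrable, so it runs
  from one end of the strip to the other, and all of these run in the same direction. The remaining terms carry
  \<open>\<kappa>|\<nabla>\<phi>| f(T)\<^sup>2|\<nabla>T|\<close>, and the weight \<open>(1 + l/h)\<^sup>-\<^sup>1\<close> is what makes them comparable to fuel and dissipation.
  The tubes are disjoint, so the sum over all of them is still controlled by the strip.
\<close>

section \<open>Integrals over boxes\<close>

text \<open>The dissipation controls only \<open>f(T) * |grad T|^2\<close>, so \<open>T\<close> can
  be tested only with a function whose derivative contains the factor \<open>f\<close>. This is why
  the tubes are tested with \<open>f(T)^2\<close>: its derivative \<open>2 * f * f'\<close> has that
  factor, whereas the derivative \<open>f'\<close> of \<open>f(T)\<close> does not. Rates of decay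
  at infinity and integrability of the time derivative are not given for positive times. They are
  propagated from the initial data with weights that are kept bounded and cut off until the
  estimates no longer depend on this. The time derivative is integrable over the strip for almost
  every time, which suffices for the time average. Within a tube the length of a line per unit of
  \<open>xi\<close> is not bounded above, so the ends of a line are located by integrability rather
  than by direct geometry. In the periodic case a tube lives on the universal cover and may wind
  through many periods; it is folded back to one period before areas are compared. All balances
  start at time 1, where derivatives are available, and the nonnegative amount burnt before is
  dropped.\<close>

type_synonym plane = "real \<times> real"

lemmas vector_derivative_iff = has_real_derivative_iff_has_vector_derivative[symmetric]

lemma box_integrable:
 fixes g :: "'a::euclidean_space => real"
 assumes "continuous_on (cbox a b) g"
 shows "g integrable_on cbox a b"
 using assms by (rule integrable_continuous)

lemma integral_box_iterated:
 fixes g :: "plane => real"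
 assumes "continuous_on (cbox (x0,a) (x1,c)) g"
 shows "integral (cbox (x0,a) (x1,c)) g = integral {x0..x1} (%x. integral {a..c} (%y. g (x,y)))"
  and "integral (cbox (x0,a) (x1,c)) g = integral {a..c} (%y. integral {x0..x1} (%x. g (x,y)))"
proof -
 show 1: "integral (cbox (x0,a) (x1,c)) g = integral {x0..x1} (%x. integral {a..c} (%y. g (x,y)))"
  using integral_prod_continuous[OF assms] by simp
 have "continuous_on (cbox (x0,a) (x1,c)) (%(x,y). g (x,y))"
  using assms by simp
 from integral_swap_continuous[OF this] 1
 show "integral (cbox (x0,a) (x1,c)) g = integral {a..c} (%y. integral {x0..x1} (%x. g (x,y)))"
  by simp
qed

lemma box_divergence:
 fixes F1 F2 D1 D2 :: "plane => real"
 assumes le: "x0 <= x1" "a <= c"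
  and c1: "continuous_on (cbox (x0,a) (x1,c)) D1" and c2: "continuous_on (cbox (x0,a) (x1,c)) D2"
  and d1: "!!x y. x \<in> {x0..x1} ==> y \<in> {a..c} ==>
   ((%x. F1 (x,y)) has_real_derivative D1 (x,y)) (at x within {x0..x1})"
  and d2: "!!x y. x \<in> {x0..x1} ==> y \<in> {a..c} ==>
   ((%y. F2 (x,y)) has_real_derivative D2 (x,y)) (at y within {a..c})"
  and e1: "!!y. y \<in> {a..c} ==> F1 (x0,y) = F1 (x1,y)"
  and e2: "!!x. x \<in> {x0..x1} ==> F2 (x,a) = F2 (x,c)"
 shows "integral (cbox (x0,a) (x1,c)) (%p. D1 p + D2 p) = 0"
proof -
 have "integral {x0..x1} (%x. D1 (x,y)) = 0" if "y \<in> {a..c}" for y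
  using fundamental_theorem_of_calculus[OF le(1), of "%x. F1 (x,y)" "%x. D1 (x,y)"] d1 that e1[OF that]
  by (auto simp: has_real_derivative_iff_has_vector_derivative dest: integral_unique)
 then have 1: "integral (cbox (x0,a) (x1,c)) D1 = 0"
  using integral_box_iterated(2)[OF c1] integral_cong[of "{a..c}" "%y. integral {x0..x1} (%x. D1 (x,y))" "%_. 0"]
  by simp
 have "integral {a..c} (%y. D2 (x,y)) = 0" if "x \<in> {x0..x1}" for x
  using fundamental_theorem_of_calculus[OF le(2), of "%y. F2 (x,y)" "%y. D2 (x,y)"] d2 that e2[OF that]
  by (auto simp: has_real_derivative_iff_has_vector_derivative dest: integral_unique)
 then have 2: "integral (cbox (x0,a) (x1,c)) D2 = 0"
  using integral_box_iterated(1)[OF c2] integral_cong[of "{x0..x1}" "%x. integral {a..c} (%y. D2 (x,y))" "%_. 0"]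
  by simp
 show ?thesis
  using 1 2 integral_add[OF box_integrable[OF c1] box_integrable[OF c2]] by simp
qed

lemma compose_within:
 assumes "(z has_real_derivative dz) (at x within A)" "(G has_real_derivative dG) (at (z x) within B)"
  and "z ` A \<subseteq> B"
 shows "((%x. G (z x)) has_real_derivative dG * dz) (at x within A)"
 using DERIV_image_chain[OF DERIV_subset[OF assms(2,3)] assms(1)] by (simp add: o_def)

lemma integral_abs_le_box:
 fixes g :: "'a::euclidean_space => real"
 assumes "continuous_on (cbox a b) g"
 shows "\<bar>integral (cbox a b) g\<bar> <= integral (cbox a b) (%p. \<bar>g p\<bar>)"
 using integral_norm_bound_integral[of g "cbox a b" "%p. \<bar>g p\<bar>"] assms
 by (auto intro!: box_integrable continuous_intros)

lemma integral_mono_box: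
 fixes g :: "'a::euclidean_space => real"
 assumes "continuous_on (cbox a b) g" "continuous_on (cbox a b) h" "!!p. p \<in> cbox a b ==> g p <= h p"
 shows "integral (cbox a b) g <= integral (cbox a b) h"
 using assms by (intro integral_le box_integrable) auto

lemma integral_nonneg_box:
 fixes g :: "'a::euclidean_space => real"
 assumes "continuous_on (cbox a b) g" "!!p. p \<in> cbox a b ==> 0 <= g p"
 shows "0 <= integral (cbox a b) g"
 using assms by (intro integral_nonneg box_integrable) auto

text \<open>As \<open>v\<close> has mean zero, \<open>g\<close> may be replaced by
  \<open>g - g 0\<close>, which is at most the integral of \<open>|g'|\<close>. Mean-zero advection
  is thereby paid for by the derivative of \<open>T\<close> across the strip.\<close>

lemma zero_mean_integral_bound:
 fixes g g' v :: "real => real"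
 assumes "0 <= H" and cv: "continuous_on {0..H} v" and v: "!!y. y \<in> {0..H} ==> \<bar>v y\<bar> <= U"
  and z: "integral {0..H} v = 0"
  and dg: "!!y. y \<in> {0..H} ==> (g has_real_derivative g' y) (at y within {0..H})"
  and cg': "continuous_on {0..H} g'"
 shows "\<bar>integral {0..H} (%y. g y * v y)\<bar> <= U * H * integral {0..H} (%y. \<bar>g' y\<bar>)"
proof -
 define J where "J = integral {0..H} (%y. \<bar>g' y\<bar>)"
 have U: "U \<ge> 0" using v[of 0] \<open>0 <= H\<close> by auto
 have cg: "continuous_on {0..H} g"
  using dg by (meson DERIV_continuous continuous_on_eq_continuous_within)
 have ca: "continuous_on {0..H} (%y. \<bar>g' y\<bar>)" using cg' by (intro continuous_intros)
 have *: "\<bar>g y - g 0\<bar> <= J" if y: "y \<in> {0..H}" for y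
 proof -
  have "(g' has_integral (g y - g 0)) {0..y}"
  proof (rule fundamental_theorem_of_calculus)
   fix x assume "x \<in> {0..y}"
   then show "(g has_vector_derivative g' x) (at x within {0..y})"
    using y DERIV_subset[OF dg[of x], of "{0..y}"]
    by (auto simp: has_real_derivative_iff_has_vector_derivative)
  qed (use y in auto)
  then have "\<bar>g y - g 0\<bar> = \<bar>integral {0..y} g'\<bar>" by (auto dest: integral_unique)
  also have "... <= integral {0..y} (%y. \<bar>g' y\<bar>)"
   using integral_abs_le_box[of 0 y g'] continuous_on_subset[OF cg', of "{0..y}"] y by auto
  also have "... <= J" unfolding J_def
   using y by (intro integral_subset_le integrable_continuous_real continuous_on_subset[OF ca]) auto
  finally show ?thesis .
 qed
 have "integral {0..H} (%y. g y * v y) = integral {0..H} (%y. (g y - g 0) * v y) + g 0 * integral {0..H} v"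
  by (subst integral_mult_right[symmetric], subst integral_add[symmetric])
   (auto intro!: integrable_continuous_real continuous_intros cg cv simp: algebra_simps)
 then have "\<bar>integral {0..H} (%y. g y * v y)\<bar> <= integral {0..H} (%y. \<bar>(g y - g 0) * v y\<bar>)"
  using integral_abs_le_box[of 0 H "%y. (g y - g 0) * v y"] z continuous_on_mult[OF continuous_on_diff[OF cg continuous_on_const] cv, of "g 0"]
  by simp
 also have "... <= integral {0..H} (%y. J * U)"
  using * v by (intro integral_le integrable_continuous_real continuous_intros cg cv)
   (auto simp: abs_mult intro!: mult_mono intro: order_trans[OF abs_ge_zero])
 also have "... = U * H * J" using \<open>0 <= H\<close> by simp
 finally show ?thesis by (simp add: J_def)
qed

text \<open>The function \<open>exp (- C * s) * y s - E * s\<close> decreases. Derivatives are asked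
  for \<open>0 < s\<close> only, since the solution is just continuous at the initial time.\<close>

lemma gronwall_linear:
 fixes y y' :: "real => real"
 assumes "0 <= t" and c: "continuous_on {0..t} y"
  and d: "!!s. 0 < s ==> s <= t ==> (y has_real_derivative y' s) (at s)"
  and le: "!!s. 0 < s ==> s <= t ==> y' s <= C * y s + E" and "0 <= C" "0 <= E"
 shows "y t <= exp (C * t) * (y 0 + E * t)"
proof (cases "t = 0")
 case False
 define N where "N s = exp (- C * s) * y s - E * s" for s
 have "N t <= N 0"
 proof (rule DERIV_nonpos_imp_decreasing_open[of 0 t])
  show "0 <= t" by fact
  show "continuous_on {0..t} N" unfolding N_def by (intro continuous_intros c)
  fix s assume s: "0 < s" "s < t"
  have "(N has_real_derivative (exp (- C * s) * y' s + (- C) * exp (- C * s) * y s - E)) (at s)"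
   unfolding N_def using s by (auto intro!: derivative_eq_intros d)
  moreover have "exp (- C * s) * y' s <= exp (- C * s) * (C * y s + E)"
   using le[of s] s by (intro mult_left_mono) auto
  moreover have "exp (- C * s) * E <= E" using \<open>0 <= E\<close> \<open>0 <= C\<close> s by (simp add: mult_left_le_one_le)
  ultimately show "\<exists>z. (N has_real_derivative z) (at s) \<and> z <= 0"
   by (intro exI[of _ "exp (- C * s) * y' s + (- C) * exp (- C * s) * y s - E"]) (auto simp: algebra_simps)
 qed
 then have "exp (- C * t) * y t <= y 0 + E * t" by (simp add: N_def)
 then have "exp (C * t) * (exp (- C * t) * y t) <= exp (C * t) * (y 0 + E * t)" by (intro mult_left_mono) auto
 then show ?thesis by (simp add: mult.assoc[symmetric] exp_add[symmetric])
qed simp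

section \<open>The flow equation and its weak form\<close>

text \<open>The second factor of \<open>dom_of b H\<close>. With the product
  \<open>UNIV \<times> yrange b H\<close> the strip and the universal cover of the cylinder are
  treated by the same arguments.\<close>

definition yrange :: "bdry => real => real set" where
 "yrange b H = (case b of Neumann => {0..H} | Periodic => UNIV)"

abbreviation "dmn b H \<equiv> UNIV \<times> yrange b H"

text \<open>Partial derivatives are separate parameters, so that the estimates use one-variable
  calculus; \<open>q\<close> stands for \<open>v0^2 / ka\<close>. The initial decay of
  \<open>1 - T\<close> is recorded for every rate \<open>al\<close> up to \<open>lam\<close>,
  because the cooling estimate uses a rate that tends to 0 as time grows.\<close>

locale reactive_flow =
 fixes b :: bdry and H ka q U F lam M0 :: real
  and u :: "plane => plane" and u1x u2y :: "plane => real"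
  and f f' :: "real => real"
  and T Tt Tx Ty Txx Tyy :: "plane => real => real"
 assumes pos: "0 < H" "0 < ka" "0 < q" "0 < F" "0 < lam" "0 <= M0" "0 <= U"
  and cont_T: "continuous_on (dmn b H \<times> {0..}) (%(p,t). T p t)"
  and cont_Tt: "continuous_on (dmn b H \<times> {0<..}) (%(p,t). Tt p t)"
  and cont_Tx: "continuous_on (dmn b H \<times> {0<..}) (%(p,t). Tx p t)"
  and cont_Ty: "continuous_on (dmn b H \<times> {0<..}) (%(p,t). Ty p t)"
  and cont_Txx: "continuous_on (dmn b H \<times> {0<..}) (%(p,t). Txx p t)"
  and cont_Tyy: "continuous_on (dmn b H \<times> {0<..}) (%(p,t). Tyy p t)"
  and der_t: "!!x y t. y \<in> yrange b H ==> 0 < t ==> (T (x,y) has_real_derivative Tt (x,y) t) (at t)"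
  and der_x: "!!x y t. y \<in> yrange b H ==> 0 < t ==> ((%x. T (x,y) t) has_real_derivative Tx (x,y) t) (at x)"
  and der_y: "!!x y t. y \<in> yrange b H ==> 0 < t ==>
   ((%y. T (x,y) t) has_real_derivative Ty (x,y) t) (at y within yrange b H)"
  and der_xx: "!!x y t. y \<in> yrange b H ==> 0 < t ==> ((%x. Tx (x,y) t) has_real_derivative Txx (x,y) t) (at x)"
  and der_yy: "!!x y t. y \<in> yrange b H ==> 0 < t ==>
   ((%y. Ty (x,y) t) has_real_derivative Tyy (x,y) t) (at y within yrange b H)"
  and T_range: "!!x y t. y \<in> yrange b H ==> 0 <= t ==> 0 <= T (x,y) t \<and> T (x,y) t <= 1"
  and pde: "!!x y t. y \<in> yrange b H ==> 0 < t ==>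
   Tt (x,y) t = ka * (Txx (x,y) t + Tyy (x,y) t)
    - (fst (u (x,y)) * Tx (x,y) t + snd (u (x,y)) * Ty (x,y) t) + q * f (T (x,y) t)"
  and cont_u: "continuous_on (dmn b H) u"
  and cont_u1x: "continuous_on (dmn b H) u1x"
  and cont_u2y: "continuous_on (dmn b H) u2y"
  and u_bound: "!!x y. y \<in> yrange b H ==> norm (u (x,y)) <= U"
  and der_u1: "!!x y. y \<in> yrange b H ==> ((%x. fst (u (x,y))) has_real_derivative u1x (x,y)) (at x)"
  and der_u2: "!!x y. y \<in> yrange b H ==> ((%y. snd (u (x,y))) has_real_derivative u2y (x,y)) (at y within yrange b H)"
  and div_free: "!!x y. y \<in> yrange b H ==> u1x (x,y) + u2y (x,y) = 0"
  and zero_mean: "!!x. integral {0..H} (%y. fst (u (x,y))) = 0"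
  and bc_Neumann: "!!x t. b = Neumann ==> 0 < t ==> Ty (x,0) t = 0 \<and> Ty (x,H) t = 0"
  and bc_wall: "!!x. b = Neumann ==> snd (u (x,0)) = 0 \<and> snd (u (x,H)) = 0"
  and bc_Periodic: "!!x y t. b = Periodic ==> 0 < t ==> T (x,y+H) t = T (x,y) t \<and> Tx (x,y+H) t = Tx (x,y) t \<and> Ty (x,y+H) t = Ty (x,y) t"
  and u_Periodic: "!!x y. b = Periodic ==> u (x,y+H) = u (x,y)"
  and cont_f: "continuous_on {0..1} f" and cont_f': "continuous_on {0..1} f'"
  and der_f: "!!s. s \<in> {0..1} ==> (f has_real_derivative f' s) (at s within {0..1})"
  and f_bounds: "!!s. s \<in> {0..1} ==> 0 <= f s \<and> f s <= F * s \<and> f s <= F * (1 - s) \<and> \<bar>f' s\<bar> <= F"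
  and decay0: "!!x y. y \<in> yrange b H ==> (T (x,y) 0)^2 * exp (lam * x) <= M0 * exp (- lam * \<bar>x\<bar>)"
  and decay1: "!!al x y. y \<in> yrange b H ==> 0 < al ==> al <= lam ==>
   (1 - T (x,y) 0)^2 * exp (- al * x) <= M0 * exp (- al * \<bar>x\<bar>)"
begin

abbreviation "Yr \<equiv> yrange b H"

lemma yr: "{0..H} \<subseteq> Yr" "y \<in> {0..H} ==> y \<in> Yr" "0 <= y ==> y <= H ==> y \<in> Yr"
 by (auto simp: yrange_def split: bdry.splits)

lemma cont_compose_pt:
 assumes "continuous_on ((UNIV \<times> Yr) \<times> J) (%(p,t). h p t)"
  and "continuous_on A g" "continuous_on A k" "!!p. p \<in> A ==> snd (g p) \<in> Yr" "!!p. p \<in> A ==> k p \<in> J"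
 shows "continuous_on A (%p. h (g p) (k p))"
proof -
 have "continuous_on A (%p. (case (g p, k p) of (p,t) => h p t))"
  by (rule continuous_on_compose2[OF assms(1) continuous_on_Pair[OF assms(2,3)]])
   (simp add: image_subset_iff mem_Times_iff assms(4,5))
 then show ?thesis by simp
qed

lemma cont_compose_p:
 assumes "continuous_on (UNIV \<times> Yr) h"
  and "continuous_on A g" "!!p. p \<in> A ==> snd (g p) \<in> Yr"
 shows "continuous_on A (%p. h (g p))"
 by (rule continuous_on_compose2[OF assms(1,2)]) (simp add: image_subset_iff mem_Times_iff assms(3))

lemma cont_compose_unit:
 fixes h :: "real => real"
 assumes "continuous_on {0..1} h" "continuous_on A g" "!!p. p \<in> A ==> g p \<in> {0..1}"
 shows "continuous_on A (%p. h (g p))"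
 by (rule continuous_on_compose2[OF assms(1,2)]) (use assms(3) in auto)

lemmas flow_cont = cont_compose_pt[OF cont_Tt] cont_compose_pt[OF cont_Tx]
 cont_compose_pt[OF cont_Ty] cont_compose_pt[OF cont_Txx] cont_compose_pt[OF cont_Tyy] cont_compose_pt[OF cont_T]
 cont_compose_p[OF cont_u] cont_compose_p[OF cont_u1x] cont_compose_p[OF cont_u2y]
 cont_compose_unit[OF cont_f] cont_compose_unit[OF cont_f']

lemma T_unit: "snd p \<in> Yr ==> 0 <= t ==> T p t \<in> {0..1}"
 using T_range[of "snd p" t "fst p"] by auto

lemma u_comp_bound:
 assumes "snd p \<in> Yr"
 shows "\<bar>fst (u p)\<bar> <= U" "\<bar>snd (u p)\<bar> <= U"
proof -
 have "norm (u p) <= U" using u_bound[OF assms, of "fst p"] by simp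
 then show "\<bar>fst (u p)\<bar> <= U" "\<bar>snd (u p)\<bar> <= U"
  using norm_fst_le[of "fst (u p)" "snd (u p)"] norm_snd_le[of "snd (u p)" "fst (u p)"] by simp_all
qed

text \<open>Functions applied to \<open>T\<close>, with two derivatives taken within
  \<open>{0..1}\<close> because \<open>f\<close> is known only there.\<close>

definition "C2fun (G::real=>real) G' G'' \<longleftrightarrow> continuous_on {0..1} G'' \<and> (\<forall>s\<in>{0..1}.
  (G has_real_derivative G' s) (at s within {0..1}) \<and> (G' has_real_derivative G'' s) (at s within {0..1}))"

lemma C2funD:
 assumes "C2fun G G' G''"
 shows "continuous_on {0..1} G" "continuous_on {0..1} G'" "continuous_on {0..1} G''"
  "!!s. s \<in> {0..1} ==> (G has_real_derivative G' s) (at s within {0..1})"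
  "!!s. s \<in> {0..1} ==> (G' has_real_derivative G'' s) (at s within {0..1})"
 using assms unfolding C2fun_def by (auto simp: continuous_on_eq_continuous_within dest: DERIV_continuous)

text \<open>The three ways in which boundary terms in \<open>y\<close> cancel: walls, periodicity,
  and a test function that vanishes on both lines. The last one serves tubes on the universal cover,
  where the box may span many periods.\<close>

definition "bdry_ok (py::real\<times>real=>real) a c \<longleftrightarrow> {a..c} \<subseteq> Yr \<and> a <= c \<and>
 ((b = Neumann \<and> a = 0 \<and> c = H) \<or> (b = Periodic \<and> a = 0 \<and> c = H \<and> (\<forall>x. py (x,0) = py (x,H)))
  \<or> (\<forall>x. py (x,a) = 0 \<and> py (x,c) = 0))"

text \<open>The equation times \<open>py * G'(T)\<close> differs from the integrand on the right by
  the divergence of \<open>ka * py * G'(T) * grad T - py * G(T) * u\<close>. Its boundary terms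
  vanish in \<open>x\<close> because \<open>py\<close> does, and cancel in \<open>y\<close> by
  \<open>bdry_ok\<close>.\<close>

lemma weak_identity:
 assumes t: "0 < t" and G: "C2fun G G' G''" and x01: "x0 <= x1" and bd: "bdry_ok py a c"
  and cx: "continuous_on (cbox (x0,a) (x1,c)) pyx" and cy: "continuous_on (cbox (x0,a) (x1,c)) pyy"
  and cpy: "continuous_on (cbox (x0,a) (x1,c)) py"
  and dx: "!!x y. x \<in> {x0..x1} ==> y \<in> {a..c} ==> ((%x. py (x,y)) has_real_derivative pyx (x,y)) (at x within {x0..x1})"
  and dy: "!!x y. x \<in> {x0..x1} ==> y \<in> {a..c} ==> ((%y. py (x,y)) has_real_derivative pyy (x,y)) (at y within {a..c})"
  and z: "!!y. y \<in> {a..c} ==> py (x0,y) = 0 \<and> py (x1,y) = 0"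
 shows "integral (cbox (x0,a) (x1,c)) (%p. py p * G' (T p t) * Tt p t) =
  integral (cbox (x0,a) (x1,c)) (%p. G (T p t) * (fst (u p) * pyx p + snd (u p) * pyy p)
   - ka * py p * G'' (T p t) * ((Tx p t)^2 + (Ty p t)^2)
   - ka * G' (T p t) * (pyx p * Tx p t + pyy p * Ty p t) + q * py p * G' (T p t) * f (T p t))"
proof -
 let ?B = "cbox (x0,a) (x1,c)"
 note G' = C2funD[OF G]
 have ac: "a <= c" "{a..c} \<subseteq> Yr" using bd by (auto simp: bdry_ok_def)
 have Y: "snd p \<in> Yr" if "p \<in> ?B" for p
  using ac that by (cases p) (auto simp: cbox_Pair_eq)
 have TU: "T p t \<in> {0..1}" if "p \<in> ?B" for p using T_unit[of p t] Y[OF that] t by auto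
 note ci = continuous_intros flow_cont cont_compose_unit[OF G'(1)] cont_compose_unit[OF G'(2)] cont_compose_unit[OF G'(3)]
  cx cy cpy
 define D1 where "D1 p = ka * (pyx p * G' (T p t) * Tx p t + py p * G'' (T p t) * (Tx p t)^2 + py p * G' (T p t) * Txx p t)
  - (pyx p * fst (u p) * G (T p t) + py p * u1x p * G (T p t) + py p * fst (u p) * G' (T p t) * Tx p t)" for p
 define D2 where "D2 p = ka * (pyy p * G' (T p t) * Ty p t + py p * G'' (T p t) * (Ty p t)^2 + py p * G' (T p t) * Tyy p t)
  - (pyy p * snd (u p) * G (T p t) + py p * u2y p * G (T p t) + py p * snd (u p) * G' (T p t) * Ty p t)" for p
 have cD: "continuous_on ?B D1" "continuous_on ?B D2"
  unfolding D1_def D2_def by (intro ci; use Y TU t in auto)+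
 let ?R = "%p. G (T p t) * (fst (u p) * pyx p + snd (u p) * pyy p)
   - ka * py p * G'' (T p t) * ((Tx p t)^2 + (Ty p t)^2)
   - ka * G' (T p t) * (pyx p * Tx p t + pyy p * Ty p t) + q * py p * G' (T p t) * f (T p t)"
 have cR: "continuous_on ?B ?R"
  by (intro ci; use Y TU t in auto)
 have "integral ?B (%p. D1 p + D2 p) = 0"
 proof (rule box_divergence[where ?F1.0="%p. ka * (py p * G' (T p t) * Tx p t) - py p * fst (u p) * G (T p t)"
    and ?F2.0="%p. ka * (py p * G' (T p t) * Ty p t) - py p * snd (u p) * G (T p t)"])
  fix x y assume x: "x \<in> {x0..x1}" and y: "y \<in> {a..c}"
  have yY: "y \<in> Yr" using y ac by auto
  have TT: "T (x,y) t \<in> {0..1}" using T_unit[of "(x,y)" t] yY t by auto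
  have im: "(%x. T (x,y) t) ` {x0..x1} \<subseteq> {0..1}" using T_unit[of "(_,y)" t] yY t by auto
  have im2: "(%y. T (x,y) t) ` {a..c} \<subseteq> {0..1}" using T_unit[of "(x,_)" t] ac t by auto
  have d: "((%x. T (x,y) t) has_real_derivative Tx (x,y) t) (at x within {x0..x1})"
   "((%x. Tx (x,y) t) has_real_derivative Txx (x,y) t) (at x within {x0..x1})"
   "((%x. fst (u (x,y))) has_real_derivative u1x (x,y)) (at x within {x0..x1})"
   using der_x[OF yY t] der_xx[OF yY t] der_u1[OF yY] by (auto intro: has_field_derivative_at_within)
  have e: "((%y. T (x,y) t) has_real_derivative Ty (x,y) t) (at y within {a..c})"
   "((%y. Ty (x,y) t) has_real_derivative Tyy (x,y) t) (at y within {a..c})"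
   "((%y. snd (u (x,y))) has_real_derivative u2y (x,y)) (at y within {a..c})"
   using der_y[OF yY t] der_yy[OF yY t] der_u2[OF yY] ac(2) by (auto intro: DERIV_subset)
  note GG = compose_within[OF d(1) G'(4)[OF TT] im] compose_within[OF d(1) G'(5)[OF TT] im]
  note GH = compose_within[OF e(1) G'(4)[OF TT] im2] compose_within[OF e(1) G'(5)[OF TT] im2]
  show "((%x. ka * (py (x,y) * G' (T (x,y) t) * Tx (x,y) t) - py (x,y) * fst (u (x,y)) * G (T (x,y) t))
    has_real_derivative D1 (x,y)) (at x within {x0..x1})"
   unfolding D1_def
   by (rule DERIV_cong[OF DERIV_diff[OF DERIV_cmult[OF DERIV_mult[OF DERIV_mult[OF dx[OF x y] GG(2)] d(2)]]
     DERIV_mult[OF DERIV_mult[OF dx[OF x y] d(3)] GG(1)]]]) (simp add: algebra_simps power2_eq_square)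
  show "((%y. ka * (py (x,y) * G' (T (x,y) t) * Ty (x,y) t) - py (x,y) * snd (u (x,y)) * G (T (x,y) t))
    has_real_derivative D2 (x,y)) (at y within {a..c})"
   unfolding D2_def
   by (rule DERIV_cong[OF DERIV_diff[OF DERIV_cmult[OF DERIV_mult[OF DERIV_mult[OF dy[OF x y] GH(2)] e(2)]]
     DERIV_mult[OF DERIV_mult[OF dy[OF x y] e(3)] GH(1)]]]) (simp add: algebra_simps power2_eq_square)
 next
  fix x assume x: "x \<in> {x0..x1}"
  consider "b = Neumann" "a = 0" "c = H" | "b = Periodic" "a = 0" "c = H" "\<forall>x. py (x,0) = py (x,H)"
   | "\<forall>x. py (x,a) = 0 \<and> py (x,c) = 0"
   using bd by (auto simp: bdry_ok_def)
  then show "ka * (py (x,a) * G' (T (x,a) t) * Ty (x,a) t) - py (x,a) * snd (u (x,a)) * G (T (x,a) t)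
   = ka * (py (x,c) * G' (T (x,c) t) * Ty (x,c) t) - py (x,c) * snd (u (x,c)) * G (T (x,c) t)"
  proof cases
   case 1 then show ?thesis using bc_Neumann[OF 1(1) t] bc_wall[OF 1(1)] by simp
  next
   case 2 then show ?thesis using bc_Periodic[OF 2(1) t, of x 0] u_Periodic[OF 2(1), of x 0] by simp
  qed simp
 qed (use x01 ac z cD in auto)
 moreover have "py p * G' (T p t) * Tt p t = ?R p + (D1 p + D2 p)" if "p \<in> ?B" for p
 proof -
  obtain x y where p: "p = (x,y)" by (cases p)
  have yY: "y \<in> Yr" using Y[OF that] p by simp
  have "u2y p = - u1x p" using div_free[OF yY, of x] p by simp
  then show ?thesis
   unfolding D1_def D2_def p pde[OF yY t] by (simp add: p algebra_simps power2_eq_square)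
 qed
 then have "integral ?B (%p. py p * G' (T p t) * Tt p t) = integral ?B (%p. ?R p + (D1 p + D2 p))"
  by (intro integral_cong)
 moreover have "... = integral ?B ?R + integral ?B (%p. D1 p + D2 p)"
  by (intro integral_add box_integrable cR continuous_on_add cD)
 ultimately show ?thesis by simp
qed

lemma box_time_derivative:
 assumes t: "0 < t" and G: "C2fun G G' G''" and ac: "{a..c} \<subseteq> Yr"
  and cpy: "continuous_on (cbox (x0,a) (x1,c)) py"
 shows "((%t. integral (cbox (x0,a) (x1,c)) (%p. py p * G (T p t)))
  has_real_derivative integral (cbox (x0,a) (x1,c)) (%p. py p * G' (T p t) * Tt p t)) (at t)"
proof -
 let ?B = "cbox (x0,a) (x1,c)"
 note G' = C2funD[OF G]
 have Y: "snd p \<in> Yr" if "p \<in> ?B" for p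
  using ac that by (cases p) (auto simp: cbox_Pair_eq)
 have TU: "T p t \<in> {0..1}" if "p \<in> ?B" "0 < t" for p t using T_unit[of p t] Y[OF that(1)] that by auto
 have 1: "((%s. py p * G (T p s)) has_real_derivative py p * G' (T p s) * Tt p s) (at s within {0<..})"
  if p: "p \<in> ?B" and s0: "0 < s" for p s
 proof -
  obtain x y where xy: "p = (x,y)" by (cases p)
  have "(T p has_real_derivative Tt p s) (at s within {0<..})"
   using der_t[of y s x] Y[OF p] s0 xy by (auto intro: has_field_derivative_at_within)
  from compose_within[OF this G'(4)[OF TU[OF p s0]]]
  have "((%s. G (T p s)) has_real_derivative G' (T p s) * Tt p s) (at s within {0<..})"
   using TU[OF p] by fastforce
  from DERIV_cmult[OF this, of "py p"] show ?thesis by (simp add: mult.assoc)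
 qed
 have 2: "(%p. py p * G (T p s)) integrable_on ?B" if "0 < s" for s
  by (intro box_integrable continuous_intros cpy flow_cont cont_compose_unit[OF G'(1)]) (use Y TU that in auto)
 have 3: "continuous_on ({0<..} \<times> ?B) (%z. py (snd z) * G' (T (snd z) (fst z)) * Tt (snd z) (fst z))"
  by (intro continuous_intros flow_cont cont_compose_unit[OF G'(2)] continuous_on_compose2[OF cpy])
   (use Y TU in \<open>auto simp: mem_Times_iff\<close>)
 have "((%t. integral ?B (%p. py p * G (T p t)))
  has_real_derivative integral ?B (%p. py p * G' (T p t) * Tt p t)) (at t within {0<..})"
  by (rule leibniz_rule_field_derivative) (use 1 2 3 t in \<open>auto simp: split_beta\<close>)
 then show ?thesis using t by (simp add: at_within_open[of t "{0<..}"])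
qed

end

section \<open>Cutoffs and exponential weights\<close>

text \<open>The arithmetic-geometric mean inequality in a form free of square roots.\<close>

lemma two_mult_le_add:
 fixes x a b :: real
 assumes "x^2 <= a * b" "0 <= a" "0 <= b"
 shows "2 * x <= a + b"
proof -
 have "(2 * x)^2 <= (a + b)^2"
  using assms(1) zero_le_power2[of "a - b"] by (simp add: power2_eq_square algebra_simps)
 then show ?thesis by (rule power2_le_imp_le) (use assms in simp)
qed

text \<open>A polynomial used only on \<open>[-R, R]\<close>, where it vanishes to second order at
  both ends. The outer square gives \<open>(cutoff')^2 <= 16 / R^2 * cutoff\<close>, so that terms
  with its derivative can be absorbed by a dissipation carrying the same weight.\<close>

definition cutoff :: "real => real => real" where "cutoff R x = (1 - (x/R)\<^sup>2)^2"
definition cutoff' :: "real => real => real" where "cutoff' R x = - 4 * (x/R) * (1 - (x/R)\<^sup>2) / R"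
definition cutoff'' :: "real => real => real" where "cutoff'' R x = (12 * (x/R)^2 - 4) / R^2"

lemma cutoff_deriv:
 assumes "R > 0"
 shows "(cutoff R has_real_derivative cutoff' R x) (at x within A)"
  "(cutoff' R has_real_derivative cutoff'' R x) (at x within A)"
proof -
 have "((%x. (1 - (x/R)\<^sup>2)^2) has_real_derivative cutoff' R x) (at x within A)"
  using assms unfolding cutoff'_def
  by (auto intro!: derivative_eq_intros simp: field_simps power2_eq_square)
 moreover have "((%x. - 4 * (x/R) * (1 - (x/R)\<^sup>2) / R) has_real_derivative cutoff'' R x) (at x within A)"
  using assms unfolding cutoff''_def
  by (auto intro!: derivative_eq_intros simp: field_simps power2_eq_square)
 ultimately show "(cutoff R has_real_derivative cutoff' R x) (at x within A)"
  "(cutoff' R has_real_derivative cutoff'' R x) (at x within A)"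
  unfolding cutoff_def[abs_def] cutoff'_def[abs_def] by simp_all
qed

lemma cutoff_cont [continuous_intros]:
 assumes "continuous_on A g"
 shows "continuous_on A (%p. cutoff R (g p))" "continuous_on A (%p. cutoff' R (g p))" "continuous_on A (%p. cutoff'' R (g p))"
proof -
 have *: "continuous_on A (%p. g p / R)"
  using continuous_on_mult[OF assms continuous_on_const, of "inverse R"] by (simp add: divide_inverse)
 have **: "continuous_on A (%p. - 4 * (g p / R) * (1 - (g p / R)\<^sup>2) * inverse R)"
  "continuous_on A (%p. (12 * (g p / R)^2 - 4) * inverse (R^2))"
  by (intro continuous_intros *)+
 show "continuous_on A (%p. cutoff R (g p))"
  unfolding cutoff_def by (intro continuous_intros *)
 show "continuous_on A (%p. cutoff' R (g p))" "continuous_on A (%p. cutoff'' R (g p))"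
  using ** by (simp_all only: cutoff'_def cutoff''_def divide_inverse)
qed

lemma cutoff_props:
 assumes "R > 0" "\<bar>x\<bar> <= R"
 shows "0 <= cutoff R x" "cutoff R x <= 1" "(cutoff' R x)^2 <= 16 / R^2 * cutoff R x" "\<bar>cutoff' R x\<bar> <= 4 / R"
  "\<bar>cutoff'' R x\<bar> <= 8 / R^2"
proof -
 define r where "r = (x/R)^2"
 have "\<bar>x/R\<bar> <= 1" using assms by simp
 then have r: "0 <= r" "r <= 1" unfolding r_def by (auto simp: abs_square_le_1)
 show 1: "0 <= cutoff R x" by (simp add: cutoff_def)
 show 2: "cutoff R x <= 1" using r unfolding cutoff_def r_def[symmetric] by (simp add: power_le_one)
 have "(cutoff' R x)^2 = 16 / R^2 * (r * cutoff R x)"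
  unfolding cutoff'_def cutoff_def r_def by (simp add: power_mult_distrib power_divide)
 also have "... <= 16 / R^2 * (1 * cutoff R x)"
  using r 1 assms by (intro mult_left_mono mult_right_mono) auto
 finally show 3: "(cutoff' R x)^2 <= 16 / R^2 * cutoff R x" by simp
 also have "... <= 16 / R^2 * 1" using 2 assms by (intro mult_left_mono) auto
 finally have "(cutoff' R x)^2 <= (4 / R)^2" by (simp add: power_divide)
 then show "\<bar>cutoff' R x\<bar> <= 4 / R" using assms abs_le_square_iff[of "cutoff' R x" "4/R"] by simp
 have "\<bar>12 * r - 4\<bar> <= 8" using r by auto
 then show "\<bar>cutoff'' R x\<bar> <= 8 / R^2"
  unfolding cutoff''_def r_def using assms by (simp add: divide_right_mono)
qed

lemma cutoff_zero [simp]: "R > 0 ==> cutoff R R = 0" "R > 0 ==> cutoff R (-R) = 0"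
 "R > 0 ==> cutoff' R R = 0" "R > 0 ==> cutoff' R (-R) = 0"
 by (auto simp: cutoff_def cutoff'_def)

text \<open>The exponential \<open>exp (a * x)\<close>, regularised to a bounded function when
  \<open>0 < et\<close>; for \<open>et = 0\<close> it is the exponential itself. Its logarithmic
  derivative is at most \<open>|a|\<close> whatever \<open>et\<close> is.\<close>

definition expw :: "real => real => real => real" where
 "expw a et x = 1 / (exp (- a * x) + et^2 * exp (a * x))"
definition expw' :: "real => real => real => real" where
 "expw' a et x = - a * (et^2 * exp (a * x) - exp (- a * x)) * (expw a et x)^2"
definition expw'' :: "real => real => real => real" where
 "expw'' a et x = - a\<^sup>2 * expw a et x + 2 * a^2 * (et^2 * exp (a * x) - exp (- a * x))^2 * (expw a et x)^3"

lemma expw_den: "0 < exp (- a * x) + et^2 * exp (a * x)" for a :: real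
 by (intro add_pos_nonneg) auto

lemma expw_deriv:
 "(expw a et has_real_derivative expw' a et x) (at x within A)"
 "(expw' a et has_real_derivative expw'' a et x) (at x within A)"
proof -
 have d: "exp (- a * x) + et^2 * exp (a * x) ~= 0" using expw_den[of a x et] by linarith
 show 1: "(expw a et has_real_derivative expw' a et x) (at x within A)" for A
  unfolding expw_def[abs_def] expw'_def using d
  by (auto intro!: derivative_eq_intros simp: divide_simps power2_eq_square) (auto simp: algebra_simps)
 have e1: "((%x. exp (c * x)) has_real_derivative c * exp (c * x)) (at x within A)" for c
  by (auto intro!: derivative_eq_intros)
 have A: "((%x. - a * (et^2 * exp (a * x) - exp (- a * x)) * (expw a et x)^2) has_real_derivative
   - a * (a * (et^2 * exp (a * x) + exp (- a * x))) * (expw a et x)^2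
   + (- a * (et^2 * exp (a * x) - exp (- a * x))) * (2 * expw a et x * expw' a et x)) (at x within A)"
  by (rule DERIV_cong[OF DERIV_mult[OF DERIV_cmult[OF DERIV_diff[OF DERIV_cmult[OF e1] e1]] DERIV_power[OF 1]]])
   (simp add: algebra_simps)
 have eq: "(et^2 * exp (a * x) + exp (- a * x)) * expw a et x = 1"
  using d by (simp add: expw_def add.commute)
 have B: "- a * (a * (et^2 * exp (a * x) + exp (- a * x))) * (expw a et x)^2 = - a\<^sup>2 * expw a et x"
 proof -
  have "- a * (a * (et^2 * exp (a * x) + exp (- a * x))) * (expw a et x)^2
   = - a\<^sup>2 * expw a et x * ((et^2 * exp (a * x) + exp (- a * x)) * expw a et x)"
   by (simp add: power2_eq_square algebra_simps)
  then show ?thesis by (simp only: eq mult_1_right)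
 qed
 have C: "(- a * (et^2 * exp (a * x) - exp (- a * x))) * (2 * expw a et x * expw' a et x) =
  2 * a^2 * (et^2 * exp (a * x) - exp (- a * x))^2 * (expw a et x)^3"
  unfolding expw'_def by (simp add: power2_eq_square power3_eq_cube)
 show "(expw' a et has_real_derivative expw'' a et x) (at x within A)"
  unfolding expw'_def[abs_def] by (rule DERIV_cong[OF A]) (simp only: B C expw''_def)
qed

text \<open>The derivatives are controlled because the difference of the two exponentials in the
  denominator is at most their sum in absolute value; hence the constants do not involve
  \<open>et\<close>. The last bound recovers the exponential on a fixed interval as
  \<open>et\<close> tends to 0.\<close>

lemma expw_props:
 shows "0 < expw a et x" "expw a et x <= exp (a * x)" "(expw' a et x)^2 <= a^2 * (expw a et x)^2"
  "\<bar>expw'' a et x\<bar> <= 3 * a^2 * expw a et x" "0 < et ==> expw a et x <= 1 / et"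
  "\<bar>x\<bar> <= L ==> exp (a * x) / (1 + et^2 * exp (2 * \<bar>a\<bar> * L)) <= expw a et x"
proof -
 define k where "k = exp (- a * x) + et^2 * exp (a * x)"
 define j where "j = et^2 * exp (a * x) - exp (- a * x)"
 have k: "0 < k" unfolding k_def by (rule expw_den)
 have e: "expw a et x = 1 / k" by (simp add: expw_def k_def)
 have "exp (- a * x) * (et^2 * exp (a * x)) \<ge> 0" by simp
 then have jk: "j^2 <= k^2" unfolding j_def k_def by (simp add: power2_eq_square algebra_simps)
 show 1: "0 < expw a et x" using k e by simp
 have "1 / k <= 1 / exp (- a * x)" using k by (intro divide_left_mono) (auto simp: k_def)
 then show "expw a et x <= exp (a * x)" by (simp add: e exp_minus field_simps)
 have jj: "j^2 * (expw a et x)^2 <= 1" using jk k by (simp add: e power_divide divide_simps)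
 have "(expw' a et x)^2 = a^2 * (expw a et x)^2 * (j^2 * (expw a et x)^2)"
  unfolding expw'_def j_def by (simp add: power2_eq_square)
 also have "... <= a^2 * (expw a et x)^2 * 1" using jj by (intro mult_left_mono) auto
 finally show "(expw' a et x)^2 <= a^2 * (expw a et x)^2" by simp
 have "expw'' a et x = - (a^2 * expw a et x) + 2 * (a^2 * expw a et x) * (j^2 * (expw a et x)^2)"
  unfolding expw''_def j_def by (simp add: power2_eq_square power3_eq_cube)
 moreover have "2 * (a^2 * expw a et x) * (j^2 * (expw a et x)^2) <= 2 * (a^2 * expw a et x) * 1"
  using jj 1 by (intro mult_left_mono) auto
 moreover have "0 <= 2 * (a^2 * expw a et x) * (j^2 * (expw a et x)^2)" "0 <= a^2 * expw a et x"
  using 1 by simp_all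
 ultimately show "\<bar>expw'' a et x\<bar> <= 3 * a^2 * expw a et x" by linarith
 show "expw a et x <= 1 / et" if "0 < et"
 proof -
  have "2 * et <= k" unfolding k_def
   by (rule two_mult_le_add) (auto simp: exp_minus divide_simps)
  then show ?thesis using that k by (simp add: e divide_simps)
 qed
 show "exp (a * x) / (1 + et^2 * exp (2 * \<bar>a\<bar> * L)) <= expw a et x" if "\<bar>x\<bar> <= L"
 proof -
  have "a * x <= \<bar>a\<bar> * L"
   using order_trans[OF abs_ge_self, of "a * x" "\<bar>a\<bar> * L"] mult_left_mono[OF that, of "\<bar>a\<bar>"] by (simp add: abs_mult)
  then have "2 * (a * x) <= 2 * (\<bar>a\<bar> * L)" by simp
  then have "exp (2 * (a * x)) <= exp (2 * (\<bar>a\<bar> * L))" by simp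
  then have "1 + et^2 * exp (2 * (a * x)) <= 1 + et^2 * exp (2 * \<bar>a\<bar> * L)"
   by (intro add_left_mono mult_left_mono) (auto simp: mult.assoc)
  moreover have "k * exp (a * x) = 1 + et^2 * exp (2 * (a * x))"
   unfolding k_def by (simp add: distrib_right mult.assoc exp_add[symmetric])
  ultimately have "k * exp (a * x) <= 1 + et^2 * exp (2 * \<bar>a\<bar> * L)" by simp
  moreover have "0 < 1 + et^2 * exp (2 * \<bar>a\<bar> * L)" by (intro add_pos_nonneg) auto
  ultimately show ?thesis using k by (simp add: e divide_simps mult.commute)
 qed
qed

lemma expw_cont [continuous_intros]:
 assumes "continuous_on A g"
 shows "continuous_on A (%p. expw a et (g p))" "continuous_on A (%p. expw' a et (g p))" "continuous_on A (%p. expw'' a et (g p))"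
proof -
 have *: "continuous_on A (%p. expw a et (g p))"
  unfolding expw_def using expw_den[of a _ et] by (intro continuous_intros assms) (auto simp: less_imp_neq[symmetric])
 show "continuous_on A (%p. expw a et (g p))" "continuous_on A (%p. expw' a et (g p))" "continuous_on A (%p. expw'' a et (g p))"
  unfolding expw'_def expw''_def by (intro * continuous_intros assms)+
qed

lemma integral_exp_abs_le:
 fixes al R :: real
 assumes "0 < al" "0 <= R"
 shows "integral {-R..R} (%x. exp (- al * \<bar>x\<bar>)) <= 2 / al"
proof -
 let ?e = "%x. exp (- al * \<bar>x\<bar>)"
 have 1: "(?e has_integral (exp (al * 0) / al - exp (al * (-R)) / al)) {-R..0}"
 proof (rule fundamental_theorem_of_calculus)
  fix x assume "x \<in> {-R..0}"
  then have "\<bar>x\<bar> = - x" by auto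
  then show "((%x. exp (al * x) / al) has_vector_derivative ?e x) (at x within {-R..0})"
   using assms by (auto simp: vector_derivative_iff intro!: derivative_eq_intros)
 qed (use assms in auto)
 have 2: "(?e has_integral (- exp (- al * R) / al - (- exp (- al * 0) / al))) {0..R}"
 proof (rule fundamental_theorem_of_calculus)
  fix x assume "x \<in> {0..R}"
  then have "\<bar>x\<bar> = x" by auto
  then show "((%x. - exp (- al * x) / al) has_vector_derivative ?e x) (at x within {0..R})"
   using assms by (auto simp: vector_derivative_iff intro!: derivative_eq_intros)
 qed (use assms in auto)
 have "(?e has_integral ((exp (al * 0) / al - exp (al * (-R)) / al) + (- exp (- al * R) / al - (- exp (- al * 0) / al)))) {-R..R}"
  using assms by (intro has_integral_combine[OF _ _ 1 2]) auto
 then have "integral {-R..R} ?e = 2 / al - 2 * (exp (- al * R) / al)"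
  by (auto dest!: integral_unique simp: field_simps)
 moreover have "0 <= exp (- al * R) / al" using assms by simp
 ultimately show ?thesis by linarith
qed

lemma integral_box_exp_abs_le:
 fixes al R H :: real
 assumes "0 < al" "0 <= R" "0 <= H"
 shows "integral (cbox (-R,0) (R,H)) (%p. exp (- al * \<bar>fst p\<bar>)) <= 2 * H / al"
proof -
 have "integral (cbox (-R,0) (R,H)) (%p. exp (- al * \<bar>fst p\<bar>)) = H * integral {-R..R} (%x. exp (- al * \<bar>x\<bar>))"
  by (subst integral_box_iterated(1)) (auto intro!: continuous_intros simp: assms)
 also have "... <= H * (2 / al)" using assms integral_exp_abs_le by (intro mult_left_mono) auto
 finally show ?thesis by (simp add: mult.commute)
qed

text \<open>The first derivative vanishes at the ends as well, so that diffusion can be integrated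
  by parts twice.\<close>

definition testfun :: "real => (real => real) => (real => real) => (real => real) => bool" where
 "testfun R m m' m'' \<longleftrightarrow> 0 < R \<and> continuous_on {-R..R} m'' \<and> m R = 0 \<and> m (-R) = 0 \<and> m' R = 0 \<and> m' (-R) = 0 \<and>
  (\<forall>x\<in>{-R..R}. (m has_real_derivative m' x) (at x within {-R..R}) \<and>
    (m' has_real_derivative m'' x) (at x within {-R..R}))"

lemma testfunD:
 assumes "testfun R m m' m''"
 shows "0 < R" "continuous_on {-R..R} m" "continuous_on {-R..R} m'" "continuous_on {-R..R} m''"
  "m R = 0" "m (-R) = 0" "m' R = 0" "m' (-R) = 0"
  "!!x. x \<in> {-R..R} ==> (m has_real_derivative m' x) (at x within {-R..R})"
  "!!x. x \<in> {-R..R} ==> (m' has_real_derivative m'' x) (at x within {-R..R})"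
 using assms unfolding testfun_def by (auto simp: continuous_on_eq_continuous_within dest: DERIV_continuous)

lemma testfun_cutoff: "0 < R ==> testfun R (cutoff R) (cutoff' R) (cutoff'' R)"
 unfolding testfun_def by (auto intro!: cutoff_deriv continuous_intros cutoff_cont[OF continuous_on_id, unfolded id_def])

lemma testfun_weighted:
 assumes "0 < R" "!!x. (g has_real_derivative g' x) (at x)" "!!x. (g' has_real_derivative g'' x) (at x)"
  and "continuous_on UNIV g''"
 shows "testfun R (%x. g x * cutoff R x) (%x. g' x * cutoff R x + g x * cutoff' R x)
  (%x. g'' x * cutoff R x + 2 * (g' x * cutoff' R x) + g x * cutoff'' R x)"
proof -
 have c: "continuous_on {-R..R} g" "continuous_on {-R..R} g'" "continuous_on {-R..R} g''"
  using assms(2,3) continuous_on_subset[OF assms(4)]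
  by (auto intro!: continuous_at_imp_continuous_on dest: DERIV_isCont)
 show ?thesis unfolding testfun_def
 proof (intro conjI ballI)
  show "continuous_on {- R..R} (%x. g'' x * cutoff R x + 2 * (g' x * cutoff' R x) + g x * cutoff'' R x)"
   by (intro continuous_intros c)
  fix x
  have d: "(g has_real_derivative g' x) (at x within {-R..R})" "(g' has_real_derivative g'' x) (at x within {-R..R})"
   using assms(2,3) by (auto intro: has_field_derivative_at_within)
  show "((%x. g x * cutoff R x) has_real_derivative g' x * cutoff R x + g x * cutoff' R x) (at x within {- R..R})"
   by (rule DERIV_cong[OF DERIV_mult[OF d(1) cutoff_deriv(1)]]) (use assms in \<open>auto simp: mult.commute\<close>)
  show "((%x. g' x * cutoff R x + g x * cutoff' R x) has_real_derivative
   g'' x * cutoff R x + 2 * (g' x * cutoff' R x) + g x * cutoff'' R x) (at x within {- R..R})"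
   by (rule DERIV_cong[OF DERIV_add[OF DERIV_mult[OF d(2) cutoff_deriv(1)] DERIV_mult[OF d(1) cutoff_deriv(2)]]])
    (use assms in \<open>auto simp: algebra_simps\<close>)
 qed (use assms(1) in auto)
qed

context reactive_flow
begin

abbreviation slab :: "real => plane set" where "slab R \<equiv> cbox (-R, 0) (R, H)"

lemma box_mem:
 assumes "p \<in> slab R"
 shows "snd p \<in> Yr" "\<bar>fst p\<bar> <= R" "fst p \<in> {-R..R}" "snd p \<in> {0..H}"
proof -
 have 1: "fst p \<in> {-R..R}" "snd p \<in> {0..H}"
  using assms unfolding cbox_Pair_eq mem_Times_iff by (simp_all add: box_real)
 then show "fst p \<in> {-R..R}" "snd p \<in> {0..H}" "snd p \<in> Yr" "\<bar>fst p\<bar> <= R"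
  using yr(2)[OF 1(2)] by auto
qed

lemma cont_fst_box:
 fixes k :: "real => real"
 assumes "continuous_on {-R..R} k"
 shows "continuous_on (slab R) (%p. k (fst p))"
 by (rule continuous_on_compose2[OF assms]) (auto intro!: continuous_intros simp: box_mem)

lemma cont_box_C2:
 assumes G: "C2fun G G' G''" and t: "0 <= t"
 shows "continuous_on (slab R) (%p. G (T p t))" "continuous_on (slab R) (%p. G' (T p t))" "continuous_on (slab R) (%p. G'' (T p t))"
proof -
 have "continuous_on (slab R) (%p. T p t)"
  using t by (intro flow_cont continuous_intros) (auto simp: box_mem)
 moreover have "T p t \<in> {0..1}" if "p \<in> slab R" for p using T_unit box_mem(1)[OF that] t by auto
 ultimately show "continuous_on (slab R) (%p. G (T p t))" "continuous_on (slab R) (%p. G' (T p t))" "continuous_on (slab R) (%p. G'' (T p t))"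
  by (auto intro: cont_compose_unit C2funD[OF G])
qed

lemma cont_box:
 assumes "0 < t"
 shows "continuous_on (slab R) (%p. Tt p t)" "continuous_on (slab R) (%p. Tx p t)" "continuous_on (slab R) (%p. Ty p t)"
  "continuous_on (slab R) (%p. Txx p t)" "continuous_on (slab R) (%p. Tyy p t)"
 using assms by (intro flow_cont continuous_intros; auto simp: box_mem)+

lemma cont_box_T: "0 <= t ==> continuous_on (slab R) (%p. T p t)"
 by (intro flow_cont continuous_intros) (auto simp: box_mem)

lemma cont_box_f: "0 <= t ==> continuous_on (slab R) (%p. f (T p t))"
 by (intro flow_cont continuous_intros) (auto simp: box_mem T_unit[simplified])

lemma cont_box_u: "continuous_on (slab R) u"
 using flow_cont(7)[of "slab R" "%p. p"] by (auto simp: box_mem continuous_on_id)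

lemma bdry_ok_x: "bdry_ok (%p. m (fst p)) 0 H"
 unfolding bdry_ok_def using yr pos by (cases b) auto

text \<open>For a test function of \<open>x\<close> alone a second integration by parts turns
  \<open>- m' * G'(T) * Tx\<close> into \<open>m'' * G(T)\<close>, which leaves the gradient only in
  the dissipation.\<close>

lemma weak_identity_x:
 assumes t: "0 < t" and G: "C2fun G G' G''" and m: "testfun R m m' m''"
 shows "integral (slab R) (%p. m (fst p) * G' (T p t) * Tt p t) =
  integral (slab R) (%p. G (T p t) * (fst (u p) * m' (fst p) + ka * m'' (fst p))
   - ka * m (fst p) * G'' (T p t) * ((Tx p t)^2 + (Ty p t)^2) + q * m (fst p) * G' (T p t) * f (T p t))"
proof -
 note M = testfunD[OF m]
 have t0: "0 <= t" using t by simp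
 note ci = continuous_intros cont_box[OF t] cont_box_T[OF t0] cont_box_f[OF t0] cont_box_u cont_box_C2[OF G t0] cont_fst_box[OF M(2)] cont_fst_box[OF M(3)] cont_fst_box[OF M(4)]
 define A where "A p = G (T p t) * (fst (u p) * m' (fst p))
   - ka * m (fst p) * G'' (T p t) * ((Tx p t)^2 + (Ty p t)^2)
   - ka * G' (T p t) * (m' (fst p) * Tx p t) + q * m (fst p) * G' (T p t) * f (T p t)" for p
 define D where "D p = m'' (fst p) * G (T p t) + m' (fst p) * G' (T p t) * Tx p t" for p
 have cA: "continuous_on (slab R) A" unfolding A_def by (intro ci)
 have cD: "continuous_on (slab R) D" unfolding D_def by (intro ci)
 have 1: "integral (slab R) (%p. m (fst p) * G' (T p t) * Tt p t) = integral (slab R) A"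
  using weak_identity[OF t G, of "-R" R "%p. m (fst p)" 0 H "%p. m' (fst p)" "%_. 0"] M pos bdry_ok_x[of m]
  unfolding A_def by (auto intro!: ci)
 have "integral (slab R) (%p. D p + 0) = 0"
 proof (rule box_divergence[where ?F1.0="%p. m' (fst p) * G (T p t)" and ?F2.0="%_. 0" and ?D2.0="%_. 0"])
  fix x y assume x: "x \<in> {-R..R}" and y: "y \<in> {0..H}"
  have yY: "y \<in> Yr" using y yr by auto
  have im: "(%x. T (x,y) t) ` {-R..R} \<subseteq> {0..1}" using T_unit[of "(_,y)" t] yY t by auto
  have d: "((%x. T (x,y) t) has_real_derivative Tx (x,y) t) (at x within {-R..R})"
   using der_x[OF yY t] by (auto intro: has_field_derivative_at_within)
  have TT: "T (x,y) t \<in> {0..1}" using T_unit[of "(x,y)" t] yY t by auto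
  show "((%x. m' (fst (x,y)) * G (T (x,y) t)) has_real_derivative D (x,y)) (at x within {-R..R})"
   unfolding D_def fst_conv
   by (rule DERIV_cong[OF DERIV_mult[OF M(10)[OF x] compose_within[OF d C2funD(4)[OF G TT] im]]])
    (simp add: algebra_simps)
 qed (use M pos cD in auto)
 then have 2: "integral (slab R) D = 0" by simp
 have "integral (slab R) (%p. G (T p t) * (fst (u p) * m' (fst p) + ka * m'' (fst p))
   - ka * m (fst p) * G'' (T p t) * ((Tx p t)^2 + (Ty p t)^2) + q * m (fst p) * G' (T p t) * f (T p t))
  = integral (slab R) (%p. A p + ka * D p)"
  by (rule integral_cong) (simp add: A_def D_def algebra_simps)
 also have "... = integral (slab R) A + integral (slab R) (%p. ka * D p)"
  by (intro integral_add box_integrable continuous_intros cA cD)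
 also have "... = integral (slab R) A" using 2 by simp
 finally show ?thesis using 1 by simp
qed

text \<open>The mean-zero estimate on each vertical section, integrated in \<open>x\<close>: since
  \<open>k\<close> does not depend on \<open>y\<close>, advection costs only
  \<open>Ty\<close>.\<close>

lemma zero_mean_box:
 assumes t: "0 < t" and G: "C2fun G G' G''" and k: "continuous_on {-R..R} k"
 shows "\<bar>integral (slab R) (%p. k (fst p) * (G (T p t) * fst (u p)))\<bar>
  <= integral (slab R) (%p. U * H * (\<bar>k (fst p)\<bar> * \<bar>G' (T p t) * Ty p t\<bar>))"
proof -
 have t0: "0 <= t" using t by simp
 note ci = continuous_intros cont_box[OF t] cont_box_T[OF t0] cont_box_f[OF t0] cont_box_u cont_box_C2[OF G t0] cont_fst_box[OF k]
 have c1: "continuous_on (slab R) (%p. k (fst p) * (G (T p t) * fst (u p)))" by (intro ci)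
 have c2: "continuous_on (slab R) (%p. U * H * (\<bar>k (fst p)\<bar> * \<bar>G' (T p t) * Ty p t\<bar>))" by (intro ci)
 let ?i = "%x. integral {0..H} (%y. k x * (G (T (x,y) t) * fst (u (x,y))))"
 let ?j = "%x. integral {0..H} (%y. U * H * (\<bar>k x\<bar> * \<bar>G' (T (x,y) t) * Ty (x,y) t\<bar>))"
 have le: "\<bar>?i x\<bar> <= ?j x" if x: "x \<in> {-R..R}" for x
 proof -
  have *: "continuous_on {0..H} (%y. h (x,y))" if "continuous_on (slab R) h" for h :: "plane => real"
   using that by (rule continuous_on_compose2) (use x in \<open>auto intro!: continuous_intros simp: cbox_Pair_eq\<close>)
  have cy: "continuous_on {0..H} (%y. G (T (x,y) t))" "continuous_on {0..H} (%y. fst (u (x,y)))"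
    "continuous_on {0..H} (%y. G' (T (x,y) t) * Ty (x,y) t)"
   by (rule *, intro ci)+
  have "\<bar>integral {0..H} (%y. G (T (x,y) t) * fst (u (x,y)))\<bar> <= U * H * integral {0..H} (%y. \<bar>G' (T (x,y) t) * Ty (x,y) t\<bar>)"
  proof (rule zero_mean_integral_bound)
   fix y assume y: "y \<in> {0..H}"
   show "\<bar>fst (u (x,y))\<bar> <= U" using u_comp_bound[of "(x,y)"] yr y by auto
   have im2: "(%y. T (x,y) t) ` {0..H} \<subseteq> {0..1}" using T_unit[of "(x,_)" t] yr t by auto
   have TT: "T (x,y) t \<in> {0..1}" using T_unit[of "(x,y)" t] yr y t by auto
   have d: "((%y. T (x,y) t) has_real_derivative Ty (x,y) t) (at y within {0..H})"
    using DERIV_subset[OF der_y yr(1)] yr y t by auto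
   show "((%y. G (T (x,y) t)) has_real_derivative G' (T (x,y) t) * Ty (x,y) t) (at y within {0..H})"
    by (rule compose_within[OF d C2funD(4)[OF G TT] im2])
  qed (use pos zero_mean cy in auto)
  from mult_left_mono[OF this, of "\<bar>k x\<bar>"] show ?thesis
   by (simp add: abs_mult mult_ac)
 qed
 have i1: "?i integrable_on {-R..R}"
  using integrable_on_superset box_integrable[OF c1]
  by (intro integrable_continuous_real integral_continuous_on_param[of _ 0 H, simplified] continuous_on_compose2[OF c1, where f="%z. z", simplified])
   (auto simp: split_beta cbox_Pair_eq intro!: continuous_on_subset[OF c1] )
 have i2: "?j integrable_on {-R..R}"
  by (intro integrable_continuous_real integral_continuous_on_param[of _ 0 H, simplified])
   (auto simp: split_beta cbox_Pair_eq intro!: continuous_on_subset[OF c2] )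
 have "\<bar>integral {-R..R} ?i\<bar> <= integral {-R..R} ?j"
  using integral_norm_bound_integral[OF i1 i2] le by auto
 then show ?thesis by (simp only: integral_box_iterated(1)[OF c1] integral_box_iterated(1)[OF c2] fst_conv)
qed

end

section \<open>Weighted energy estimates\<close>

definition wfun where "wfun a et R x = expw a et x * cutoff R x"
definition wfun' where "wfun' a et R x = expw' a et x * cutoff R x + expw a et x * cutoff' R x"
definition wfun'' where
 "wfun'' a et R x = expw'' a et x * cutoff R x + 2 * (expw' a et x * cutoff' R x) + expw a et x * cutoff'' R x"

lemma testfun_wfun: "0 < R ==> testfun R (wfun a et R) (wfun' a et R) (wfun'' a et R)"
 unfolding wfun_def[abs_def] wfun'_def[abs_def] wfun''_def[abs_def]
 by (rule testfun_weighted) (auto intro!: expw_deriv continuous_intros)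

text \<open>The third bound has the form \<open>m * n\<close> that the energy inequality can absorb.
  In \<open>n\<close> the part with \<open>a^2\<close> feeds the growth rate, and the part with
  \<open>1 / R^2\<close> is the error of the cutoff.\<close>

lemma wfun_props:
 assumes "0 < R" "\<bar>x\<bar> <= R"
 shows "0 <= wfun a et R x" "wfun a et R x <= expw a et x"
  "(wfun' a et R x)^2 <= wfun a et R x * (2 * a^2 * wfun a et R x + 32 / R^2 * expw a et x)"
  "\<bar>wfun'' a et R x\<bar> <= 4 * a^2 * wfun a et R x + 24 / R^2 * expw a et x"
proof -
 note c = cutoff_props[OF assms] and e = expw_props(1-4)[of a et x]
 define g where "g = expw a et x"
 define p where "p = cutoff R x"
 have g: "0 < g" and p: "0 <= p" "p <= 1" using e c by (auto simp: g_def p_def)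
 show "0 <= wfun a et R x" using g p by (simp add: wfun_def g_def p_def)
 show "wfun a et R x <= expw a et x" using g p mult_left_mono[of p 1 g] by (simp add: wfun_def g_def p_def)
 have pp: "p^2 <= p" using p by (simp add: power2_eq_square mult_left_le)
 have "(wfun' a et R x)^2 <= 2 * (expw' a et x * p)^2 + 2 * (g * cutoff' R x)^2"
  unfolding wfun'_def g_def[symmetric] p_def[symmetric]
  using zero_le_power2[of "expw' a et x * p - g * cutoff' R x"] by (simp add: power2_eq_square algebra_simps)
 also have "... = 2 * ((expw' a et x)^2 * p^2) + 2 * (g^2 * (cutoff' R x)^2)" by (simp add: power_mult_distrib)
 also have "... <= 2 * ((a^2 * g^2) * p^2) + 2 * (g^2 * (16 / R^2 * p))"
  using e(3) c(3) by (intro add_mono mult_left_mono mult_right_mono) (auto simp: g_def p_def)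
 also have "... = (g * p) * (2 * a^2 * (g * p) + 32 / R^2 * g)" by (simp add: power2_eq_square algebra_simps)
 finally show "(wfun' a et R x)^2 <= wfun a et R x * (2 * a^2 * wfun a et R x + 32 / R^2 * expw a et x)"
  by (simp add: wfun_def g_def p_def)
 have "2 * \<bar>expw' a et x * cutoff' R x\<bar> <= a^2 * (g * p) + 16 / R^2 * g"
 proof (rule two_mult_le_add)
  have "\<bar>expw' a et x * cutoff' R x\<bar>\<^sup>2 = (expw' a et x)^2 * (cutoff' R x)^2" by (simp add: power_mult_distrib)
  also have "... <= (a^2 * g^2) * (16 / R^2 * p)"
   using e(3) c(3) by (intro mult_mono) (auto simp: g_def p_def)
  finally show "\<bar>expw' a et x * cutoff' R x\<bar>\<^sup>2 <= a^2 * (g * p) * (16 / R^2 * g)"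
   by (simp add: power2_eq_square mult_ac)
 qed (use g p in auto)
 moreover have "\<bar>expw'' a et x * p\<bar> <= 3 * a^2 * g * p"
  using e(4) p mult_right_mono[of "\<bar>expw'' a et x\<bar>" "3 * a^2 * g" p] by (simp add: abs_mult g_def)
 moreover have "\<bar>g * cutoff'' R x\<bar> <= 8 / R^2 * g"
  using c(5) g mult_left_mono[of "\<bar>cutoff'' R x\<bar>" "8 / R^2" g] by (simp add: abs_mult mult.commute)
 ultimately have "\<bar>wfun'' a et R x\<bar> <= 3 * a^2 * g * p + (a^2 * (g * p) + 16 / R^2 * g) + 8 / R^2 * g"
  unfolding wfun''_def g_def[symmetric] p_def[symmetric] by linarith
 then show "\<bar>wfun'' a et R x\<bar> <= 4 * a^2 * wfun a et R x + 24 / R^2 * expw a et x"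
  unfolding wfun_def g_def[symmetric] p_def[symmetric] by (simp add: algebra_simps)
qed

context reactive_flow
begin

text \<open>An effective diffusivity due to advection, of the kind known from Taylor dispersion. It
  arises when the \<open>Ty\<close> produced by the mean-zero estimate is absorbed by the
  dissipation.\<close>

definition "acoef = U^2 * H^2 / ka"

lemma acoef_nonneg: "0 <= acoef" using pos by (simp add: acoef_def)

abbreviation "gsq p t \<equiv> (Tx p t)^2 + (Ty p t)^2"

lemma C2fun_square: "C2fun (%s. (s - c)^2) (%s. 2 * (s - c)) (%_. 2)"
 unfolding C2fun_def by (auto intro!: derivative_eq_intros continuous_intros)

text \<open>As the second derivative of \<open>(s - c)^2\<close> is 2, the weak form yields two
  copies of the dissipation. One of them absorbs the \<open>Ty\<close> from mean-zero advection, at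
  the price of \<open>acoef\<close>; the other stays in the conclusion.\<close>

lemma energy_inequality:
 assumes t: "0 < t" and m: "testfun R m m' m''"
  and bm: "!!x. x \<in> {-R..R} ==> 0 <= m x \<and> 0 <= n x \<and> (m' x)^2 <= m x * n x" and cn: "continuous_on {-R..R} n"
  and react: "!!s. s \<in> {0..1} ==> q * ((s - c) * f s) <= B * (s - c)^2"
 shows "integral (slab R) (%p. m (fst p) * (2 * (T p t - c)) * Tt p t) <=
  integral (slab R) (%p. (T p t - c)^2 * (acoef * n (fst p) + ka * \<bar>m'' (fst p)\<bar> + 2 * B * m (fst p)))
   - ka * integral (slab R) (%p. m (fst p) * gsq p t)"
proof -
 note M = testfunD[OF m]
 have t0: "0 <= t" using t by simp
 note ci = continuous_intros cont_box[OF t] cont_box_T[OF t0] cont_box_f[OF t0] cont_box_u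
  cont_fst_box[OF M(2)] cont_fst_box[OF M(3)] cont_fst_box[OF M(4)] cont_fst_box[OF cn]
 let ?P = "%p. m' (fst p) * ((T p t - c)^2 * fst (u p))"
 let ?P' = "%p. U * H * (\<bar>m' (fst p)\<bar> * \<bar>2 * (T p t - c) * Ty p t\<bar>)"
 let ?Q = "%p. (T p t - c)^2 * ka * m'' (fst p) - 2 * ka * m (fst p) * gsq p t + q * m (fst p) * (2 * (T p t - c)) * f (T p t)"
 let ?Z = "%p. (T p t - c)^2 * (acoef * n (fst p) + ka * \<bar>m'' (fst p)\<bar> + 2 * B * m (fst p)) - ka * (m (fst p) * gsq p t)"
 have cP: "continuous_on (slab R) ?P" by (intro ci)
 have cP': "continuous_on (slab R) ?P'" by (intro ci)
 have cQ: "continuous_on (slab R) ?Q" by (intro ci)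
 have cZ: "continuous_on (slab R) ?Z" by (intro ci)
 have "integral (slab R) (%p. m (fst p) * (2 * (T p t - c)) * Tt p t) = integral (slab R) (%p. ?P p + ?Q p)"
  unfolding weak_identity_x[OF t C2fun_square m]
  by (rule integral_cong) (simp add: algebra_simps)
 also have "... = integral (slab R) ?P + integral (slab R) ?Q"
  by (intro integral_add box_integrable cP cQ)
 also have "... <= integral (slab R) ?P' + integral (slab R) ?Q"
  using zero_mean_box[OF t C2fun_square[of c] M(3)] by auto
 also have "... = integral (slab R) (%p. ?P' p + ?Q p)"
  by (intro integral_add[symmetric] box_integrable cP' cQ)
 also have "... <= integral (slab R) ?Z"
 proof (rule integral_mono_box)
  fix p assume p: "p \<in> slab R"
  note b = bm[OF box_mem(3)[OF p]]
  define z where "z = T p t - c"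
  define x where "x = fst p"
  have "2 * (U * H * \<bar>z\<bar> * \<bar>m' x\<bar> * \<bar>Ty p t\<bar>) <= ka * m x * (Ty p t)^2 + acoef * n x * z^2"
  proof (rule two_mult_le_add)
   have "(U * H * \<bar>z\<bar> * \<bar>m' x\<bar> * \<bar>Ty p t\<bar>)^2 = (U^2 * H^2 * z^2 * (Ty p t)^2) * (m' x)^2"
    by (simp add: power_mult_distrib)
   also have "... <= (U^2 * H^2 * z^2 * (Ty p t)^2) * (m x * n x)"
    using b by (intro mult_left_mono) (auto simp: x_def)
   also have "... = ka * m x * (Ty p t)^2 * (acoef * n x * z^2)"
    using pos by (simp add: acoef_def)
   finally show "(U * H * \<bar>z\<bar> * \<bar>m' x\<bar> * \<bar>Ty p t\<bar>)^2 <= ka * m x * (Ty p t)^2 * (acoef * n x * z^2)" .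
  qed (use b acoef_nonneg pos in \<open>auto simp: x_def\<close>)
  moreover have P: "?P' p = 2 * (U * H * \<bar>z\<bar> * \<bar>m' x\<bar> * \<bar>Ty p t\<bar>)"
   by (simp only: abs_mult z_def x_def abs_numeral mult_ac)
  moreover have "z^2 * ka * m'' x <= z^2 * ka * \<bar>m'' x\<bar>" using pos by (intro mult_left_mono) auto
  moreover have "2 * m x * (q * (z * f (T p t))) <= 2 * m x * (B * z^2)"
   using react[OF T_unit[OF box_mem(1)[OF p] t0]] b by (intro mult_left_mono) (auto simp: z_def x_def)
  moreover have "0 <= ka * m x * (Tx p t)^2" using b pos by (auto simp: x_def)
  ultimately show "?P' p + ?Q p <= ?Z p"
   unfolding P unfolding z_def[symmetric] x_def[symmetric] by (simp add: algebra_simps)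
 qed (intro continuous_on_add cP' cQ cZ)+
 also have "... = integral (slab R) (%p. (T p t - c)^2 * (acoef * n (fst p) + ka * \<bar>m'' (fst p)\<bar> + 2 * B * m (fst p)))
   - integral (slab R) (%p. ka * (m (fst p) * gsq p t))"
  by (intro integral_diff box_integrable ci)
 finally show ?thesis by simp
qed

text \<open>The growth rate is quadratic in \<open>a\<close>: for \<open>B = 0\<close> and
  \<open>a\<close> of order \<open>1 / sqrt t\<close> the factor \<open>exp (erate a B * t)\<close>
  stays bounded.\<close>

definition "erate a B = (2 * acoef + 4 * ka) * a^2 + 2 * B"
text \<open>The constant of the cutoff error: the density
  \<open>(32 * acoef + 24 * ka) / (et * R^2)\<close> integrated over a slab of area
  \<open>2 * R * H\<close> gives \<open>eerr / (et * R)\<close>.\<close>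

definition "eerr = (64 * acoef + 48 * ka) * H"

lemma eerr_nonneg: "0 <= eerr" using acoef_nonneg pos by (simp add: eerr_def)

lemma erate_nonneg: "0 <= B ==> 0 <= erate a B" using acoef_nonneg pos by (simp add: erate_def)

lemma T_diff_sq_le_1:
 assumes "p \<in> slab R" "0 <= t" "c \<in> {0,1}"
 shows "(T p t - c)^2 <= 1"
 using T_unit[OF box_mem(1)[OF assms(1)] assms(2)] assms(3) by (auto simp: abs_square_le_1)

text \<open>The cutoff error is estimated by \<open>(T - c)^2 <= 1\<close> and
  \<open>expw <= 1 / et\<close> alone, as no rate of decay of \<open>T\<close> is known at this
  stage. This is the reason for a bounded weight.\<close>

lemma weighted_energy_rate:
 assumes t: "0 < t" and R: "0 < R" and et: "0 < et" and c: "c \<in> {0,1}" and B: "0 <= B"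
  and react: "!!s. s \<in> {0..1} ==> q * ((s - c) * f s) <= B * (s - c)^2"
 shows "integral (slab R) (%p. wfun a et R (fst p) * (2 * (T p t - c)) * Tt p t) <=
  erate a B * integral (slab R) (%p. wfun a et R (fst p) * (T p t - c)^2) + eerr / (et * R)
   - ka * integral (slab R) (%p. wfun a et R (fst p) * gsq p t)"
proof -
 let ?m = "wfun a et R"
 let ?n = "%x. 2 * a^2 * ?m x + 32 / R^2 * expw a et x"
 note tf = testfun_wfun[OF R, of a et]
 note M = testfunD[OF tf]
 have t0: "0 <= t" using t by simp
 have ce: "continuous_on {-R..R} (expw a et)" by (intro continuous_intros expw_cont[OF continuous_on_id, unfolded id_def])
 note ci = continuous_intros cont_box[OF t] cont_box_T[OF t0] cont_box_f[OF t0] cont_box_u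
  cont_fst_box[OF M(2)] cont_fst_box[OF M(3)] cont_fst_box[OF M(4)] cont_fst_box[OF ce]
 have "integral (slab R) (%p. ?m (fst p) * (2 * (T p t - c)) * Tt p t) <=
  integral (slab R) (%p. (T p t - c)^2 * (acoef * ?n (fst p) + ka * \<bar>wfun'' a et R (fst p)\<bar> + 2 * B * ?m (fst p)))
   - ka * integral (slab R) (%p. ?m (fst p) * gsq p t)"
 proof (rule energy_inequality[OF t tf _ _ react])
  show "continuous_on {-R..R} ?n" by (intro continuous_intros M ce)
  fix x assume "x \<in> {-R..R}"
  then have "\<bar>x\<bar> <= R" by auto
  then show "0 <= ?m x \<and> 0 <= ?n x \<and> (wfun' a et R x)^2 <= ?m x * ?n x"
   using wfun_props[OF R, of x a et] expw_props(1)[of a et x] by (auto intro!: add_nonneg_nonneg mult_nonneg_nonneg)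
 qed
 also have "integral (slab R) (%p. (T p t - c)^2 * (acoef * ?n (fst p) + ka * \<bar>wfun'' a et R (fst p)\<bar> + 2 * B * ?m (fst p)))
  <= integral (slab R) (%p. erate a B * (?m (fst p) * (T p t - c)^2) + (32 * acoef + 24 * ka) / (et * R^2))"
 proof (rule integral_mono_box)
  fix p assume p: "p \<in> slab R"
  define x where "x = fst p"
  define z where "z = T p t - c"
  have x: "\<bar>x\<bar> <= R" using box_mem[OF p] by (simp add: x_def)
  note w = wfun_props[OF R x, of a et] and e = expw_props(1)[of a et x] expw_props(5)[of et a x]
  have z: "z^2 <= 1" using T_diff_sq_le_1[OF p t0 c] by (simp add: z_def)
  have "acoef * ?n x + ka * \<bar>wfun'' a et R x\<bar> + 2 * B * ?m x <=
   acoef * ?n x + ka * (4 * a^2 * ?m x + 24 / R^2 * expw a et x) + 2 * B * ?m x"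
   using w(4) pos by (auto intro!: mult_left_mono)
  also have "... = erate a B * ?m x + (32 * acoef + 24 * ka) / R^2 * expw a et x"
   by (simp add: erate_def algebra_simps add_divide_distrib)
  finally have "z^2 * (acoef * ?n x + ka * \<bar>wfun'' a et R x\<bar> + 2 * B * ?m x) <=
    z^2 * (erate a B * ?m x + (32 * acoef + 24 * ka) / R^2 * expw a et x)"
   by (intro mult_left_mono) auto
  also have "... = erate a B * (?m x * z^2) + z^2 * ((32 * acoef + 24 * ka) / R^2 * expw a et x)"
   by (simp add: algebra_simps)
  also have "z^2 * ((32 * acoef + 24 * ka) / R^2 * expw a et x) <= 1 * ((32 * acoef + 24 * ka) / R^2 * (1 / et))"
   using z e et acoef_nonneg pos by (intro mult_mono mult_left_mono) (auto intro!: mult_nonneg_nonneg divide_nonneg_nonneg)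
  finally show "(T p t - c)^2 * (acoef * ?n (fst p) + ka * \<bar>wfun'' a et R (fst p)\<bar> + 2 * B * ?m (fst p))
    <= erate a B * (?m (fst p) * (T p t - c)^2) + (32 * acoef + 24 * ka) / (et * R^2)"
   by (simp add: x_def z_def mult.commute)
 qed (intro ci)+
 also have "... = erate a B * integral (slab R) (%p. ?m (fst p) * (T p t - c)^2)
   + integral (slab R) (%p. (32 * acoef + 24 * ka) / (et * R^2))"
  by (subst integral_add) (auto intro!: box_integrable ci)
 also have "integral (slab R) (%p. (32 * acoef + 24 * ka) / (et * R^2)) = eerr / (et * R)"
  using R et pos by (simp add: content_Pair eerr_def field_simps power2_eq_square)
 finally show ?thesis by simp
qed

end

section \<open>Weighted energy bounds independent of the cutoff and of the regularisation\<close>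

context reactive_flow
begin

declare yr(3) [simp]

lemma slab_subset: "L <= R ==> slab L \<subseteq> slab R"
 by (auto simp: cbox_Pair_eq)

lemma cont_slab_time:
 fixes h :: "real => plane => real"
 assumes "continuous_on (A \<times> slab R) (%z. h (fst z) (snd z))"
 shows "continuous_on A (%ta. integral (slab R) (h ta))"
 by (rule integral_continuous_on_param) (use assms in \<open>simp add: split_beta\<close>)

lemma slab_section_integrable:
 fixes g :: "plane => real"
 assumes "continuous_on (slab R) g"
 shows "(%x. integral {0..H} (%y. g (x,y))) integrable_on {-R..R}"
 by (intro integrable_continuous_real integral_continuous_on_param[of _ 0 H, simplified])
  (use assms in \<open>auto simp: split_beta cbox_Pair_eq\<close>)

lemma slab_section_continuous:
 fixes g :: "plane => real"
 assumes "continuous_on (slab R) g" "x \<in> {-R..R}"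
 shows "continuous_on {0..H} (%y. g (x,y))"
 using assms(1) by (rule continuous_on_compose2) (use assms(2) in \<open>auto intro!: continuous_intros simp: cbox_Pair_eq\<close>)

lemma continuous_T_slab: "continuous_on ({0..t} \<times> slab R) (%z. T (snd z) (fst z))"
 by (intro flow_cont continuous_intros) (auto simp: box_mem)

lemma continuous_grad_slab:
 assumes "0 < s"
 shows "continuous_on ({s..t} \<times> slab R) (%z. Tx (snd z) (fst z))" "continuous_on ({s..t} \<times> slab R) (%z. Ty (snd z) (fst z))"
  "continuous_on ({s..t} \<times> slab R) (%z. Tt (snd z) (fst z))"
 using assms by (intro flow_cont continuous_intros; auto simp: box_mem)+

lemma continuous_fst_slab_time:
 assumes "continuous_on {-R..R} k"
 shows "continuous_on ({s..t} \<times> slab R) (%z. k (fst (snd z)))"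
 by (rule continuous_on_compose2[OF assms]) (auto intro!: continuous_intros simp: box_mem)

text \<open>The energy is bounded by the Gronwall inequality, and the dissipation by integrating the
  same rate over \<open>[s, t]\<close>. The lower end \<open>s\<close> is positive because
  derivatives of \<open>T\<close> exist for positive times only.\<close>

lemma weighted_energy_finite:
 assumes t: "0 <= t" and R: "0 < R" and et: "0 < et" and c: "c \<in> {0,1}" and B: "0 <= B" and a: "a ~= 0"
  and react: "!!s. s \<in> {0..1} ==> q * ((s - c) * f s) <= B * (s - c)^2"
  and init: "!!x y. y \<in> Yr ==> (T (x,y) 0 - c)^2 * exp (a * x) <= M0 * exp (- \<bar>a\<bar> * \<bar>x\<bar>)"
 defines "Y \<equiv> exp (erate a B * t) * (2 * H * M0 / \<bar>a\<bar> + eerr / (et * R) * t)"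
 shows "integral (slab R) (%p. wfun a et R (fst p) * (T p t - c)^2) <= Y"
  and "0 < s ==> s <= t ==> ka * integral {s..t} (%ta. integral (slab R) (%p. wfun a et R (fst p) * gsq p ta))
   <= (1 + erate a B * t) * Y + eerr / (et * R) * t"
proof -
 let ?m = "wfun a et R"
 let ?E = "eerr / (et * R)"
 let ?C = "erate a B"
 let ?y = "%t. integral (slab R) (%p. ?m (fst p) * (T p t - c)^2)"
 let ?y' = "%t. integral (slab R) (%p. ?m (fst p) * (2 * (T p t - c)) * Tt p t)"
 let ?D = "%t. integral (slab R) (%p. ?m (fst p) * gsq p t)"
 note tf = testfun_wfun[OF R, of a et]
 note M = testfunD[OF tf]
 have m0: "0 <= ?m (fst p)" if "p \<in> slab R" for p using wfun_props(1)[OF R box_mem(2)[OF that]] .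
 have E: "0 <= ?E" using eerr_nonneg R et by simp
 have C: "0 <= ?C" using erate_nonneg[OF B] .
 have cy: "continuous_on {0..t} ?y" for t
  by (rule cont_slab_time) (intro continuous_intros continuous_fst_slab_time M continuous_T_slab)
 have dy: "(?y has_real_derivative ?y' s) (at s)" if "0 < s" for s
  using box_time_derivative[OF that C2fun_square[of c] yr(1) cont_fst_box[OF M(2)]] .
 have le: "?y' s <= ?C * ?y s + ?E - ka * ?D s" if "0 < s" for s
  using weighted_energy_rate[OF that R et c B react] by simp
 have D0: "0 <= ?D s" if "0 < s" for s
  by (rule integral_nonneg_box, intro continuous_intros cont_fst_box M cont_box that) (simp add: m0)
 have y0: "0 <= ?y s" if "0 <= s" for s
  by (rule integral_nonneg_box, intro continuous_intros cont_fst_box M cont_box_T that) (simp add: m0)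
 have "?y 0 <= integral (slab R) (%p. M0 * exp (- \<bar>a\<bar> * \<bar>fst p\<bar>))"
 proof (rule integral_mono_box)
  fix p assume p: "p \<in> slab R"
  have "?m (fst p) * (T p 0 - c)^2 <= exp (a * fst p) * (T p 0 - c)^2"
   using wfun_props(2)[OF R box_mem(2)[OF p], of a et] expw_props(2)[of a et "fst p"] by (intro mult_right_mono) auto
  also have "... <= M0 * exp (- \<bar>a\<bar> * \<bar>fst p\<bar>)"
   using init[OF box_mem(1)[OF p], of "fst p"] by (simp add: mult.commute)
  finally show "?m (fst p) * (T p 0 - c)^2 <= M0 * exp (- \<bar>a\<bar> * \<bar>fst p\<bar>)" .
 qed (intro continuous_intros cont_fst_box M cont_box_T order_refl)+
 also have "... <= M0 * (2 * H / \<bar>a\<bar>)"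
  using mult_left_mono[OF integral_box_exp_abs_le[of "\<bar>a\<bar>" R H], of M0] R a pos by simp
 finally have y00: "?y 0 <= 2 * H * M0 / \<bar>a\<bar>" by (simp add: mult.commute mult.left_commute)
 have yt: "?y s <= exp (?C * s) * (2 * H * M0 / \<bar>a\<bar> + ?E * s)" if "0 <= s" for s
 proof -
  have "?y s <= exp (?C * s) * (?y 0 + ?E * s)"
  proof (rule gronwall_linear[OF that cy dy _ C E])
   show "?y' r <= ?C * ?y r + ?E" if "0 < r" for r
   proof -
    have "0 <= ka * ?D r" using D0[OF that] pos by simp
    then show ?thesis using le[OF that] by linarith
   qed
  qed
  also have "... <= exp (?C * s) * (2 * H * M0 / \<bar>a\<bar> + ?E * s)" using y00 by simp
  finally show ?thesis .
 qed
 show "?y t <= Y" using yt[OF t] by (simp add: Y_def)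
 assume s: "0 < s" "s <= t"
 have yY: "?y r <= Y" if "0 <= r" "r <= t" for r
 proof -
  have "exp (?C * r) * (2 * H * M0 / \<bar>a\<bar> + ?E * r) <= Y" unfolding Y_def
   using that C E pos mult_nonneg_nonneg[OF E that(1)]
   by (intro mult_mono add_left_mono mult_left_mono) (auto intro!: add_nonneg_nonneg mult_left_mono)
  then show ?thesis using yt[OF that(1)] by simp
 qed
 have "(?y' has_integral (?y t - ?y s)) {s..t}"
  using dy s by (intro fundamental_theorem_of_calculus)
   (auto simp: vector_derivative_iff intro: has_field_derivative_at_within)
 moreover have cD: "continuous_on {s..t} ?D"
  by (rule cont_slab_time) (intro continuous_intros continuous_fst_slab_time M continuous_grad_slab s)
 then have iD: "((%r. (?C * Y + ?E) - ka * ?D r) has_integral ((?C * Y + ?E) * (t - s) - ka * integral {s..t} ?D)) {s..t}"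
  using s has_integral_const_real[of "?C * Y + ?E" s t]
  by (intro has_integral_diff has_integral_mult_right integrable_integral integrable_continuous_real) (auto simp: mult.commute)
 ultimately have "?y t - ?y s <= (?C * Y + ?E) * (t - s) - ka * integral {s..t} ?D"
 proof (rule has_integral_le)
  fix r assume r: "r \<in> {s..t}"
  have "?C * ?y r <= ?C * Y" using yY[of r] r s C by (intro mult_left_mono) auto
  then show "?y' r <= ?C * Y + ?E - ka * ?D r" using le[of r] r s by auto
 qed
 moreover have Y0: "0 <= Y" using yY[of t] y0[of t] t by linarith
 then have "(?C * Y + ?E) * (t - s) <= (?C * Y + ?E) * t" using C E s by (intro mult_left_mono) auto
 ultimately have "ka * integral {s..t} ?D <= ?y s - ?y t + (?C * Y + ?E) * t" by linarith
 also have "... <= Y + (?C * Y + ?E) * t" using yY[of s] y0[of t] s t by simp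
 finally show "ka * integral {s..t} ?D <= (1 + ?C * t) * Y + ?E * t" by (simp add: algebra_simps)
qed

text \<open>The radius is tied to the regularisation by \<open>R = 1 / ep^2\<close>, so that
  \<open>eerr / (ep * R) = eerr * ep\<close> and a single parameter tends to 0. On a fixed slab the
  weight then approaches \<open>exp (a * x)\<close>, and the factor on the left tends to 1.\<close>

lemma slab_weight_compare:
 assumes ep: "0 < ep" and L: "0 < L" "L * ep^2 <= 1" and c: "continuous_on (slab (1/ep^2)) h"
  and h: "!!p. p \<in> slab (1/ep^2) ==> 0 <= h p"
 shows "(1 - (L * ep^2)\<^sup>2)^2 / (1 + ep^2 * exp (2 * \<bar>a\<bar> * L)) * integral (slab L) (%p. exp (a * fst p) * h p)
  <= integral (slab (1/ep^2)) (%p. wfun a ep (1/ep^2) (fst p) * h p)"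
proof -
 let ?R = "1/ep^2"
 let ?fac = "(1 - (L * ep^2)\<^sup>2)^2 / (1 + ep^2 * exp (2 * \<bar>a\<bar> * L))"
 have R: "0 < ?R" "L <= ?R" using ep L by (auto simp: field_simps)
 note sub = slab_subset[OF R(2)]
 have ch: "continuous_on (slab L) h" using continuous_on_subset[OF c sub] .
 have cw: "continuous_on (slab ?R) (%p. wfun a ep ?R (fst p) * h p)"
  by (intro continuous_intros c cont_fst_box testfunD(2)[OF testfun_wfun] R)
 have "?fac * integral (slab L) (%p. exp (a * fst p) * h p) = integral (slab L) (%p. ?fac * (exp (a * fst p) * h p))" by simp
 also have "... <= integral (slab L) (%p. wfun a ep ?R (fst p) * h p)"
 proof (rule integral_mono_box)
  fix p assume p: "p \<in> slab L"
  define x where "x = fst p"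
  have x: "\<bar>x\<bar> <= L" using box_mem[OF p] by (simp add: x_def)
  have "(x / ?R)^2 <= (L * ep^2)^2" using x ep by (intro abs_le_square_iff[THEN iffD1]) (auto simp: abs_mult intro!: mult_right_mono)
  moreover have "(L * ep^2)^2 <= 1" using L ep by (simp add: abs_square_le_1)
  ultimately have "(1 - (L * ep^2)\<^sup>2)^2 <= cutoff ?R x"
   unfolding cutoff_def by (intro power_mono) auto
  moreover have "exp (a * x) / (1 + ep^2 * exp (2 * \<bar>a\<bar> * L)) <= expw a ep x" using expw_props(6)[OF x] .
  ultimately have "exp (a * x) / (1 + ep^2 * exp (2 * \<bar>a\<bar> * L)) * (1 - (L * ep^2)\<^sup>2)^2 <= wfun a ep ?R x"
   unfolding wfun_def using expw_props(1)[of a ep x] by (intro mult_mono) (auto simp: less_imp_le)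
  then have "(exp (a * x) / (1 + ep^2 * exp (2 * \<bar>a\<bar> * L)) * (1 - (L * ep^2)\<^sup>2)^2) * h p <= wfun a ep ?R x * h p"
   using h[of p] p sub by (intro mult_right_mono) auto
  then show "?fac * (exp (a * fst p) * h p) <= wfun a ep ?R (fst p) * h p"
   by (simp add: x_def mult.commute mult.left_commute)
 next
  show "continuous_on (slab L) (%p. ?fac * (exp (a * fst p) * h p))"
   by (intro continuous_on_mult_left continuous_intros ch)
  show "continuous_on (slab L) (%p. wfun a ep ?R (fst p) * h p)" using continuous_on_subset[OF cw sub] .
 qed
 also have "... <= integral (slab ?R) (%p. wfun a ep ?R (fst p) * h p)"
  by (intro integral_subset_le sub box_integrable cw continuous_on_subset[OF cw sub])
   (auto intro!: mult_nonneg_nonneg h wfun_props(1) R box_mem)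
 finally show ?thesis .
qed

lemma fac_tendsto: "((%ep. (1 - (L * ep^2)\<^sup>2)^2 / (1 + ep^2 * exp (2 * \<bar>a\<bar> * L)) * I) \<longlongrightarrow> I) (at_right 0)" for L a I :: real
 by (rule tendsto_eq_intros refl | simp)+

lemma eventually_small: "0 < L ==> eventually (%ep::real. 0 < ep \<and> L * ep^2 <= 1) (at_right 0)"
proof -
 assume "0 < L"
 have "((%ep::real. L * ep^2) \<longlongrightarrow> L * 0^2) (at_right 0)" by (intro tendsto_intros)
 then have "eventually (%ep::real. L * ep^2 < 1) (at_right 0)" by (rule order_tendstoD) simp
 then show ?thesis by (intro eventually_conj eventually_at_right_less) (auto elim: eventually_mono)
qed

text \<open>As \<open>ep\<close> tends to 0 the cutoff and the regularisation disappear, and the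
  bounds no longer depend on \<open>L\<close>. Exponential decay is thus carried from the initial
  data to all times, in the mean.\<close>

lemma weighted_decay:
 assumes t: "0 <= t" and L: "0 < L" and c: "c \<in> {0,1}" and B: "0 <= B" and a: "a ~= 0"
  and react: "!!s. s \<in> {0..1} ==> q * ((s - c) * f s) <= B * (s - c)^2"
  and init: "!!x y. y \<in> Yr ==> (T (x,y) 0 - c)^2 * exp (a * x) <= M0 * exp (- \<bar>a\<bar> * \<bar>x\<bar>)"
 shows "integral (slab L) (%p. exp (a * fst p) * (T p t - c)^2) <= exp (erate a B * t) * (2 * H * M0 / \<bar>a\<bar>)"
  and "0 < s ==> s <= t ==> ka * integral {s..t} (%ta. integral (slab L) (%p. exp (a * fst p) * gsq p ta))
   <= (1 + erate a B * t) * (exp (erate a B * t) * (2 * H * M0 / \<bar>a\<bar>))"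
proof -
 let ?I = "integral (slab L) (%p. exp (a * fst p) * (T p t - c)^2)"
 let ?fac = "%ep. (1 - (L * ep^2)\<^sup>2)^2 / (1 + ep^2 * exp (2 * \<bar>a\<bar> * L))"
 have E: "eerr / (ep * (1/ep^2)) = eerr * ep" if "0 < ep" for ep using that by (simp add: power2_eq_square)
 show "?I <= exp (erate a B * t) * (2 * H * M0 / \<bar>a\<bar>)"
 proof (rule tendsto_le[OF _ _ fac_tendsto])
  show "((%ep. exp (erate a B * t) * (2 * H * M0 / \<bar>a\<bar> + eerr * ep * t)) \<longlongrightarrow> exp (erate a B * t) * (2 * H * M0 / \<bar>a\<bar>)) (at_right 0)"
   by (rule tendsto_eq_intros refl | simp)+
  show "\<forall>\<^sub>F ep in at_right 0. ?fac ep * ?I <= exp (erate a B * t) * (2 * H * M0 / \<bar>a\<bar> + eerr * ep * t)"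
   using eventually_small[OF L]
  proof (rule eventually_mono)
   fix ep :: real assume ep: "0 < ep \<and> L * ep^2 <= 1"
   then have "0 < 1/ep^2" by simp
   from weighted_energy_finite(1)[OF t this conjunct1[OF ep] c B a react init]
   have "integral (slab (1/ep^2)) (%p. wfun a ep (1/ep^2) (fst p) * (T p t - c)^2)
     <= exp (erate a B * t) * (2 * H * M0 / \<bar>a\<bar> + eerr * ep * t)"
    unfolding E[OF conjunct1[OF ep]] by blast
   moreover have "?fac ep * ?I <= integral (slab (1/ep^2)) (%p. wfun a ep (1/ep^2) (fst p) * (T p t - c)^2)"
    using ep L by (intro slab_weight_compare continuous_intros cont_box_T t) auto
   ultimately show "?fac ep * ?I <= exp (erate a B * t) * (2 * H * M0 / \<bar>a\<bar> + eerr * ep * t)" by linarith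
  qed
 qed simp
 assume s: "0 < s" "s <= t"
 let ?J = "ka * integral {s..t} (%ta. integral (slab L) (%p. exp (a * fst p) * gsq p ta))"
 let ?Z = "%ep. (1 + erate a B * t) * (exp (erate a B * t) * (2 * H * M0 / \<bar>a\<bar> + eerr * ep * t)) + eerr * ep * t"
 show "?J <= (1 + erate a B * t) * (exp (erate a B * t) * (2 * H * M0 / \<bar>a\<bar>))"
 proof (rule tendsto_le[OF _ _ fac_tendsto])
  show "(?Z \<longlongrightarrow> (1 + erate a B * t) * (exp (erate a B * t) * (2 * H * M0 / \<bar>a\<bar>))) (at_right 0)"
   by (rule tendsto_eq_intros refl | simp)+
  show "\<forall>\<^sub>F ep in at_right 0. ?fac ep * ?J <= ?Z ep"
   using eventually_small[OF L]
  proof (rule eventually_mono)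
   fix ep :: real assume ep: "0 < ep \<and> L * ep^2 <= 1"
   let ?R = "1/ep^2"
   have R: "0 < ?R" using ep by simp
   from weighted_energy_finite(2)[OF t R conjunct1[OF ep] c B a react init s]
   have "ka * integral {s..t} (%ta. integral (slab ?R) (%p. wfun a ep ?R (fst p) * gsq p ta)) <= ?Z ep"
    unfolding E[OF conjunct1[OF ep]] by blast
   moreover have "ka * integral {s..t} (%ta. ?fac ep * integral (slab L) (%p. exp (a * fst p) * gsq p ta)) <=
     ka * integral {s..t} (%ta. integral (slab ?R) (%p. wfun a ep ?R (fst p) * gsq p ta))"
   proof (intro mult_left_mono integral_le integrable_continuous_real)
    show "continuous_on {s..t} (%ta. ?fac ep * integral (slab L) (%p. exp (a * fst p) * gsq p ta))"
     by (intro continuous_on_mult_left cont_slab_time continuous_intros continuous_grad_slab s)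
    show "continuous_on {s..t} (%ta. integral (slab ?R) (%p. wfun a ep ?R (fst p) * gsq p ta))"
     by (intro cont_slab_time continuous_intros continuous_grad_slab continuous_fst_slab_time testfunD(2)[OF testfun_wfun] R s)
    fix ta assume "ta \<in> {s..t}"
    then have "0 < ta" using s by auto
    then show "?fac ep * integral (slab L) (%p. exp (a * fst p) * gsq p ta) <= integral (slab ?R) (%p. wfun a ep ?R (fst p) * gsq p ta)"
     using ep L by (intro slab_weight_compare continuous_intros cont_box) auto
   qed (use pos in auto)
   moreover have "?fac ep * ?J = ka * integral {s..t} (%ta. ?fac ep * integral (slab L) (%p. exp (a * fst p) * gsq p ta))"
    by (simp add: mult.left_commute)
   ultimately show "?fac ep * ?J <= ?Z ep" by linarith
  qed
 qed simp
qed

end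

section \<open>Cooling is sublinear in time\<close>

context reactive_flow
begin

text \<open>Dominates \<open>1 - T\<close> on the left and \<open>T\<close> on the right. The
  inequality \<open>z <= (z^2 * exp c + exp (- c)) / 2\<close> turns the weighted square bounds into
  integrability of these functions.\<close>

definition "majorant p t = ((T p t)^2 * exp (lam * fst p) + (1 - T p t)^2 * exp (- lam * fst p) + exp (- lam * \<bar>fst p\<bar>)) / 2"

text \<open>Bounds the integral of the majorant over every slab. It grows exponentially in time,
  which is harmless: it gives finiteness at each time, and in the quantitative bounds it occurs
  divided by the size of a cutoff that tends to infinity at fixed time.\<close>

definition "KD t = (exp (erate lam (q * F) * t) * (2 * H * M0 / lam) + exp (erate (- lam) 0 * t) * (2 * H * M0 / lam) + 2 * H / lam) / 2"

lemma react0: "s \<in> {0..1} ==> q * ((s - 0) * f s) <= q * F * (s - 0)^2"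
 using f_bounds[of s] pos mult_left_mono[of "f s" "F * s" "q * s"] by (simp add: power2_eq_square mult_ac)

text \<open>Burning only decreases \<open>1 - T\<close>, so the energy of \<open>1 - T\<close> has
  growth constant \<open>B = 0\<close>. The cooling estimate depends on this, whereas the energy of
  \<open>T\<close> grows at a rate containing \<open>q * F\<close>.\<close>

lemma react1: "s \<in> {0..1} ==> q * ((s - 1) * f s) <= 0 * (s - 1)^2"
 using f_bounds[of s] pos mult_nonneg_nonpos[of q "(s - 1) * f s"] mult_nonpos_nonneg[of "s - 1" "f s"] by auto

lemma init0: "y \<in> Yr ==> (T (x,y) 0 - 0)^2 * exp (lam * x) <= M0 * exp (- \<bar>lam\<bar> * \<bar>x\<bar>)"
 using decay0[of y x] pos by simp

lemma init1:
 assumes "y \<in> Yr" "0 < al" "al <= lam"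
 shows "(T (x,y) 0 - 1)^2 * exp (- al * x) <= M0 * exp (- \<bar>- al\<bar> * \<bar>x\<bar>)"
 using decay1[OF assms, of x] assms by (simp add: power2_commute)

lemma decay_right:
 assumes "0 <= t" "0 < L"
 shows "integral (slab L) (%p. exp (lam * fst p) * (T p t)^2) <= exp (erate lam (q * F) * t) * (2 * H * M0 / lam)"
  "0 < s ==> s <= t ==> ka * integral {s..t} (%ta. integral (slab L) (%p. exp (lam * fst p) * gsq p ta))
   <= (1 + erate lam (q * F) * t) * (exp (erate lam (q * F) * t) * (2 * H * M0 / lam))"
 using weighted_decay(1)[OF assms _ _ _ react0 init0] weighted_decay(2)[OF assms _ _ _ react0 init0, of s] pos by auto

lemma decay_left:
 assumes "0 <= t" "0 < L" "0 < al" "al <= lam"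
 shows "integral (slab L) (%p. exp (- al * fst p) * (1 - T p t)^2) <= exp (erate (- al) 0 * t) * (2 * H * M0 / al)"
  "0 < s ==> s <= t ==> ka * integral {s..t} (%ta. integral (slab L) (%p. exp (- al * fst p) * gsq p ta))
   <= (1 + erate (- al) 0 * t) * (exp (erate (- al) 0 * t) * (2 * H * M0 / al))"
 using weighted_decay(1)[OF assms(1,2) _ _ _ react1 init1[OF _ assms(3,4)]]
  weighted_decay(2)[OF assms(1,2) _ _ _ react1 init1[OF _ assms(3,4)], of s] assms(3) by (auto simp: power2_commute[of 1])

lemma cont_majorant: "0 <= t ==> continuous_on (slab R) (%p. majorant p t)"
 unfolding majorant_def by (intro continuous_intros cont_box_T) auto

lemma majorant_nonneg: "0 <= majorant p t" by (simp add: majorant_def)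

lemma majorant_integral:
 assumes "0 <= t" "0 < L"
 shows "integral (slab L) (%p. majorant p t) <= KD t"
proof -
 let ?a = "%p. exp (lam * fst p) * (T p t)^2" and ?b = "%p. exp (- lam * fst p) * (1 - T p t)^2" and ?c = "%p. exp (- lam * \<bar>fst p\<bar>)"
 have c: "continuous_on (slab L) ?a" "continuous_on (slab L) ?b" "continuous_on (slab L) ?c"
  by (intro continuous_intros cont_box_T assms(1))+
 have "integral (slab L) (%p. majorant p t) = integral (slab L) (%p. (?a p + ?b p + ?c p) * (1/2))"
  by (rule integral_cong) (simp add: majorant_def mult.commute)
 also have "... = (integral (slab L) ?a + integral (slab L) ?b + integral (slab L) ?c) * (1/2)"
  using integral_add[OF box_integrable[OF continuous_on_add[OF c(1,2)]] box_integrable[OF c(3)]]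
   integral_add[OF box_integrable[OF c(1)] box_integrable[OF c(2)]] by simp
 also have "... <= KD t"
  using decay_right(1)[OF assms] decay_left(1)[OF assms pos(5) order_refl] integral_box_exp_abs_le[of lam L H] assms pos
  unfolding KD_def by simp
 finally show ?thesis .
qed

lemma KD_mono: "0 <= s ==> s <= t ==> KD s <= KD t"
 unfolding KD_def using pos erate_nonneg[of "q * F" lam] erate_nonneg[of 0 "- lam"]
 by (intro divide_right_mono add_mono mult_right_mono) (auto intro!: mult_left_mono)

lemma KD_nonneg: "0 <= KD t" unfolding KD_def using pos by simp

lemma le_half_weight: "z <= (z^2 * exp c + exp (- c)) / 2" for z c :: real
proof -
 have "2 * z <= z^2 * exp c + exp (- c)"
  by (rule two_mult_le_add) (auto simp: exp_minus divide_simps)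
 then show ?thesis by simp
qed

lemma majorant_bounds:
 assumes "snd p \<in> Yr" "0 <= t"
 shows "fst p <= 0 ==> 1 - T p t <= majorant p t" "0 <= fst p ==> T p t <= majorant p t"
  "f (T p t) <= F * majorant p t"
proof -
 have T: "0 <= T p t" "T p t <= 1" using T_unit[OF assms] by auto
 have 1: "1 - T p t <= majorant p t" if "fst p <= 0"
 proof -
  have "\<bar>fst p\<bar> = - fst p" using that by simp
  then have e: "exp (- lam * \<bar>fst p\<bar>) = exp (- (- lam * fst p))" by simp
  show ?thesis unfolding majorant_def e
   by (rule order_trans[OF le_half_weight[of "1 - T p t" "- lam * fst p"]]) simp
 qed
 have 2: "T p t <= majorant p t" if "0 <= fst p"
 proof -
  have e: "exp (- lam * \<bar>fst p\<bar>) = exp (- (lam * fst p))" using that by simp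
  show ?thesis unfolding majorant_def e
   by (rule order_trans[OF le_half_weight[of "T p t" "lam * fst p"]]) simp
 qed
 show "fst p <= 0 ==> 1 - T p t <= majorant p t" "0 <= fst p ==> T p t <= majorant p t" by (fact 1 2)+
 have fb: "f (T p t) <= F * T p t" "f (T p t) <= F * (1 - T p t)" using f_bounds[of "T p t"] T by auto
 show "f (T p t) <= F * majorant p t"
 proof (cases "fst p <= 0")
  case True
  then show ?thesis using fb(2) mult_left_mono[OF 1[OF True], of F] pos by linarith
 next
  case False
  then show ?thesis using fb(1) mult_left_mono[OF 2, of F] pos by linarith
 qed
qed

definition "cool t = (exp (erate lam (q * F)) * (2 * H * M0 / lam) + (exp (2 * acoef + 4 * ka) * (2 * H * M0) + 2 * H) * (1 / lam + sqrt t)) / 2"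

text \<open>\<open>1 - T\<close> is a subsolution of the linear advection--diffusion equation. Its energy with weight
 \<open>exp (- x / sqrt t)\<close> stays bounded by a multiple of its initial value up to time \<open>t\<close>, hence cooling is
 confined to a region of measure \<open>O (sqrt t)\<close>. This replaces monotonicity of \<open>T\<close> in time.\<close>

lemma cooling_bound:
 assumes t: "1 <= t" and L: "0 < L"
 shows "integral (slab L) (%p. max 0 (T p 1 - T p t)) <= cool t"
proof -
 define al where "al = min lam (1 / sqrt t)"
 have al: "0 < al" "al <= lam" "al <= 1 / sqrt t" using t pos by (auto simp: al_def)
 have "al^2 <= (1 / sqrt t)^2" using al by (intro power_mono) auto
 then have a2: "al^2 * t <= 1" using t by (simp add: power_divide field_simps)
 have "1 / al <= 1 / lam + sqrt t"
 proof (cases "lam <= 1 / sqrt t")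
  case True then show ?thesis using t by (simp add: al_def)
 next
  case False then show ?thesis using t pos by (simp add: al_def)
 qed
 note ia = this
 have t0: "0 <= t" using t by simp
 let ?a = "%p. exp (lam * fst p) * (T p 1)^2" and ?b = "%p. exp (- al * fst p) * (1 - T p t)^2" and ?c = "%p. exp (- al * \<bar>fst p\<bar>)"
 have c: "continuous_on (slab L) ?a" "continuous_on (slab L) ?b" "continuous_on (slab L) ?c"
  by (intro continuous_intros cont_box_T t0 zero_le_one)+
 have "integral (slab L) (%p. max 0 (T p 1 - T p t)) <= integral (slab L) (%p. (?a p + ?b p + ?c p) * (1/2))"
 proof (rule integral_mono_box)
  show "continuous_on (slab L) (%p. max 0 (T p 1 - T p t))"
   by (intro continuous_intros cont_box_T t0 zero_le_one)
  show "continuous_on (slab L) (%p. (?a p + ?b p + ?c p) * (1/2))" by (intro continuous_intros c)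
  fix p assume p: "p \<in> slab L"
  have T: "0 <= T p 1" "T p 1 <= 1" "0 <= T p t" "T p t <= 1" using T_unit[OF box_mem(1)[OF p]] t0 by auto
  have 1: "T p 1 <= (?a p + exp (- (lam * fst p))) / 2" using le_half_weight[of "T p 1" "lam * fst p"] by (simp add: mult.commute)
  have 2: "1 - T p t <= (?b p + exp (- (- al * fst p))) / 2" using le_half_weight[of "1 - T p t" "- al * fst p"] by (simp add: mult.commute)
  show "max 0 (T p 1 - T p t) <= (?a p + ?b p + ?c p) * (1/2)"
  proof (cases "fst p <= 0")
   case True
   then have "?c p = exp (- (- al * fst p))" by simp
   then have "1 - T p t <= (?b p + ?c p) / 2" using 2 by simp
   also have "... <= (?a p + ?b p + ?c p) * (1/2)" by simp
   finally show ?thesis using T by (simp only: max.bounded_iff) auto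
  next
   case False
   then have "al * fst p <= lam * fst p" using al by (intro mult_right_mono) auto
   then have e: "exp (- (lam * fst p)) <= ?c p" using False by simp
   have "T p 1 <= (?a p + ?c p) / 2"
    by (rule order_trans[OF 1], intro divide_right_mono add_left_mono) (use e in auto)
   also have "... <= (?a p + ?b p + ?c p) * (1/2)" by simp
   finally show ?thesis using T by (simp only: max.bounded_iff) auto
  qed
 qed
 also have "... = (integral (slab L) ?a + integral (slab L) ?b + integral (slab L) ?c) * (1/2)"
  using integral_add[OF box_integrable[OF continuous_on_add[OF c(1,2)]] box_integrable[OF c(3)]]
   integral_add[OF box_integrable[OF c(1)] box_integrable[OF c(2)]] by simp
 also have "... <= cool t"
 proof -
  have "erate (- al) 0 * t = (2 * acoef + 4 * ka) * (al^2 * t)" by (simp add: erate_def)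
  also have "... <= (2 * acoef + 4 * ka) * 1" using a2 acoef_nonneg pos by (intro mult_left_mono) auto
  finally have "exp (erate (- al) 0 * t) <= exp (2 * acoef + 4 * ka)" by simp
  then have "exp (erate (- al) 0 * t) * (2 * H * M0) * (1 / al) <= exp (2 * acoef + 4 * ka) * (2 * H * M0) * (1 / lam + sqrt t)"
   using ia al pos t by (intro mult_mono) auto
  then have b: "integral (slab L) ?b <= exp (2 * acoef + 4 * ka) * (2 * H * M0) * (1 / lam + sqrt t)"
   using decay_left(1)[OF t0 L al(1,2)] by (simp add: mult.assoc)
  have "2 * H * (1 / al) <= 2 * H * (1 / lam + sqrt t)" using ia pos by (intro mult_left_mono) auto
  then have c': "integral (slab L) ?c <= 2 * H * (1 / lam + sqrt t)"
   using integral_box_exp_abs_le[OF al(1), of L H] L pos by simp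
  show ?thesis using b c' decay_right(1)[OF zero_le_one L] unfolding cool_def by (simp add: distrib_right)
 qed
 finally show ?thesis .
qed

lemma cool_sublinear: "((%t. cool t / t) \<longlongrightarrow> 0) at_top"
proof -
 define c1 where "c1 = (exp (erate lam (q * F)) * (2 * H * M0 / lam) + (exp (2 * acoef + 4 * ka) * (2 * H * M0) + 2 * H) * (1 / lam)) / 2"
 define c2 where "c2 = (exp (2 * acoef + 4 * ka) * (2 * H * M0) + 2 * H) / 2"
 have "((%t. c1 * inverse t + c2 * inverse (sqrt t)) \<longlongrightarrow> c1 * 0 + c2 * 0) at_top"
  by (intro tendsto_intros tendsto_inverse_0_at_top filterlim_ident sqrt_at_top)
 moreover have "eventually (%t. c1 * inverse t + c2 * inverse (sqrt t) = cool t / t) at_top"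
  using eventually_gt_at_top[of 0]
 proof (rule eventually_mono)
  fix t :: real assume t: "0 < t"
  have "cool t = c1 + c2 * sqrt t" unfolding cool_def c1_def c2_def by (simp add: distrib_left distrib_right add_divide_distrib)
  moreover have "sqrt t / t = inverse (sqrt t)" using t by (simp add: field_simps)
  ultimately show "c1 * inverse t + c2 * inverse (sqrt t) = cool t / t" by (simp add: divide_inverse distrib_right mult.assoc)
 qed
 ultimately show ?thesis by (simp add: tendsto_cong)
qed

text \<open>On each vertical section the zero mean of \<open>u\<close> allows \<open>G 1\<close> to
  be subtracted from \<open>G(T)\<close> on the left and \<open>G 0\<close> on the right. The rest
  is dominated by the majorant, so advection against \<open>cutoff'\<close> is of order
  \<open>1 / R\<close> and involves no gradient of \<open>T\<close>.\<close>

lemma slab_transport_error: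
 assumes t: "0 <= t" and G: "C2fun G G' G''" and R: "0 < R"
  and Gb: "!!s. s \<in> {0..1} ==> \<bar>G s - G 0\<bar> <= Lip * s \<and> \<bar>G s - G 1\<bar> <= Lip * (1 - s) \<and> \<bar>G s\<bar> <= \<Gamma>"
 shows "\<bar>integral (slab R) (%p. G (T p t) * (fst (u p) * cutoff' R (fst p) + ka * cutoff'' R (fst p)))\<bar>
  <= (4 * U * Lip * KD t + 16 * ka * \<Gamma> * H) / R"
proof -
 note M = testfunD[OF testfun_cutoff[OF R]]
 have Lip: "0 <= Lip" using Gb[of 1] by auto
 have \<Gamma>: "0 <= \<Gamma>" using Gb[of 1] by auto
 note ci = continuous_intros cont_box_T[OF t] cont_box_u cont_box_C2[OF G t] cont_majorant[OF t]
  cont_fst_box[OF M(2)] cont_fst_box[OF M(3)] cont_fst_box[OF M(4)]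
 let ?A = "%p. cutoff' R (fst p) * (G (T p t) * fst (u p))"
 let ?A' = "%p. 4 / R * (U * Lip * majorant p t)"
 have cA: "continuous_on (slab R) ?A" by (intro ci)
 have cA': "continuous_on (slab R) ?A'" by (intro continuous_on_mult_left ci)
 have cB: "continuous_on (slab R) (%p. ka * (G (T p t) * cutoff'' R (fst p)))" by (intro ci)
 let ?i = "%x. integral {0..H} (%y. cutoff' R x * (G (T (x,y) t) * fst (u (x,y))))"
 let ?j = "%x. integral {0..H} (%y. 4 / R * (U * Lip * majorant (x,y) t))"
 have le: "\<bar>?i x\<bar> <= ?j x" if x: "x \<in> {-R..R}" for x
 proof -
  note * = slab_section_continuous[OF _ x]
  define c where "c = (if x <= 0 then G 1 else G 0)"
  have cg: "continuous_on {0..H} (%y. G (T (x,y) t))" "continuous_on {0..H} (%y. fst (u (x,y)))"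
   "continuous_on {0..H} (%y. majorant (x,y) t)" by (rule *, intro ci)+
  have c1: "continuous_on {0..H} (%y. (G (T (x,y) t) - c) * fst (u (x,y)))" by (intro continuous_intros cg)
  have "integral {0..H} (%y. G (T (x,y) t) * fst (u (x,y))) = integral {0..H} (%y. (G (T (x,y) t) - c) * fst (u (x,y)) + c * fst (u (x,y)))"
   by (rule integral_cong) (simp add: algebra_simps)
  also have "... = integral {0..H} (%y. (G (T (x,y) t) - c) * fst (u (x,y))) + c * integral {0..H} (%y. fst (u (x,y)))"
   by (subst integral_add) (auto intro!: integrable_continuous_real c1 continuous_intros cg)
  finally have e: "integral {0..H} (%y. G (T (x,y) t) * fst (u (x,y))) = integral {0..H} (%y. (G (T (x,y) t) - c) * fst (u (x,y)))"
   using zero_mean by simp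
  have "\<bar>integral {0..H} (%y. (G (T (x,y) t) - c) * fst (u (x,y)))\<bar> <= integral {0..H} (%y. \<bar>(G (T (x,y) t) - c) * fst (u (x,y))\<bar>)"
   using integral_abs_le_box[of 0 H "%y. (G (T (x,y) t) - c) * fst (u (x,y))"] c1 by simp
  also have "... <= integral {0..H} (%y. U * Lip * majorant (x,y) t)"
  proof (intro integral_le integrable_continuous_real)
   fix y assume y: "y \<in> {0..H}"
   then have yY: "snd (x,y) \<in> Yr" by auto
   have TT: "T (x,y) t \<in> {0..1}" using T_unit[OF yY t] by simp
   have "\<bar>G (T (x,y) t) - c\<bar> <= Lip * majorant (x,y) t"
   proof (cases "x <= 0")
    case True
    then have "\<bar>G (T (x,y) t) - c\<bar> <= Lip * (1 - T (x,y) t)" using Gb[OF TT] by (simp add: c_def)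
    also have "... <= Lip * majorant (x,y) t" using majorant_bounds(1)[OF yY t] True Lip by (intro mult_left_mono) auto
    finally show ?thesis .
   next
    case False
    then have "\<bar>G (T (x,y) t) - c\<bar> <= Lip * T (x,y) t" using Gb[OF TT] by (simp add: c_def)
    also have "... <= Lip * majorant (x,y) t" using majorant_bounds(2)[OF yY t] False Lip by (intro mult_left_mono) auto
    finally show ?thesis .
   qed
   then have "\<bar>G (T (x,y) t) - c\<bar> * \<bar>fst (u (x,y))\<bar> <= (Lip * majorant (x,y) t) * U"
    using u_comp_bound(1)[OF yY] Lip majorant_nonneg by (intro mult_mono) auto
   then show "\<bar>(G (T (x,y) t) - c) * fst (u (x,y))\<bar> <= U * Lip * majorant (x,y) t"
    by (simp add: abs_mult mult_ac)
  qed (intro continuous_intros c1 cg)+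
  finally have "\<bar>integral {0..H} (%y. G (T (x,y) t) * fst (u (x,y)))\<bar> <= integral {0..H} (%y. U * Lip * majorant (x,y) t)"
   unfolding e .
  moreover have "\<bar>cutoff' R x\<bar> <= 4 / R" using cutoff_props(4)[OF R, of x] x by auto
  ultimately have "\<bar>cutoff' R x\<bar> * \<bar>integral {0..H} (%y. G (T (x,y) t) * fst (u (x,y)))\<bar> <= 4 / R * integral {0..H} (%y. U * Lip * majorant (x,y) t)"
   using R by (intro mult_mono) auto
  then show ?thesis by (simp add: abs_mult)
 qed
 have ii: "?i integrable_on {-R..R}"
  using slab_section_integrable[OF cA] by (simp only: fst_conv)
 have ij: "?j integrable_on {-R..R}"
  by (rule slab_section_integrable[OF cA'])
 have "\<bar>integral {-R..R} ?i\<bar> <= integral {-R..R} ?j"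
  using integral_norm_bound_integral[OF ii ij] le by auto
 then have "\<bar>integral (slab R) ?A\<bar> <= integral (slab R) ?A'"
  by (simp only: integral_box_iterated(1)[OF cA] integral_box_iterated(1)[OF cA'] fst_conv)
 also have "... = 4 / R * (U * Lip) * integral (slab R) (%p. majorant p t)" by (simp add: mult.assoc)
 also have "... <= 4 / R * (U * Lip) * KD t"
  using majorant_integral[OF t R] R pos Lip by (intro mult_left_mono) auto
 finally have 1: "\<bar>integral (slab R) ?A\<bar> <= 4 * U * Lip * KD t / R" by (simp add: mult_ac)
 have "\<bar>integral (slab R) (%p. ka * (G (T p t) * cutoff'' R (fst p)))\<bar> <= integral (slab R) (%p. \<bar>ka * (G (T p t) * cutoff'' R (fst p))\<bar>)"
  by (rule integral_abs_le_box[OF cB])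
 also have "... <= integral (slab R) (%p. ka * (\<Gamma> * (8 / R^2)))"
 proof (rule integral_mono_box)
  fix p assume p: "p \<in> slab R"
  have "\<bar>G (T p t)\<bar> * \<bar>cutoff'' R (fst p)\<bar> <= \<Gamma> * (8 / R^2)"
   using Gb[OF T_unit[OF box_mem(1)[OF p] t]] cutoff_props(5)[OF R box_mem(2)[OF p]] \<Gamma> by (intro mult_mono) auto
  from mult_left_mono[OF this, of ka]
  show "\<bar>ka * (G (T p t) * cutoff'' R (fst p))\<bar> <= ka * (\<Gamma> * (8 / R^2))"
   using pos by (simp add: abs_mult)
 qed (intro continuous_intros cB)+
 also have "... = 16 * ka * \<Gamma> * H / R" using R pos by (simp add: content_Pair power2_eq_square)
 finally have 2: "\<bar>integral (slab R) (%p. ka * (G (T p t) * cutoff'' R (fst p)))\<bar> <= 16 * ka * \<Gamma> * H / R" .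
 have "integral (slab R) (%p. G (T p t) * (fst (u p) * cutoff' R (fst p) + ka * cutoff'' R (fst p)))
  = integral (slab R) (%p. ?A p + ka * (G (T p t) * cutoff'' R (fst p)))"
  by (rule integral_cong) (simp add: algebra_simps)
 also have "... = integral (slab R) ?A + integral (slab R) (%p. ka * (G (T p t) * cutoff'' R (fst p)))"
  by (intro integral_add box_integrable cA cB)
 finally show ?thesis using 1 2 by (simp add: add_divide_distrib)
qed

end

section \<open>Fuel, dissipation and displacement\<close>

context reactive_flow
begin

definition "Phi s = integral {0..s} f"
text \<open>Its second derivative is \<open>f\<close>, so this energy dissipates exactly
  \<open>ka * f(T) * |grad T|^2\<close>.\<close>

definition "Gam s = integral {0..s} Phi"
text \<open>The quantity transported through the tubes. Its second derivative
  \<open>2 * f * f'\<close> retains a factor \<open>f\<close>, which makes its diffusion term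
  comparable with the dissipation.\<close>

definition "Psi s = integral {0..s} (%r. (f r)^2)"

lemma Phi_deriv: "s \<in> {0..1} ==> (Phi has_real_derivative f s) (at s within {0..1})"
 unfolding Phi_def[abs_def] using integral_has_real_derivative[OF cont_f] by simp

lemma cont_Phi: "continuous_on {0..1} Phi"
 by (meson DERIV_continuous Phi_deriv continuous_on_eq_continuous_within)

lemma C2fun_Gam: "C2fun Gam Phi f"
 unfolding C2fun_def Gam_def[abs_def]
 using integral_has_real_derivative[OF cont_Phi] Phi_deriv cont_f by simp

lemma C2fun_Psi: "C2fun Psi (%s. (f s)^2) (%s. 2 * f s * f' s)"
proof -
 have c: "continuous_on {0..1} (%s. (f s)^2)" by (intro continuous_intros cont_f)
 have "continuous_on {0..1} (%s. 2 * f s * f' s)" by (intro continuous_intros cont_f cont_f')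
 moreover have "((%s. (f s)^2) has_real_derivative 2 * f s * f' s) (at s within {0..1})" if "s \<in> {0..1}" for s
  using DERIV_power[OF der_f[OF that], of 2] by (simp add: mult.commute mult.left_commute)
 ultimately show ?thesis unfolding C2fun_def Psi_def[abs_def] using integral_has_real_derivative[OF c] by simp
qed

lemma C2fun_id: "C2fun (%s. s) (%_. 1) (%_. 0)"
 unfolding C2fun_def by (auto intro!: derivative_eq_intros)

lemma f_unit: "s \<in> {0..1} ==> 0 <= f s \<and> f s <= F"
proof -
 assume s: "s \<in> {0..1}"
 then have "F * s <= F" using pos by (simp add: mult_left_le)
 then show ?thesis using f_bounds[OF s] by linarith
qed

lemma unit_lipschitz:
 assumes "!!s. s \<in> {0..1} ==> (G has_real_derivative G' s) (at s within {0..1})"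
  and "!!s. s \<in> {0..1} ==> \<bar>G' s\<bar> <= Lip" and "r \<in> {0..1}" "s \<in> {0..1}"
 shows "\<bar>G r - G s\<bar> <= Lip * \<bar>r - s\<bar>"
 using field_differentiable_bound[of "{0..1}" G G' Lip s r] assms by (auto simp: convex_real_interval abs_minus_commute)

lemma C2fun_transport_bounds:
 assumes "C2fun G G' G''" "!!s. s \<in> {0..1} ==> \<bar>G' s\<bar> <= Lip" "G 0 = 0" "s \<in> {0..1}"
 shows "\<bar>G s - G 0\<bar> <= Lip * s \<and> \<bar>G s - G 1\<bar> <= Lip * (1 - s) \<and> \<bar>G s\<bar> <= Lip"
proof -
 note l = unit_lipschitz[OF C2funD(4)[OF assms(1)] assms(2), of s]
 have "0 <= Lip" using assms(2)[of 0] by auto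
 then have "Lip * s <= Lip" using assms(4) by (simp add: mult_left_le)
 then show ?thesis using l[of 0] l[of 1] assms(3,4) by auto
qed

lemma Phi_0: "Phi 0 = 0" and Gam_0: "Gam 0 = 0" and Psi_0: "Psi 0 = 0"
 by (simp_all add: Phi_def Gam_def Psi_def)

lemma Phi_range:
 assumes "s \<in> {0..1}"
 shows "0 <= Phi s" "Phi s <= Phi 1"
proof -
 have i: "f integrable_on {0..r}" if "r <= 1" for r
  using that by (intro integrable_continuous_real continuous_on_subset[OF cont_f]) auto
 show "0 <= Phi s" unfolding Phi_def using assms f_unit by (intro integral_nonneg i) auto
 show "Phi s <= Phi 1" unfolding Phi_def using assms f_unit by (intro integral_subset_le i) auto
qed

lemma Gam_mono: "r \<in> {0..1} ==> s \<in> {0..1} ==> r <= s ==> Gam r <= Gam s"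
 unfolding Gam_def using Phi_range
 by (intro integral_subset_le integrable_continuous_real continuous_on_subset[OF cont_Phi]) auto

text \<open>The cutoff error of a balance, uniformly over all times up to \<open>t\<close>; it tends
  to 0 as \<open>R\<close> grows with \<open>t\<close> fixed.\<close>

definition "eb Lip t R = (4 * U * Lip * KD t + 16 * ka * Lip * H) / R"

lemma cont_slab_time_C2:
 assumes G: "C2fun G G' G''" and s: "0 <= s"
 shows "continuous_on ({s..t} \<times> slab R) (%z. G (T (snd z) (fst z)))" "continuous_on ({s..t} \<times> slab R) (%z. G' (T (snd z) (fst z)))"
  "continuous_on ({s..t} \<times> slab R) (%z. G'' (T (snd z) (fst z)))"
proof -
 have "continuous_on ({s..t} \<times> slab R) (%z. T (snd z) (fst z))"
  by (rule continuous_on_subset[OF continuous_T_slab[of t]]) (use s in auto)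
 moreover have "T (snd z) (fst z) \<in> {0..1}" if "z \<in> {s..t} \<times> slab R" for z
  using that s by (intro T_unit box_mem(1)[of _ R]) auto
 ultimately show "continuous_on ({s..t} \<times> slab R) (%z. G (T (snd z) (fst z)))" "continuous_on ({s..t} \<times> slab R) (%z. G' (T (snd z) (fst z)))"
  "continuous_on ({s..t} \<times> slab R) (%z. G'' (T (snd z) (fst z)))"
  by (auto intro: cont_compose_unit C2funD[OF G])
qed

lemma cont_f_slab_time: "0 <= s ==> continuous_on ({s..t} \<times> slab R) (%z. f (T (snd z) (fst z)))"
 using cont_slab_time_C2(3)[OF C2fun_Gam] .

text \<open>The weak form integrated over time. With \<open>G = Gam\<close> it bounds the
  dissipation, and with the identity it compares the burnt fuel with the displacement of
  \<open>T\<close>.\<close>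

lemma slab_balance:
 assumes s: "0 < s" "s <= t" and R: "0 < R" and G: "C2fun G G' G''" and b: "!!s. s \<in> {0..1} ==> \<bar>G' s\<bar> <= Lip" and G0: "G 0 = 0"
 shows "\<bar>integral (slab R) (%p. cutoff R (fst p) * G (T p t)) - integral (slab R) (%p. cutoff R (fst p) * G (T p s))
   + ka * integral {s..t} (%ta. integral (slab R) (%p. cutoff R (fst p) * G'' (T p ta) * gsq p ta))
   - q * integral {s..t} (%ta. integral (slab R) (%p. cutoff R (fst p) * G' (T p ta) * f (T p ta)))\<bar>
  <= (t - s) * eb Lip t R"
proof -
 let ?y = "%ta. integral (slab R) (%p. cutoff R (fst p) * G (T p ta))"
 let ?y' = "%ta. integral (slab R) (%p. cutoff R (fst p) * G' (T p ta) * Tt p ta)"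
 let ?D = "%ta. integral (slab R) (%p. cutoff R (fst p) * G'' (T p ta) * gsq p ta)"
 let ?r = "%ta. integral (slab R) (%p. cutoff R (fst p) * G' (T p ta) * f (T p ta))"
 let ?e = "%ta. integral (slab R) (%p. G (T p ta) * (fst (u p) * cutoff' R (fst p) + ka * cutoff'' R (fst p)))"
 note tf = testfun_cutoff[OF R]
 note M = testfunD[OF tf]
 have s0: "0 <= s" using s by simp
 have "(?y' has_integral (?y t - ?y s)) {s..t}"
  using box_time_derivative[OF _ G yr(1) cont_fst_box[OF M(2)]] s by (intro fundamental_theorem_of_calculus)
   (auto simp: vector_derivative_iff intro: has_field_derivative_at_within)
 moreover have cD: "continuous_on {s..t} ?D"
  by (rule cont_slab_time) (intro continuous_intros continuous_grad_slab s cont_slab_time_C2[OF G s0])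
 moreover have cr: "continuous_on {s..t} ?r"
  by (rule cont_slab_time) (intro continuous_intros cont_f_slab_time[OF s0] cont_slab_time_C2[OF G s0])
 moreover have "((%ta. ka * ?D ta - q * ?r ta) has_integral (ka * integral {s..t} ?D - q * integral {s..t} ?r)) {s..t}"
  by (intro has_integral_diff has_integral_mult_right integrable_integral integrable_continuous_real cD cr)
 ultimately have I1: "((%ta. ?y' ta + (ka * ?D ta - q * ?r ta)) has_integral (?y t - ?y s + (ka * integral {s..t} ?D - q * integral {s..t} ?r))) {s..t}"
  by (intro has_integral_add) auto
 have *: "?y' ta + (ka * ?D ta - q * ?r ta) = ?e ta" if "ta \<in> {s..t}" for ta
 proof -
  have t0: "0 < ta" and t1: "0 <= ta" using that s by auto
  note ci = continuous_intros cont_box_T[OF t1] cont_box_u cont_box_C2[OF G t1] cont_box_f[OF t1] cont_box[OF t0]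
   cont_fst_box[OF M(2)] cont_fst_box[OF M(3)] cont_fst_box[OF M(4)]
  have c1: "continuous_on (slab R) (%p. G (T p ta) * (fst (u p) * cutoff' R (fst p) + ka * cutoff'' R (fst p)))"
   and c2: "continuous_on (slab R) (%p. cutoff R (fst p) * G'' (T p ta) * gsq p ta)"
   and c3: "continuous_on (slab R) (%p. cutoff R (fst p) * G' (T p ta) * f (T p ta))"
   by (intro ci)+
  have "?y' ta = integral (slab R) (%p. G (T p ta) * (fst (u p) * cutoff' R (fst p) + ka * cutoff'' R (fst p))
    - ka * (cutoff R (fst p) * G'' (T p ta) * gsq p ta) + q * (cutoff R (fst p) * G' (T p ta) * f (T p ta)))"
   unfolding weak_identity_x[OF t0 G tf] by (rule integral_cong) (simp add: algebra_simps)
  also have "... = ?e ta - integral (slab R) (%p. ka * (cutoff R (fst p) * G'' (T p ta) * gsq p ta))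
    + integral (slab R) (%p. q * (cutoff R (fst p) * G' (T p ta) * f (T p ta)))"
   by (subst integral_add integral_diff; (intro box_integrable continuous_on_diff continuous_on_mult_left c1 c2 c3)?)+ simp
  finally show ?thesis by simp
 qed
 have "(?e has_integral (?y t - ?y s + (ka * integral {s..t} ?D - q * integral {s..t} ?r))) {s..t}"
  by (rule has_integral_eq[OF * I1])
 then have I2: "(?e has_integral (?y t - ?y s + (ka * integral {s..t} ?D - q * integral {s..t} ?r))) (cbox s t)"
  by simp
 have Lip: "0 <= Lip" using b[of 0] by auto
 have e0: "0 <= eb Lip t R"
  unfolding eb_def using pos KD_nonneg R Lip by (intro divide_nonneg_pos add_nonneg_nonneg mult_nonneg_nonneg) auto
 have "norm (?e ta) <= eb Lip t R" if "ta \<in> cbox s t" for ta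
 proof -
  have t1: "0 <= ta" "ta <= t" using s that by auto
  have "\<bar>?e ta\<bar> <= (4 * U * Lip * KD ta + 16 * ka * Lip * H) / R"
   using slab_transport_error[OF t1(1) G R C2fun_transport_bounds[OF G b G0]] by auto
  also have "... <= eb Lip t R" unfolding eb_def
   using KD_mono[OF t1] pos R Lip by (intro divide_right_mono add_right_mono mult_left_mono) auto
  finally show ?thesis by simp
 qed
 from has_integral_bound[OF e0 I2 this] show ?thesis using s by (simp add: mult.commute algebra_simps)
qed

text \<open>Counted from time 1, as is \<open>dissip\<close>, so that the gradient and the time
  derivative are continuous on the closed time interval.\<close>

definition "fuel R t = q * integral {1..t} (%ta. integral (slab R) (%p. f (T p ta)))"
definition "dissip R t = ka * integral {1..t} (%ta. integral (slab R) (%p. cutoff R (fst p) * f (T p ta) * gsq p ta))"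

lemma cutoff_slab: "0 < R ==> p \<in> slab R ==> 0 <= cutoff R (fst p) \<and> cutoff R (fst p) <= 1"
 using cutoff_props(1,2)[of R "fst p"] box_mem(2)[of p R] by auto

lemma f_T_bounds: "p \<in> slab R ==> 0 <= t ==> 0 <= f (T p t) \<and> f (T p t) <= F"
 using f_unit[OF T_unit[OF box_mem(1)]] .

lemma fuel_cutoff_le:
 assumes R: "0 < R" and h: "continuous_on {0..1} h" "!!s. s \<in> {0..1} ==> h s <= c"
  and c: "0 <= c"
 shows "q * integral {1..t} (%ta. integral (slab R) (%p. cutoff R (fst p) * h (T p ta) * f (T p ta))) <= c * fuel R t"
proof -
 have cf: "continuous_on {1..t} (%ta. integral (slab R) (%p. f (T p ta)))"
  by (rule cont_slab_time) (intro cont_f_slab_time zero_le_one)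
 have "continuous_on ({1..t} \<times> slab R) (%z. h (T (snd z) (fst z)))"
  by (intro cont_compose_unit[OF h(1)] flow_cont continuous_intros) (auto simp: box_mem intro!: T_unit[simplified])
 then have ch: "continuous_on {1..t} (%ta. integral (slab R) (%p. cutoff R (fst p) * h (T p ta) * f (T p ta)))"
  by (intro cont_slab_time continuous_intros cont_f_slab_time zero_le_one)
 have "integral {1..t} (%ta. integral (slab R) (%p. cutoff R (fst p) * h (T p ta) * f (T p ta)))
  <= integral {1..t} (%ta. c * integral (slab R) (%p. f (T p ta)))"
 proof (intro integral_le integrable_continuous_real ch continuous_on_mult_left cf)
  fix ta assume "ta \<in> {1..t}"
  then have t1: "0 <= ta" by auto
  have cT: "continuous_on (slab R) (%p. h (T p ta))"
   by (intro cont_compose_unit[OF h(1)] cont_box_T t1 T_unit box_mem(1))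
  have "integral (slab R) (%p. cutoff R (fst p) * h (T p ta) * f (T p ta)) <= integral (slab R) (%p. c * f (T p ta))"
  proof (rule integral_mono_box)
   fix p assume p: "p \<in> slab R"
   note k = cutoff_slab[OF R p] and ff = f_T_bounds[OF p t1]
   have "cutoff R (fst p) * h (T p ta) <= cutoff R (fst p) * c"
    using k h(2)[OF T_unit[OF box_mem(1)[OF p] t1]] by (intro mult_left_mono) auto
   also have "... <= c" using k c by (simp add: mult_left_le_one_le)
   finally show "cutoff R (fst p) * h (T p ta) * f (T p ta) <= c * f (T p ta)" using ff by (intro mult_right_mono) auto
  qed (intro continuous_intros cT cont_box_f t1)+
  then show "integral (slab R) (%p. cutoff R (fst p) * h (T p ta) * f (T p ta)) <= c * integral (slab R) (%p. f (T p ta))" by simp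
 qed
 then show ?thesis unfolding fuel_def using mult_left_mono[of _ _ q] pos by (simp add: mult.left_commute)
qed

lemma Phi1_nonneg: "0 <= Phi 1" using Phi_range(1)[of 1] by simp

text \<open>In the balance of \<open>Gam\<close> the reaction contributes at most
  \<open>Phi 1\<close> times the fuel. What remains is the decrease of \<open>Gam(T)\<close> between
  time 1 and time \<open>t\<close>; as \<open>Gam\<close> increases, it can occur only where
  \<open>T\<close> has cooled.\<close>

lemma dissip_bound:
 assumes t: "1 <= t" and R: "0 < R"
 shows "dissip R t <= Phi 1 * (fuel R t + cool t) + (t - 1) * eb (Phi 1) t R"
proof -
 have t0: "0 <= t" using t by simp
 have b: "\<bar>Phi s\<bar> <= Phi 1" if "s \<in> {0..1}" for s using Phi_range[OF that] by auto
 let ?A = "integral (slab R) (%p. cutoff R (fst p) * Gam (T p t))"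
 let ?B = "integral (slab R) (%p. cutoff R (fst p) * Gam (T p 1))"
 have c: "continuous_on (slab R) (%p. cutoff R (fst p) * Gam (T p ta))" if "0 <= ta" for ta
  by (intro continuous_intros cont_box_C2[OF C2fun_Gam that])
 have "?B - ?A = integral (slab R) (%p. cutoff R (fst p) * Gam (T p 1) - cutoff R (fst p) * Gam (T p t))"
  by (intro integral_diff[symmetric] box_integrable c t0 zero_le_one)
 also have "... <= integral (slab R) (%p. Phi 1 * max 0 (T p 1 - T p t))"
 proof (rule integral_mono_box)
  fix p assume p: "p \<in> slab R"
  note k = cutoff_slab[OF R p]
  have T: "T p 1 \<in> {0..1}" "T p t \<in> {0..1}" using T_unit[OF box_mem(1)[OF p]] t0 by auto
  have "Gam (T p 1) - Gam (T p t) <= Phi 1 * max 0 (T p 1 - T p t)"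
  proof (cases "T p t <= T p 1")
   case True
   then show ?thesis using unit_lipschitz[OF C2funD(4)[OF C2fun_Gam] b T] by auto
  next
   case False
   then show ?thesis using Gam_mono[OF T] Phi1_nonneg by auto
  qed
  then have "cutoff R (fst p) * (Gam (T p 1) - Gam (T p t)) <= cutoff R (fst p) * (Phi 1 * max 0 (T p 1 - T p t))"
   using k by (intro mult_left_mono) auto
  also have "... <= Phi 1 * max 0 (T p 1 - T p t)" using k Phi1_nonneg by (intro mult_left_le_one_le) auto
  finally show "cutoff R (fst p) * Gam (T p 1) - cutoff R (fst p) * Gam (T p t) <= Phi 1 * max 0 (T p 1 - T p t)"
   by (simp add: algebra_simps)
 qed (intro continuous_intros c cont_box_T t0 zero_le_one)+
 also have "... <= Phi 1 * cool t" using cooling_bound[OF t R] Phi1_nonneg by (simp add: mult_left_mono)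
 finally have 1: "?B - ?A <= Phi 1 * cool t" .
 have 2: "q * integral {1..t} (%ta. integral (slab R) (%p. cutoff R (fst p) * Phi (T p ta) * f (T p ta))) <= Phi 1 * fuel R t"
  using Phi_range(2) Phi1_nonneg by (intro fuel_cutoff_le[OF R cont_Phi]) auto
 show ?thesis
  using slab_balance[OF zero_less_one t R C2fun_Gam b Gam_0] 1 2 unfolding dissip_def
  by (simp add: distrib_left abs_le_iff)
qed

text \<open>By \<open>|z| = z + 2 * max 0 (- z)\<close> the absolute displacement is the signed one
  plus twice the cooling, and the signed one is at most the fuel up to the cutoff error.\<close>

lemma displacement_bound:
 assumes t: "1 <= t" and R: "0 < R"
 shows "integral (slab R) (%p. cutoff R (fst p) * \<bar>T p t - T p 1\<bar>) <= fuel R t + 2 * cool t + (t - 1) * eb 1 t R"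
proof -
 have t0: "0 <= t" using t by simp
 let ?A = "integral (slab R) (%p. cutoff R (fst p) * T p t)"
 let ?B = "integral (slab R) (%p. cutoff R (fst p) * T p 1)"
 have c: "continuous_on (slab R) (%p. cutoff R (fst p) * T p ta)" if "0 <= ta" for ta
  by (intro continuous_intros cont_box_T that)
 have c2: "continuous_on (slab R) (%p. 2 * max 0 (T p 1 - T p t))" by (intro continuous_intros cont_box_T t0 zero_le_one)
 have "integral (slab R) (%p. cutoff R (fst p) * \<bar>T p t - T p 1\<bar>) <=
  integral (slab R) (%p. (cutoff R (fst p) * T p t - cutoff R (fst p) * T p 1) + 2 * max 0 (T p 1 - T p t))"
 proof (rule integral_mono_box)
  fix p assume p: "p \<in> slab R"
  note k = cutoff_slab[OF R p]
  have m: "\<bar>T p t - T p 1\<bar> = (T p t - T p 1) + 2 * max 0 (T p 1 - T p t)" by (simp add: max_def)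
  have "cutoff R (fst p) * \<bar>T p t - T p 1\<bar> = (cutoff R (fst p) * T p t - cutoff R (fst p) * T p 1) + cutoff R (fst p) * (2 * max 0 (T p 1 - T p t))"
   unfolding m distrib_left right_diff_distrib ..
  moreover have "cutoff R (fst p) * (2 * max 0 (T p 1 - T p t)) <= 2 * max 0 (T p 1 - T p t)"
   using k by (intro mult_left_le_one_le) auto
  ultimately show "cutoff R (fst p) * \<bar>T p t - T p 1\<bar> <= (cutoff R (fst p) * T p t - cutoff R (fst p) * T p 1) + 2 * max 0 (T p 1 - T p t)"
   by linarith
 qed (intro continuous_intros c c2 cont_box_T t0 zero_le_one)+
 also have "... = (?A - ?B) + integral (slab R) (%p. 2 * max 0 (T p 1 - T p t))"
  by (subst integral_add integral_diff; (intro box_integrable continuous_on_diff c c2 t0 zero_le_one)?)+ simp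
 also have "integral (slab R) (%p. 2 * max 0 (T p 1 - T p t)) <= 2 * cool t"
  using cooling_bound[OF t R] by simp
 finally have 1: "integral (slab R) (%p. cutoff R (fst p) * \<bar>T p t - T p 1\<bar>) <= (?A - ?B) + 2 * cool t" by simp
 have 2: "q * integral {1..t} (%ta. integral (slab R) (%p. cutoff R (fst p) * 1 * f (T p ta))) <= 1 * fuel R t"
  by (intro fuel_cutoff_le[OF R]) auto
 show ?thesis
  using slab_balance[OF zero_less_one t R C2fun_id, of 1] 1 2
  by (simp add: abs_le_iff)
qed

end

section \<open>The front speed bound\<close>

context reactive_flow
begin

text \<open>The cutoff rises from 0 to 1 on the left half of the slab, where \<open>Phi(T)\<close>
  is close to \<open>Phi 1\<close>, and falls on the right half, where \<open>Phi(T)\<close> is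
  close to 0. Integrating the derivative of \<open>cutoff * Phi(T)\<close> in \<open>x\<close>
  therefore leaves \<open>Phi 1\<close> per unit height, up to an error measured by the
  majorant.\<close>

lemma front_gradient:
 assumes t: "0 < t" and R: "0 < R"
 shows "Phi 1 * H <= integral (slab R) (%p. cutoff R (fst p) * f (T p t) * \<bar>Tx p t\<bar>) + 4 * F * KD t / R"
proof -
 have t0: "0 <= t" using t by simp
 note M = testfunD[OF testfun_cutoff[OF R]]
 note ci = continuous_intros cont_box_T[OF t0] cont_box_C2[OF C2fun_Gam t0] cont_majorant[OF t0]
  cont_fst_box[OF M(2)] cont_fst_box[OF M(3)] cont_fst_box[OF M(4)] cont_box[OF t]
 let ?A = "%p. cutoff' R (fst p) * Phi (T p t)"
 let ?B = "%p. cutoff R (fst p) * f (T p t) * Tx p t"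
 let ?B' = "%p. cutoff R (fst p) * f (T p t) * \<bar>Tx p t\<bar>"
 have cA: "continuous_on (slab R) ?A" and cB: "continuous_on (slab R) ?B" and cB': "continuous_on (slab R) ?B'" by (intro ci)+
 have cm: "continuous_on (slab R) (%p. majorant p t)" by (intro ci)
 have "integral (slab R) (%p. (?A p + ?B p) + 0) = 0"
 proof (rule box_divergence[where ?F1.0="%p. cutoff R (fst p) * Phi (T p t)" and ?F2.0="%_. 0" and ?D2.0="%_. 0"])
  fix x y assume x: "x \<in> {-R..R}" and y: "y \<in> {0..H}"
  have yY: "y \<in> Yr" using y by auto
  have im: "(%x. T (x,y) t) ` {-R..R} \<subseteq> {0..1}" using T_unit[of "(_,y)" t] yY t by auto
  have d: "((%x. T (x,y) t) has_real_derivative Tx (x,y) t) (at x within {-R..R})"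
   using der_x[OF yY t] by (auto intro: has_field_derivative_at_within)
  have TT: "T (x,y) t \<in> {0..1}" using T_unit[of "(x,y)" t] yY t by auto
  show "((%x. cutoff R (fst (x,y)) * Phi (T (x,y) t)) has_real_derivative ?A (x,y) + ?B (x,y)) (at x within {-R..R})"
   unfolding fst_conv
   by (rule DERIV_cong[OF DERIV_mult[OF M(9)[OF x] compose_within[OF d Phi_deriv[OF TT] im]]])
    (simp add: algebra_simps)
 qed (use R pos in \<open>auto intro!: continuous_on_add cA cB\<close>)
 then have AB: "integral (slab R) ?A + integral (slab R) ?B = 0"
  using integral_add[OF box_integrable[OF cA] box_integrable[OF cB]] by simp
 have "- integral (slab R) ?B <= integral (slab R) (%p. \<bar>?B p\<bar>)" using integral_abs_le_box[OF cB] by simp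
 also have "... = integral (slab R) ?B'"
 proof (rule integral_cong)
  fix p assume p: "p \<in> slab R"
  show "\<bar>?B p\<bar> = ?B' p" using cutoff_slab[OF R p] f_T_bounds[OF p t0] by (simp add: abs_mult)
 qed
 finally have 1: "integral (slab R) ?A <= integral (slab R) ?B'" using AB by linarith
 define h where "h x = integral {0..H} (%y. cutoff' R x * Phi (T (x,y) t))" for x
 define d where "d x = integral {0..H} (%y. majorant (x,y) t)" for x
 have ih: "h integrable_on {-R..R}" unfolding h_def using slab_section_integrable[OF cA] by (simp only: fst_conv)
 have id: "d integrable_on {-R..R}" unfolding d_def using slab_section_integrable[OF cm] .
 have hA: "integral (slab R) ?A = integral {-R..R} h" unfolding h_def by (simp only: integral_box_iterated(1)[OF cA] fst_conv)
 have dA: "integral (slab R) (%p. majorant p t) = integral {-R..R} d" unfolding d_def by (rule integral_box_iterated(1)[OF cm])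
 have d0: "0 <= d x" for x unfolding d_def
  by (cases "(%y. majorant (x,y) t) integrable_on {0..H}") (auto intro!: integral_nonneg simp: majorant_nonneg not_integrable_integral)
 have sec: "continuous_on {0..H} (%y. Phi (T (x,y) t))" "continuous_on {0..H} (%y. majorant (x,y) t)" if "x \<in> {-R..R}" for x
  by (rule slab_section_continuous[OF _ that], intro ci)+
 have lip: "\<bar>Phi r - Phi s\<bar> <= F * \<bar>r - s\<bar>" if "r \<in> {0..1}" "s \<in> {0..1}" for r s
  using unit_lipschitz[OF Phi_deriv _ that, of F] f_unit by auto
 have left: "cutoff' R x * (Phi 1 * H) - 4 * F / R * d x <= h x" if x: "x \<in> {-R..0}" for x
 proof -
  have xR: "x \<in> {-R..R}" "\<bar>x\<bar> <= R" using x R by auto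
  have c0: "0 <= cutoff' R x"
  proof -
   have n: "-1 <= x / R" "x / R <= 0" using x R by (simp_all add: pos_le_divide_eq divide_nonpos_pos)
   then have "(x/R)^2 <= 1" unfolding abs_square_le_1 by linarith
   then have 1: "0 <= 1 - (x/R)\<^sup>2" by simp
   have "0 <= - 4 * (x/R)" using n by linarith
   from mult_nonneg_nonneg[OF this 1] have "0 <= - 4 * (x/R) * (1 - (x/R)\<^sup>2)" .
   from divide_nonneg_pos[OF this R] show ?thesis by (simp only: cutoff'_def)
  qed
  have "integral {0..H} (%y. Phi 1 - F * majorant (x,y) t) <= integral {0..H} (%y. Phi (T (x,y) t))"
  proof (intro integral_le integrable_continuous_real continuous_intros sec xR)
   fix y assume "y \<in> {0..H}"
   then have yY: "snd (x,y) \<in> Yr" by auto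
   have "Phi 1 - Phi (T (x,y) t) <= F * (1 - T (x,y) t)" using lip[OF _ T_unit[OF yY t0], of 1] T_unit[OF yY t0] by auto
   also have "... <= F * majorant (x,y) t" using majorant_bounds(1)[OF yY t0] x pos by (intro mult_left_mono) auto
   finally show "Phi 1 - F * majorant (x,y) t <= Phi (T (x,y) t)" by linarith
  qed
  moreover have "integral {0..H} (%y. Phi 1 - F * majorant (x,y) t) = Phi 1 * H - F * d x"
   unfolding d_def using pos by (subst integral_diff) (auto intro!: integrable_continuous_real continuous_intros sec xR)
  ultimately have "cutoff' R x * (Phi 1 * H - F * d x) <= h x"
   unfolding h_def using mult_left_mono[OF _ c0] by simp
  moreover have "cutoff' R x * (F * d x) <= 4 / R * (F * d x)"
   using cutoff_props(4)[OF R xR(2)] d0[of x] pos by (intro mult_right_mono) auto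
  ultimately show ?thesis by (simp add: right_diff_distrib)
 qed
 have right: "- (4 * F / R * d x) <= h x" if x: "x \<in> {0..R}" for x
 proof -
  have xR: "x \<in> {-R..R}" "\<bar>x\<bar> <= R" using x R by auto
  have "\<bar>integral {0..H} (%y. Phi (T (x,y) t))\<bar> <= integral {0..H} (%y. F * majorant (x,y) t)"
  proof (rule order_trans[OF integral_abs_le_box[of 0 H, simplified]])
   show "integral {0..H} (%y. \<bar>Phi (T (x,y) t)\<bar>) <= integral {0..H} (%y. F * majorant (x,y) t)"
   proof (intro integral_le integrable_continuous_real continuous_intros sec xR)
    fix y assume "y \<in> {0..H}"
    then have yY: "snd (x,y) \<in> Yr" by auto
    have "\<bar>Phi (T (x,y) t)\<bar> <= F * T (x,y) t" using lip[OF T_unit[OF yY t0], of 0] T_unit[OF yY t0] Phi_0 by auto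
    also have "... <= F * majorant (x,y) t" using majorant_bounds(2)[OF yY t0] x pos by (intro mult_left_mono) auto
    finally show "\<bar>Phi (T (x,y) t)\<bar> <= F * majorant (x,y) t" .
   qed
  qed (intro sec xR)
  then have "\<bar>cutoff' R x\<bar> * \<bar>integral {0..H} (%y. Phi (T (x,y) t))\<bar> <= 4 / R * (F * d x)"
   using cutoff_props(4)[OF R xR(2)] R unfolding d_def by (intro mult_mono) auto
  then have "\<bar>h x\<bar> <= 4 * F / R * d x" unfolding h_def by (simp add: abs_mult)
  then show ?thesis by linarith
 qed
 have int: "g integrable_on {-R..0}" "g integrable_on {0..R}" if "g integrable_on {-R..R}" for g :: "real => real"
  using that R by (auto intro: integrable_on_subinterval)
 have c': "(cutoff' R has_integral cutoff R 0 - cutoff R (-R)) {-R..0}"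
  using R by (intro fundamental_theorem_of_calculus)
   (auto simp: vector_derivative_iff intro: cutoff_deriv)
 have iL: "(%x. cutoff' R x * (Phi 1 * H) - 4 * F / R * d x) integrable_on {-R..0}"
  using integrable_diff[OF integrable_on_mult_left[OF has_integral_integrable[OF c'], of "Phi 1 * H"]
    integrable_on_mult_right[OF int(1)[OF id], of "4 * F / R"]] .
 have iR: "(%x. - (4 * F / R * d x)) integrable_on {0..R}"
  using integrable_neg[OF integrable_on_mult_right[OF int(2)[OF id], of "4 * F / R"]] .
 have "Phi 1 * H - 4 * F / R * integral {-R..0} d = integral {-R..0} (%x. cutoff' R x * (Phi 1 * H) - 4 * F / R * d x)"
  using integral_unique[OF c'] int(1)[OF id] has_integral_integrable[OF c'] R
  by (subst integral_diff) (auto simp: cutoff_def intro!: integrable_on_mult_left integrable_on_mult_right)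
 also have "... <= integral {-R..0} h"
  by (rule integral_le[OF iL int(1)[OF ih] left])
 finally have L: "Phi 1 * H - 4 * F / R * integral {-R..0} d <= integral {-R..0} h" .
 have "- (4 * F / R * integral {0..R} d) = integral {0..R} (%x. - (4 * F / R * d x))" by simp
 also have "... <= integral {0..R} h"
  by (rule integral_le[OF iR int(2)[OF ih] right])
 finally have Rr: "- (4 * F / R * integral {0..R} d) <= integral {0..R} h" .
 have ch: "integral {-R..R} h = integral {-R..0} h + integral {0..R} h" and cd: "integral {-R..R} d = integral {-R..0} d + integral {0..R} d"
  using Henstock_Kurzweil_Integration.integral_combine[OF _ _ ih, of 0] Henstock_Kurzweil_Integration.integral_combine[OF _ _ id, of 0] R by simp_all
 have "Phi 1 * H - 4 * F / R * integral {-R..R} d <= integral {-R..R} h"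
  unfolding ch cd distrib_left using L Rr by linarith
 moreover have "4 * F / R * integral {-R..R} d <= 4 * F / R * KD t"
  using majorant_integral[OF t0 R] dA R pos by (intro mult_left_mono) auto
 ultimately show ?thesis using 1 hA by simp
qed

lemma front_speed_bound:
 assumes t: "1 <= t" and R: "0 < R" and v: "0 < v" "v^2 = q * ka"
 shows "v * Phi 1 * H * (t - 1) <= (fuel R t + dissip R t) / 2 + v * (t - 1) * (4 * F * KD t / R)"
proof -
 let ?f = "%ta. integral (slab R) (%p. f (T p ta))"
 let ?D = "%ta. integral (slab R) (%p. cutoff R (fst p) * f (T p ta) * gsq p ta)"
 let ?e = "4 * F * KD t / R"
 have cf: "continuous_on {1..t} ?f"
  by (rule cont_slab_time) (intro cont_f_slab_time zero_le_one)
 have cD: "continuous_on {1..t} ?D"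
  by (rule cont_slab_time) (intro continuous_intros cont_f_slab_time zero_le_one continuous_grad_slab zero_less_one)
 have "v * Phi 1 * H * (t - 1) = integral {1..t} (%ta. v * (Phi 1 * H))" using t by (simp add: mult_ac)
 also have "... <= integral {1..t} (%ta. (q * ?f ta + ka * ?D ta) * (1/2) + v * ?e)"
 proof (intro integral_le integrable_continuous_real)
  show "continuous_on {1..t} (%ta. (q * ?f ta + ka * ?D ta) * (1/2) + v * ?e)" by (intro continuous_intros cf cD)
  fix ta assume ta: "ta \<in> {1..t}"
  have t0: "0 < ta" and t1: "0 <= ta" using ta by auto
  have cc: "continuous_on (slab R) (%p. cutoff R (fst p) * f (T p ta) * \<bar>Tx p ta\<bar>)"
   "continuous_on (slab R) (%p. f (T p ta))" "continuous_on (slab R) (%p. cutoff R (fst p) * f (T p ta) * gsq p ta)"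
   by (intro continuous_intros cont_box_f t1 cont_box t0)+
  have "v * integral (slab R) (%p. cutoff R (fst p) * f (T p ta) * \<bar>Tx p ta\<bar>) =
   integral (slab R) (%p. v * (cutoff R (fst p) * f (T p ta) * \<bar>Tx p ta\<bar>))" by simp
  also have "... <= integral (slab R) (%p. (q * f (T p ta) + ka * (cutoff R (fst p) * f (T p ta) * gsq p ta)) * (1/2))"
  proof (rule integral_mono_box)
   fix p assume p: "p \<in> slab R"
   define c where "c = cutoff R (fst p) * f (T p ta)"
   have c: "0 <= c" "c <= f (T p ta)" using cutoff_slab[OF R p] f_T_bounds[OF p t1] by (auto simp: c_def mult_left_le_one_le)
   have "2 * (v * \<bar>Tx p ta\<bar>) <= q + ka * (Tx p ta)^2"
    by (rule two_mult_le_add) (use v pos in \<open>auto simp: power_mult_distrib\<close>)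
   also have "... <= q + ka * gsq p ta" using pos by simp
   finally have "c * (2 * (v * \<bar>Tx p ta\<bar>)) <= c * (q + ka * gsq p ta)" using c by (intro mult_left_mono) auto
   moreover have "c * q <= f (T p ta) * q" using c pos by (intro mult_right_mono) auto
   ultimately have "c * (2 * (v * \<bar>Tx p ta\<bar>)) <= q * f (T p ta) + ka * (c * gsq p ta)"
    unfolding distrib_left by (simp add: mult_ac)
   then show "v * (cutoff R (fst p) * f (T p ta) * \<bar>Tx p ta\<bar>) <= (q * f (T p ta) + ka * (cutoff R (fst p) * f (T p ta) * gsq p ta)) * (1/2)"
    unfolding c_def[symmetric] by (simp add: mult_ac)
  qed (intro continuous_intros cc)+
  also have "... = (integral (slab R) (%p. q * f (T p ta)) + integral (slab R) (%p. ka * (cutoff R (fst p) * f (T p ta) * gsq p ta))) * (1/2)"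
   using integral_add[OF box_integrable[OF continuous_on_mult_left[OF cc(2), of q]]
     box_integrable[OF continuous_on_mult_left[OF cc(3), of ka]]] by simp
  finally have 1: "v * integral (slab R) (%p. cutoff R (fst p) * f (T p ta) * \<bar>Tx p ta\<bar>) <= (q * ?f ta + ka * ?D ta) * (1/2)"
   by simp
  have "4 * F * KD ta / R <= ?e" using KD_mono[OF t1, of t] ta pos R by (intro divide_right_mono mult_left_mono) auto
  then have "Phi 1 * H <= integral (slab R) (%p. cutoff R (fst p) * f (T p ta) * \<bar>Tx p ta\<bar>) + ?e"
   using front_gradient[OF t0 R] by linarith
  from mult_left_mono[OF this, of v] v
  have "v * (Phi 1 * H) <= v * integral (slab R) (%p. cutoff R (fst p) * f (T p ta) * \<bar>Tx p ta\<bar>) + v * ?e"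
   by (simp only: distrib_left less_imp_le)
  then show "v * (Phi 1 * H) <= (q * ?f ta + ka * ?D ta) * (1/2) + v * ?e" using 1 by linarith
 qed (intro continuous_intros)
 also have "... = (q * integral {1..t} ?f + ka * integral {1..t} ?D) * (1/2) + v * ?e * (t - 1)"
 proof -
  have "((%ta. (q * ?f ta + ka * ?D ta) * (1/2) + v * ?e) has_integral ((q * integral {1..t} ?f + ka * integral {1..t} ?D) * (1/2) + (t - 1) *\<^sub>R (v * ?e))) {1..t}"
   using has_integral_const_real[of "v * ?e" 1 t] t
   by (intro has_integral_add has_integral_mult_left has_integral_mult_right integrable_integral integrable_continuous_real cf cD) auto
  then show ?thesis by (simp add: integral_unique mult.commute)
 qed
 finally show ?thesis unfolding fuel_def dissip_def by (simp add: mult_ac)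
qed

end

section \<open>Integrability of the time derivative\<close>

lemma integral_sum_box:
 fixes g h :: "'a::euclidean_space => real"
 assumes "continuous_on (cbox a b) g" "continuous_on (cbox a b) h"
 shows "integral (cbox a b) (%p. g p + h p) = integral (cbox a b) g + integral (cbox a b) h"
  "integral (cbox a b) (%p. g p - h p) = integral (cbox a b) g - integral (cbox a b) h"
 using assms by (auto intro!: integral_add integral_diff box_integrable)

context reactive_flow
begin

text \<open>The difference quotient of \<open>T\<close> in time, written as an average of
  \<open>Tt\<close> so that it is jointly continuous also at \<open>s = t\<close>.\<close>

definition "Tmean t p s = integral {0..1} (%th. Tt p (t + th * (s - t)))"

lemma segment_pos:
 fixes t s th :: real
 assumes "0 < t" "0 < s" "th \<in> {0..1}"
 shows "0 < t + th * (s - t)"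
proof -
 have "t + th * (s - t) = (1 - th) * t + th * s" by (simp add: algebra_simps)
 moreover have "0 < (1 - th) * t + th * s"
  using assms by (cases "th = 0") (auto intro!: add_nonneg_pos)
 ultimately show ?thesis by simp
qed

lemma Tmean_diff:
 assumes "snd p \<in> Yr" "0 < t" "0 < s"
 shows "T p s - T p t = (s - t) * Tmean t p s"
proof -
 have "((%th. Tt p (t + th * (s - t)) * (s - t)) has_integral (T p (t + 1 * (s - t)) - T p (t + 0 * (s - t)))) {0..1}"
 proof (rule fundamental_theorem_of_calculus)
  fix th :: real assume th: "th \<in> {0..1}"
  have d: "(T p has_real_derivative Tt p (t + th * (s - t))) (at (t + th * (s - t)))"
   using der_t[OF assms(1) segment_pos[OF assms(2,3) th], of "fst p"] by simp
  have "((%th. t + th * (s - t)) has_real_derivative (s - t)) (at th within {0..1})"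
   by (auto intro!: derivative_eq_intros)
  from DERIV_chain2[OF d this]
  show "((%th. T p (t + th * (s - t))) has_vector_derivative Tt p (t + th * (s - t)) * (s - t)) (at th within {0..1})"
   by (simp add: has_real_derivative_iff_has_vector_derivative)
 qed simp
 then show ?thesis unfolding Tmean_def by (auto dest!: integral_unique simp: mult.commute)
qed

lemma Tmean_same: "Tmean t p t = Tt p t" by (simp add: Tmean_def)

lemma cont_Tmean:
 assumes "0 < t"
 shows "continuous_on ({0::real<..} \<times> slab R) (%z. Tmean t (snd z) (fst z))"
 unfolding Tmean_def
proof (rule integral_continuous_on_param[of _ 0 1 "%z th. Tt (snd z) (t + th * (fst z - t))", simplified])
 show "continuous_on (({0::real<..} \<times> slab R) \<times> {0..1}) (%(z, th). Tt (snd z) (t + th * (fst z - t)))"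
  unfolding split_beta
 proof (intro flow_cont continuous_intros)
  fix w assume w: "w \<in> ({0::real<..} \<times> slab R) \<times> {0..1::real}"
  then show "snd (snd (fst w)) \<in> Yr" by (auto intro: box_mem(1))
  show "t + snd w * (fst (fst w) - t) \<in> {0<..}"
   using segment_pos[OF assms, of "fst (fst w)" "snd w"] w by auto
 qed
qed

text \<open>The gradient of \<open>T\<close> is not assumed differentiable in time. The difference
  of its squares at two times factors into difference times sum, and integration by parts moves the
  derivative from \<open>T(s) - T(t)\<close> onto the sum. After that only
  \<open>T(s) - T(t)\<close> has to be divided by \<open>s - t\<close>.\<close>

lemma gradient_energy_derivative:
 assumes t: "0 < t" and m: "testfun R m m' m''"
 shows "((%t. integral (slab R) (%p. m (fst p) * gsq p t)) has_real_derivative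
  - (2 * integral (slab R) (%p. Tt p t * (m (fst p) * (Txx p t + Tyy p t) + m' (fst p) * Tx p t)))) (at t)"
proof -
 note M = testfunD[OF m]
 let ?g = "%t. integral (slab R) (%p. m (fst p) * gsq p t)"
 define W where "W p s = m (fst p) * (Txx p s + Txx p t + (Tyy p s + Tyy p t)) + m' (fst p) * (Tx p s + Tx p t)" for p s
 define ph where "ph s = integral (slab R) (%p. Tmean t p s * W p s)" for s
 have diff: "?g s - ?g t = - ((s - t) * ph s)" if s: "0 < s" for s
 proof -
  note ci = continuous_intros cont_box[OF t] cont_box[OF s] cont_box_T[OF less_imp_le[OF t]] cont_box_T[OF less_imp_le[OF s]]
   cont_fst_box[OF M(2)] cont_fst_box[OF M(3)] cont_fst_box[OF M(4)]
  define D1 where "D1 p = m (fst p) * ((Tx p s)^2 - (Tx p t)\<^sup>2) + (T p s - T p t) * (m (fst p) * (Txx p s + Txx p t) + m' (fst p) * (Tx p s + Tx p t))" for p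
  define D2 where "D2 p = m (fst p) * ((Ty p s)^2 - (Ty p t)\<^sup>2) + (T p s - T p t) * (m (fst p) * (Tyy p s + Tyy p t))" for p
  have cD: "continuous_on (slab R) D1" "continuous_on (slab R) D2" unfolding D1_def D2_def by (intro ci)+
  have "integral (slab R) (%p. D1 p + D2 p) = 0"
  proof (rule box_divergence[where ?F1.0="%p. (T p s - T p t) * (m (fst p) * (Tx p s + Tx p t))"
     and ?F2.0="%p. (T p s - T p t) * (m (fst p) * (Ty p s + Ty p t))"])
   fix x y assume x: "x \<in> {-R..R}" and y: "y \<in> {0..H}"
   have yY: "y \<in> Yr" using y by auto
   have d: "((%x. T (x,y) r) has_real_derivative Tx (x,y) r) (at x within {-R..R})"
    "((%x. Tx (x,y) r) has_real_derivative Txx (x,y) r) (at x within {-R..R})"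
    "((%y. T (x,y) r) has_real_derivative Ty (x,y) r) (at y within {0..H})"
    "((%y. Ty (x,y) r) has_real_derivative Tyy (x,y) r) (at y within {0..H})" if "0 < r" for r
    using der_x[OF yY that] der_xx[OF yY that] DERIV_subset[OF der_y[OF yY that] yr(1)] DERIV_subset[OF der_yy[OF yY that] yr(1)]
    by (auto intro: has_field_derivative_at_within)
   show "((%x. (T (x,y) s - T (x,y) t) * (m (fst (x,y)) * (Tx (x,y) s + Tx (x,y) t))) has_real_derivative D1 (x,y)) (at x within {-R..R})"
    unfolding D1_def fst_conv
    by (rule DERIV_cong[OF DERIV_mult[OF DERIV_diff[OF d(1)[OF s] d(1)[OF t]] DERIV_mult[OF M(9)[OF x] DERIV_add[OF d(2)[OF s] d(2)[OF t]]]]])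
     (simp add: algebra_simps power2_eq_square)
   show "((%y. (T (x,y) s - T (x,y) t) * (m (fst (x,y)) * (Ty (x,y) s + Ty (x,y) t))) has_real_derivative D2 (x,y)) (at y within {0..H})"
    unfolding D2_def fst_conv
    by (rule DERIV_cong[OF DERIV_mult[OF DERIV_diff[OF d(3)[OF s] d(3)[OF t]] DERIV_cmult[OF DERIV_add[OF d(4)[OF s] d(4)[OF t]]]]])
     (simp add: algebra_simps power2_eq_square)
  next
   fix x assume "x \<in> {-R..R}"
   show "(T (x,0) s - T (x,0) t) * (m (fst (x,0::real)) * (Ty (x,0) s + Ty (x,0) t)) =
    (T (x,H) s - T (x,H) t) * (m (fst (x,H)) * (Ty (x,H) s + Ty (x,H) t))"
    using bc_Neumann[OF _ t] bc_Neumann[OF _ s] bc_Periodic[OF _ t, of x 0] bc_Periodic[OF _ s, of x 0] by (cases b) auto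
  qed (use M pos cD in auto)
  moreover have "integral (slab R) (%p. D1 p + D2 p) = integral (slab R) (%p. (m (fst p) * gsq p s - m (fst p) * gsq p t) + (T p s - T p t) * W p s)"
   by (rule integral_cong) (simp add: D1_def D2_def W_def algebra_simps)
  moreover have "... = ?g s - ?g t + integral (slab R) (%p. (T p s - T p t) * W p s)"
   unfolding W_def by (subst integral_sum_box integral_sum_box(2); (intro ci)?)+ simp
  moreover have "integral (slab R) (%p. (T p s - T p t) * W p s) = integral (slab R) (%p. (s - t) * (Tmean t p s * W p s))"
   using Tmean_diff[OF box_mem(1) t s] by (intro integral_cong) (simp add: mult.assoc)
  ultimately show ?thesis by (simp add: ph_def)
 qed
 have cW: "continuous_on ({0::real<..} \<times> slab R) (%z. W (snd z) (fst z))"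
  unfolding W_def
  by (intro continuous_intros flow_cont continuous_on_compose2[OF M(2)] continuous_on_compose2[OF M(3)]) (use t in \<open>auto simp: box_mem\<close>)
 have "continuous_on {0<..} ph" unfolding ph_def
  by (rule cont_slab_time) (intro continuous_intros cont_Tmean[OF t] cW)
 then have "isCont ph t" using t by (simp add: continuous_on_eq_continuous_at)
 then have "((%s. - ph s) \<longlongrightarrow> - ph t) (at t)" by (intro tendsto_minus isContD)
 moreover have "\<forall>\<^sub>F s in at t. - ph s = (?g s - ?g t) / (s - t)"
 proof -
  have "\<forall>\<^sub>F s in at t. s \<in> {0<..} - {t}" using t by (intro eventually_at_in_open) auto
  then show ?thesis by (rule eventually_mono) (use diff in auto)
 qed
 ultimately have "((%s. (?g s - ?g t) / (s - t)) \<longlongrightarrow> - ph t) (at t)" by (rule Lim_transform_eventually)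
 moreover have "ph t = 2 * integral (slab R) (%p. Tt p t * (m (fst p) * (Txx p t + Tyy p t) + m' (fst p) * Tx p t))"
  unfolding ph_def W_def Tmean_same by (subst integral_mult_right[symmetric]) (rule integral_cong, simp add: algebra_simps)
 ultimately show ?thesis by (simp add: has_field_derivative_iff)
qed

definition "grate a = 2 * U^2 + 2 * ka^2 * (2 * a^2 + 32)"

text \<open>The equation replaces \<open>ka\<close> times the Laplacian by
  \<open>Tt + u . grad T - q * f(T)\<close>, which produces \<open>- 2 * m * Tt^2\<close>.
  Advection, reaction and the derivative of the weight each spend \<open>m * Tt^2 / 2\<close> of it,
  and the last half remains. The condition \<open>1 <= R\<close> makes the bound on the weight
  uniform in \<open>R\<close>.\<close>

lemma gradient_energy_rate:
 assumes t: "0 < t" and R: "1 <= R" and c: "!!s. s \<in> {0..1} ==> (f s)^2 <= F^2 * (s - c)^2"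
 shows "- (2 * ka * integral (slab R) (%p. Tt p t * (wfun a 0 R (fst p) * (Txx p t + Tyy p t) + wfun' a 0 R (fst p) * Tx p t)))
  <= - (1/2) * integral (slab R) (%p. wfun a 0 R (fst p) * (Tt p t)^2)
   + grate a * integral (slab R) (%p. exp (a * fst p) * gsq p t) + 2 * q^2 * F^2 * integral (slab R) (%p. exp (a * fst p) * (T p t - c)^2)"
proof -
 let ?m = "wfun a 0 R" and ?m' = "wfun' a 0 R"
 have R0: "0 < R" using R by simp
 note M = testfunD[OF testfun_wfun[OF R0, of a 0]]
 note ci = continuous_intros cont_box[OF t] cont_box_T[OF less_imp_le[OF t]] cont_fst_box[OF M(2)] cont_fst_box[OF M(3)]
 let ?A = "%p. ?m (fst p) * (Tt p t)^2" and ?B = "%p. exp (a * fst p) * gsq p t" and ?C = "%p. exp (a * fst p) * (T p t - c)^2"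
 have cc: "continuous_on (slab R) ?A" "continuous_on (slab R) ?B" "continuous_on (slab R) ?C" by (intro ci)+
 have "- (2 * ka * integral (slab R) (%p. Tt p t * (?m (fst p) * (Txx p t + Tyy p t) + ?m' (fst p) * Tx p t)))
  = integral (slab R) (%p. - (2 * ka) * (Tt p t * (?m (fst p) * (Txx p t + Tyy p t) + ?m' (fst p) * Tx p t)))"
  by simp
 also have "... <= integral (slab R) (%p. - (1/2) * ?A p + grate a * ?B p + 2 * q^2 * F^2 * ?C p)"
 proof (rule integral_mono_box)
  fix p assume p: "p \<in> slab R"
  define x where "x = fst p"
  define g where "g = exp (a * x)"
  define w where "w = Tt p t"
  define ug where "ug = fst (u p) * Tx p t + snd (u p) * Ty p t"
  have xR: "\<bar>x\<bar> <= R" using box_mem(2)[OF p] by (simp add: x_def)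
  note W = wfun_props[OF R0 xR, of a 0]
  have g: "expw a 0 x = g" by (simp add: expw_def g_def exp_minus divide_inverse)
  have g0: "0 < g" by (simp add: g_def)
  have m: "0 <= ?m x" "?m x <= g" using W g by auto
  have TT: "T p t \<in> {0..1}" using T_unit[OF box_mem(1)[OF p]] t by auto
  have eq: "ka * (Txx p t + Tyy p t) = w + ug - q * f (T p t)"
   using pde[OF box_mem(1)[OF p] t, of "fst p"] unfolding w_def ug_def by simp
  have ug2: "ug^2 <= U^2 * gsq p t"
  proof -
   have "ug^2 <= ((fst (u p))^2 + (snd (u p))^2) * gsq p t"
    unfolding ug_def using zero_le_power2[of "fst (u p) * Ty p t - snd (u p) * Tx p t"] by (simp add: power2_eq_square algebra_simps)
   also have "(fst (u p))^2 + (snd (u p))^2 = (norm (u p))^2" by (simp add: norm_prod_def)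
   also have "(norm (u p))^2 * gsq p t <= U^2 * gsq p t" using u_bound[OF box_mem(1)[OF p], of "fst p"] by (intro mult_right_mono power_mono) auto
   finally show ?thesis .
  qed
  have "- (2 * (w * ug)) <= (1/2) * w^2 + 2 * ug^2" using zero_le_power2[of "w + 2 * ug"] by (simp add: power2_eq_square algebra_simps)
  then have "?m x * - (2 * (w * ug)) <= ?m x * ((1/2) * w^2 + 2 * ug^2)" using m by (intro mult_left_mono) auto
  moreover have "?m x * ug^2 <= g * (U^2 * gsq p t)" using m ug2 g0 by (intro mult_mono) auto
  ultimately have 1: "?m x * - (2 * (w * ug)) <= (1/2) * (?m x * w^2) + 2 * U^2 * (g * gsq p t)" by (simp add: algebra_simps)
  have "2 * (w * (q * f (T p t))) <= (1/2) * w^2 + 2 * (q * f (T p t))^2" using zero_le_power2[of "w - 2 * (q * f (T p t))"] by (simp add: power2_eq_square algebra_simps)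
  then have "?m x * (2 * (w * (q * f (T p t)))) <= ?m x * ((1/2) * w^2 + 2 * (q * f (T p t))^2)" using m by (intro mult_left_mono) auto
  moreover have "?m x * (q * f (T p t))^2 <= g * (q^2 * (F^2 * (T p t - c)^2))"
   unfolding power_mult_distrib using m g0 c[OF TT] by (intro mult_mono mult_left_mono) auto
  ultimately have 2: "?m x * (2 * (w * (q * f (T p t)))) <= (1/2) * (?m x * w^2) + 2 * q^2 * F^2 * (g * (T p t - c)^2)" by (simp add: algebra_simps)
  have 3: "2 * (- (ka * ?m' x * w * Tx p t)) <= (1/2) * (?m x * w^2) + 2 * ka^2 * (2 * a^2 + 32) * (g * gsq p t)"
  proof (rule two_mult_le_add)
   have "1 <= R^2" using R by simp
   then have "32 / R^2 * g <= 32 * g" using g0 by (intro mult_right_mono) (auto simp: divide_simps)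
   moreover have "2 * a^2 * ?m x <= 2 * a^2 * g" using m by (intro mult_left_mono) auto
   ultimately have n: "2 * a^2 * ?m x + 32 / R^2 * g <= (2 * a^2 + 32) * g" by (simp add: distrib_right)
   have "(- (ka * ?m' x * w * Tx p t))^2 = (ka^2 * w^2) * ((?m' x)^2 * (Tx p t)^2)" by (simp add: power_mult_distrib)
   also have "... <= (ka^2 * w^2) * ((?m x * ((2 * a^2 + 32) * g)) * gsq p t)"
    using order_trans[OF W(3) mult_left_mono[OF n[folded g] m(1)]] m g0 g by (intro mult_left_mono mult_mono) auto
   finally show "(- (ka * ?m' x * w * Tx p t))^2 <= (1/2) * (?m x * w^2) * (2 * ka^2 * (2 * a^2 + 32) * (g * gsq p t))"
    by (simp add: mult_ac)
  qed (use m g0 in auto)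
  have "- (2 * ka) * (w * (?m x * (Txx p t + Tyy p t) + ?m' x * Tx p t)) =
    - 2 * w * ?m x * (ka * (Txx p t + Tyy p t)) + 2 * (- (ka * ?m' x * w * Tx p t))"
   by (simp add: algebra_simps)
  also have "... = - (2 * (?m x * w^2)) + ?m x * - (2 * (w * ug)) + ?m x * (2 * (w * (q * f (T p t)))) + 2 * (- (ka * ?m' x * w * Tx p t))"
   unfolding eq by (simp add: algebra_simps power2_eq_square)
  also have "... <= - (1/2) * (?m x * w^2) + grate a * (g * gsq p t) + 2 * q^2 * F^2 * (g * (T p t - c)^2)"
   using 1 2 3 unfolding grate_def distrib_right by linarith
  finally show "- (2 * ka) * (Tt p t * (?m (fst p) * (Txx p t + Tyy p t) + ?m' (fst p) * Tx p t))
   <= - (1/2) * ?A p + grate a * ?B p + 2 * q^2 * F^2 * ?C p"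
   unfolding w_def x_def g_def .
 qed (intro ci)+
 also have "... = integral (slab R) (%p. - (1/2) * ?A p + grate a * ?B p) + integral (slab R) (%p. 2 * q^2 * F^2 * ?C p)"
  by (rule integral_sum_box(1)) (intro continuous_on_add continuous_on_mult_left cc)+
 also have "integral (slab R) (%p. - (1/2) * ?A p + grate a * ?B p) = integral (slab R) (%p. - (1/2) * ?A p) + integral (slab R) (%p. grate a * ?B p)"
  by (rule integral_sum_box(1)) (intro continuous_on_mult_left cc)+
 finally show ?thesis by simp
qed

end

section \<open>Passage from boxes to the infinite strip, and integrability of the time
  derivative\<close>

lemma nn_integral_continuous_box:
 fixes h :: "'a::euclidean_space => real"
 assumes "continuous_on (cbox a b) h" "!!x. x \<in> cbox a b ==> 0 <= h x"
 shows "(\<integral>\<^sup>+x. ennreal (indicator (cbox a b) x * h x) \<partial>lborel) = ennreal (integral (cbox a b) h)"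
proof (rule nn_integral_has_integral_lborel)
 show "(%x. indicator (cbox a b) x * h x) \<in> borel_measurable borel"
  using borel_measurable_continuous_on_indicator[OF _ assms(1)] by simp
 show "0 <= indicator (cbox a b) x * h x" for x using assms(2) by (auto simp: indicator_def)
 have "(h has_integral integral (cbox a b) h) (cbox a b)"
  using assms(1) by (intro integrable_integral box_integrable)
 moreover have "(%x. if x \<in> cbox a b then h x else 0) = (%x. indicator (cbox a b) x * h x)"
  by (auto simp: indicator_def)
 ultimately show "((%x. indicator (cbox a b) x * h x) has_integral integral (cbox a b) h) UNIV"
  using has_integral_restrict_UNIV[of "cbox a b" h] by simp
qed

context reactive_flow
begin

abbreviation "strip \<equiv> UNIV \<times> {0..H} :: plane set"

lemma slab_in_strip: "slab R \<subseteq> strip" by (auto simp: cbox_Pair_eq)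

lemma strip_in_slab: "p \<in> strip ==> \<bar>fst p\<bar> <= R ==> p \<in> slab R"
 by (cases p) (auto simp: cbox_Pair_eq)

lemma strip_integrable:
 fixes g :: "plane => real"
 assumes c: "continuous_on strip g" and b: "!!n. integral (slab (real n)) (%p. \<bar>g p\<bar>) <= M"
 shows "set_integrable lborel strip g"
proof -
 have strip: "strip \<in> sets borel" by (intro borel_closed closed_Times) auto
 have cs: "continuous_on (slab R) (%p. \<bar>g p\<bar>)" for R
  by (intro continuous_intros continuous_on_subset[OF c slab_in_strip])
 let ?h = "%n p. ennreal (indicator (slab (real n)) p * \<bar>g p\<bar>)"
 have inc: "incseq ?h"
  unfolding incseq_def le_fun_def
 proof (intro allI impI ennreal_leI mult_right_mono)
  fix m n :: nat and p assume "m <= n"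
  then have "slab (real m) \<subseteq> slab (real n)" by (intro slab_subset) simp
  then show "(indicator (slab (real m)) p :: real) <= indicator (slab (real n)) p" by (auto simp: indicator_def)
 qed simp
 have sup: "(SUP n. ?h n p) = ennreal (indicator strip p * \<bar>g p\<bar>)" for p
 proof (cases "p \<in> strip")
  case True
  obtain N :: nat where N: "\<bar>fst p\<bar> <= real N" using real_arch_simple by blast
  show ?thesis
  proof (rule antisym)
   show "(SUP n. ?h n p) <= ennreal (indicator strip p * \<bar>g p\<bar>)"
    using slab_in_strip by (intro SUP_least ennreal_leI mult_right_mono) (auto simp: indicator_def)
   show "ennreal (indicator strip p * \<bar>g p\<bar>) <= (SUP n. ?h n p)"
    using True strip_in_slab[OF True N] by (intro SUP_upper2[of N]) auto
  qed
 next
  case False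
  then have "p \<notin> slab (real n)" for n using slab_in_strip by blast
  then show ?thesis using False by simp
 qed
 have "(\<integral>\<^sup>+p. ennreal (norm (indicator strip p *\<^sub>R g p)) \<partial>lborel) = (\<integral>\<^sup>+p. (SUP n. ?h n p) \<partial>lborel)"
  unfolding sup by (intro nn_integral_cong) (simp add: abs_mult)
 also have "... = (SUP n. \<integral>\<^sup>+p. ?h n p \<partial>lborel)"
  using inc borel_measurable_continuous_on_indicator[OF _ cs] by (intro nn_integral_monotone_convergence_SUP) auto
 also have "... = (SUP n. ennreal (integral (slab (real n)) (%p. \<bar>g p\<bar>)))"
  using nn_integral_continuous_box[OF cs] by simp
 also have "... <= ennreal M" using b by (intro SUP_least ennreal_leI) auto
 also have "... < \<infinity>" by simp
 finally show ?thesis unfolding set_integrable_def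
  using borel_measurable_continuous_on_indicator[OF strip c] by (intro integrableI_bounded) auto
qed

lemma strip_limit:
 fixes g :: "plane => real"
 assumes c: "continuous_on strip g" and i: "set_integrable lborel strip g"
  and k: "!!n p. p \<in> slab (real n) ==> \<bar>k n p\<bar> <= 1" and ck: "!!n. continuous_on (slab (real n)) (k n)"
  and lim: "!!p. p \<in> strip ==> (%n. k n p) \<longlonglongrightarrow> (1::real)"
 shows "(%n. integral (slab (real n)) (%p. k n p * g p)) \<longlonglongrightarrow> set_lebesgue_integral lborel strip g"
proof -
 have cs: "continuous_on (slab (real n)) (%p. k n p * g p)" for n
  by (intro continuous_on_mult ck continuous_on_subset[OF c slab_in_strip])
 have "set_integrable lborel (slab (real n)) (%p. k n p * g p)" for n
  using borel_integrable_compact[OF compact_cbox cs] by (simp add: set_integrable_def)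
 then have e: "integral (slab (real n)) (%p. k n p * g p) = (\<integral>p. indicator (slab (real n)) p *\<^sub>R (k n p * g p) \<partial>lborel)" for n
  using set_borel_integral_eq_integral(2)[of "slab (real n)", symmetric] unfolding set_lebesgue_integral_def by blast
 show ?thesis unfolding e set_lebesgue_integral_def
 proof (rule integral_dominated_convergence[where w="%p. norm (indicator strip p *\<^sub>R g p)"])
  show "(%p. indicator strip p *\<^sub>R g p) \<in> borel_measurable lborel"
   using i unfolding set_integrable_def by (rule borel_measurable_integrable)
  show "(%p. indicator (slab (real n)) p *\<^sub>R (k n p * g p)) \<in> borel_measurable lborel" for n
   using borel_measurable_continuous_on_indicator[OF _ cs[of n]] by simp
  show "integrable lborel (%p. norm (indicator strip p *\<^sub>R g p))"
   using i unfolding set_integrable_def by (rule integrable_norm)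
  show "AE p in lborel. norm (indicator (slab (real n)) p *\<^sub>R (k n p * g p)) <= norm (indicator strip p *\<^sub>R g p)" for n
  proof (intro AE_I2)
   fix p
   show "norm (indicator (slab (real n)) p *\<^sub>R (k n p * g p)) <= norm (indicator strip p *\<^sub>R g p)"
    using k[of p n] slab_in_strip[of "real n"] mult_right_mono[of "\<bar>k n p\<bar>" 1 "\<bar>g p\<bar>"]
    by (auto simp: indicator_def abs_mult)
  qed
  show "AE p in lborel. (%n. indicator (slab (real n)) p *\<^sub>R (k n p * g p)) \<longlonglongrightarrow> indicator strip p *\<^sub>R g p"
  proof (intro AE_I2)
   fix p
   show "(%n. indicator (slab (real n)) p *\<^sub>R (k n p * g p)) \<longlonglongrightarrow> indicator strip p *\<^sub>R g p"
   proof (cases "p \<in> strip")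
    case True
    obtain N :: nat where N: "\<bar>fst p\<bar> <= real N" using real_arch_simple by blast
    have "(%n. k n p * g p) \<longlonglongrightarrow> 1 * g p" by (intro tendsto_mult lim True tendsto_const)
    moreover have "\<forall>\<^sub>F n in sequentially. k n p * g p = indicator (slab (real n)) p *\<^sub>R (k n p * g p)"
     using eventually_ge_at_top[of N]
    proof (rule eventually_mono)
     fix n assume "N <= n"
     then have "p \<in> slab (real n)" using strip_in_slab[OF True] N by (meson of_nat_mono order_trans)
     then show "k n p * g p = indicator (slab (real n)) p *\<^sub>R (k n p * g p)" by simp
    qed
    ultimately show ?thesis using True by (auto intro: Lim_transform_eventually)
   next
    case False
    then have "p \<notin> slab (real n)" for n using slab_in_strip by blast
    then show ?thesis using False by simp
   qed
  qed
 qed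
qed

lemma cutoff_tendsto: "(%n. cutoff (real n) x) \<longlonglongrightarrow> 1"
proof -
 have "(%n. (1 - (x * inverse (real n))\<^sup>2)^2) \<longlonglongrightarrow> (1 - (x * 0)\<^sup>2)^2"
  by (intro tendsto_intros lim_inverse_n)
 then show ?thesis by (simp add: cutoff_def divide_inverse)
qed

text \<open>The gradient energy is controlled in time average but not at the single time
  \<open>s\<close>. The factor \<open>ta - s\<close> removes its value at \<open>s\<close> from the
  integrated identity, and the derivative of this factor adds only a time integral that is already
  bounded. The bound is uniform in \<open>R\<close>.\<close>

lemma Tt_weighted_energy:
 assumes c: "c \<in> {0,1}" and B: "0 <= B" and a: "a ~= 0" and s: "0 < s" "s <= t"
  and react: "!!s. s \<in> {0..1} ==> q * ((s - c) * f s) <= B * (s - c)^2"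
  and init: "!!x y. y \<in> Yr ==> (T (x,y) 0 - c)^2 * exp (a * x) <= M0 * exp (- \<bar>a\<bar> * \<bar>x\<bar>)"
  and fc: "!!s. s \<in> {0..1} ==> (f s)^2 <= F^2 * (s - c)^2"
 shows "\<exists>M. \<forall>R\<ge>1. integral {s..t} (%ta. (ta - s) * integral (slab R) (%p. wfun a 0 R (fst p) * (Tt p ta)^2)) <= M"
proof -
 define K1 where "K1 = exp (erate a B * t) * (2 * H * M0 / \<bar>a\<bar>)"
 define K2 where "K2 = (1 + erate a B * t) * K1"
 define g2 where "g2 = 2 * q^2 * F^2"
 have g: "0 <= g2" "0 <= grate a" by (auto simp: g2_def grate_def)
 have t: "0 <= t" using s by simp
 have "integral {s..t} (%ta. (ta - s) * integral (slab R) (%p. wfun a 0 R (fst p) * (Tt p ta)^2))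
  <= 2 * (K2 + (t - s) * (grate a * (K2 / ka) + g2 * K1 * (t - s)))" if R: "1 <= R" for R
 proof -
  have R0: "0 < R" using R by simp
  let ?m = "wfun a 0 R" and ?m' = "wfun' a 0 R"
  note tf = testfun_wfun[OF R0, of a 0]
  note M = testfunD[OF tf]
  let ?y = "%ta. integral (slab R) (%p. ?m (fst p) * gsq p ta)"
  let ?w = "%ta. integral (slab R) (%p. Tt p ta * (?m (fst p) * (Txx p ta + Tyy p ta) + ?m' (fst p) * Tx p ta))"
  let ?A = "%ta. integral (slab R) (%p. ?m (fst p) * (Tt p ta)^2)"
  let ?B = "%ta. integral (slab R) (%p. exp (a * fst p) * gsq p ta)"
  have cA: "continuous_on {s..t} ?A" and cB: "continuous_on {s..t} ?B"
   by (rule cont_slab_time, intro continuous_intros continuous_grad_slab continuous_fst_slab_time M s)+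
  have "((%ta. (ta - s) * (ka * - (2 * ?w ta)) + 1 * (ka * ?y ta)) has_integral ((t - s) * (ka * ?y t) - (s - s) * (ka * ?y s))) {s..t}"
  proof (rule fundamental_theorem_of_calculus[OF s(2)])
   fix ta assume ta: "ta \<in> {s..t}"
   then have t0: "0 < ta" using s by auto
   have "((%ta. ta - s) has_real_derivative 1) (at ta)" by (auto intro!: derivative_eq_intros)
   from DERIV_mult[OF this DERIV_cmult[OF gradient_energy_derivative[OF t0 tf], of ka]]
   have "((%ta. (ta - s) * (ka * ?y ta)) has_real_derivative (ta - s) * (ka * - (2 * ?w ta)) + 1 * (ka * ?y ta)) (at ta)"
    by (rule DERIV_cong) (simp add: mult_ac)
   then show "((%ta. (ta - s) * (ka * ?y ta)) has_vector_derivative (ta - s) * (ka * - (2 * ?w ta)) + 1 * (ka * ?y ta)) (at ta within {s..t})"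
    unfolding vector_derivative_iff by (rule has_field_derivative_at_within)
  qed
  moreover have "((%ta. ka * ?B ta + (t - s) * (grate a * ?B ta + g2 * K1) - (1/2) * ((ta - s) * ?A ta)) has_integral
    (ka * integral {s..t} ?B + (t - s) * (grate a * integral {s..t} ?B + (t - s) *\<^sub>R (g2 * K1)) - (1/2) * integral {s..t} (%ta. (ta - s) * ?A ta))) {s..t}"
   using has_integral_const_real[of "g2 * K1" s t] s
   by (intro has_integral_diff has_integral_add has_integral_mult_right integrable_integral integrable_continuous_real cB continuous_intros cA) auto
  ultimately have "(t - s) * (ka * ?y t) - (s - s) * (ka * ?y s) <=
    ka * integral {s..t} ?B + (t - s) * (grate a * integral {s..t} ?B + (t - s) *\<^sub>R (g2 * K1)) - (1/2) * integral {s..t} (%ta. (ta - s) * ?A ta)"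
  proof (rule has_integral_le)
   fix ta assume ta: "ta \<in> {s..t}"
   then have t0: "0 < ta" and t1: "0 <= ta" using s by auto
   have yB: "?y ta <= ?B ta"
   proof (rule integral_mono_box)
    fix p assume p: "p \<in> slab R"
    have "?m (fst p) <= exp (a * fst p)"
     using wfun_props(2)[OF R0 box_mem(2)[OF p], of a 0] expw_props(2)[of a 0 "fst p"] by linarith
    then show "?m (fst p) * gsq p ta <= exp (a * fst p) * gsq p ta" by (intro mult_right_mono) auto
   qed (intro continuous_intros cont_fst_box M cont_box t0)+
   have B0: "0 <= ?B ta" by (rule integral_nonneg_box) (auto intro!: continuous_intros cont_box t0)
   have K: "integral (slab R) (%p. exp (a * fst p) * (T p ta - c)^2) <= K1"
   proof -
    have "exp (erate a B * ta) <= exp (erate a B * t)" using ta erate_nonneg[OF B] by (auto intro: mult_left_mono)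
    then have "exp (erate a B * ta) * (2 * H * M0 / \<bar>a\<bar>) <= K1" unfolding K1_def using pos by (intro mult_right_mono) auto
    then show ?thesis using weighted_decay(1)[OF t1 R0 c B a react init] by linarith
   qed
   have "ka * - (2 * ?w ta) <= - (1/2) * ?A ta + (grate a * ?B ta + g2 * K1)"
    using gradient_energy_rate[OF t0 R fc, of a] mult_left_mono[OF K g(1)] unfolding g2_def by linarith
   then have "(ta - s) * (ka * - (2 * ?w ta)) <= (ta - s) * (- (1/2) * ?A ta + (grate a * ?B ta + g2 * K1))"
    using ta by (intro mult_left_mono) auto
   also have "... = - (1/2) * ((ta - s) * ?A ta) + (ta - s) * (grate a * ?B ta + g2 * K1)"
    unfolding distrib_left by simp
   also have "(ta - s) * (grate a * ?B ta + g2 * K1) <= (t - s) * (grate a * ?B ta + g2 * K1)"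
    using ta g B0 pos by (intro mult_right_mono add_nonneg_nonneg mult_nonneg_nonneg) (auto simp: K1_def)
   finally show "(ta - s) * (ka * - (2 * ?w ta)) + 1 * (ka * ?y ta) <= ka * ?B ta + (t - s) * (grate a * ?B ta + g2 * K1) - (1/2) * ((ta - s) * ?A ta)"
    using mult_left_mono[OF yB, of ka] pos by linarith
  qed
  moreover have "0 <= ?y t" using s
   by (intro integral_nonneg_box mult_nonneg_nonneg continuous_intros cont_fst_box M cont_box wfun_props(1)[OF R0] box_mem(2)) auto
  then have "0 <= (t - s) * (ka * ?y t)" using s pos by auto
  moreover have kB: "ka * integral {s..t} ?B <= K2"
   using weighted_decay(2)[OF t R0 c B a react init s] unfolding K2_def K1_def by simp
  moreover have "(t - s) * (grate a * integral {s..t} ?B + (t - s) *\<^sub>R (g2 * K1)) <= (t - s) * (grate a * (K2 / ka) + g2 * K1 * (t - s))"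
   using kB s g pos by (intro mult_left_mono add_mono) (auto simp: field_simps)
  ultimately show ?thesis by simp
 qed
 then show ?thesis by blast
qed

lemma f_sq_bounds:
 assumes "s \<in> {0..1}"
 shows "(f s)^2 <= F^2 * (s - 0)^2" "(f s)^2 <= F^2 * (s - 1)^2"
proof -
 note b = f_bounds[OF assms]
 have "(f s)^2 <= (F * s)^2" "(f s)^2 <= (F * (1 - s))^2" using b by (auto intro: power_mono)
 then show "(f s)^2 <= F^2 * (s - 0)^2" "(f s)^2 <= F^2 * (s - 1)^2" by (auto simp: power_mult_distrib power2_commute[of 1])
qed

text \<open>The arithmetic-geometric mean inequality bounds \<open>|Tt|\<close> by its square with
  an exponential growing on either side, plus \<open>exp (- lam * |x|)\<close>. The two exponentials
  come from the energies of \<open>T\<close> and of \<open>1 - T\<close>.\<close>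

lemma Tt_L1_bound:
 assumes s: "0 < s" "s <= t"
 shows "\<exists>M. \<forall>n. integral {s..t} (%ta. (ta - s) * integral (slab (real n)) (%p. \<bar>Tt p ta\<bar>)) <= M"
proof -
 obtain Ma where Ma: "!!R. 1 <= R ==> integral {s..t} (%ta. (ta - s) * integral (slab R) (%p. wfun lam 0 R (fst p) * (Tt p ta)^2)) <= Ma"
  using Tt_weighted_energy[OF _ _ _ s react0 init0 f_sq_bounds(1)] pos by auto
 obtain Mb where Mb: "!!R. 1 <= R ==> integral {s..t} (%ta. (ta - s) * integral (slab R) (%p. wfun (- lam) 0 R (fst p) * (Tt p ta)^2)) <= Mb"
  using Tt_weighted_energy[OF _ _ _ s react1 init1[OF _ pos(5) order_refl] f_sq_bounds(2)] pos by auto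
 have "integral {s..t} (%ta. (ta - s) * integral (slab (real n)) (%p. \<bar>Tt p ta\<bar>)) <= Ma + Mb + (t - s) * ((t - s) * (2 * H / lam))" for n
 proof -
  \<comment> \<open>On \<open>|x| <= n\<close> this makes \<open>|x / R|\<close> at most 1/2, so the
    cutoff there is at least 9/16. The summand 1 gives \<open>1 <= R\<close> also for
    \<open>n = 0\<close>.\<close>
  define R where "R = 2 * real n + 1"
  have R: "1 <= R" "0 < R" "real n <= R" by (auto simp: R_def)
  let ?A = "%a ta. integral (slab R) (%p. wfun a 0 R (fst p) * (Tt p ta)^2)"
  have M: "continuous_on {-R..R} (wfun a 0 R)" for a using testfunD(2)[OF testfun_wfun[OF R(2)]] .
  have cA: "continuous_on {s..t} (?A a)" for a
   by (rule cont_slab_time, intro continuous_intros continuous_grad_slab continuous_fst_slab_time M s)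
  have cT: "continuous_on {s..t} (%ta. integral (slab (real n)) (%p. \<bar>Tt p ta\<bar>))"
   by (rule cont_slab_time, intro continuous_intros continuous_grad_slab s)
  have "integral {s..t} (%ta. (ta - s) * integral (slab (real n)) (%p. \<bar>Tt p ta\<bar>))
   <= integral {s..t} (%ta. (ta - s) * ?A lam ta + (ta - s) * ?A (- lam) ta + (t - s) * (2 * H / lam))"
  proof (intro integral_le integrable_continuous_real continuous_intros cA cT)
   fix ta assume ta: "ta \<in> {s..t}"
   then have t0: "0 < ta" using s by auto
   have cw: "continuous_on (slab R) (%p. wfun a 0 R (fst p) * (Tt p ta)^2)" for a
    by (intro continuous_intros cont_fst_box M cont_box t0)
   have w0: "0 <= wfun a 0 R (fst p) * (Tt p ta)^2" if "p \<in> slab R" for a p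
    using wfun_props(1)[OF R(2) box_mem(2)[OF that]] by auto
   have ce: "continuous_on (slab (real n)) (%p. exp (- lam * \<bar>fst p\<bar>))" by (intro continuous_intros)
   have cws: "continuous_on (slab (real n)) (%p. wfun a 0 R (fst p) * (Tt p ta)^2)" for a
    using continuous_on_subset[OF cw slab_subset[OF R(3)]] .
   have "integral (slab (real n)) (%p. \<bar>Tt p ta\<bar>) <= integral (slab (real n))
    (%p. wfun lam 0 R (fst p) * (Tt p ta)^2 + wfun (- lam) 0 R (fst p) * (Tt p ta)^2 + exp (- lam * \<bar>fst p\<bar>))"
   proof (rule integral_mono_box)
    fix p assume p: "p \<in> slab (real n)"
    define x where "x = fst p"
    have x: "\<bar>x\<bar> <= real n" using box_mem(2)[OF p] by (simp add: x_def)
    have "\<bar>x / R\<bar> <= 1/2" using x R by (simp add: abs_divide R_def pos_divide_le_eq)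
    then have "\<bar>x / R\<bar>\<^sup>2 <= (1/2)^2" by (intro power_mono) auto
    then have "3/4 <= 1 - (x/R)\<^sup>2" by (simp add: power_divide)
    then have "(3/4)^2 <= cutoff R x" unfolding cutoff_def by (intro power_mono) auto
    then have k: "1/2 <= cutoff R x" by (simp add: power2_eq_square)
    have w: "wfun a 0 R x \<ge> exp (a * x) / 2" for a
    proof -
     have "expw a 0 x = exp (a * x)" by (simp add: expw_def exp_minus divide_inverse)
     then show ?thesis using mult_left_mono[OF k, of "exp (a * x)"] unfolding wfun_def by simp
    qed
    define e where "e = (if 0 <= x then lam * x else - lam * x)"
    have e: "exp (- lam * \<bar>x\<bar>) = exp (- e)" by (auto simp: e_def)
    have "exp e / 2 <= wfun lam 0 R x + wfun (- lam) 0 R x"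
    proof -
     have wn: "0 <= wfun a 0 R x" for a using w[of a] order_trans[of 0 "exp (a * x) / 2"] by simp
     show ?thesis using w[of lam] w[of "- lam"] wn[of lam] wn[of "- lam"] by (auto simp: e_def)
    qed
    from mult_right_mono[OF this, of "\<bar>Tt p ta\<bar>\<^sup>2"]
    have "\<bar>Tt p ta\<bar>\<^sup>2 * exp e / 2 <= wfun lam 0 R x * (Tt p ta)^2 + wfun (- lam) 0 R x * (Tt p ta)^2"
     unfolding distrib_right by (simp add: mult.commute)
    moreover have "0 <= exp (- e)" by simp
    ultimately show "\<bar>Tt p ta\<bar> <= wfun lam 0 R (fst p) * (Tt p ta)^2 + wfun (- lam) 0 R (fst p) * (Tt p ta)^2 + exp (- lam * \<bar>fst p\<bar>)"
     using le_half_weight[of "\<bar>Tt p ta\<bar>" e] unfolding x_def[symmetric] e add_divide_distrib by linarith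
   qed (intro continuous_intros cont_box t0 cws ce)+
   also have "... = integral (slab (real n)) (%p. wfun lam 0 R (fst p) * (Tt p ta)^2 + wfun (- lam) 0 R (fst p) * (Tt p ta)^2)
     + integral (slab (real n)) (%p. exp (- lam * \<bar>fst p\<bar>))"
    by (rule integral_sum_box(1)) (intro continuous_on_add cws ce)+
   also have "... = integral (slab (real n)) (%p. wfun lam 0 R (fst p) * (Tt p ta)^2) + integral (slab (real n)) (%p. wfun (- lam) 0 R (fst p) * (Tt p ta)^2)
     + integral (slab (real n)) (%p. exp (- lam * \<bar>fst p\<bar>))"
    using integral_sum_box(1)[OF cws cws] by simp
   also have "... <= ?A lam ta + ?A (- lam) ta + 2 * H / lam"
    using pos integral_subset_le[OF slab_subset[OF R(3)] box_integrable[OF cws] box_integrable[OF cw]] w0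
     integral_box_exp_abs_le[OF pos(5), of "real n" H]
    by (intro add_mono) (blast | simp)+
   finally have "(ta - s) * integral (slab (real n)) (%p. \<bar>Tt p ta\<bar>) <= (ta - s) * (?A lam ta + ?A (- lam) ta + 2 * H / lam)"
    using ta by (intro mult_left_mono) auto
   moreover have "(ta - s) * (2 * H / lam) <= (t - s) * (2 * H / lam)" using ta pos by (intro mult_right_mono) auto
   ultimately show "(ta - s) * integral (slab (real n)) (%p. \<bar>Tt p ta\<bar>) <= (ta - s) * ?A lam ta + (ta - s) * ?A (- lam) ta + (t - s) * (2 * H / lam)"
    unfolding distrib_left by linarith
  qed
  also have "... = integral {s..t} (%ta. (ta - s) * ?A lam ta) + integral {s..t} (%ta. (ta - s) * ?A (- lam) ta) + (t - s) * ((t - s) * (2 * H / lam))"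
  proof -
   have c: "continuous_on {s..t} (%ta. (ta - s) * ?A a ta)" for a by (intro continuous_intros cA)
   have "((%ta. (ta - s) * ?A lam ta + (ta - s) * ?A (- lam) ta + (t - s) * (2 * H / lam)) has_integral
    (integral {s..t} (%ta. (ta - s) * ?A lam ta) + integral {s..t} (%ta. (ta - s) * ?A (- lam) ta) + (t - s) *\<^sub>R ((t - s) * (2 * H / lam)))) {s..t}"
    using has_integral_const_real[of "(t - s) * (2 * H / lam)" s t] s
    by (intro has_integral_add integrable_integral integrable_continuous_real c) auto
   then show ?thesis by (simp add: integral_unique)
  qed
  also have "... <= Ma + Mb + (t - s) * ((t - s) * (2 * H / lam))" using Ma[OF R(1)] Mb[OF R(1)] by simp
  finally show ?thesis .
 qed
 then show ?thesis by blast
qed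

end

section \<open>The burning rate as burnt fuel, at almost every time\<close>

context reactive_flow
begin

lemma slab_integral_mono:
 fixes g :: "plane => real"
 assumes "continuous_on (slab R) g" "L <= R" "!!p. p \<in> slab R ==> 0 <= g p"
 shows "integral (slab L) g <= integral (slab R) g"
 using assms by (intro integral_subset_le slab_subset box_integrable continuous_on_subset[OF assms(1)]) auto

text \<open>The integrals over slabs increase with \<open>n\<close>, and their limit has a finite
  integral in time against \<open>ta - s\<close>. It is therefore finite at almost every time, and
  the factor can be divided out after \<open>s\<close>.\<close>

lemma Tt_L1_ae_after:
 assumes s: "0 < s" "s <= t"
 shows "\<exists>N. negligible N \<and> (\<forall>ta\<in>{s<..t} - N. \<exists>M. \<forall>n. integral (slab (real n)) (%p. \<bar>Tt p ta\<bar>) <= M)"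
proof -
 obtain M where M: "!!n. integral {s..t} (%ta. (ta - s) * integral (slab (real n)) (%p. \<bar>Tt p ta\<bar>)) <= M"
  using Tt_L1_bound[OF s] by blast
 let ?i = "%n ta. integral (slab (real n)) (%p. \<bar>Tt p ta\<bar>)"
 let ?h = "%n ta. ennreal (indicator (cbox s t) ta * ((ta - s) * ?i n ta))"
 have ci: "continuous_on (cbox s t) (%ta. (ta - s) * ?i n ta)" for n
  unfolding box_real by (intro continuous_intros cont_slab_time continuous_grad_slab s)
 have cT: "continuous_on (slab R) (%p. \<bar>Tt p ta\<bar>)" if "ta \<in> {s..t}" for ta R
  using that s by (intro continuous_intros cont_box) auto
 have i0: "0 <= ?i n ta" if "ta \<in> {s..t}" for n ta
  by (rule integral_nonneg_box[OF cT[OF that]]) auto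
 have meas: "?h n \<in> borel_measurable lborel" for n
  using borel_measurable_continuous_on_indicator[OF _ ci[of n]] by simp
 have inc: "incseq ?h"
  unfolding incseq_def le_fun_def
 proof (intro allI impI ennreal_leI)
  fix m n :: nat and ta assume mn: "m <= n"
  show "indicator (cbox s t) ta * ((ta - s) * ?i m ta) <= indicator (cbox s t) ta * ((ta - s) * ?i n ta)"
  proof (cases "ta \<in> cbox s t")
   case True
   have "?i m ta <= ?i n ta"
    by (rule slab_integral_mono[OF cT]) (use True mn in auto)
   then show ?thesis using True by (auto intro!: mult_left_mono)
  qed simp
 qed
 have "(\<integral>\<^sup>+ta. (SUP n. ?h n ta) \<partial>lborel) = (SUP n. \<integral>\<^sup>+ta. ?h n ta \<partial>lborel)"
  by (rule nn_integral_monotone_convergence_SUP[OF inc meas])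
 also have "... = (SUP n. ennreal (integral (cbox s t) (%ta. (ta - s) * ?i n ta)))"
  using nn_integral_continuous_box[OF ci] i0 by simp
 also have "... <= ennreal M" using M by (intro SUP_least ennreal_leI) simp
 finally have "(\<integral>\<^sup>+ta. (SUP n. ?h n ta) \<partial>lborel) ~= \<infinity>" by (auto simp: top_unique)
 then have "AE ta in lborel. (SUP n. ?h n ta) ~= \<infinity>"
  by (intro nn_integral_PInf_AE borel_measurable_SUP meas) auto
 then obtain N where N: "N \<in> null_sets lborel" "{ta. \<not> (SUP n. ?h n ta) ~= \<infinity>} \<subseteq> N"
  by (auto simp: eventually_ae_filter)
 have "negligible N" using N(1) by (simp add: negligible_iff_null_sets null_sets_completionI)
 moreover have "\<exists>M. \<forall>n. ?i n ta <= M" if ta: "ta \<in> {s<..t} - N" for ta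
 proof -
  have "(SUP n. ?h n ta) ~= \<infinity>" using N(2) ta by blast
  then have fin: "(SUP n. ?h n ta) < \<infinity>" unfolding infinity_ennreal_def by (rule less_top[THEN iffD1])
  define r where "r = enn2real (SUP n. ?h n ta)"
  have "?i n ta <= r / (ta - s)" for n
  proof -
   have "?h n ta <= (SUP n. ?h n ta)" by (rule SUP_upper) simp
   also have "... = ennreal r" using fin by (simp add: r_def)
   finally have "ennreal ((ta - s) * ?i n ta) <= ennreal r" using ta by simp
   moreover have "0 <= r" by (simp add: r_def)
   ultimately have "(ta - s) * ?i n ta <= r" by (simp add: ennreal_le_iff)
   then show ?thesis using ta by (simp add: field_simps)
  qed
  then show ?thesis by blast
 qed
 ultimately show ?thesis by blast
qed

lemma Tt_L1_ae:
 "\<exists>N. negligible N \<and> (\<forall>ta\<in>{0<..t} - N. \<exists>M. \<forall>n. integral (slab (real n)) (%p. \<bar>Tt p ta\<bar>) <= M)"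
proof -
 have "\<exists>N. negligible N \<and> (\<forall>ta\<in>{1 / real (Suc k)<..t} - N. \<exists>M. \<forall>n. integral (slab (real n)) (%p. \<bar>Tt p ta\<bar>) <= M)" for k
 proof (cases "1 / real (Suc k) <= t")
  case True then show ?thesis by (intro Tt_L1_ae_after) auto
 next
  case False then show ?thesis by (intro exI[of _ "{}"]) auto
 qed
 then obtain N where N: "!!k. negligible (N k)"
  "!!k ta. ta \<in> {1 / real (Suc k)<..t} - N k ==> \<exists>M. \<forall>n. integral (slab (real n)) (%p. \<bar>Tt p ta\<bar>) <= M"
  by metis
 have "negligible (\<Union>k. N k)" by (rule negligible_Union_nat[OF N(1)])
 moreover have "\<exists>M. \<forall>n. integral (slab (real n)) (%p. \<bar>Tt p ta\<bar>) <= M" if ta: "ta \<in> {0<..t} - (\<Union>k. N k)" for ta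
 proof -
  obtain k where "1 / real (Suc k) < ta" using nat_approx_posE[of ta] ta by auto
  then show ?thesis using ta by (intro N(2)[of _ k]) auto
 qed
 ultimately show ?thesis by blast
qed

definition "burn ta = set_lebesgue_integral lborel strip (%p. f (T p ta))"

lemma cont_strip:
 assumes "0 <= ta"
 shows "continuous_on strip (%p. f (T p ta))" "0 < ta ==> continuous_on strip (%p. Tt p ta)"
 using assms by (auto intro!: flow_cont continuous_intros simp: T_unit[simplified])

lemma f_nonneg: "p \<in> slab R ==> 0 <= t ==> 0 <= f (T p t)"
 using f_T_bounds by blast

lemma f_slab_bound:
 assumes "0 <= ta"
 shows "integral (slab (real n)) (%p. f (T p ta)) <= F * KD ta"
proof -
 have "integral (slab (real n)) (%p. f (T p ta)) <= integral (slab (real n + 1)) (%p. f (T p ta))"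
  by (rule slab_integral_mono[OF cont_box_f[OF assms]], simp, erule f_nonneg, rule assms)
 also have "... <= integral (slab (real n + 1)) (%p. F * majorant p ta)"
  by (rule integral_mono_box, intro cont_box_f assms, intro continuous_intros cont_majorant assms)
   (rule majorant_bounds(3)[OF box_mem(1) assms])
 also have "... <= F * KD ta" using majorant_integral[OF assms, of "real n + 1"] pos by (simp add: mult_left_mono)
 finally show ?thesis .
qed

lemma f_strip_integrable:
 assumes "0 <= ta"
 shows "set_integrable lborel strip (%p. f (T p ta))"
proof (rule strip_integrable[OF cont_strip(1)[OF assms]])
 fix n
 have "integral (slab (real n)) (%p. \<bar>f (T p ta)\<bar>) = integral (slab (real n)) (%p. f (T p ta))"
  using f_T_bounds[OF _ assms] by (intro integral_cong) auto
 then show "integral (slab (real n)) (%p. \<bar>f (T p ta)\<bar>) <= F * KD ta" using f_slab_bound[OF assms] by simp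
qed

lemma burn_limit: "0 <= ta ==> (%n. integral (slab (real n)) (%p. f (T p ta))) \<longlonglongrightarrow> burn ta"
 unfolding burn_def using strip_limit[OF cont_strip(1) f_strip_integrable, of ta "%_ _. 1"] by auto

lemma burn_integral:
 assumes a: "0 <= a" "a <= t"
 shows "burn integrable_on {a..t}" "integral {a..t} (%ta. integral (slab (real n)) (%p. f (T p ta))) <= integral {a..t} burn"
  "ta \<in> {a..t} ==> 0 <= burn ta"
proof -
 let ?h = "%n ta. integral (slab (real n)) (%p. f (T p ta))"
 have i: "?h n integrable_on {a..t}" for n
  by (intro integrable_continuous_real cont_slab_time cont_f_slab_time a)
 have mono: "?h n ta <= ?h (Suc n) ta" if "ta \<in> {a..t}" for n ta
 proof -
  have t0: "0 <= ta" using that a by auto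
  show ?thesis by (rule slab_integral_mono[OF cont_box_f[OF t0]], simp, erule f_nonneg, rule t0)
 qed
 have h0: "0 <= ?h n ta" if "ta \<in> {a..t}" for n ta
 proof -
  have t0: "0 <= ta" using that a by auto
  show ?thesis by (rule integral_nonneg_box[OF cont_box_f[OF t0]], erule f_nonneg, rule t0)
 qed
 have lim: "(%n. ?h n ta) \<longlonglongrightarrow> burn ta" if "ta \<in> {a..t}" for ta
  using that a by (intro burn_limit) auto
 show b0: "0 <= burn ta" if "ta \<in> {a..t}" for ta
  by (rule LIMSEQ_le_const[OF lim[OF that]]) (use h0[OF that] in auto)
 have "integral {a..t} (?h n) <= integral {a..t} (%_. F * KD t)" for n
 proof (intro integral_le i)
  fix ta assume ta: "ta \<in> {a..t}"
  then have "0 <= ta" using a by simp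
  have "F * KD ta <= F * KD t" using KD_mono[of ta t] ta a pos by (intro mult_left_mono) auto
  then show "?h n ta <= F * KD t" using f_slab_bound[OF \<open>0 <= ta\<close>, of n] by linarith
 qed auto
 moreover have "0 <= integral {a..t} (?h n)" for n by (rule integral_nonneg[OF i h0])
 ultimately have "norm (integral {a..t} (?h n)) <= integral {a..t} (%_. F * KD t)" for n by simp
 then have "bounded (range (%n. integral {a..t} (?h n)))" unfolding bounded_iff by blast
 from monotone_convergence_increasing[OF i mono lim this]
 have c: "burn integrable_on {a..t}" "(%n. integral {a..t} (?h n)) \<longlonglongrightarrow> integral {a..t} burn" by auto
 show "burn integrable_on {a..t}" by (rule c)
 have "incseq (%n. integral {a..t} (?h n))" by (rule incseq_SucI, rule integral_le[OF i i mono])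
 then show "integral {a..t} (?h n) <= integral {a..t} burn" using incseq_le[OF _ c(2)] by blast
qed

text \<open>The balance of \<open>T\<close> against the cutoff has an error of order
  \<open>1 / n\<close>. The absolute bound \<open>M\<close> is what allows the cutoff to be removed
  from \<open>Tt\<close> by dominated convergence.\<close>

lemma Tt_strip_integral:
 assumes ta: "0 < ta" and M: "!!n. integral (slab (real n)) (%p. \<bar>Tt p ta\<bar>) <= M"
 shows "set_lebesgue_integral lborel strip (%p. Tt p ta) = q * burn ta"
proof -
 have t0: "0 <= ta" using ta by simp
 \<comment> \<open>The index 0 is set apart because the bounds on \<open>cutoff\<close> ask for a
   positive radius.\<close>
 let ?k = "%n p. if n = 0 then 1 else cutoff (real n) (fst p)"
 have k1: "\<bar>?k n p\<bar> <= 1" if "p \<in> slab (real n)" for n p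
  using cutoff_slab[of "real n" p] that by (cases "n = 0") auto
 have ck: "continuous_on (slab (real n)) (?k n)" for n by (cases "n = 0") (auto intro!: continuous_intros)
 have kl: "(%n. ?k n p) \<longlonglongrightarrow> 1" for p
  by (rule Lim_transform_eventually[OF cutoff_tendsto[of "fst p"] eventually_mono[OF eventually_gt_at_top[of 0]]]) simp
 have l1: "(%n. integral (slab (real n)) (%p. ?k n p * Tt p ta)) \<longlonglongrightarrow> set_lebesgue_integral lborel strip (%p. Tt p ta)"
  by (rule strip_limit[OF cont_strip(2)[OF t0 ta] strip_integrable[OF cont_strip(2)[OF t0 ta] M] k1 ck kl])
 have l2: "(%n. integral (slab (real n)) (%p. ?k n p * f (T p ta))) \<longlonglongrightarrow> burn ta"
  unfolding burn_def by (rule strip_limit[OF cont_strip(1)[OF t0] f_strip_integrable[OF t0] k1 ck kl])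
 define e where "e n = integral (slab (real n)) (%p. T p ta * (fst (u p) * cutoff' (real n) (fst p) + ka * cutoff'' (real n) (fst p)))" for n
 have id: "integral (slab (real n)) (%p. ?k n p * Tt p ta) = e n + q * integral (slab (real n)) (%p. ?k n p * f (T p ta))" if n: "0 < n" for n
 proof -
  have R: "0 < real n" using n by simp
  have c1: "continuous_on (slab (real n)) (%p. T p ta * (fst (u p) * cutoff' (real n) (fst p) + ka * cutoff'' (real n) (fst p)))"
   and c2: "continuous_on (slab (real n)) (%p. q * (?k n p * f (T p ta)))"
   by (intro continuous_intros cont_box_T[OF t0] cont_box_u cont_box_f[OF t0] ck)+
  have "integral (slab (real n)) (%p. ?k n p * Tt p ta) = integral (slab (real n)) (%p. T p ta * (fst (u p) * cutoff' (real n) (fst p) + ka * cutoff'' (real n) (fst p))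
    + q * (?k n p * f (T p ta)))"
   using weak_identity_x[OF ta C2fun_id testfun_cutoff[OF R]] n by (simp add: mult.assoc)
  also have "... = e n + integral (slab (real n)) (%p. q * (?k n p * f (T p ta)))"
   unfolding e_def by (rule integral_sum_box(1)[OF c1 c2])
  finally show ?thesis by simp
 qed
 have "(%n. (4 * U * 1 * KD ta + 16 * ka * 1 * H) * inverse (real n)) \<longlonglongrightarrow> (4 * U * 1 * KD ta + 16 * ka * 1 * H) * 0"
  by (intro tendsto_intros lim_inverse_n)
 then have "(%n. (4 * U * 1 * KD ta + 16 * ka * 1 * H) * inverse (real n)) \<longlonglongrightarrow> 0" by (simp only: mult_zero_right)
 then have e0: "e \<longlonglongrightarrow> 0"
 proof (rule Lim_null_comparison[rotated])
  show "\<forall>\<^sub>F n in sequentially. norm (e n) <= (4 * U * 1 * KD ta + 16 * ka * 1 * H) * inverse (real n)"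
   using eventually_gt_at_top[of 0]
  proof (rule eventually_mono)
   fix n :: nat assume "0 < n"
   then show "norm (e n) <= (4 * U * 1 * KD ta + 16 * ka * 1 * H) * inverse (real n)"
    using slab_transport_error[OF t0 C2fun_id, of "real n" 1 1] by (simp add: e_def divide_inverse)
  qed
 qed
 have "(%n. e n + q * integral (slab (real n)) (%p. ?k n p * f (T p ta))) \<longlonglongrightarrow> 0 + q * burn ta"
  by (intro tendsto_intros e0 l2)
 then have "(%n. integral (slab (real n)) (%p. ?k n p * Tt p ta)) \<longlonglongrightarrow> 0 + q * burn ta"
  by (rule Lim_transform_eventually) (rule eventually_mono[OF eventually_gt_at_top[of 0] id[symmetric]])
 from LIMSEQ_unique[OF l1 this] show ?thesis by simp
qed

text \<open>On an exceptional null set of times \<open>Tt\<close> may fail to be integrable, and the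
  Lebesgue integral in \<open>V\<close> then takes its default value; the integral over time is not
  affected. The inequality comes from dropping the fuel burnt before time 1 and outside the
  slab.\<close>

lemma burning_rate_facts:
 assumes V: "!!ta. 0 < ta ==> V ta = set_lebesgue_integral lborel strip (%p. Tt p ta / H)" and t: "1 <= t"
 shows "V integrable_on {0..t}" "fuel (real n) t <= H * integral {0..t} V"
proof -
 obtain N where N: "negligible N" "!!ta. ta \<in> {0<..t} - N ==> \<exists>M. \<forall>n. integral (slab (real n)) (%p. \<bar>Tt p ta\<bar>) <= M"
  using Tt_L1_ae[of t] by blast
 have t0: "0 <= t" using t by simp
 have N': "negligible (insert 0 N)" using N(1) by simp
 have VN: "V ta = q / H * burn ta" if "ta \<in> {0..t} - insert 0 N" for ta
 proof -
  have t0: "0 < ta" using that by auto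
  have "ta \<in> {0<..t} - N" using that t0 by auto
  from N(2)[OF this] obtain M where "!!n. integral (slab (real n)) (%p. \<bar>Tt p ta\<bar>) <= M" by blast
  from Tt_strip_integral[OF t0 this] have "set_lebesgue_integral lborel strip (%p. Tt p ta) = q * burn ta" .
  then show ?thesis unfolding V[OF t0] by (simp add: set_integral_divide_zero)
 qed
 have bi: "(%ta. q / H * burn ta) integrable_on {0..t}" by (intro integrable_on_mult_right burn_integral(1) t0 order_refl)
 show "V integrable_on {0..t}" by (rule integrable_spike[OF bi N' VN])
 have "integral {0..t} V = integral {0..t} (%ta. q / H * burn ta)" by (rule integral_spike[OF N']) (use VN in auto)
 then have e: "H * integral {0..t} V = q * integral {0..t} burn" using pos by simp
 have "integral {1..t} (%ta. integral (slab (real n)) (%p. f (T p ta))) <= integral {1..t} burn"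
  by (rule burn_integral(2)) (use t in auto)
 also have "... <= integral {0..t} burn"
  using t t0 by (intro integral_subset_le burn_integral) (auto intro: burn_integral(3)[of 0 t])
 finally show "fuel (real n) t <= H * integral {0..t} V" unfolding fuel_def e using pos by (intro mult_left_mono) auto
qed

end

section \<open>Streamlines\<close>

lemma exp_ramp_integral:
 fixes L s :: real
 shows "((%th. \<bar>s\<bar> * (L * exp (2 * L * \<bar>th * s\<bar>))) has_integral (exp (2 * L * \<bar>s\<bar>) - 1) / 2) {0..1}"
proof -
 have "((%th. \<bar>s\<bar> * (L * exp (2 * L * \<bar>th * s\<bar>))) has_integral (exp (2 * L * (1 * \<bar>s\<bar>)) / 2 - exp (2 * L * (0 * \<bar>s\<bar>)) / 2)) {0..1}"
 proof (rule fundamental_theorem_of_calculus)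
  fix th :: real assume "th \<in> {0..1}"
  then have "\<bar>th * s\<bar> = th * \<bar>s\<bar>" by (simp add: abs_mult)
  moreover have "((%th. exp (2 * L * (th * \<bar>s\<bar>)) / 2) has_real_derivative \<bar>s\<bar> * (L * exp (2 * L * (th * \<bar>s\<bar>)))) (at th within {0..1})"
   by (auto intro!: derivative_eq_intros)
  ultimately show "((%th. exp (2 * L * (th * \<bar>s\<bar>)) / 2) has_vector_derivative \<bar>s\<bar> * (L * exp (2 * L * \<bar>th * s\<bar>))) (at th within {0..1})"
   by (simp add: has_real_derivative_iff_has_vector_derivative)
 qed simp
 then show ?thesis by (simp add: diff_divide_distrib)
qed

text \<open>Writing the primitive as an average over \<open>{0..1}\<close> treats both signs of
  \<open>s\<close> at once, without oriented integrals.\<close>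

lemma primitive_scaled_average:
 fixes g :: "real => 'a::banach"
 assumes "continuous_on UNIV g"
 shows "((%s. s *\<^sub>R integral {0..1} (%th. g (th * s))) has_vector_derivative g s0) (at s0)"
proof -
 define M where "M = \<bar>s0\<bar> + 1"
 define G where "G s = integral {-M..s} g" for s
 have c: "continuous_on A g" for A using continuous_on_subset[OF assms] by blast
 have dG: "(G has_vector_derivative g s) (at s within {-M..M})" if "s \<in> {-M..M}" for s
  unfolding G_def using integral_has_vector_derivative[OF c that] .
 have e: "G s - G 0 = s *\<^sub>R integral {0..1} (%th. g (th * s))" if s: "s \<in> {-M<..<M}" for s
 proof -
  have im: "th * s \<in> {-M..M}" if "th \<in> {0..1}" for th
  proof -
   have "\<bar>th * s\<bar> <= 1 * \<bar>s\<bar>" unfolding abs_mult using that by (intro mult_right_mono) auto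
   then show ?thesis using s by auto
  qed
  have "((%th. s *\<^sub>R g (th * s)) has_integral (G (1 * s) - G (0 * s))) {0..1}"
  proof (rule fundamental_theorem_of_calculus)
   fix th :: real assume th: "th \<in> {0..1}"
   have "((%th. th * s) has_vector_derivative s) (at th within {0..1})"
    by (auto simp: vector_derivative_iff intro!: derivative_eq_intros)
   moreover have "(G has_vector_derivative g (th * s)) (at (th * s) within (%th. th * s) ` {0..1})"
    using dG[OF im[OF th]] by (rule has_vector_derivative_within_subset) (use im in auto)
   ultimately show "((%th. G (th * s)) has_vector_derivative s *\<^sub>R g (th * s)) (at th within {0..1})"
    using vector_diff_chain_within[of "%th. th * s" s th "{0..1}" G "g (th * s)"] by (simp add: o_def)
  qed simp
  then show ?thesis by (auto dest!: integral_unique)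
 qed
 have s0: "s0 \<in> {-M<..<M}" by (auto simp: M_def)
 have "(G has_vector_derivative g s0) (at s0)"
  using dG[of s0] s0 at_within_Icc_at[of "-M" s0 M] by auto
 then have "((%s. G s - G 0) has_vector_derivative g s0) (at s0)" by (auto intro!: derivative_eq_intros)
 then show ?thesis
  by (rule has_vector_derivative_transform_within_open[OF _ _ s0]) (use e in auto)
qed

text \<open>A contraction on the whole line at once: the unknown is
  \<open>(ga - p) / exp (2 * L * |s|)\<close> among bounded continuous functions. In this weighted
  supremum norm, due to Bielecki, the integral operator contracts by 1/2, so no continuation of
  local solutions is involved.\<close>

lemma global_solution_exists:
 fixes v :: "'a::euclidean_space => 'a"
 assumes L: "0 < L" and lip: "!!x y. norm (v x - v y) <= L * norm (x - y)"
 shows "\<exists>ga. ga 0 = p \<and> (\<forall>s. (ga has_vector_derivative v (ga s)) (at s))"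
proof -
 define e where "e s = exp (2 * L * \<bar>s\<bar>)" for s :: real
 have e0: "0 < e s" for s by (simp add: e_def)
 have ce: "continuous_on A e" for A unfolding e_def by (intro continuous_intros)
 have cv: "continuous_on A v" for A
  by (rule lipschitz_on_continuous_on[of L]) (use L lip in \<open>auto simp: lipschitz_on_def dist_norm\<close>)
 define z where "z be s = p + e s *\<^sub>R apply_bcontfun be s" for be :: "real \<Rightarrow>\<^sub>C 'a" and s
 have cz: "continuous_on A (z be)" for A be unfolding z_def by (intro continuous_intros ce continuous_on_apply_bcontfun)
 define g where "g be s = v (z be s)" for be s
 have cg: "continuous_on A (g be)" for A be unfolding g_def by (rule continuous_on_compose2[OF cv cz]) auto
 define I where "I be s = s *\<^sub>R integral {0..1} (%th. g be (th * s))" for be s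
 have cgs: "continuous_on {0..1} (%th. g be (th * s))" for be s
  by (rule continuous_on_compose2[OF cg[of UNIV]]) (auto intro!: continuous_intros)
 have dI: "(I be has_vector_derivative g be s) (at s)" for be s
  unfolding I_def by (rule primitive_scaled_average[OF cg])
 have cI: "continuous_on UNIV (I be)" for be
  using has_vector_derivative_continuous[OF dI] by (intro continuous_at_imp_continuous_on) auto
 have diff: "norm (I be s - I be' s) <= e s * (dist be be' / 2)" for be be' s
 proof -
  have "I be s - I be' s = integral {0..1} (%th. s *\<^sub>R (g be (th * s) - g be' (th * s)))"
   unfolding I_def
   by (subst integral_cmul, subst integral_diff[OF integrable_continuous_real[OF cgs] integrable_continuous_real[OF cgs]])
    (simp add: scaleR_diff_right)
  also have "norm ... <= integral {0..1} (%th. (\<bar>s\<bar> * (L * exp (2 * L * \<bar>th * s\<bar>))) * dist be be')"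
  proof (rule integral_norm_bound_integral)
   show "(%th. s *\<^sub>R (g be (th * s) - g be' (th * s))) integrable_on {0..1}"
    by (intro integrable_continuous_real continuous_intros cgs)
   show "(%th. (\<bar>s\<bar> * (L * exp (2 * L * \<bar>th * s\<bar>))) * dist be be') integrable_on {0..1}"
    by (intro integrable_continuous_real continuous_intros)
   fix th :: real assume "th \<in> {0..1}"
   define r where "r = th * s"
   have "norm (g be r - g be' r) <= L * norm (z be r - z be' r)" unfolding g_def by (rule lip)
   also have "z be r - z be' r = e r *\<^sub>R (apply_bcontfun be r - apply_bcontfun be' r)" unfolding z_def by (simp add: scaleR_diff_right)
   also have "L * norm ... <= L * (e r * dist be be')"
    using L e0[of r] dist_bounded[of be r be'] by (auto simp: dist_norm intro!: mult_left_mono)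
   finally have "\<bar>s\<bar> * norm (g be r - g be' r) <= \<bar>s\<bar> * (L * (e r * dist be be'))" by (intro mult_left_mono) auto
   then show "norm (s *\<^sub>R (g be (th * s) - g be' (th * s))) <= (\<bar>s\<bar> * (L * exp (2 * L * \<bar>th * s\<bar>))) * dist be be'"
    by (simp add: r_def e_def mult.assoc)
  qed
  also have "... = (e s - 1) / 2 * dist be be'"
   by (subst integral_mult_left) (simp only: integral_unique[OF exp_ramp_integral] e_def)
  also have "... <= e s * (dist be be' / 2)" by (simp add: left_diff_distrib)
  finally show ?thesis .
 qed
 have I0: "I 0 s = s *\<^sub>R v p" for s by (simp add: I_def g_def z_def)
 define Op where "Op be = Bcontfun (%s. inverse (e s) *\<^sub>R I be s)" for be
 have bc: "(%s. inverse (e s) *\<^sub>R I be s) \<in> bcontfun" for be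
 proof (rule bcontfun_normI)
  show "continuous_on UNIV (%s. inverse (e s) *\<^sub>R I be s)"
   using e0 by (intro continuous_intros ce cI) (auto simp: less_imp_neq[symmetric])
  fix s
  have "norm (I be s) <= norm (I be s - I 0 s) + norm (I 0 s)" using norm_triangle_ineq[of "I be s - I 0 s" "I 0 s"] by simp
  also have "... <= e s * (dist be 0 / 2) + e s * (norm (v p) / (2 * L))"
  proof (intro add_mono diff)
   have "2 * L * \<bar>s\<bar> <= e s" unfolding e_def using exp_ge_add_one_self[of "2 * L * \<bar>s\<bar>"] by linarith
   then have "2 * L * \<bar>s\<bar> * norm (v p) <= e s * norm (v p)" by (intro mult_right_mono) auto
   then show "norm (I 0 s) <= e s * (norm (v p) / (2 * L))" using L by (simp add: I0 field_simps)
  qed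
  finally have "inverse (e s) * norm (I be s) <= inverse (e s) * (e s * (dist be 0 / 2 + norm (v p) / (2 * L)))"
   using e0[of s] by (intro mult_left_mono) (auto simp: distrib_left)
  also have "... = dist be 0 / 2 + norm (v p) / (2 * L)" using e0[of s] by (simp add: mult.assoc[symmetric])
  finally show "norm (inverse (e s) *\<^sub>R I be s) <= dist be 0 / 2 + norm (v p) / (2 * L)" using e0[of s] by simp
 qed
 have Op: "apply_bcontfun (Op be) s = inverse (e s) *\<^sub>R I be s" for be s
  unfolding Op_def by (simp add: Bcontfun_inverse[OF bc])
 have "\<exists>!be. Op be = be"
 proof (rule banach_fix_type[of "1/2"])
  show "\<forall>be be'. dist (Op be) (Op be') <= 1/2 * dist be be'"
  proof (intro allI dist_bound)
   fix be be' s
   have "dist (Op be s) (Op be' s) = inverse (e s) * norm (I be s - I be' s)"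
    using e0[of s] by (simp add: Op dist_norm scaleR_diff_right[symmetric])
   also have "... <= inverse (e s) * (e s * (dist be be' / 2))" using e0[of s] diff by (intro mult_left_mono) auto
   also have "... = 1/2 * dist be be'" using e0[of s] by simp
   finally show "dist (Op be s) (Op be' s) <= 1/2 * dist be be'" .
  qed
 qed auto
 then obtain be where be: "Op be = be" by blast
 have z: "z be s = p + I be s" for s
  using arg_cong[OF be, of "%b. apply_bcontfun b s"] e0[of s] unfolding z_def Op by (metis divideR_right less_irrefl scaleR_scaleR right_inverse scaleR_one)
 have "(z be has_vector_derivative v (z be s)) (at s)" for s
 proof -
  have "((%s. p + I be s) has_vector_derivative g be s) (at s)" using dI by (auto intro!: derivative_eq_intros)
  moreover have "z be = (%s. p + I be s)" using z by auto
  ultimately show ?thesis by (simp add: g_def)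
 qed
 moreover have "z be 0 = p" by (simp add: z I_def)
 ultimately show ?thesis by blast
qed

lemma DERIV_neg_part_square: "((%y::real. (min 0 y)^2) has_real_derivative 2 * min 0 y) (at y)"
proof (cases y "0::real" rule: linorder_cases)
 case less
 have "((%y. y^2) has_real_derivative 2 * min 0 y) (at y)" using less by (auto intro!: derivative_eq_intros)
 then show ?thesis by (rule has_field_derivative_transform_within_open[of _ _ _ "{..<0}"]) (use less in auto)
next
 case greater
 have "((%y. 0) has_real_derivative 2 * min 0 y) (at y)" using greater by (auto intro!: derivative_eq_intros)
 then show ?thesis by (rule has_field_derivative_transform_within_open[of _ _ _ "{0<..}"]) (use greater in auto)
next
 case equal
 have "((%h. (min 0 h)^2 / h) \<longlongrightarrow> 0) (at (0::real))"
 proof (rule Lim_null_comparison)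
  show "\<forall>\<^sub>F h in at 0. norm ((min 0 h)^2 / h) <= \<bar>h\<bar>"
   by (intro always_eventually allI) (auto simp: min_def power2_eq_square)
  show "((%h. \<bar>h\<bar>) \<longlongrightarrow> 0) (at (0::real))" using tendsto_rabs[OF tendsto_ident_at, of "0::real" UNIV] by simp
 qed
 then show ?thesis using equal by (simp add: has_field_derivative_iff)
qed

text \<open>The square of the negative part of \<open>y\<close> has derivative 0 everywhere, hence
  keeps its initial value 0. This keeps streamlines between the walls.\<close>

lemma invariant_lower_bound:
 fixes y y' :: "real => real"
 assumes d: "!!s. (y has_real_derivative y' s) (at s)" and z: "!!s. y s <= 0 ==> y' s = 0" and "0 <= y 0"
 shows "0 <= y s"
proof -
 have "((%s. (min 0 (y s))^2) has_real_derivative 0) (at s)" for s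
 proof -
  have "2 * min 0 (y s) * y' s = 0" using z[of s] by (cases "y s <= 0") auto
  then show ?thesis by (rule DERIV_cong[OF DERIV_chain2[OF DERIV_neg_part_square d]])
 qed
 then have "(min 0 (y s))^2 = (min 0 (y 0))^2" using DERIV_isconst_all by blast
 then show ?thesis using assms(3) by (auto simp: min_def split: if_splits)
qed

text \<open>Extends the velocity from the strip to the plane. The clamp is 1-Lipschitz, so the
  Lipschitz constant of the velocity is kept.\<close>

definition yclamp :: "bdry => real => real => real" where
 "yclamp b H y = (case b of Neumann => min H (max 0 y) | Periodic => y)"

lemma yclamp: "0 < H ==> yclamp b H y \<in> yrange b H" "y \<in> yrange b H ==> yclamp b H y = y" "\<bar>yclamp b H y - yclamp b H y'\<bar> <= \<bar>y - y'\<bar>"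
 by (auto simp: yclamp_def yrange_def split: bdry.splits)

text \<open>The hypotheses on tubes speak about streamlines but do not supply them. The clamped
  velocity has a global solution; beyond a wall its vertical component is the value 0 at the wall,
  so a solution that starts in the strip stays there.\<close>

lemma streamline_through:
 fixes u :: "plane => plane"
 assumes H: "0 < H" and L: "0 < L"
  and lip: "!!p p'. p \<in> dmn b H ==> p' \<in> dmn b H ==> norm (u p - u p') <= L * norm (p - p')"
  and wall: "!!x. b = Neumann ==> snd (u (x,0)) = 0 \<and> snd (u (x,H)) = 0"
  and p: "p \<in> dmn b H"
 shows "\<exists>ga. streamline (dmn b H) u ga \<and> ga 0 = p"
proof -
 define v where "v p = u (fst p, yclamp b H (snd p))" for p
 have vl: "norm (v p - v p') <= L * norm (p - p')" for p p'
 proof -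
  have "norm (v p - v p') <= L * norm ((fst p, yclamp b H (snd p)) - (fst p', yclamp b H (snd p')))"
   unfolding v_def using H by (intro lip) (auto simp: yclamp)
  also have "norm ((fst p, yclamp b H (snd p)) - (fst p', yclamp b H (snd p'))) <= norm (p - p')"
   unfolding norm_prod_def using yclamp(3)[of b H "snd p" "snd p'"] by (auto intro!: real_sqrt_le_mono add_left_mono simp: abs_le_square_iff)
  finally show ?thesis using L by simp
 qed
 obtain ga where ga: "ga 0 = p" "!!s. (ga has_vector_derivative v (ga s)) (at s)"
  using global_solution_exists[OF L vl] by metis
 have dy: "((%s. snd (ga s)) has_real_derivative snd (v (ga s))) (at s)" for s
  using bounded_linear.has_vector_derivative[OF bounded_linear_snd ga(2)] by (simp add: has_real_derivative_iff_has_vector_derivative)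
 have "snd (ga s) \<in> yrange b H" for s
 proof (cases b)
  case Neumann
  have "0 <= snd (ga s)"
   by (rule invariant_lower_bound[OF dy]) (use Neumann wall p ga(1) H in \<open>auto simp: v_def yclamp_def yrange_def\<close>)
  moreover have "0 <= H - snd (ga s)"
  proof -
   have "((%s. H - snd (ga s)) has_real_derivative 0 - snd (v (ga s))) (at s)" for s by (intro derivative_intros dy)
   then show ?thesis
    by (rule invariant_lower_bound) (use Neumann wall p ga(1) H in \<open>auto simp: v_def yclamp_def yrange_def\<close>)
  qed
  ultimately show ?thesis using Neumann by (simp add: yrange_def)
 qed (simp add: yrange_def)
 then have "streamline (dmn b H) u ga"
  unfolding streamline_def using ga(2) by (auto simp: v_def yclamp mem_Times_iff)
 then show ?thesis using ga(1) by blast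
qed

section \<open>Change of variables in the plane\<close>

definition vec_pair :: "real^2 => plane" where "vec_pair v = (v $ 1, v $ 2)"
definition pair_vec :: "plane => real^2" where "pair_vec p = (\<chi> i. if i = 1 then fst p else snd p)"

lemma vec_pair_inverse [simp]: "pair_vec (vec_pair v) = v" "vec_pair (pair_vec p) = p"
 by (auto simp: vec_pair_def pair_vec_def vec_eq_iff forall_2)

lemma linear_vec_pair: "bounded_linear vec_pair" "bounded_linear pair_vec"
proof -
 show "bounded_linear vec_pair"
  unfolding vec_pair_def[abs_def] by (intro bounded_linear_Pair bounded_linear_vec_nth)
 have "linear pair_vec"
  by (rule linearI) (auto simp: pair_vec_def vec_eq_iff)
 then show "bounded_linear pair_vec" by (simp add: linear_conv_bounded_linear)
qed

lemma continuous_vec_pair: "continuous_on A vec_pair" "continuous_on B pair_vec"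
 using linear_vec_pair by (auto intro: linear_continuous_on)

lemma measurable_vec_pair [measurable]: "vec_pair \<in> borel_measurable borel" "pair_vec \<in> borel_measurable borel"
 by (auto intro: borel_measurable_continuous_onI continuous_vec_pair)

lemma lborel_vec_pair: "distr lborel borel vec_pair = lborel"
proof (rule lborel_eqI[symmetric])
 fix l u :: "plane"
 assume le: "!!b. b \<in> Basis ==> l \<bullet> b <= u \<bullet> b"
 have "vec_pair -` box l u = box (pair_vec l) (pair_vec u)"
  by (auto simp: vec_pair_def pair_vec_def box_def Basis_prod_def Basis_vec_def inner_axis forall_2 inner_Pair_0)
 moreover have "fst l <= fst u" "snd l <= snd u"
  using le[of "(1,0)"] le[of "(0,1)"] by (simp_all add: Basis_prod_def inner_prod_def)
 then have "(pair_vec l) \<bullet> b <= (pair_vec u) \<bullet> b" if "b \<in> Basis" for b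
  using that
  by (auto simp: pair_vec_def Basis_prod_def Basis_vec_def inner_axis forall_2 split: if_splits)
 ultimately have "emeasure (distr lborel borel vec_pair) (box l u) = (\<Prod>b\<in>Basis. (pair_vec u - pair_vec l) \<bullet> b)"
  by (simp add: emeasure_distr emeasure_lborel_box)
 also have "(\<Prod>b\<in>Basis. (pair_vec u - pair_vec l) \<bullet> b) = (\<Prod>i\<in>UNIV. (pair_vec u - pair_vec l) $ i)"
 proof -
  have B: "(Basis :: (real^2) set) = (%i. axis i 1) ` UNIV" by (auto simp: Basis_vec_def)
  have I: "inj (%i::2. axis i (1::real))" by (auto simp: inj_def axis_eq_axis)
  show ?thesis unfolding B by (subst prod.reindex[OF I]) (simp add: inner_axis)
 qed
 also have "... = (fst u - fst l) * (snd u - snd l)" by (simp add: UNIV_2 pair_vec_def)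
 also have "... = (\<Prod>b\<in>Basis. (u - l) \<bullet> b)"
 proof -
  have B: "(Basis :: plane set) = {(1,0), (0,1)}" by (auto simp: Basis_prod_def)
  show ?thesis unfolding B by (simp add: inner_prod_def)
 qed
 finally show "emeasure (distr lborel borel vec_pair) (box l u) = ennreal (\<Prod>b\<in>Basis. (u - l) \<bullet> b)" by simp
qed simp

lemma plane_integral_vec:
 fixes f :: "plane => real"
 assumes [measurable]: "f \<in> borel_measurable borel"
 shows "integrable lborel f \<longleftrightarrow> integrable lborel (%v. f (vec_pair v))"
  "integral\<^sup>L lborel f = integral\<^sup>L lborel (%v. f (vec_pair v))"
proof -
 have "integrable (distr lborel borel vec_pair) f \<longleftrightarrow> integrable lborel (%v. f (vec_pair v))"
  by (rule integrable_distr_eq) auto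
 then show "integrable lborel f \<longleftrightarrow> integrable lborel (%v. f (vec_pair v))" by (simp add: lborel_vec_pair)
 have "integral\<^sup>L (distr lborel borel vec_pair) f = integral\<^sup>L lborel (%v. f (vec_pair v))"
  by (rule integral_distr) auto
 then show "integral\<^sup>L lborel f = integral\<^sup>L lborel (%v. f (vec_pair v))" by (simp add: lborel_vec_pair)
qed

lemma set_integral_plane_vec:
 fixes f :: "plane => real"
 assumes m: "(%p. indicator A p *\<^sub>R f p) \<in> borel_measurable borel"
 shows "set_integrable lborel A f \<longleftrightarrow> (%v. f (vec_pair v)) absolutely_integrable_on (pair_vec ` A)"
  "set_integrable lborel A f ==> set_lebesgue_integral lborel A f = integral (pair_vec ` A) (%v. f (vec_pair v))"
proof -
 have ind: "indicator A (vec_pair v) = (indicator (pair_vec ` A) v :: real)" for v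
  using vec_pair_inverse by (auto simp: indicator_def) (metis vec_pair_inverse(1) image_eqI)
 have m2: "(%v. indicator (pair_vec ` A) v *\<^sub>R f (vec_pair v)) \<in> borel_measurable lborel"
  using measurable_compose[OF measurable_vec_pair(1) m] by (simp add: ind)
 show 1: "set_integrable lborel A f \<longleftrightarrow> (%v. f (vec_pair v)) absolutely_integrable_on (pair_vec ` A)"
  unfolding set_integrable_def using plane_integral_vec(1)[OF m] integrable_completion[OF m2] by (simp add: ind)
 assume "set_integrable lborel A f"
 with 1 have i: "set_integrable lebesgue (pair_vec ` A) (%v. f (vec_pair v))" by simp
 have "set_lebesgue_integral lborel A f = (\<integral>v. indicator (pair_vec ` A) v *\<^sub>R f (vec_pair v) \<partial>lborel)"
  unfolding set_lebesgue_integral_def using plane_integral_vec(2)[OF m] by (simp add: ind)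
 also have "... = set_lebesgue_integral lebesgue (pair_vec ` A) (%v. f (vec_pair v))"
  unfolding set_lebesgue_integral_def using integral_completion[OF m2] by simp
 also have "... = integral (pair_vec ` A) (%v. f (vec_pair v))"
  by (rule set_lebesgue_integral_eq_integral(2)[OF i])
 finally show "set_lebesgue_integral lborel A f = integral (pair_vec ` A) (%v. f (vec_pair v))" .
qed

definition pair_det :: "(plane => plane) => real" where
 "pair_det l = fst (l (1,0)) * snd (l (0,1)) - fst (l (0,1)) * snd (l (1,0))"

text \<open>The library states the change of variables formula for maps of \<open>real^'n\<close> only.\<close>

lemma plane_change_of_variables:
 fixes F :: "plane => real"
 assumes W: "open W" and P: "!!q. q \<in> W ==> (P has_derivative P' q) (at q)" and inj: "inj_on P W"
  and F: "set_integrable lborel (P ` W) F" and mF: "(%p. indicator (P ` W) p *\<^sub>R F p) \<in> borel_measurable borel"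
  and mJ: "(%q. indicator W q *\<^sub>R (\<bar>pair_det (P' q)\<bar> * F (P q))) \<in> borel_measurable borel"
 shows "set_integrable lborel W (%q. \<bar>pair_det (P' q)\<bar> * F (P q))"
  "set_lebesgue_integral lborel W (%q. \<bar>pair_det (P' q)\<bar> * F (P q)) = set_lebesgue_integral lborel (P ` W) F"
proof -
 define g where "g v = pair_vec (P (vec_pair v))" for v
 define g' where "g' v w = pair_vec (P' (vec_pair v) (vec_pair w))" for v w
 let ?S = "pair_vec ` W"
 have S: "?S = vec_pair -` W" by (auto simp: image_iff) (metis vec_pair_inverse(1))
 have "open ?S" unfolding S by (rule open_vimage[OF W continuous_vec_pair(1)])
 then have mS: "?S \<in> sets lebesgue" by simp
 have gS: "g ` ?S = pair_vec ` (P ` W)" by (auto simp: g_def image_image)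
 have dg: "(g has_derivative g' v) (at v within ?S)" if "v \<in> ?S" for v
 proof -
  have "(vec_pair has_derivative vec_pair) (at v)" using linear_vec_pair(1) by (rule bounded_linear_imp_has_derivative)
  moreover have "(P has_derivative P' (vec_pair v)) (at (vec_pair v))" using that P by auto
  ultimately have "((%v. P (vec_pair v)) has_derivative (%w. P' (vec_pair v) (vec_pair w))) (at v)"
   by (rule has_derivative_compose)
  from bounded_linear.has_derivative[OF linear_vec_pair(2) this]
  show ?thesis unfolding g_def[abs_def] g'_def[abs_def] by (rule has_derivative_at_withinI)
 qed
 have ig: "inj_on g ?S"
 proof (rule inj_onI)
  fix v w assume vw: "v \<in> ?S" "w \<in> ?S" "g v = g w"
  then have "P (vec_pair v) = P (vec_pair w)" unfolding g_def by (metis vec_pair_inverse(2))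
  then have "vec_pair v = vec_pair w" using vw inj by (auto dest: inj_onD)
  then show "v = w" by (metis vec_pair_inverse(1))
 qed
 have det: "det (matrix (g' v)) = pair_det (P' (vec_pair v))" for v
  unfolding det_2 matrix_def pair_det_def g'_def by (simp add: vec_pair_def pair_vec_def axis_def)
 define F1 :: "real^2 => real^1" where "F1 v = vec (F (vec_pair v))" for v
 have "linear (vec :: real => real^1)" by (rule linearI) (auto simp: vec_eq_iff)
 then have bl: "bounded_linear (vec :: real => real^1)" by (simp add: linear_conv_bounded_linear)
 have vec1: "(%v. vec (h v) :: real^1) absolutely_integrable_on A \<longleftrightarrow> h absolutely_integrable_on A" for h :: "real^2 => real" and A
 proof
  assume "h absolutely_integrable_on A"
  then have "((vec :: real => real^1) \<circ> h) absolutely_integrable_on A" using bl by (rule absolutely_integrable_linear)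
  then show "(%v. vec (h v) :: real^1) absolutely_integrable_on A" by (simp add: o_def)
 next
  assume "(%v. vec (h v) :: real^1) absolutely_integrable_on A"
  then have "((%x::real^1. x $ 1) \<circ> (%v. vec (h v) :: real^1)) absolutely_integrable_on A"
   by (rule absolutely_integrable_linear) (rule bounded_linear_vec_nth)
  then show "h absolutely_integrable_on A" by (simp add: o_def)
 qed
 have vint: "integral A (%v. vec (h v) :: real^1) $ 1 = integral A h" if "h absolutely_integrable_on A" for h :: "real^2 => real" and A
 proof -
  have "(%v. vec (h v) :: real^1) integrable_on A" using that vec1 absolutely_integrable_on_def by blast
  from integral_linear[OF this bounded_linear_vec_nth[of 1]] show ?thesis by (simp add: o_def)
 qed
 have F1: "(%v. F (vec_pair v)) absolutely_integrable_on (g ` ?S)"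
  unfolding gS using set_integral_plane_vec(1)[OF mF] F by simp
 have "F1 absolutely_integrable_on (g ` ?S)" unfolding F1_def vec1 by (rule F1)
 then have cov: "(%v. \<bar>det (matrix (g' v))\<bar> *\<^sub>R F1 (g v)) absolutely_integrable_on ?S"
  "integral ?S (%v. \<bar>det (matrix (g' v))\<bar> *\<^sub>R F1 (g v)) = integral (g ` ?S) F1"
  using has_absolute_integral_change_of_variables[OF mS dg ig, of F1 "integral (g ` ?S) F1"] by blast+
 have e: "\<bar>det (matrix (g' v))\<bar> *\<^sub>R F1 (g v) = vec (\<bar>pair_det (P' (vec_pair v))\<bar> * F (P (vec_pair v)))" for v
  by (simp add: det F1_def g_def vec_eq_iff)
 have c1: "(%v. \<bar>pair_det (P' (vec_pair v))\<bar> * F (P (vec_pair v))) absolutely_integrable_on ?S"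
  using cov(1) unfolding e vec1 .
 show i: "set_integrable lborel W (%q. \<bar>pair_det (P' q)\<bar> * F (P q))"
  using set_integral_plane_vec(1)[OF mJ] c1 by simp
 have "set_lebesgue_integral lborel W (%q. \<bar>pair_det (P' q)\<bar> * F (P q)) = integral ?S (%v. \<bar>pair_det (P' (vec_pair v))\<bar> * F (P (vec_pair v)))"
  by (rule set_integral_plane_vec(2)[OF mJ i])
 also have "... = integral (g ` ?S) F1 $ 1" using cov(2) unfolding e by (simp add: vint[OF c1, symmetric])
 also have "... = integral (g ` ?S) (%v. F (vec_pair v))" unfolding F1_def by (rule vint[OF F1])
 also have "... = set_lebesgue_integral lborel (P ` W) F" unfolding gS by (rule set_integral_plane_vec(2)[OF mF F, symmetric])
 finally show "set_lebesgue_integral lborel W (%q. \<bar>pair_det (P' q)\<bar> * F (P q)) = set_lebesgue_integral lborel (P ` W) F" .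
qed

section \<open>Geometry of a tube\<close>

text \<open>Streamlines through every point enter as an assumption because the outer locale bounds
  \<open>u\<close> but records no Lipschitz constant. The condition \<open>translates\<close> says
  that the interior of the tube embeds into the cylinder.\<close>

locale flow_with_tube = reactive_flow +
 fixes K :: real and D :: tube and sg :: bool
 assumes K: "0 < K"
  and stream: "!!p. p \<in> dmn b H ==> \<exists>ga. streamline (dmn b H) u ga \<and> ga 0 = p"
  and tube: "flow_tube (dmn b H) K u sg D"
  and translates: "!!k::int. k ~= 0 ==> disjnt (core D) ((+) (0, of_int k * H) ` core D)"
begin

abbreviation "P \<equiv> param D"
abbreviation "Ch \<equiv> chart D"
definition "Iv = {ctr D - hw D <..< ctr D + hw D}"
text \<open>The open part of the coordinate strip. It and its image \<open>core D\<close> are open,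
  so there the derivatives within \<open>coords D\<close> and \<open>region D\<close> are ordinary
  ones.\<close>

definition "Wd = Iv \<times> (UNIV :: real set)"

lemma core_eq: "core D = P ` Wd" by (simp add: core_def Wd_def Iv_def)

lemma Wd_open: "open Wd" unfolding Wd_def Iv_def by (intro open_Times) auto

lemma Wd_coords: "Wd \<subseteq> coords D" by (auto simp: Wd_def Iv_def coords_def)

lemma hw_pos: "0 < hw D" using tube by (simp add: flow_tube_def)

lemma region_S: "region D \<subseteq> UNIV \<times> Yr" using tube by (simp add: flow_tube_def)

lemma homeo: "homeomorphism (region D) (coords D) Ch P" using tube by (simp add: flow_tube_def)

lemma chart_param: "qq \<in> coords D ==> Ch (P qq) = qq" "p \<in> region D ==> P (Ch p) = p"
 "qq \<in> coords D ==> P qq \<in> region D" "p \<in> region D ==> Ch p \<in> coords D"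
 using homeo by (auto simp: homeomorphism_def)

lemma cont_param: "continuous_on (coords D) P" and cont_chart: "continuous_on (region D) Ch"
 using homeo by (auto simp: homeomorphism_def)

lemma inj_param: "inj_on P Wd"
 by (rule inj_on_inverseI[of _ Ch]) (use chart_param Wd_coords in auto)

lemma core_open: "open (core D)"
 unfolding core_eq by (rule invariance_of_domain[OF continuous_on_subset[OF cont_param Wd_coords] Wd_open inj_param])

lemma core_region: "core D \<subseteq> region D" unfolding core_eq using chart_param Wd_coords by auto

lemma core_strip: "p \<in> core D ==> snd p \<in> Yr" using core_region region_S by auto

lemma chart_core: "p \<in> core D ==> Ch p \<in> Wd" "p \<in> core D ==> P (Ch p) = p" "qq \<in> Wd ==> P qq \<in> core D" "qq \<in> Wd ==> Ch (P qq) = qq"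
proof -
 show 1: "P qq \<in> core D" if "qq \<in> Wd" for qq using that by (simp add: core_eq)
 show 2: "Ch (P qq) = qq" if "qq \<in> Wd" for qq using chart_param(1)[OF subsetD[OF Wd_coords that]] .
 assume "p \<in> core D"
 then obtain qq where qq: "qq \<in> Wd" "p = P qq" by (auto simp: core_eq)
 show "Ch p \<in> Wd" "P (Ch p) = p" unfolding qq(2) 2[OF qq(1)] by (simp_all add: qq(1))
qed

definition "dP qq = frechet_derivative P (at qq)"
definition "dC p = frechet_derivative Ch (at p)"

lemma at_core: "p \<in> core D ==> at p within region D = at p"
 using core_open core_region by (metis at_within_open_subset)

lemma at_Wd: "qq \<in> Wd ==> at qq within coords D = at qq"
 using Wd_open Wd_coords by (metis at_within_open_subset)

lemma C2_derivative:
 fixes g :: "plane => plane"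
 assumes "C2_on A g" "open B" "B \<subseteq> A"
 shows "!!qq. qq \<in> B ==> (g has_derivative frechet_derivative g (at qq)) (at qq)"
  "continuous_on B (%qq. frechet_derivative g (at qq) v)"
proof -
 obtain g' where g': "C1_on A g'" "!!p. p \<in> A ==> (g has_derivative blinfun_apply (g' p)) (at p within A)"
  using assms(1) unfolding C2_on_def by blast
 have d: "(g has_derivative blinfun_apply (g' qq)) (at qq)" if "qq \<in> B" for qq
  using g'(2)[of qq] that assms(2,3) by (metis at_within_open_subset subsetD)
 then show "(g has_derivative frechet_derivative g (at qq)) (at qq)" if "qq \<in> B" for qq
  using that by (metis frechet_derivative_at)
 have "continuous_on A g'" using g'(1) unfolding C1_on_def
  by (auto simp: continuous_on_eq_continuous_within intro: has_derivative_continuous)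
 then have c: "continuous_on B g'" using assms(3) by (rule continuous_on_subset)
 have "continuous_on B (%qq. blinfun_apply (g' qq) v)" by (intro continuous_intros c)
 moreover have "blinfun_apply (g' qq) v = frechet_derivative g (at qq) v" if "qq \<in> B" for qq
  using frechet_derivative_at[OF d[OF that]] by simp
 ultimately show "continuous_on B (%qq. frechet_derivative g (at qq) v)"
  by (rule continuous_on_eq)
qed

lemma dP: "qq \<in> Wd ==> (P has_derivative dP qq) (at qq)" "continuous_on Wd (%qq. dP qq v)"
 using C2_derivative[OF _ Wd_open Wd_coords, of P] tube unfolding dP_def flow_tube_def by auto

lemma dC: "p \<in> core D ==> (Ch has_derivative dC p) (at p)" "continuous_on (core D) (%p. dC p v)"
 using C2_derivative[OF _ core_open core_region, of Ch] tube unfolding dC_def flow_tube_def by auto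

lemma dP_linear: "qq \<in> Wd ==> bounded_linear (dP qq)" and dC_linear: "p \<in> core D ==> bounded_linear (dC p)"
 by (rule has_derivative_bounded_linear[OF dP(1)], assumption, rule has_derivative_bounded_linear[OF dC(1)], assumption)

lemma dP_dC: "p \<in> core D ==> dP (Ch p) (dC p v) = v"
proof -
 assume p: "p \<in> core D"
 have "((%p. P (Ch p)) has_derivative (%v. dP (Ch p) (dC p v))) (at p)"
  by (rule has_derivative_compose[OF dC(1)[OF p] dP(1)[OF chart_core(1)[OF p]]])
 moreover have "((%p. P (Ch p)) has_derivative (%v. v)) (at p)"
  by (rule has_derivative_transform_within_open[OF has_derivative_ident core_open p]) (simp add: chart_core)
 ultimately have "(%v. dP (Ch p) (dC p v)) = (%v. v)" by (rule has_derivative_unique)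
 then show ?thesis by metis
qed

lemma metric:
 assumes "qq \<in> Wd"
 shows "(norm (dP qq v))^2 = (E1 D qq)^2 * (fst v)^2 + (E2 D qq)^2 * (snd v)^2"
proof -
 have "(norm (ddir (coords D) v P qq))^2 = (E1 D qq)^2 * (fst v)^2 + (E2 D qq)^2 * (snd v)^2"
  using tube assms Wd_coords unfolding flow_tube_def by blast
 then show ?thesis unfolding ddir_def at_Wd[OF assms] dP_def .
qed

lemma E_lower:
 assumes "qq \<in> coords D"
 shows "inverse K <= E1 D qq" "inverse K <= E2 D qq" "0 < E1 D qq" "0 < E2 D qq" "1 <= K * E1 D qq" "1 <= K * E2 D qq"
proof -
 show 1: "inverse K <= E1 D qq" "inverse K <= E2 D qq" using tube assms unfolding flow_tube_def by blast+
 moreover have "0 < inverse K" using K by simp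
 ultimately show "0 < E1 D qq" "0 < E2 D qq" by linarith+
 show "1 <= K * E1 D qq" "1 <= K * E2 D qq" using 1 K by (auto simp: field_simps)
qed

lemma norm_dP:
 assumes "qq \<in> Wd"
 shows "norm (dP qq (1,0)) = E1 D qq" "norm (dP qq (0,1)) = E2 D qq" "norm (dP qq (0,s)) = E2 D qq * \<bar>s\<bar>"
proof -
 note E = E_lower(3,4)[OF subsetD[OF Wd_coords assms]]
 have "norm (dP qq (0,s)) = E2 D qq * \<bar>s\<bar>" for s
 proof (rule power2_eq_imp_eq)
  show "(norm (dP qq (0,s)))^2 = (E2 D qq * \<bar>s\<bar>)^2" using metric[OF assms, of "(0,s)"] by (simp add: power_mult_distrib)
 qed (use E in auto)
 from this[of s] this[of 1] show "norm (dP qq (0,s)) = E2 D qq * \<bar>s\<bar>" "norm (dP qq (0,1)) = E2 D qq" by simp_all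
 show "norm (dP qq (1,0)) = E1 D qq"
  by (rule power2_eq_imp_eq) (use metric[OF assms, of "(1,0)"] E in auto)
qed

lemma cont_E: "continuous_on Wd (E1 D)" "continuous_on Wd (E2 D)"
proof -
 have "continuous_on Wd (%qq. norm (dP qq (1,0)))" "continuous_on Wd (%qq. norm (dP qq (0,1)))"
  by (intro continuous_intros dP)+
 then show "continuous_on Wd (E1 D)" "continuous_on Wd (E2 D)"
  by (auto elim!: continuous_on_eq simp: norm_dP)
qed

text \<open>The metric at \<open>(1,1)\<close>, compared with its values at the two unit vectors,
  gives orthogonality of the columns of the derivative. Lagrange's identity then turns the product
  of their lengths into the determinant.\<close>

lemma pair_det_dP:
 assumes qq: "qq \<in> Wd"
 shows "\<bar>pair_det (dP qq)\<bar> = E1 D qq * E2 D qq"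
proof -
 obtain a c where ac: "dP qq (1,0) = (a,c)" by fastforce
 obtain a' c' where ac': "dP qq (0,1) = (a',c')" by fastforce
 have "dP qq (1,1) = dP qq (1,0) + dP qq (0,1)"
  using linear_add[OF bounded_linear.linear[OF dP_linear[OF qq]], of "(1,0)" "(0,1)"] by simp
 then have s: "dP qq (1,1) = (a + a', c + c')" using ac ac' by simp
 have n: "(norm (x,y))^2 = x^2 + y^2" for x y :: real by (simp add: norm_prod_def)
 have 1: "a^2 + c^2 = (E1 D qq)^2" "a'^2 + c'^2 = (E2 D qq)^2" "(a + a')^2 + (c + c')^2 = (E1 D qq)^2 + (E2 D qq)^2"
  using metric[OF qq, of "(1,0)"] metric[OF qq, of "(0,1)"] metric[OF qq, of "(1,1)"] ac ac' s by (simp_all add: n)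
 then have o: "a * a' + c * c' = 0" by (simp add: power2_eq_square algebra_simps)
 have "(pair_det (dP qq))^2 = (a^2 + c^2) * (a'^2 + c'^2) - (a * a' + c * c')\<^sup>2"
  unfolding pair_det_def ac ac' by (simp add: power2_eq_square algebra_simps)
 also have "... = (E1 D qq * E2 D qq)^2" unfolding 1(1,2) o by (simp add: power_mult_distrib)
 finally have "\<bar>pair_det (dP qq)\<bar>\<^sup>2 = (E1 D qq * E2 D qq)^2" by simp
 then show ?thesis by (rule power2_eq_imp_eq) (use E_lower(3,4)[OF subsetD[OF Wd_coords qq]] in simp_all)
qed

text \<open>A lower bound on a metric coefficient is an upper bound on the gradient of the
  corresponding coordinate; both gradients are at most \<open>K\<close>.\<close>

lemma dC_bound:
 assumes p: "p \<in> core D"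
 shows "\<bar>fst (dC p w)\<bar> <= K * norm w" "\<bar>snd (dC p w)\<bar> <= K * norm w"
proof -
 define qq where "qq = Ch p"
 have qq: "qq \<in> Wd" using chart_core(1)[OF p] by (simp add: qq_def)
 define v where "v = dC p w"
 have m: "(norm w)^2 = (E1 D qq)^2 * (fst v)^2 + (E2 D qq)^2 * (snd v)^2"
  using metric[OF qq, of v] dP_dC[OF p, of w] by (simp add: qq_def v_def)
 note E = E_lower[OF subsetD[OF Wd_coords qq]]
 have "\<bar>z\<bar> <= K * norm w" if "e^2 * z^2 <= (norm w)^2" "1 <= K * e" "0 < e" for e z :: real
 proof -
  have "(e * \<bar>z\<bar>)^2 <= (norm w)^2" using that(1) by (simp add: power_mult_distrib)
  then have "e * \<bar>z\<bar> <= norm w" by (rule power2_le_imp_le) simp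
  then have "K * (e * \<bar>z\<bar>) <= K * norm w" using K by (intro mult_left_mono) auto
  moreover have "1 * \<bar>z\<bar> <= (K * e) * \<bar>z\<bar>" using that(2) by (intro mult_right_mono) auto
  ultimately show ?thesis by (simp add: mult.assoc)
 qed
 from this[of "E1 D qq" "fst v"] this[of "E2 D qq" "snd v"]
 show "\<bar>fst (dC p w)\<bar> <= K * norm w" "\<bar>snd (dC p w)\<bar> <= K * norm w"
  using m E by (auto simp: v_def)
qed

lemma streamline_in_core:
 assumes ga: "streamline (UNIV \<times> Yr) u ga" and s: "ga s \<in> core D"
 obtains ep where "0 < ep" "!!r. \<bar>r - s\<bar> <= ep ==> ga r \<in> core D \<and> fst (Ch (ga r)) = fst (Ch (ga s))"
proof -
 have c: "continuous_on UNIV ga"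
  using ga unfolding streamline_def by (intro continuous_at_imp_continuous_on ballI has_vector_derivative_continuous) auto
 have "open (ga -` core D)" by (rule open_vimage[OF core_open c])
 moreover have "s \<in> ga -` core D" using s by simp
 ultimately obtain e where e: "0 < e" "ball s e \<subseteq> ga -` core D" by (rule openE)
 define ep where "ep = e / 2"
 have ep: "0 < ep" using e by (simp add: ep_def)
 have in_core: "ga r \<in> core D" if "\<bar>r - s\<bar> <= ep" for r
 proof -
  have "\<bar>s - r\<bar> < e" using that e(1) unfolding ep_def by linarith
  then show ?thesis using e(2) by (auto simp: dist_real_def subset_iff)
 qed
 have "ga ` {s-ep..s+ep} \<subseteq> region D" using in_core core_region by (fastforce simp: abs_le_iff)
 then have "(%r. fst (Ch (ga r))) constant_on {s-ep..s+ep}" using tube ga unfolding flow_tube_def by blast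
 then have "fst (Ch (ga r)) = fst (Ch (ga s))" if "\<bar>r - s\<bar> <= ep" for r
  using that ep unfolding constant_on_def by (auto simp: abs_le_iff)
 then show ?thesis using that[OF ep] in_core by blast
qed

text \<open>The streamline through \<open>p\<close> keeps \<open>rho\<close> constant for a short
  time, and its velocity at \<open>p\<close> is \<open>u p\<close>.\<close>

lemma u_grad_rho:
 assumes p: "p \<in> core D"
 shows "fst (dC p (u p)) = 0"
proof -
 have "p \<in> UNIV \<times> Yr" using core_region region_S p by auto
 from stream[OF this] obtain ga where ga: "streamline (UNIV \<times> Yr) u ga" "ga 0 = p" by blast
 have "ga 0 \<in> core D" using ga(2) p by simp
 from streamline_in_core[OF ga(1) this]
 obtain ep where ep: "0 < ep" "!!r. \<bar>r - 0\<bar> <= ep ==> ga r \<in> core D \<and> fst (Ch (ga r)) = fst (Ch (ga 0))" by blast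
 have "(ga has_derivative (%h. h *\<^sub>R u p)) (at 0)"
  using ga unfolding streamline_def has_vector_derivative_def by metis
 moreover have "(Ch has_derivative dC p) (at (ga 0))" using dC(1)[OF p] ga(2) by simp
 ultimately have "((%r. Ch (ga r)) has_derivative (%h. dC p (h *\<^sub>R u p))) (at 0)" by (rule has_derivative_compose)
 from has_derivative_fst[OF this]
 have 1: "((%r. fst (Ch (ga r))) has_derivative (%h. fst (dC p (h *\<^sub>R u p)))) (at 0)" .
 have "((%r. fst (Ch (ga r))) has_derivative (%h. 0)) (at 0)"
 proof (rule has_derivative_transform_within_open[OF has_derivative_const open_ball])
  show "(0::real) \<in> ball 0 ep" using ep(1) by simp
  fix r :: real assume "r \<in> ball 0 ep"
  then have "\<bar>r - 0\<bar> <= ep" by (simp add: dist_real_def)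
  from conjunct2[OF ep(2)[OF this]] show "fst (Ch (ga 0)) = fst (Ch (ga r))" by (rule sym)
 qed
 from has_derivative_unique[OF 1 this] have "fst (dC p (1 *\<^sub>R u p)) = 0" by metis
 then show ?thesis by simp
qed

text \<open>The derivative of \<open>xi\<close> along the flow, \<open>u . grad xi\<close>, as a
  function of the coordinates.\<close>

definition "gx qq = snd (dC (P qq) (u (P qq)))"

definition "sgn_tube = (if sg then 1 else - 1 :: real)"

text \<open>Since \<open>u\<close> has only a \<open>xi\<close> component, its norm is
  \<open>E2 * |gx|\<close>. Hence the area element times \<open>u . grad xi\<close> is the flux
  density \<open>E1 * |u|\<close> up to the sign of the tube, and this density varies at most by a
  factor 2 within the tube.\<close>

lemma gx_speed:
 assumes qq: "qq \<in> Wd"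
 shows "E1 D qq * E2 D qq * gx qq = sgn_tube * speed u D qq"
proof -
 define p where "p = P qq"
 have p: "p \<in> core D" using chart_core(3)[OF qq] by (simp add: p_def)
 have e: "dC p (u p) = (0, gx qq)" using u_grad_rho[OF p] by (simp add: gx_def p_def prod_eq_iff)
 have "u p = dP qq (0, gx qq)" using dP_dC[OF p, of "u p"] chart_core(4)[OF qq] e by (simp add: p_def)
 then have n: "norm (u p) = E2 D qq * \<bar>gx qq\<bar>" using norm_dP(3)[OF qq] by simp
 have "u p \<bullet> grad (region D) (%p'. snd (Ch p')) p = gx qq"
 proof -
  have "((%p'. snd (Ch p')) has_derivative (%w. snd (dC p w))) (at p)" by (rule has_derivative_snd[OF dC(1)[OF p]])
  then have f: "frechet_derivative (%p'. snd (Ch p')) (at p within region D) = (%w. snd (dC p w))"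
   unfolding at_core[OF p] by (rule frechet_derivative_at[symmetric])
  have "u p \<bullet> grad (region D) (%p'. snd (Ch p')) p = (\<Sum>i\<in>Basis. snd (dC p i) * (u p \<bullet> i))"
   unfolding grad_def ddir_def f by (simp add: inner_sum_right)
  also have "... = snd (dC p (\<Sum>i\<in>Basis. (u p \<bullet> i) *\<^sub>R i))"
  proof -
   have l: "linear (%w. snd (dC p w))" using bounded_linear_compose[OF bounded_linear_snd dC_linear[OF p]] bounded_linear.linear by blast
   show ?thesis unfolding linear_sum[OF l] linear_scale[OF l] by (simp add: mult.commute)
  qed
  finally show ?thesis by (simp add: euclidean_representation gx_def p_def)
 qed
 then have s: "if sg then gx qq > 0 else gx qq < 0"
  using tube p core_region unfolding flow_tube_def by (metis (no_types, lifting) subsetD)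
 then have "E2 D qq * gx qq = sgn_tube * norm (u p)" using n by (auto simp: sgn_tube_def split: if_splits)
 then show ?thesis by (simp add: speed_def p_def mult_ac)
qed

definition "Msp = (SUP qq\<in>coords D. speed u D qq)"

lemma speed_bounds: "qq \<in> coords D ==> Msp / 2 <= speed u D qq \<and> speed u D qq <= Msp"
 using tube unfolding flow_tube_def Msp_def by blast

lemma Msp_nonneg: "0 <= Msp"
proof -
 have "(ctr D, 0) \<in> coords D" using hw_pos by (auto simp: coords_def)
 from speed_bounds[OF this] show ?thesis by linarith
qed

lemma tube_flux_le: "tube_flux u D xi <= 2 * hw D * Msp"
proof (cases "(%rh. norm (u (P (rh, xi))) * E1 D (rh, xi)) integrable_on {ctr D - hw D..ctr D + hw D}")
 case True
 have "tube_flux u D xi <= integral {ctr D - hw D..ctr D + hw D} (%_. Msp)"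
  unfolding tube_flux_def
 proof (rule integral_le[OF True])
  fix rh assume "rh \<in> {ctr D - hw D..ctr D + hw D}"
  then have "(rh, xi) \<in> coords D" by (simp add: coords_def)
  from speed_bounds[OF this] show "norm (u (P (rh, xi))) * E1 D (rh, xi) <= Msp" by (simp add: speed_def mult.commute)
 qed auto
 then show ?thesis using hw_pos by simp
next
 \<comment> \<open>A Henstock-Kurzweil integral that does not exist has the value 0.\<close>
 case False
 then show ?thesis using Msp_nonneg hw_pos by (simp add: tube_flux_def not_integrable_integral)
qed

end

section \<open>Disjoint tubes counted on one period of the strip\<close>

lemma nn_integral_translate:
 fixes c :: "plane"
 assumes [measurable]: "g \<in> borel_measurable borel"
 shows "(\<integral>\<^sup>+p. g p \<partial>lborel) = (\<integral>\<^sup>+p. g (c + p) \<partial>lborel)"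
proof -
 have "(\<integral>\<^sup>+p. g p \<partial>distr lborel borel ((+) c)) = (\<integral>\<^sup>+p. g (c + p) \<partial>lborel)"
  by (subst nn_integral_distr) auto
 then show ?thesis by (simp add: lborel_distr_plus)
qed

lemma suminf_indicator_le_1:
 fixes h :: "nat => ennreal"
 assumes "!!n. h n <= 1" "!!m n. h m ~= 0 ==> h n ~= 0 ==> m = n"
 shows "(\<Sum>n. h n) <= 1"
proof (cases "\<exists>n. h n ~= 0")
 case True
 then obtain n where n: "h n ~= 0" by blast
 have "(\<Sum>m. h m) = (\<Sum>m\<in>{n}. h m)"
  by (rule suminf_finite) (use assms(2)[OF n] in auto)
 then show ?thesis using assms(1) by simp
qed simp

text \<open>Each set on the cover is cut along the translates of one period, and the pieces are
  moved into that period without changing the integral, as \<open>g\<close> is periodic.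
  Disjointness of all translates means that a point is covered at most once by all pieces
  together.\<close>

lemma translate_family_nn_integral_le:
 fixes A :: "'j => plane set" and g :: "plane => ennreal"
 assumes H: "0 < H" and J: "finite J" and A [measurable]: "!!j. A j \<in> sets borel" and g [measurable]: "g \<in> borel_measurable borel"
  and per: "!!(k::int) p. g ((0, of_int k * H) + p) = g p"
  and disj: "!!i j (k::int). i \<in> J ==> j \<in> J ==> i ~= j \<or> k ~= 0 ==> disjnt (A i) ((+) (0, of_int k * H) ` A j)"
 shows "(\<Sum>j\<in>J. \<integral>\<^sup>+p. indicator (A j) p * g p \<partial>lborel) <= (\<integral>\<^sup>+p. indicator (UNIV \<times> {0..H}) p * g p \<partial>lborel)"
proof -
 define c where "c n = (0::real, of_int (int_decode n) * H)" for n
 \<comment> \<open>Half-open, so that its translates partition the plane.\<close>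
 define B where "B = (UNIV :: real set) \<times> {0..<H}"
 have B [measurable]: "B \<in> sets borel"
  unfolding B_def by (metis borel_prod pair_measureI atLeastLessThan_borel sets.top space_borel)
 have part: "(\<Sum>n. indicator B (p - c n)) = (1::ennreal)" for p
 proof -
  define k where "k = \<lfloor>snd p / H\<rfloor>"
  have iff: "p - (0, of_int m * H) \<in> B \<longleftrightarrow> m = k" for m :: int
  proof -
   have "p - (0, of_int m * H) \<in> B \<longleftrightarrow> of_int m * H <= snd p \<and> snd p < (of_int m + 1) * H"
    by (cases p) (auto simp: B_def algebra_simps)
   also have "... \<longleftrightarrow> of_int m <= snd p / H \<and> snd p / H < of_int m + 1" using H by (simp add: field_simps)
   also have "... \<longleftrightarrow> m = k" unfolding k_def by (metis floor_eq_iff)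
   finally show ?thesis .
  qed
  have "(\<Sum>n. indicator B (p - c n)) = (\<Sum>n\<in>{int_encode k}. indicator B (p - c n) :: ennreal)"
  proof (rule suminf_finite)
   fix n assume "n \<notin> {int_encode k}"
   then have "int_decode n ~= k" by (metis int_decode_inverse singletonI)
   then show "indicator B (p - c n) = (0::ennreal)" using iff[of "int_decode n"] by (simp add: c_def)
  qed simp
  then show ?thesis using iff[of k] by (simp add: c_def)
 qed
 have gc: "g (c n + p) = g p" for n p unfolding c_def by (rule per)
 have meas [measurable]: "(%p. indicator B (p - c n) :: ennreal) \<in> borel_measurable borel" for n
  by measurable
 have measA [measurable]: "(%p. indicator (A j) (c n + p) :: ennreal) \<in> borel_measurable borel" for n j
  by measurable
 have tr: "(\<integral>\<^sup>+p. indicator B (p - c n) * (indicator (A j) p * g p) \<partial>lborel) = (\<integral>\<^sup>+p. indicator B p * (indicator (A j) (c n + p) * g p) \<partial>lborel)" for n j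
  by (subst nn_integral_translate[of _ "c n"]) (auto simp: gc)
 have one: "(\<integral>\<^sup>+p. indicator (A j) p * g p \<partial>lborel) = (\<Sum>n. \<integral>\<^sup>+p. indicator B p * (indicator (A j) (c n + p) * g p) \<partial>lborel)" for j
 proof -
  have "(\<integral>\<^sup>+p. indicator (A j) p * g p \<partial>lborel) = (\<integral>\<^sup>+p. (\<Sum>n. indicator B (p - c n) * (indicator (A j) p * g p)) \<partial>lborel)"
   by (simp add: part)
  also have "... = (\<Sum>n. \<integral>\<^sup>+p. indicator B (p - c n) * (indicator (A j) p * g p) \<partial>lborel)"
   by (rule nn_integral_suminf) auto
  also have "... = (\<Sum>n. \<integral>\<^sup>+p. indicator B p * (indicator (A j) (c n + p) * g p) \<partial>lborel)"
   unfolding tr ..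
  finally show ?thesis .
 qed
 have "(\<Sum>j\<in>J. \<integral>\<^sup>+p. indicator (A j) p * g p \<partial>lborel) = (\<Sum>n. \<Sum>j\<in>J. \<integral>\<^sup>+p. indicator B p * (indicator (A j) (c n + p) * g p) \<partial>lborel)"
  unfolding one by (rule suminf_sum[symmetric]) simp
 also have "... = (\<Sum>n. \<integral>\<^sup>+p. indicator B p * ((\<Sum>j\<in>J. indicator (A j) (c n + p)) * g p) \<partial>lborel)"
  by (subst nn_integral_sum[symmetric]) (auto simp: sum_distrib_left sum_distrib_right)
 also have "... = (\<integral>\<^sup>+p. (\<Sum>n. indicator B p * ((\<Sum>j\<in>J. indicator (A j) (c n + p)) * g p)) \<partial>lborel)"
  by (rule nn_integral_suminf[symmetric]) auto
 also have "... <= (\<integral>\<^sup>+p. indicator (UNIV \<times> {0..H}) p * g p \<partial>lborel)"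
 proof (rule nn_integral_mono)
  fix p
  define h where "h n = (\<Sum>j\<in>J. indicator (A j) (c n + p) :: ennreal)" for n
  have hit: "i = j \<and> m = n" if "i \<in> J" "j \<in> J" "c m + p \<in> A i" "c n + p \<in> A j" for i j m n
  proof (rule ccontr)
   assume ne: "\<not> (i = j \<and> m = n)"
   define k where "k = int_decode m - int_decode n"
   have "i ~= j \<or> k ~= 0"
   proof (cases "i = j")
    case True
    then have "m ~= n" using ne by simp
    then have "int_decode m ~= int_decode n" using inj_int_decode by (auto dest: injD)
    then show ?thesis by (simp add: k_def)
   qed simp
   from disj[OF that(1,2) this] have "disjnt (A i) ((+) (0, of_int k * H) ` A j)" .
   moreover have "c m + p = (0, of_int k * H) + (c n + p)" by (cases p) (simp add: c_def k_def algebra_simps)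
   ultimately show False using that(3,4) by (auto simp: disjnt_def)
  qed
  have hle: "h n <= 1" for n
  proof (cases "\<exists>j\<in>J. c n + p \<in> A j")
   case True
   then obtain j where j: "j \<in> J" "c n + p \<in> A j" by blast
   have "h n = (\<Sum>i\<in>J. if i = j then 1 else 0)" unfolding h_def
   proof (rule sum.cong[OF refl])
    fix i assume i: "i \<in> J"
    show "indicator (A i) (c n + p) = (if i = j then 1 else 0 :: ennreal)"
    proof (cases "c n + p \<in> A i")
     case True
     then have "i = j" using hit[OF i j(1) True j(2)] by simp
     then show ?thesis using True by simp
    next
     case False
     then have "i ~= j" using j(2) by blast
     then show ?thesis using False by simp
    qed
   qed
   then show ?thesis using J by simp
  next
   case False then show ?thesis by (simp add: h_def)
  qed
  have "m = n" if hm: "h m ~= 0" and hn: "h n ~= 0" for m n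
  proof -
   have ex: "\<exists>i\<in>J. c m + p \<in> A i" if "h m ~= 0" for m
   proof (rule ccontr)
    assume "\<not> (\<exists>i\<in>J. c m + p \<in> A i)"
    then have "h m = 0" unfolding h_def by (intro sum.neutral) auto
    then show False using that by simp
   qed
   obtain i where "i \<in> J" "c m + p \<in> A i" using ex[OF hm] by blast
   moreover obtain j where "j \<in> J" "c n + p \<in> A j" using ex[OF hn] by blast
   ultimately show ?thesis using hit by blast
  qed
  then have "(\<Sum>n. h n) <= 1" using hle by (rule suminf_indicator_le_1[rotated])
  then have "indicator B p * ((\<Sum>n. h n) * g p) <= indicator (UNIV \<times> {0..H}) p * (1 * g p)"
   by (intro mult_mono) (auto simp: B_def indicator_def)
  then show "(\<Sum>n. indicator B p * ((\<Sum>j\<in>J. indicator (A j) (c n + p)) * g p)) <= indicator (UNIV \<times> {0..H}) p * g p"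
   unfolding h_def[symmetric] by (simp add: mult_ac)
 qed
 finally show ?thesis .
qed

lemma mono_bounded_tendsto:
 fixes f :: "real => real"
 assumes m: "!!x y. a <= x ==> x <= y ==> f x <= f y" and b: "!!x. a <= x ==> f x <= B"
 shows "\<exists>l. (f \<longlongrightarrow> l) at_top"
proof -
 define l where "l = (SUP x\<in>{a..}. f x)"
 have bd: "bdd_above (f ` {a..})" using b by (auto intro!: bdd_aboveI2)
 have "(f \<longlongrightarrow> l) at_top"
 proof (rule order_tendstoI)
  fix y assume "y < l"
  then obtain x where x: "a <= x" "y < f x" unfolding l_def using less_cSUP_iff[OF _ bd] by auto
  show "\<forall>\<^sub>F z in at_top. y < f z"
   using eventually_ge_at_top[of x] by (rule eventually_mono) (use x m in force)
 next
  fix y assume y: "l < y"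
  show "\<forall>\<^sub>F z in at_top. f z < y"
   using eventually_ge_at_top[of a]
  proof (rule eventually_mono)
   fix z assume "a <= z"
   then have "f z <= l" unfolding l_def by (intro cSUP_upper bd) auto
   then show "f z < y" using y by simp
  qed
 qed
 then show ?thesis by blast
qed

text \<open>The integrable bound on the derivative forces convergence. At a limit other than
  \<open>pi / 2\<close> or \<open>- (pi / 2)\<close> the squared cosine would stay positive, so
  \<open>k\<close> would be bounded below near infinity and its integral could not stay
  bounded.\<close>

lemma bounded_variation_end_limit:
 fixes a a' k :: "real => real"
 assumes da: "!!s. 0 <= s ==> (a has_real_derivative a' s) (at s)" and le: "!!s. 0 <= s ==> \<bar>a' s\<bar> <= k s"
  and ck: "continuous_on {0..} k" and kb: "!!s. 0 <= s ==> integral {0..s} k <= B"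
  and cos: "!!s. 0 <= s ==> (cos (a s))^2 <= C * k s" and C: "0 < C" and ab: "!!s. \<bar>a s\<bar> <= pi / 2"
 shows "(a \<longlongrightarrow> pi / 2) at_top \<or> (a \<longlongrightarrow> - (pi / 2)) at_top"
proof -
 define Ki where "Ki s = integral {0..s} k" for s
 have k0: "0 <= k s" if "0 <= s" for s using le[OF that] by linarith
 have ik: "k integrable_on {r..s}" if "0 <= r" for r s
  using that by (intro integrable_continuous_real continuous_on_subset[OF ck]) auto
 have comb: "Ki s = Ki r + integral {r..s} k" if "0 <= r" "r <= s" for r s
  unfolding Ki_def using Henstock_Kurzweil_Integration.integral_combine[OF that ik[of 0]] by simp
 have mono: "Ki r <= Ki s" if "0 <= r" "r <= s" for r s
 proof -
  have "0 <= integral {r..s} k" using that k0 ik by (intro integral_nonneg) auto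
  then show ?thesis using comb[OF that] by simp
 qed
 have var: "\<bar>a s - a r\<bar> <= Ki s - Ki r" if "0 <= r" "r <= s" for r s
 proof -
  have "(a' has_integral (a s - a r)) {r..s}"
   using that da by (intro fundamental_theorem_of_calculus)
    (auto simp: vector_derivative_iff intro: has_field_derivative_at_within)
  then have 1: "a' integrable_on {r..s}" "a s - a r = integral {r..s} a'" by (auto simp: integral_unique)
  have "norm (integral {r..s} a') <= integral {r..s} k"
   using that le by (intro integral_norm_bound_integral 1 ik) auto
  then show ?thesis using 1 comb[OF that] by simp
 qed
 obtain l1 where l1: "(Ki \<longlongrightarrow> l1) at_top" using mono_bounded_tendsto[of 0 Ki B] mono kb unfolding Ki_def by blast
 \<comment> \<open>Here \<open>a + Ki\<close> is increasing and bounded, so \<open>a\<close>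
   converges as the difference of two convergent monotone functions.\<close>
 have "\<exists>l. ((%s. a s + Ki s) \<longlongrightarrow> l) at_top"
 proof (rule mono_bounded_tendsto[of 0 _ "pi / 2 + B"])
  fix r s :: real assume "0 <= r" "r <= s"
  from var[OF this] show "a r + Ki r <= a s + Ki s" by linarith
 next
  fix s :: real assume s: "0 <= s"
  show "a s + Ki s <= pi / 2 + B" using kb[OF s] ab[of s] unfolding Ki_def by linarith
 qed
 then obtain l2 where l2: "((%s. a s + Ki s) \<longlongrightarrow> l2) at_top" by blast
 define l where "l = l2 - l1"
 have l: "(a \<longlongrightarrow> l) at_top" using tendsto_diff[OF l2 l1] by (simp add: l_def)
 have lb: "\<bar>l\<bar> <= pi / 2"
  by (rule tendsto_upperbound[OF tendsto_rabs[OF l] always_eventually]) (use ab in auto)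
 have "cos l = 0"
 proof (rule ccontr)
  assume "cos l ~= 0"
  then have pos: "0 < (cos l)^2" by simp
  define dl where "dl = (cos l)^2 / 2"
  have d: "0 < dl" "dl < (cos l)^2" using pos by (auto simp: dl_def)
  have "((%s. (cos (a s))^2) \<longlongrightarrow> (cos l)^2) at_top" by (intro tendsto_intros l)
  then have "\<forall>\<^sub>F s in at_top. dl < (cos (a s))^2" using d(2) by (rule order_tendstoD)
  then obtain s0 where s0: "!!s. s0 <= s ==> dl < (cos (a s))^2" unfolding eventually_at_top_linorder by blast
  define r where "r = max 0 s0"
  \<comment> \<open>Far enough for the lower bound \<open>dl / C\<close> on \<open>k\<close> to
    yield an integral of at least \<open>B + 1\<close>.\<close>
  define s where "s = r + C * (B + 1) / dl"
  have B0: "0 <= B" using kb[of 0] by simp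
  have rs: "0 <= r" "r <= s" using C d B0 by (auto simp: r_def s_def)
  have "integral {r..s} (%_. dl / C) <= integral {r..s} k"
  proof (intro integral_le ik rs)
   fix z assume z: "z \<in> {r..s}"
   then have "dl < C * k z" using s0[of z] cos[of z] by (auto simp: r_def)
   then show "dl / C <= k z" using C by (simp add: field_simps)
  qed auto
  then have "(s - r) * (dl / C) <= Ki s - Ki r" using comb[OF rs] rs by simp
  moreover have "(s - r) * (dl / C) = B + 1" using C d by (simp add: s_def)
  moreover have "Ki s <= B" unfolding Ki_def using kb[of s] rs by auto
  moreover have "0 <= Ki r" using mono[of 0 r] rs by (simp add: Ki_def)
  ultimately show False by linarith
 qed
 then have "\<not> (- (pi/2) < l \<and> l < pi/2)" using cos_gt_zero_pi[of l] by auto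
 then have "l = pi/2 \<or> l = - (pi/2)" using lb by auto
 then show ?thesis using l by metis
qed

context reactive_flow
begin

text \<open>Sums over tubes are controlled by a single integral over the strip, so their number does
  not enter the final constant. Between walls the sets already lie in the strip and the translation
  by \<open>k = 0\<close> suffices.\<close>

lemma cores_nn_integral_le:
 fixes A :: "'j => plane set" and g :: "plane => ennreal"
 assumes J: "finite J" and A: "!!j. open (A j)" "!!j. A j \<subseteq> UNIV \<times> Yr" and g: "g \<in> borel_measurable borel"
  and per: "!!p. b = Periodic ==> g (fst p, snd p + H) = g p"
  and disj: "!!i j (k::int). i \<in> J ==> j \<in> J ==> i ~= j \<or> k ~= 0 ==> disjnt (A i) ((+) (0, of_int k * H) ` A j)"
 shows "(\<Sum>j\<in>J. \<integral>\<^sup>+p. indicator (A j) p * g p \<partial>lborel) <= (\<integral>\<^sup>+p. indicator strip p * g p \<partial>lborel)"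
proof (cases b)
 case Periodic
 have "g (x, y + real n * H) = g (x, y)" for x y n
 proof (induction n)
  case (Suc n)
  have "y + real (Suc n) * H = (y + real n * H) + H" by (simp add: algebra_simps)
  then have "g (x, y + real (Suc n) * H) = g (fst (x, y + real n * H), snd (x, y + real n * H) + H)" by (simp add: add.assoc)
  also have "... = g (x, y + real n * H)" by (rule per[OF Periodic])
  finally show ?case using Suc by simp
 qed simp
 note nat = this
 have "g ((0, of_int k * H) + p) = g p" for k :: int and p
 proof -
  obtain x y where p: "p = (x,y)" by (cases p)
  have "of_int k + real (nat (-k)) = real (nat k)" by (cases "0 <= k") auto
  then have e: "y + of_int k * H + real (nat (-k)) * H = y + real (nat k) * H"
   unfolding add.assoc distrib_right[symmetric] by simp
  have "g (x, y + of_int k * H) = g (x, y + of_int k * H + real (nat (-k)) * H)" by (rule nat[symmetric])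
  also have "... = g (x, y)" unfolding e by (rule nat)
  finally have "g (x, y + of_int k * H) = g (x, y)" .
  then show ?thesis by (simp add: p add.commute)
 qed
 then show ?thesis using A(1) disj by (intro translate_family_nn_integral_le[OF pos(1) J _ g]) (auto intro: borel_open)
next
 case Neumann
 have [measurable]: "A j \<in> sets borel" for j using A(1) by (intro borel_open)
 note [measurable] = g
 have "(\<Sum>j\<in>J. \<integral>\<^sup>+p. indicator (A j) p * g p \<partial>lborel) = (\<integral>\<^sup>+p. (\<Sum>j\<in>J. indicator (A j) p) * g p \<partial>lborel)"
  by (subst nn_integral_sum[symmetric]) (auto simp: sum_distrib_right)
 also have "... <= (\<integral>\<^sup>+p. indicator strip p * g p \<partial>lborel)"
 proof (intro nn_integral_mono mult_right_mono)
  fix p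
  show "(\<Sum>j\<in>J. indicator (A j) p) <= (indicator strip p :: ennreal)"
  proof (cases "\<exists>j\<in>J. p \<in> A j")
   case True
   then obtain j where j: "j \<in> J" "p \<in> A j" by blast
   have "(\<Sum>i\<in>J. indicator (A i) p) = (\<Sum>i\<in>J. if i = j then 1 else 0 :: ennreal)"
   proof (rule sum.cong[OF refl])
    fix i assume i: "i \<in> J"
    show "indicator (A i) p = (if i = j then 1 else 0 :: ennreal)"
    proof (cases "i = j")
     case False
     then have "disjnt (A i) ((+) (0, of_int 0 * H) ` A j)" using disj[OF i j(1), of 0] by simp
     then have "p \<notin> A i" using j(2) by (auto simp: disjnt_def zero_prod_def[symmetric])
     then show ?thesis using False by simp
    qed (use j in simp)
   qed
   moreover have "p \<in> strip" using A(2)[of j] j(2) Neumann by (auto simp: yrange_def)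
   ultimately show ?thesis using J j by simp
  next
   case False then show ?thesis by simp
  qed
 qed simp
 finally show ?thesis .
qed

lemma inverse_square_strip: "(\<integral>\<^sup>+p. indicator strip p * ennreal (1 / (1 + (fst p)^2)) \<partial>lborel) < \<infinity>"
proof -
 have c: "continuous_on A (%p. 1 / (1 + (fst p)^2))" for A :: "plane set"
  by (intro continuous_intros ballI) (simp add: add_nonneg_eq_0_iff)
 have "set_integrable lborel strip (%p. 1 / (1 + (fst p)^2))"
 proof (rule strip_integrable[OF c])
  fix n
  have "integral (slab (real n)) (%p. \<bar>1 / (1 + (fst p)^2)\<bar>) = integral (slab (real n)) (%p. 1 / (1 + (fst p)^2))"
   by (intro integral_cong) (simp add: add_nonneg_nonneg)
  also have "... = integral {-real n..real n} (%x. integral {0..H} (%y. 1 / (1 + x^2)))"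
   by (subst integral_box_iterated(1)[OF c]) simp
  also have "... = H * integral {-real n..real n} (%x. 1 / (1 + x^2))"
   using pos by (simp add: divide_inverse)
  also have "integral {-real n..real n} (%x. 1 / (1 + x^2)) = arctan (real n) - arctan (- real n)"
  proof (intro integral_unique fundamental_theorem_of_calculus)
   fix x :: real
   have "(arctan has_real_derivative inverse (1 + x^2)) (at x)" by (rule DERIV_arctan)
   then show "(arctan has_vector_derivative 1 / (1 + x^2)) (at x within {-real n..real n})"
    by (simp add: vector_derivative_iff has_field_derivative_at_within inverse_eq_divide)
  qed simp
  also have "H * (arctan (real n) - arctan (- real n)) <= H * pi"
   using arctan_bounded[of "real n"] pos by (intro mult_left_mono) (auto simp: arctan_minus)
  finally show "integral (slab (real n)) (%p. \<bar>1 / (1 + (fst p)^2)\<bar>) <= H * pi" .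
 qed
 then have "(\<integral>\<^sup>+p. ennreal (norm (indicator strip p *\<^sub>R (1 / (1 + (fst p)^2)))) \<partial>lborel) < \<infinity>"
  unfolding set_integrable_def by (simp add: integrable_iff_bounded)
 also have "(\<integral>\<^sup>+p. ennreal (norm (indicator strip p *\<^sub>R (1 / (1 + (fst p)^2)))) \<partial>lborel) = (\<integral>\<^sup>+p. indicator strip p * ennreal (1 / (1 + (fst p)^2)) \<partial>lborel)"
  by (intro nn_integral_cong) (auto simp: indicator_def)
 finally show ?thesis .
qed

end

section \<open>Weighted area of a tube and integrability along its lines\<close>

context flow_with_tube
begin

lemma core_nn_integral_le:
 assumes g: "g \<in> borel_measurable borel" and per: "!!p. b = Periodic ==> g (fst p, snd p + H) = g p"
 shows "(\<integral>\<^sup>+p. indicator (core D) p * g p \<partial>lborel) <= (\<integral>\<^sup>+p. indicator strip p * g p \<partial>lborel)"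
 using cores_nn_integral_le[of "{()}" "%_. core D" g] core_open core_region region_S g per translates by auto

text \<open>The weight is the derivative of the arctangent, so that up to powers of \<open>K\<close>
  this density bounds the variation of \<open>arctan x\<close> in both coordinate
  directions.\<close>

definition "kx z = E1 D z * E2 D z * (1 / (1 + (fst (P z))^2))"

lemma cont_P: "continuous_on Wd P" by (rule continuous_on_subset[OF cont_param Wd_coords])

lemma EWd: "z \<in> Wd ==> 0 < E1 D z" "z \<in> Wd ==> 0 < E2 D z" "z \<in> Wd ==> 1 <= K * E1 D z" "z \<in> Wd ==> 1 <= K * E2 D z"
 using E_lower(3-6)[OF subsetD[OF Wd_coords]] by blast+

lemma den_pos: "0 < 1 + (x::real)^2" by (simp add: add_pos_nonneg)

lemma cont_kx: "continuous_on Wd kx"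
 unfolding kx_def using den_pos by (intro continuous_intros cont_E cont_P) (metis less_irrefl)

lemma kx_nonneg: "z \<in> Wd ==> 0 <= kx z"
 unfolding kx_def using EWd[of z] den_pos[of "fst (P z)"] by (intro mult_nonneg_nonneg) auto

lemma core_change_of_variables:
 fixes Fn :: "plane => real"
 assumes Fn: "set_integrable lborel (core D) Fn" and mF: "Fn \<in> borel_measurable borel"
 shows "set_integrable lborel Wd (%z. E1 D z * E2 D z * Fn (P z))"
  "set_lebesgue_integral lborel Wd (%z. E1 D z * E2 D z * Fn (P z)) = set_lebesgue_integral lborel (core D) Fn"
proof -
 have bW: "Wd \<in> sets borel" using Wd_open by (rule borel_open)
 have mP: "(%z. indicator Wd z *\<^sub>R P z) \<in> borel_measurable borel"
  by (rule borel_measurable_continuous_on_indicator[OF bW cont_P])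
 have mE: "(%z. indicator Wd z *\<^sub>R (E1 D z * E2 D z)) \<in> borel_measurable borel"
  by (rule borel_measurable_continuous_on_indicator[OF bW]) (intro continuous_intros cont_E)
 have "(%z. (indicator Wd z *\<^sub>R (E1 D z * E2 D z)) * Fn (indicator Wd z *\<^sub>R P z)) \<in> borel_measurable borel"
  using measurable_compose[OF mP mF] mE by measurable
 moreover have "(%z. (indicator Wd z *\<^sub>R (E1 D z * E2 D z)) * Fn (indicator Wd z *\<^sub>R P z)) = (%z. indicator Wd z *\<^sub>R (\<bar>pair_det (dP z)\<bar> * Fn (P z)))"
  by (auto simp: indicator_def pair_det_dP)
 ultimately have mJ: "(%z. indicator Wd z *\<^sub>R (\<bar>pair_det (dP z)\<bar> * Fn (P z))) \<in> borel_measurable borel" by simp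
 have mc: "(%p. indicator (P ` Wd) p *\<^sub>R Fn p) \<in> borel_measurable borel"
  using borel_open[OF core_open] mF unfolding core_eq[symmetric] by measurable
 note cov = plane_change_of_variables[OF Wd_open dP(1) inj_param _ mc mJ, folded core_eq, OF _ Fn]
 have e: "indicator Wd z *\<^sub>R (\<bar>pair_det (dP z)\<bar> * Fn (P z)) = indicator Wd z *\<^sub>R (E1 D z * E2 D z * Fn (P z))" for z
  by (auto simp: indicator_def pair_det_dP)
 show "set_integrable lborel Wd (%z. E1 D z * E2 D z * Fn (P z))"
  "set_lebesgue_integral lborel Wd (%z. E1 D z * E2 D z * Fn (P z)) = set_lebesgue_integral lborel (core D) Fn"
  using cov unfolding set_integrable_def set_lebesgue_integral_def e by auto
qed

lemma area_finite: "(\<integral>\<^sup>+z. ennreal (indicator Wd z * kx z) \<partial>lborel) < \<infinity>"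
proof -
 let ?F = "%p::real\<times>real. 1 / (1 + (fst p)^2)"
 have "continuous_on UNIV ?F"
  using den_pos by (intro continuous_intros) (metis less_irrefl)
 then have m: "?F \<in> borel_measurable borel" by (rule borel_measurable_continuous_onI)
 have "(\<integral>\<^sup>+p. ennreal (norm (indicator (core D) p *\<^sub>R ?F p)) \<partial>lborel) = (\<integral>\<^sup>+p. indicator (core D) p * ennreal (?F p) \<partial>lborel)"
  using den_pos by (intro nn_integral_cong) (auto simp: indicator_def less_imp_le)
 also have "... <= (\<integral>\<^sup>+p. indicator strip p * ennreal (?F p) \<partial>lborel)"
  by (rule core_nn_integral_le) (use m in auto)
 also have "... < \<infinity>" by (rule inverse_square_strip)
 finally have fin: "(\<integral>\<^sup>+p. ennreal (norm (indicator (core D) p *\<^sub>R ?F p)) \<partial>lborel) < \<infinity>" .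
 have "(%p. indicator (core D) p *\<^sub>R ?F p) \<in> borel_measurable borel"
  by (intro borel_measurable_scaleR borel_measurable_indicator m borel_open[OF core_open])
 then have mi: "(%p. indicator (core D) p *\<^sub>R ?F p) \<in> borel_measurable lborel" by simp
 have "set_integrable lborel (core D) ?F" unfolding set_integrable_def by (rule integrableI_bounded[OF mi fin])
 from core_change_of_variables(1)[OF this m]
 have "(\<integral>\<^sup>+z. ennreal (norm (indicator Wd z *\<^sub>R kx z)) \<partial>lborel) < \<infinity>"
  unfolding set_integrable_def kx_def by (simp add: integrable_iff_bounded)
 also have "(\<integral>\<^sup>+z. ennreal (norm (indicator Wd z *\<^sub>R kx z)) \<partial>lborel) = (\<integral>\<^sup>+z. ennreal (indicator Wd z * kx z) \<partial>lborel)"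
  using kx_nonneg by (intro nn_integral_cong) (auto simp: indicator_def)
 finally show ?thesis .
qed

lemma kx_measurable: "(%z. ennreal (indicator Wd z * kx z)) \<in> borel_measurable borel"
 using borel_measurable_continuous_on_indicator[OF borel_open[OF Wd_open] cont_kx] by simp

lemma box_in_Wd: "{rh1..rh2} \<subseteq> Iv ==> cbox (rh1,s) (rh2,t) \<subseteq> Wd"
 by (auto simp: cbox_Pair_eq Wd_def)

lemma box_area: "\<exists>B. \<forall>rh1 rh2 s t. {rh1..rh2} \<subseteq> Iv --> integral (cbox (rh1,s) (rh2,t)) kx <= B"
proof (intro exI allI impI)
 fix rh1 rh2 s t assume "{rh1..rh2} \<subseteq> Iv"
 note sub = box_in_Wd[OF this, of s t]
 have c: "continuous_on (cbox (rh1,s) (rh2,t)) kx" using continuous_on_subset[OF cont_kx sub] .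
 have "ennreal (integral (cbox (rh1,s) (rh2,t)) kx) = (\<integral>\<^sup>+z. ennreal (indicator (cbox (rh1,s) (rh2,t)) z * kx z) \<partial>lborel)"
  by (rule nn_integral_continuous_box[symmetric, OF c]) (use kx_nonneg sub in blast)
 also have "... <= (\<integral>\<^sup>+z. ennreal (indicator Wd z * kx z) \<partial>lborel)"
 proof (intro nn_integral_mono ennreal_leI)
  fix z show "indicator (cbox (rh1,s) (rh2,t)) z * kx z <= indicator Wd z * kx z"
   using sub kx_nonneg[of z] by (cases "z \<in> cbox (rh1,s) (rh2,t)"; cases "z \<in> Wd") auto
 qed
 also have "... = ennreal (enn2real (\<integral>\<^sup>+z. ennreal (indicator Wd z * kx z) \<partial>lborel))"
  using area_finite by simp
 finally show "integral (cbox (rh1,s) (rh2,t)) kx <= enn2real (\<integral>\<^sup>+z. ennreal (indicator Wd z * kx z) \<partial>lborel)"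
  by (simp add: ennreal_le_iff)
qed

definition "good rh \<longleftrightarrow> rh \<in> Iv \<and> (\<exists>B. \<forall>s t. integral {s..t} (%xi. kx (rh,xi)) <= B)"

lemma cont_kx_line: "rh \<in> Iv ==> continuous_on A (%xi. kx (rh,xi))"
 by (rule continuous_on_compose2[OF cont_kx]) (auto intro!: continuous_intros simp: Wd_def)

text \<open>The weighted area of the whole tube is finite, so by Tonelli's theorem its integral
  along the line of constant \<open>rho\<close> is finite for almost every
  \<open>rho\<close>.\<close>

lemma good_ae: "AE rh in lborel. rh \<in> Iv --> good rh"
proof -
 let ?h = "%z. ennreal (indicator Wd z * kx z)"
 have m: "?h \<in> borel_measurable (lborel \<Otimes>\<^sub>M lborel)" unfolding lborel_prod using kx_measurable by simp
 have "(\<integral>\<^sup>+rh. \<integral>\<^sup>+xi. ?h (rh,xi) \<partial>lborel \<partial>lborel) = integral\<^sup>N lborel ?h"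
  using lborel.nn_integral_fst[OF m] by (simp add: lborel_prod)
 then have "(\<integral>\<^sup>+rh. \<integral>\<^sup>+xi. ?h (rh,xi) \<partial>lborel \<partial>lborel) ~= \<infinity>" using area_finite by simp
 moreover have "(%rh. \<integral>\<^sup>+xi. ?h (rh,xi) \<partial>lborel) \<in> borel_measurable lborel"
  using lborel.borel_measurable_nn_integral_fst[OF m] by simp
 ultimately have "AE rh in lborel. (\<integral>\<^sup>+xi. ?h (rh,xi) \<partial>lborel) ~= \<infinity>"
  by (intro nn_integral_PInf_AE) auto
 then show ?thesis
 proof (rule AE_mp, intro AE_I2 impI)
  fix rh assume fin: "(\<integral>\<^sup>+xi. ?h (rh,xi) \<partial>lborel) ~= \<infinity>" and rh: "rh \<in> Iv"
  have "integral {s..t} (%xi. kx (rh,xi)) <= enn2real (\<integral>\<^sup>+xi. ?h (rh,xi) \<partial>lborel)" for s t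
  proof -
   have W: "(rh,xi) \<in> Wd" for xi using rh by (simp add: Wd_def)
   have "ennreal (integral (cbox s t) (%xi. kx (rh,xi))) = (\<integral>\<^sup>+xi. ennreal (indicator (cbox s t) xi * kx (rh,xi)) \<partial>lborel)"
    by (rule nn_integral_continuous_box[symmetric, OF cont_kx_line[OF rh]]) (use kx_nonneg W in blast)
   also have "... <= (\<integral>\<^sup>+xi. ?h (rh,xi) \<partial>lborel)"
    using kx_nonneg[OF W] W by (intro nn_integral_mono ennreal_leI) (auto simp: indicator_def)
   also have "... = ennreal (enn2real (\<integral>\<^sup>+xi. ?h (rh,xi) \<partial>lborel))" using fin by (simp add: less_top)
   finally show ?thesis by (simp add: ennreal_le_iff)
  qed
  then show "good rh" using rh unfolding good_def by blast
 qed
qed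

end

section \<open>Orientation of a tube\<close>

context flow_with_tube
begin

text \<open>The coordinate \<open>x\<close> along a line, compactified: convergence to
  \<open>pi / 2\<close> or \<open>- (pi / 2)\<close> means escape to an end of the strip.\<close>

definition "ax rh xi = arctan (fst (P (rh,xi)))"

lemma ax_bound: "\<bar>ax rh xi\<bar> < pi / 2"
 using arctan_bounded[of "fst (P (rh,xi))"] unfolding ax_def abs_less_iff by linarith

lemma Wd_I: "rh \<in> Iv ==> (rh,xi) \<in> Wd" by (simp add: Wd_def)

lemma ax_derivative:
 assumes "rh \<in> Iv"
 shows "((%xi. ax rh xi) has_real_derivative fst (dP (rh,xi) (0,1)) / (1 + (fst (P (rh,xi)))^2)) (at xi)"
  "((%rh. ax rh xi) has_real_derivative fst (dP (rh,xi) (1,0)) / (1 + (fst (P (rh,xi)))^2)) (at rh)"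
proof -
 note W = Wd_I[OF assms, of xi]
 have d: "((%xi. fst (P (rh,xi))) has_real_derivative fst (dP (rh,xi) (0,1))) (at xi)"
  "((%rh. fst (P (rh,xi))) has_real_derivative fst (dP (rh,xi) (1,0))) (at rh)"
 proof -
  have s: "fst (dP (rh,xi) (h *\<^sub>R v)) = h * fst (dP (rh,xi) v)" for h v
   using linear_scale[OF bounded_linear.linear[OF dP_linear[OF W]]] by simp
  have "((%xi. (rh,xi)) has_derivative (%h. h *\<^sub>R (0,1))) (at xi)" by (auto intro!: derivative_eq_intros)
  from has_derivative_fst[OF has_derivative_compose[OF this dP(1)[OF W]]]
  show "((%xi. fst (P (rh,xi))) has_real_derivative fst (dP (rh,xi) (0,1))) (at xi)"
   unfolding s by (rule has_derivative_imp_has_field_derivative) simp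
  have "((%rh. (rh,xi)) has_derivative (%h. h *\<^sub>R (1,0))) (at rh)" by (auto intro!: derivative_eq_intros)
  from has_derivative_fst[OF has_derivative_compose[OF this dP(1)[OF W]]]
  show "((%rh. fst (P (rh,xi))) has_real_derivative fst (dP (rh,xi) (1,0))) (at rh)"
   unfolding s by (rule has_derivative_imp_has_field_derivative) simp
 qed
 show "((%xi. ax rh xi) has_real_derivative fst (dP (rh,xi) (0,1)) / (1 + (fst (P (rh,xi)))^2)) (at xi)"
  "((%rh. ax rh xi) has_real_derivative fst (dP (rh,xi) (1,0)) / (1 + (fst (P (rh,xi)))^2)) (at rh)"
  unfolding ax_def using DERIV_chain2[OF DERIV_arctan d(1)] DERIV_chain2[OF DERIV_arctan d(2)]
  by (simp_all add: divide_inverse mult.commute)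
qed

text \<open>As both metric coefficients are at least \<open>1 / K\<close>, each of them is at most
  \<open>K * E1 * E2\<close>, so a derivative in either direction is dominated by the area element.
  The third bound uses that the squared cosine of \<open>arctan x\<close> is
  \<open>1 / (1 + x^2)\<close>.\<close>

lemma ax_derivative_bound:
 assumes "rh \<in> Iv"
 shows "\<bar>fst (dP (rh,xi) (0,1)) / (1 + (fst (P (rh,xi)))^2)\<bar> <= K * kx (rh,xi)"
  "\<bar>fst (dP (rh,xi) (1,0)) / (1 + (fst (P (rh,xi)))^2)\<bar> <= K * kx (rh,xi)"
  "(cos (ax rh xi))^2 <= K * (K * kx (rh,xi))"
proof -
 note W = Wd_I[OF assms, of xi]
 define d where "d = 1 / (1 + (fst (P (rh,xi)))^2)"
 have d: "0 < d" using den_pos by (simp add: d_def)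
 note E = EWd[OF W]
 have n: "\<bar>fst w\<bar> <= norm w" for w :: "plane" using norm_fst_le[of "fst w" "snd w"] by simp
 have e: "E2 D (rh,xi) <= K * (E1 D (rh,xi) * E2 D (rh,xi))" "E1 D (rh,xi) <= K * (E1 D (rh,xi) * E2 D (rh,xi))"
  using mult_right_mono[OF E(3) less_imp_le[OF E(2)]] mult_right_mono[OF E(4) less_imp_le[OF E(1)]]
  by (simp_all only: mult_1 mult.assoc mult.commute[of "E2 D (rh,xi)"])
 have 1: "\<bar>fst (dP (rh,xi) (0,1))\<bar> <= K * (E1 D (rh,xi) * E2 D (rh,xi))"
  using n[of "dP (rh,xi) (0,1)"] norm_dP(2)[OF W] e(1) by linarith
 have 2: "\<bar>fst (dP (rh,xi) (1,0))\<bar> <= K * (E1 D (rh,xi) * E2 D (rh,xi))"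
  using n[of "dP (rh,xi) (1,0)"] norm_dP(1)[OF W] e(2) by linarith
 show "\<bar>fst (dP (rh,xi) (0,1)) / (1 + (fst (P (rh,xi)))^2)\<bar> <= K * kx (rh,xi)"
  "\<bar>fst (dP (rh,xi) (1,0)) / (1 + (fst (P (rh,xi)))^2)\<bar> <= K * kx (rh,xi)"
  using mult_right_mono[OF 1, of d] mult_right_mono[OF 2, of d] d den_pos[of "fst (P (rh,xi))"]
  unfolding kx_def d_def by (simp_all add: abs_divide mult.assoc abs_of_pos)
 have "1 * 1 <= (K * E1 D (rh,xi)) * (K * E2 D (rh,xi))" using E by (intro mult_mono) auto
 then have "1 * d <= ((K * E1 D (rh,xi)) * (K * E2 D (rh,xi))) * d" using d by (intro mult_right_mono) auto
 moreover have "(cos (ax rh xi))^2 = d" unfolding ax_def d_def cos_arctan using den_pos[of "fst (P (rh,xi))"] by (simp add: power_divide)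
 ultimately show "(cos (ax rh xi))^2 <= K * (K * kx (rh,xi))" unfolding kx_def d_def by (simp add: mult_ac)
qed

lemma ax_ends:
 assumes g: "good rh" and s: "s \<in> {1, - 1}"
 shows "((%xi. ax rh (s * xi)) \<longlongrightarrow> pi / 2) at_top \<or> ((%xi. ax rh (s * xi)) \<longlongrightarrow> - (pi / 2)) at_top"
proof -
 have rh: "rh \<in> Iv" using g by (simp add: good_def)
 obtain B where B: "!!r t. integral {r..t} (%xi. kx (rh,xi)) <= B" using g unfolding good_def by blast
 have ck: "continuous_on A (%xi. kx (rh, s * xi))" for A
  by (rule continuous_on_compose2[OF cont_kx_line[OF rh, of UNIV]]) (auto intro!: continuous_intros)
 show ?thesis
 proof (rule bounded_variation_end_limit)
  fix r :: real assume "0 <= r"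
  have "((%xi. s * xi) has_real_derivative s) (at r)" by (auto intro!: derivative_eq_intros)
  from DERIV_chain2[OF ax_derivative(1)[OF rh] this]
  show "((%xi. ax rh (s * xi)) has_real_derivative fst (dP (rh, s * r) (0,1)) / (1 + (fst (P (rh, s * r)))^2) * s) (at r)" .
  show "\<bar>fst (dP (rh, s * r) (0,1)) / (1 + (fst (P (rh, s * r)))^2) * s\<bar> <= K * kx (rh, s * r)"
   using ax_derivative_bound(1)[OF rh, of "s * r"] s by (auto simp: abs_mult)
  show "(cos (ax rh (s * r)))^2 <= K * (K * kx (rh, s * r))" by (rule ax_derivative_bound(3)[OF rh])
  have "integral {0..r} (%xi. kx (rh, s * xi)) <= B"
  proof (cases "s = 1")
   case False
   then have "s = - 1" using s by simp
   moreover have "integral {0..r} (%xi. kx (rh, - xi)) = integral {-r..0} (%xi. kx (rh, xi))"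
    using Henstock_Kurzweil_Integration.integral_reflect_real[of r 0 "%xi. kx (rh, - xi)"] by simp
   ultimately show ?thesis using B by simp
  qed (use B in simp)
  then show "integral {0..r} (%xi. K * kx (rh, s * xi)) <= K * B" using K by (simp add: mult_left_mono)
 next
  show "continuous_on {0..} (%xi. K * kx (rh, s * xi))" by (intro continuous_intros ck)
  show "0 < K" by (rule K)
  show "\<bar>ax rh (s * xi)\<bar> <= pi / 2" for xi using ax_bound[of rh "s * xi"] by simp
 qed
qed

lemma transversal_difference:
 assumes "rh1 <= rh2" "{rh1..rh2} \<subseteq> Iv"
 shows "\<bar>ax rh2 xi - ax rh1 xi\<bar> <= K * integral {rh1..rh2} (%rh. kx (rh,xi))"
proof -
 have ck: "continuous_on {rh1..rh2} (%rh. kx (rh,xi))"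
  by (rule continuous_on_compose2[OF cont_kx]) (use assms(2) in \<open>auto intro!: continuous_intros simp: Wd_def\<close>)
 let ?d = "%rh. fst (dP (rh,xi) (1,0)) / (1 + (fst (P (rh,xi)))^2)"
 have h: "(?d has_integral (ax rh2 xi - ax rh1 xi)) {rh1..rh2}"
 proof (rule fundamental_theorem_of_calculus[OF assms(1)])
  fix rh assume "rh \<in> {rh1..rh2}"
  then have "rh \<in> Iv" using assms(2) by blast
  from has_field_derivative_at_within[OF ax_derivative(2)[OF this]]
  show "((%rh. ax rh xi) has_vector_derivative ?d rh) (at rh within {rh1..rh2})"
   unfolding has_real_derivative_iff_has_vector_derivative .
 qed
 have "norm (integral {rh1..rh2} ?d) <= integral {rh1..rh2} (%rh. K * kx (rh,xi))"
  using assms ax_derivative_bound(2)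
  by (intro integral_norm_bound_integral has_integral_integrable[OF h] integrable_continuous_real continuous_intros ck) auto
 then show ?thesis using integral_unique[OF h] by simp
qed

text \<open>If two lines stayed apart by 1 for all large \<open>xi\<close>, integrating the
  transversal estimate over a \<open>xi\<close> interval longer than \<open>K\<close> times the
  weighted area of the tube would give a contradiction.\<close>

lemma transversal_small:
 assumes s: "s \<in> {1, - 1}" and rh: "rh1 <= rh2" "{rh1..rh2} \<subseteq> Iv"
 shows "\<exists>xi\<ge>r. \<bar>ax rh2 (s * xi) - ax rh1 (s * xi)\<bar> < 1"
proof (rule ccontr)
 assume neg: "\<not> ?thesis"
 obtain B where B: "!!s t. integral (cbox (rh1,s) (rh2,t)) kx <= B" using box_area rh(2) by blast
 define l where "l = K * (\<bar>B\<bar> + 1)"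
 have l: "0 < l" using K by (simp add: l_def)
 define lo hi where "lo = (if s = 1 then r else - (r + l))" and "hi = (if s = 1 then r + l else - r)"
 have lh: "hi - lo = l" using s by (auto simp: lo_def hi_def)
 have c: "continuous_on (cbox (rh1,lo) (rh2,hi)) kx" using continuous_on_subset[OF cont_kx box_in_Wd[OF rh(2)]] .
 have "integral {lo..hi} (%_. 1) <= integral {lo..hi} (%xi. K * integral {rh1..rh2} (%rh. kx (rh,xi)))"
 proof (rule integral_le)
  have "continuous_on (cbox lo hi) (%xi. integral (cbox rh1 rh2) (%rh. kx (rh,xi)))"
  proof (rule integral_continuous_on_param)
   have "continuous_on (cbox lo hi \<times> cbox rh1 rh2) (%z. kx (snd z, fst z))"
    by (rule continuous_on_compose2[OF c]) (auto intro!: continuous_intros simp: cbox_Pair_eq)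
   then show "continuous_on (cbox lo hi \<times> cbox rh1 rh2) (%(xi, rh). kx (rh,xi))" by (simp add: split_beta)
  qed
  then show "(%xi. K * integral {rh1..rh2} (%rh. kx (rh,xi))) integrable_on {lo..hi}"
   by (intro integrable_continuous_real continuous_intros) simp
  fix xi assume "xi \<in> {lo..hi}"
  then have "r <= s * xi" using s by (auto simp: lo_def hi_def split: if_splits)
  then have "1 <= \<bar>ax rh2 (s * (s * xi)) - ax rh1 (s * (s * xi))\<bar>" using neg by (metis not_less)
  moreover have "s * (s * xi) = xi" using s by auto
  ultimately show "1 <= K * integral {rh1..rh2} (%rh. kx (rh,xi))" using transversal_difference[OF rh, of xi] by simp
 qed auto
 then have "l <= K * integral {lo..hi} (%xi. integral {rh1..rh2} (%rh. kx (rh,xi)))" using lh l by simp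
 also have "integral {lo..hi} (%xi. integral {rh1..rh2} (%rh. kx (rh,xi))) = integral (cbox (rh1,lo) (rh2,hi)) kx"
  by (rule integral_box_iterated(2)[OF c, symmetric])
 also have "K * ... <= K * \<bar>B\<bar>" using B[of lo hi] K by (intro mult_left_mono) auto
 finally show False using K by (simp add: l_def)
qed

lemma good_between: "good rh1 ==> good rh2 ==> {rh1..rh2} \<subseteq> Iv"
 by (auto simp: good_def Iv_def)

text \<open>Lines leading to opposite ends would differ by almost \<open>pi\<close> in
  \<open>ax\<close> for all large \<open>xi\<close>, whereas two lines of one tube come within 1 of
  each other at arbitrarily large \<open>xi\<close>.\<close>

lemma same_end:
 assumes g: "good rh1" "good rh2" and s: "s \<in> {1, - 1}"
  and l: "((%xi. ax rh1 (s * xi)) \<longlongrightarrow> pi / 2) at_top"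
 shows "((%xi. ax rh2 (s * xi)) \<longlongrightarrow> pi / 2) at_top"
proof (rule ccontr)
 assume "\<not> ?thesis"
 then have l2: "((%xi. ax rh2 (s * xi)) \<longlongrightarrow> - (pi / 2)) at_top" using ax_ends[OF g(2) s] by blast
 have "((%xi. ax rh1 (s * xi) - ax rh2 (s * xi)) \<longlongrightarrow> pi / 2 - - (pi / 2)) at_top" by (intro tendsto_diff l l2)
 moreover have "1 < pi / 2 - - (pi / 2)" using pi_ge_two by simp
 ultimately have "\<forall>\<^sub>F xi in at_top. 1 < ax rh1 (s * xi) - ax rh2 (s * xi)" by (rule order_tendstoD)
 then obtain r where r: "!!xi. r <= xi ==> 1 < ax rh1 (s * xi) - ax rh2 (s * xi)" unfolding eventually_at_top_linorder by blast
 have "\<exists>xi\<ge>r. \<bar>ax rh2 (s * xi) - ax rh1 (s * xi)\<bar> < 1"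
 proof (cases "rh1 <= rh2")
  case True
  then show ?thesis using transversal_small[OF s True good_between[OF g], of r] by simp
 next
  case False
  then show ?thesis using transversal_small[OF s _ good_between[OF g(2,1)], of r] by (auto simp: abs_minus_commute)
 qed
 then show False using r by fastforce
qed

lemma ax_large:
 assumes "((%xi. ax rh (s * xi)) \<longlongrightarrow> pi / 2) at_top"
 shows "\<forall>\<^sub>F xi in at_top. r < fst (P (rh, s * xi))"
proof -
 have "arctan r < pi / 2" using arctan_bounded by blast
 with assms have "\<forall>\<^sub>F xi in at_top. arctan r < ax rh (s * xi)" by (rule order_tendstoD)
 then show ?thesis by (rule eventually_mono) (simp add: ax_def arctan_less_iff)
qed

lemma ax_small:
 assumes "((%xi. ax rh (s * xi)) \<longlongrightarrow> - (pi / 2)) at_top"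
 shows "\<forall>\<^sub>F xi in at_top. fst (P (rh, s * xi)) < r"
proof -
 have "- (pi / 2) < arctan r" using arctan_bounded[of r] by simp
 with assms have "\<forall>\<^sub>F xi in at_top. ax rh (s * xi) < arctan r" by (rule order_tendstoD)
 then show ?thesis by (rule eventually_mono) (simp add: ax_def arctan_less_iff)
qed

lemma line_escapes:
 assumes g: "good rh"
 shows "\<exists>m. \<forall>xi. m < \<bar>xi\<bar> --> r < \<bar>fst (P (rh,xi))\<bar>"
proof -
 have "\<exists>m. \<forall>xi\<ge>m. r < \<bar>fst (P (rh, s * xi))\<bar>" if s: "s \<in> {1, - 1}" for s
 proof -
  have "\<forall>\<^sub>F xi in at_top. r < \<bar>fst (P (rh, s * xi))\<bar>"
   using ax_ends[OF g s]
  proof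
   assume "((%xi. ax rh (s * xi)) \<longlongrightarrow> pi / 2) at_top"
   from ax_large[OF this, of r] show ?thesis by (rule eventually_mono) auto
  next
   assume "((%xi. ax rh (s * xi)) \<longlongrightarrow> - (pi / 2)) at_top"
   from ax_small[OF this, of "- r"] show ?thesis by (rule eventually_mono) auto
  qed
  then show ?thesis unfolding eventually_at_top_linorder by blast
 qed
 from this[of 1] this[of "- 1"] obtain m1 m2 where m: "!!xi. m1 <= xi ==> r < \<bar>fst (P (rh, xi))\<bar>" "!!xi. m2 <= xi ==> r < \<bar>fst (P (rh, - xi))\<bar>" by auto
 show ?thesis
 proof (intro exI allI impI)
  fix xi assume "max m1 m2 < \<bar>xi\<bar>"
  then show "r < \<bar>fst (P (rh,xi))\<bar>" using m(1)[of xi] m(2)[of "- xi"] by (cases "0 <= xi") auto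
 qed
qed

text \<open>Since \<open>|x|\<close> tends to infinity along the line, a convergent sequence on it
  uses only a bounded range of \<open>xi\<close>, whose image is compact.\<close>

lemma line_closed:
 assumes g: "good rh"
 shows "closed (P ` ({rh} \<times> UNIV))"
 unfolding closed_sequential_limits
proof (intro allI impI)
 fix z l assume z: "(\<forall>n. z n \<in> P ` ({rh} \<times> UNIV)) \<and> z \<longlonglongrightarrow> l"
 have rh: "rh \<in> Iv" using g by (simp add: good_def)
 obtain m where m: "!!xi. m < \<bar>xi\<bar> ==> \<bar>fst l\<bar> + 1 < \<bar>fst (P (rh,xi))\<bar>" using line_escapes[OF g] by blast
 have "(%n. \<bar>fst (z n)\<bar>) \<longlonglongrightarrow> \<bar>fst l\<bar>" using z by (intro tendsto_intros) auto
 then have "\<forall>\<^sub>F n in sequentially. \<bar>fst (z n)\<bar> < \<bar>fst l\<bar> + 1" by (rule order_tendstoD) simp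
 then obtain N where N: "!!n. N <= n ==> \<bar>fst (z n)\<bar> < \<bar>fst l\<bar> + 1" unfolding eventually_sequentially by blast
 define C where "C = P ` ({rh} \<times> {-m..m})"
 have "compact C" unfolding C_def
  by (intro compact_continuous_image continuous_on_subset[OF cont_P] compact_Times) (use rh in \<open>auto simp: Wd_def\<close>)
 then have cl: "closed C" by (rule compact_imp_closed)
 have zC: "z (n + N) \<in> C" for n
 proof -
  obtain xi where xi: "z (n + N) = P (rh,xi)" using z by auto
  have "\<not> m < \<bar>xi\<bar>" using m[of xi] N[of "n + N"] xi by auto
  then have "xi \<in> {-m..m}" by auto
  then show ?thesis unfolding C_def xi by blast
 qed
 have zl: "(%n. z (n + N)) \<longlonglongrightarrow> l" using z by (intro LIMSEQ_ignore_initial_segment) auto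
 have "l \<in> C" by (rule closed_sequentially[OF cl zC zl])
 then show "l \<in> P ` ({rh} \<times> UNIV)" unfolding C_def by auto
qed

text \<open>The streamline through one point of the line never leaves it: the set of times spent on
  the line is open, because \<open>rho\<close> is locally constant along streamlines, and closed,
  because the line is. The streamline thus lies in the tube, and the projection hypothesis applies
  to it.\<close>

lemma line_covers:
 assumes g: "good rh"
 shows "\<exists>xi. fst (P (rh,xi)) = x"
proof -
 have rh: "rh \<in> Iv" using g by (simp add: good_def)
 define Ln where "Ln = P ` ({rh} \<times> UNIV)"
 have Ln_core: "Ln \<subseteq> core D" unfolding Ln_def core_eq using rh by (auto simp: Wd_def)
 have Ln_iff: "p \<in> Ln \<longleftrightarrow> fst (Ch p) = rh" if "p \<in> core D" for p
 proof
  assume "p \<in> Ln"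
  then obtain xi where "p = P (rh,xi)" by (auto simp: Ln_def)
  then show "fst (Ch p) = rh" using chart_core(4)[OF Wd_I[OF rh]] by simp
 next
  assume "fst (Ch p) = rh"
  then have "p = P (rh, snd (Ch p))" using chart_core(2)[OF that] by (metis prod.collapse)
  then show "p \<in> Ln" unfolding Ln_def by auto
 qed
 have p0: "P (rh,0) \<in> Ln" by (simp add: Ln_def)
 then have "P (rh,0) \<in> UNIV \<times> Yr" using Ln_core core_region region_S by blast
 from stream[OF this] obtain ga where ga: "streamline (UNIV \<times> Yr) u ga" "ga 0 = P (rh,0)" by blast
 have c: "continuous_on UNIV ga"
  using ga(1) unfolding streamline_def by (intro continuous_at_imp_continuous_on ballI has_vector_derivative_continuous) auto
 have "closed (ga -` Ln)" unfolding Ln_def by (rule closed_vimage[OF line_closed[OF g] c])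
 moreover have "open (ga -` Ln)"
  unfolding open_contains_ball
 proof
  fix s assume "s \<in> ga -` Ln"
  then have s: "ga s \<in> Ln" "ga s \<in> core D" using Ln_core by auto
  obtain ep where ep: "0 < ep" "!!r. \<bar>r - s\<bar> <= ep ==> ga r \<in> core D \<and> fst (Ch (ga r)) = fst (Ch (ga s))"
   using streamline_in_core[OF ga(1) s(2)] by blast
  have "ball s ep \<subseteq> ga -` Ln"
  proof
   fix r assume "r \<in> ball s ep"
   then have "\<bar>r - s\<bar> <= ep" by (simp add: dist_real_def)
   from ep(2)[OF this] show "r \<in> ga -` Ln" using Ln_iff s by auto
  qed
  then show "\<exists>e>0. ball s e \<subseteq> ga -` Ln" using ep(1) by blast
 qed
 moreover have "0 \<in> ga -` Ln" using ga(2) p0 by simp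
 ultimately have "ga -` Ln = UNIV" using clopen[of "ga -` Ln"] by blast
 then have r: "range ga \<subseteq> Ln" by blast
 then have "range ga \<subseteq> region D" using Ln_core core_region by blast
 then have "fst ` range ga = UNIV" using tube ga(1) unfolding flow_tube_def by blast
 then have "x \<in> fst ` range ga" by blast
 then obtain s where "x = fst (ga s)" by blast
 moreover have "ga s \<in> Ln" using r by blast
 ultimately show ?thesis unfolding Ln_def by auto
qed

lemma cont_fst_line: "rh \<in> Iv ==> continuous_on A (%xi. fst (P (rh,xi)))"
 by (intro continuous_intros continuous_on_compose2[OF cont_P]) (auto simp: Wd_def)

text \<open>If both ends of a line led to the same side, \<open>x\<close> would be bounded on the
  other side along the line, contradicting that it covers the whole axis.\<close>

lemma opposite_ends:
 assumes g: "good rh"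
 shows "\<not> (((%xi. ax rh (1 * xi)) \<longlongrightarrow> l) at_top \<and> ((%xi. ax rh (- 1 * xi)) \<longlongrightarrow> l) at_top \<and> l \<in> {pi / 2, - (pi / 2)})"
proof
 assume l: "((%xi. ax rh (1 * xi)) \<longlongrightarrow> l) at_top \<and> ((%xi. ax rh (- 1 * xi)) \<longlongrightarrow> l) at_top \<and> l \<in> {pi / 2, - (pi / 2)}"
 have rh: "rh \<in> Iv" using g by (simp add: good_def)
 define t :: real where "t = (if l = pi / 2 then 1 else - 1)"
 have ls: "((%xi. ax rh (s * xi)) \<longlongrightarrow> l) at_top" if "s \<in> {1, - 1}" for s using l that by auto
 have ev: "\<forall>\<^sub>F xi in at_top. 0 < t * fst (P (rh, s * xi))" if "s \<in> {1, - 1}" for s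
 proof (cases "l = pi / 2")
  case True
  have "((%xi. ax rh (s * xi)) \<longlongrightarrow> pi / 2) at_top" using ls[OF that] unfolding True .
  from ax_large[OF this, of 0] show ?thesis by (rule eventually_mono) (simp add: t_def True)
 next
  case False
  then have e: "l = - (pi / 2)" using l by blast
  have "((%xi. ax rh (s * xi)) \<longlongrightarrow> - (pi / 2)) at_top" using ls[OF that] unfolding e .
  moreover have "t = - 1" by (simp only: t_def if_not_P[OF False])
  ultimately show ?thesis using ax_small[of rh s 0] by simp
 qed
 obtain m1 m2 where m: "!!xi. m1 <= xi ==> 0 < t * fst (P (rh, xi))" "!!xi. m2 <= xi ==> 0 < t * fst (P (rh, - xi))"
  using ev[of 1] ev[of "- 1"] unfolding eventually_at_top_linorder by auto
 define m where "m = max \<bar>m1\<bar> \<bar>m2\<bar>"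
 have out: "0 < t * fst (P (rh, xi))" if "m < \<bar>xi\<bar>" for xi
  using m(1)[of xi] m(2)[of "- xi"] that by (cases "0 <= xi") (auto simp: m_def)
 have "continuous_on {-m..m} (%xi. t * fst (P (rh, xi)))" by (intro continuous_intros cont_fst_line rh)
 moreover have "{-m..m} ~= {}" by (auto simp: m_def)
 ultimately obtain xi0 where "!!xi. xi \<in> {-m..m} ==> t * fst (P (rh, xi0)) <= t * fst (P (rh, xi))"
  using continuous_attains_inf[of "{-m..m}"] by (metis compact_Icc)
 then have lower: "min 0 (t * fst (P (rh, xi0))) <= t * fst (P (rh, xi))" for xi
 proof (cases "m < \<bar>xi\<bar>")
  case True
  from out[OF this] show ?thesis by linarith
 next
  case False
  then have "xi \<in> {-m..m}" by auto
  then show ?thesis using \<open>!!xi. xi \<in> {-m..m} ==> t * fst (P (rh, xi0)) <= t * fst (P (rh, xi))\<close> by (meson min.coboundedI2)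
 qed
 obtain xi where "fst (P (rh,xi)) = t * (min 0 (t * fst (P (rh, xi0))) - 1)" using line_covers[OF g] by blast
 then have "t * fst (P (rh,xi)) = min 0 (t * fst (P (rh, xi0))) - 1" by (simp add: t_def)
 then show False using lower[of xi] by linarith
qed

text \<open>One sign \<open>ta\<close> for all good lines tells whether \<open>xi\<close> runs with
  or against \<open>x\<close>. It is separate from \<open>sg\<close>, which tells whether the flow
  runs with \<open>xi\<close>; the product of both is the direction of the flow along the
  strip.\<close>

lemma orientation:
 "\<exists>ta\<in>{1, - 1}. \<forall>rh. good rh --> (\<forall>\<^sub>F xi in at_top. 0 < ta * fst (P (rh,xi))) \<and> (\<forall>\<^sub>F xi in at_top. ta * fst (P (rh, - xi)) < 0)"
proof (cases "\<exists>rh. good rh")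
 case True
 then obtain rh0 where g0: "good rh0" by blast
 have pm: "1 \<in> {1, - 1::real}" "- 1 \<in> {1, - 1::real}" by auto
 show ?thesis
 proof (cases "((%xi. ax rh0 (1 * xi)) \<longlongrightarrow> pi / 2) at_top")
  case True
  have "(\<forall>\<^sub>F xi in at_top. 0 < 1 * fst (P (rh,xi))) \<and> (\<forall>\<^sub>F xi in at_top. 1 * fst (P (rh, - xi)) < 0)" if g: "good rh" for rh
  proof -
   note top = same_end[OF g0 g pm(1) True]
   then have "((%xi. ax rh (- 1 * xi)) \<longlongrightarrow> - (pi / 2)) at_top"
    using opposite_ends[OF g, of "pi / 2"] ax_ends[OF g pm(2)] by blast
   from ax_small[OF this, of 0] ax_large[OF top, of 0] show ?thesis by simp
  qed
  then show ?thesis by (intro bexI[of _ 1]) auto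
 next
  case False
  have "(\<forall>\<^sub>F xi in at_top. 0 < - 1 * fst (P (rh,xi))) \<and> (\<forall>\<^sub>F xi in at_top. - 1 * fst (P (rh, - xi)) < 0)" if g: "good rh" for rh
  proof -
   have "\<not> ((%xi. ax rh (1 * xi)) \<longlongrightarrow> pi / 2) at_top" using same_end[OF g g0 pm(1)] False by blast
   then have top: "((%xi. ax rh (1 * xi)) \<longlongrightarrow> - (pi / 2)) at_top" using ax_ends[OF g pm(1)] by blast
   then have "((%xi. ax rh (- 1 * xi)) \<longlongrightarrow> pi / 2) at_top"
    using opposite_ends[OF g, of "- (pi / 2)"] ax_ends[OF g pm(2)] by blast
   from ax_large[OF this, of 0] ax_small[OF top, of 0] show ?thesis by simp
  qed
  then show ?thesis by (intro bexI[of _ "- 1"]) auto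
 qed
qed auto

end

section \<open>Test functions along a tube\<close>

text \<open>The function \<open>cutoff\<close> extended by 0; the minimum inside the square makes it
  continuously differentiable on the whole line.\<close>

definition bump :: "real => real => real" where "bump R x = (min 0 ((x/R)^2 - 1))^2"
definition bump' :: "real => real => real" where "bump' R x = 2 * min 0 ((x/R)^2 - 1) * (2 * x / R^2)"

lemma bump_deriv: "0 < R ==> (bump R has_real_derivative bump' R x) (at x)"
proof -
 assume R: "0 < R"
 have "((%x. (x/R)^2 - 1) has_real_derivative 2 * x / R^2) (at x)"
  using R by (auto intro!: derivative_eq_intros simp: field_simps power2_eq_square)
 from DERIV_chain2[OF DERIV_neg_part_square this]
 show ?thesis unfolding bump_def[abs_def] bump'_def .
qed

lemma bump_cont: "continuous_on A g ==> continuous_on A (%p. bump R (g p))" "continuous_on A g ==> continuous_on A (%p. bump' R (g p))"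
proof -
 assume g: "continuous_on A g"
 have *: "continuous_on A (%p. g p / R)" "continuous_on A (%p. 2 * g p / R^2)"
  using continuous_on_mult_right[OF g, of "inverse R"] continuous_on_mult_right[OF continuous_on_mult_left[OF g, of 2], of "inverse (R^2)"] by (simp_all add: divide_inverse)
 show "continuous_on A (%p. bump R (g p))" "continuous_on A (%p. bump' R (g p))"
  unfolding bump_def bump'_def by (intro continuous_intros *)+
qed

lemma bump_props:
 assumes R: "0 < R"
 shows "0 <= bump R x" "bump R x <= 1" "R <= \<bar>x\<bar> ==> bump R x = 0" "R <= \<bar>x\<bar> ==> bump' R x = 0" "\<bar>bump' R x\<bar> <= 4 / R"
  "0 <= x ==> bump' R x <= 0" "x <= 0 ==> 0 <= bump' R x" "\<bar>x\<bar> <= R / 2 ==> 1/2 <= bump R x" "bump R 0 = 1"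
proof -
 define r where "r = (x/R)^2"
 have r0: "0 <= r" by (simp add: r_def)
 have big: "1 <= r" if "R <= \<bar>x\<bar>"
 proof -
  have "1 <= \<bar>x / R\<bar>" using that R by (simp add: abs_divide)
  then have "1^2 <= \<bar>x / R\<bar>\<^sup>2" by (intro power_mono) auto
  then show ?thesis unfolding r_def power2_abs by simp
 qed
 have m: "-1 <= min 0 (r - 1)" "min 0 (r - 1) <= 0" using r0 by auto
 show "0 <= bump R x" by (simp add: bump_def)
 show "bump R x <= 1" unfolding bump_def r_def[symmetric] using m by (simp add: abs_square_le_1)
 show "bump R x = 0" "bump' R x = 0" if "R <= \<bar>x\<bar>" using big[OF that] unfolding bump_def bump'_def r_def[symmetric] by auto
 show "\<bar>bump' R x\<bar> <= 4 / R"
 proof (cases "R <= \<bar>x\<bar>")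
  case True then show ?thesis using big unfolding bump'_def r_def[symmetric] using R by auto
 next
  case False
  have "\<bar>2 * min 0 (r - 1)\<bar> * \<bar>2 * x / R^2\<bar> <= 2 * (2 * R / R^2)"
  proof (rule mult_mono)
   show "\<bar>2 * min 0 (r - 1)\<bar> <= 2"
    using m unfolding abs_mult by (cases "min 0 (r - 1) = 0") (auto simp: abs_le_iff)
   have "\<bar>2 * x\<bar> / R^2 <= 2 * R / R^2" using False by (intro divide_right_mono) auto
   then show "\<bar>2 * x / R^2\<bar> <= 2 * R / R^2" by (simp add: abs_divide)
  qed auto
  also have "... = 4 / R" using R by (simp add: power2_eq_square)
  finally show ?thesis unfolding bump'_def r_def[symmetric] abs_mult .
 qed
 show "bump' R x <= 0" if "0 <= x"
  unfolding bump'_def r_def[symmetric] using that by (rule_tac mult_nonpos_nonneg[of "2 * min 0 (r - 1)"]) (simp, simp)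
 show "0 <= bump' R x" if "x <= 0"
  unfolding bump'_def r_def[symmetric] using that by (rule_tac mult_nonpos_nonpos[of "2 * min 0 (r - 1)"]) (simp, simp add: divide_nonpos_nonneg)
 show "1/2 <= bump R x" if "\<bar>x\<bar> <= R / 2"
 proof -
  have "\<bar>x / R\<bar> <= 1/2" using that R by (simp add: abs_divide pos_divide_le_eq)
  then have "\<bar>x / R\<bar>\<^sup>2 <= (1/2)^2" by (intro power_mono) auto
  then have "r <= 1/4" unfolding r_def power2_abs by (simp add: power2_eq_square)
  then have "min 0 (r - 1) = r - 1" "3/4 <= 1 - r" by auto
  moreover from this(2) have "(3/4)^2 <= (1 - r)^2" by (rule power_mono) simp
  moreover have "(r - 1)^2 = (1 - r)^2" by (rule power2_commute)
  moreover have "(3/4)^2 = (9/16::real)" by (simp add: power2_eq_square)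
  ultimately show ?thesis unfolding bump_def r_def[symmetric] by simp
 qed
 show "bump R 0 = 1" by (simp add: bump_def)
qed

text \<open>For either sign exactly one half of the bump contributes, the rising or the falling one,
  and both have height \<open>bump R 0 = 1\<close>.\<close>

lemma bump'_positive_part_integral:
 assumes R: "0 < R" and ta: "ta \<in> {1, - 1}"
 shows "integral {-R..R} (%xi. max 0 (ta * bump' R xi)) = 1"
proof -
 have c: "continuous_on A (%xi. max 0 (ta * bump' R xi))" for A by (intro continuous_intros bump_cont)
 have "(bump' R has_integral bump R 0 - bump R (-R)) {-R..0}" "(bump' R has_integral bump R R - bump R 0) {0..R}"
  using R by (auto intro!: fundamental_theorem_of_calculus has_field_derivative_at_within[OF bump_deriv[OF R]]
    simp: vector_derivative_iff)
 then have b: "(bump' R has_integral 1) {-R..0}" "(bump' R has_integral - 1) {0..R}"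
  using bump_props(3)[OF R, of R] bump_props(3)[OF R, of "-R"] bump_props(9)[OF R] R by auto
 have l: "integral {-R..0} (%xi. max 0 (ta * bump' R xi)) = (if ta = 1 then 1 else 0)"
 proof (cases "ta = 1")
  case True
  have "integral {-R..0} (%xi. max 0 (ta * bump' R xi)) = integral {-R..0} (bump' R)"
   using bump_props(7)[OF R] True by (intro integral_cong) auto
  then show ?thesis using integral_unique[OF b(1)] True by simp
 next
  case False
  then have "ta = - 1" using ta by simp
  then have "integral {-R..0} (%xi. max 0 (ta * bump' R xi)) = integral {-R..0} (%_. 0)"
   using bump_props(7)[OF R] by (intro integral_cong) auto
  then show ?thesis using False by simp
 qed
 have r: "integral {0..R} (%xi. max 0 (ta * bump' R xi)) = (if ta = 1 then 0 else 1)"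
 proof (cases "ta = 1")
  case True
  then have "integral {0..R} (%xi. max 0 (ta * bump' R xi)) = integral {0..R} (%_. 0)"
   using bump_props(6)[OF R] by (intro integral_cong) auto
  then show ?thesis using True by simp
 next
  case False
  then have "ta = - 1" using ta by simp
  then have "integral {0..R} (%xi. max 0 (ta * bump' R xi)) = integral {0..R} (%xi. - bump' R xi)"
   using bump_props(6)[OF R] by (intro integral_cong) auto
  then show ?thesis using integral_unique[OF has_integral_neg[OF b(2)]] False by simp
 qed
 show ?thesis
  using Henstock_Kurzweil_Integration.integral_combine[of "-R" 0 R "%xi. max 0 (ta * bump' R xi)"] R c l r
  by (auto intro: integrable_continuous_real split: if_splits)
qed

context flow_with_tube
begin

text \<open>Smaller than \<open>hw D\<close>, so that the test function has compact support in the
  open core and extends by 0. Still large enough at the end: the flux bound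
  \<open>Msp * ah / 4 = 3/16 * hw D * Msp\<close> exceeds \<open>tube_flux / 16\<close>, which is at
  most \<open>hw D * Msp / 8\<close>.\<close>

definition "ah = 3 * hw D / 4"
definition "phi rh = bump ah (rh - ctr D)"
definition "phi' rh = bump' ah (rh - ctr D)"
definition "psi R p = (if p \<in> core D then phi (fst (Ch p)) * bump R (snd (Ch p)) else 0)"
definition "Dpsi R p v = (if p \<in> core D then phi' (fst (Ch p)) * bump R (snd (Ch p)) * fst (dC p v)
  + phi (fst (Ch p)) * bump' R (snd (Ch p)) * snd (dC p v) else 0)"
definition "Zc (R::real) = {ctr D - ah..ctr D + ah} \<times> {-R..R}"
definition "Zs R = P ` Zc R"

lemma ah: "0 < ah" "ah < hw D" using hw_pos by (auto simp: ah_def)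

lemma Zc_W: "Zc R \<subseteq> Wd" using ah by (auto simp: Zc_def Wd_def Iv_def)

lemma Zs_compact: "compact (Zs R)" unfolding Zs_def Zc_def
 by (intro compact_continuous_image continuous_on_subset[OF cont_P Zc_W[unfolded Zc_def]] compact_Times compact_Icc)

lemma Zs_core: "Zs R \<subseteq> core D" unfolding Zs_def core_eq using Zc_W by blast

lemma off_Zs:
 assumes R: "0 < R" and p: "p \<notin> Zs R"
 shows "psi R p = 0" "Dpsi R p v = 0"
proof -
 have "phi (fst (Ch p)) * bump R (snd (Ch p)) = 0 \<and> phi' (fst (Ch p)) * bump R (snd (Ch p)) = 0 \<and> phi (fst (Ch p)) * bump' R (snd (Ch p)) = 0" if c: "p \<in> core D"
 proof -
  have "Ch p \<notin> Zc R" using p chart_core(2)[OF c] unfolding Zs_def by (metis image_eqI)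
  then have "ah <= \<bar>fst (Ch p) - ctr D\<bar> \<or> R <= \<bar>snd (Ch p)\<bar>" by (auto simp: Zc_def mem_Times_iff)
  then show ?thesis using bump_props(3,4)[OF R] bump_props(3,4)[OF ah(1)] unfolding phi_def phi'_def by auto
 qed
 then show "psi R p = 0" "Dpsi R p v = 0" by (auto simp: psi_def Dpsi_def)
qed

lemma psi_core_derivative:
 assumes R: "0 < R" and p: "p \<in> core D"
 shows "(psi R has_derivative Dpsi R p) (at p)"
proof -
 have f: "((%p. fst (Ch p)) has_derivative (%v. fst (dC p v))) (at p)" "((%p. snd (Ch p)) has_derivative (%v. snd (dC p v))) (at p)"
  using has_derivative_fst[OF dC(1)[OF p]] has_derivative_snd[OF dC(1)[OF p]] .
 have "(phi has_derivative (%h. h * phi' (fst (Ch p)))) (at (fst (Ch p)))"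
 proof -
  have "((%rh. rh - ctr D) has_real_derivative 1) (at (fst (Ch p)))" by (auto intro!: derivative_eq_intros)
  from DERIV_chain2[OF bump_deriv[OF ah(1)] this] show ?thesis
   unfolding phi_def[abs_def] phi'_def has_field_derivative_def by (rule has_derivative_eq_rhs) (auto simp: fun_eq_iff)
 qed
 from has_derivative_compose[OF f(1) this]
 have 1: "((%p. phi (fst (Ch p))) has_derivative (%v. fst (dC p v) * phi' (fst (Ch p)))) (at p)" .
 have "(bump R has_derivative (%h. h * bump' R (snd (Ch p)))) (at (snd (Ch p)))"
  using bump_deriv[OF R, of "snd (Ch p)"] unfolding has_field_derivative_def by (rule has_derivative_eq_rhs) (auto simp: fun_eq_iff)
 from has_derivative_compose[OF f(2) this]
 have 2: "((%p. bump R (snd (Ch p))) has_derivative (%v. snd (dC p v) * bump' R (snd (Ch p)))) (at p)" .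
 have "((%p. phi (fst (Ch p)) * bump R (snd (Ch p))) has_derivative Dpsi R p) (at p)"
  using has_derivative_mult[OF 1 2] by (rule has_derivative_eq_rhs) (use p in \<open>auto simp: Dpsi_def fun_eq_iff\<close>)
 then show ?thesis
  by (rule has_derivative_transform_within_open[OF _ core_open p]) (simp add: psi_def)
qed

lemma psi_derivative:
 assumes R: "0 < R"
 shows "(psi R has_derivative Dpsi R p) (at p)"
proof (cases "p \<in> Zs R")
 case True
 then show ?thesis using psi_core_derivative[OF R] Zs_core by blast
next
 case False
 have "open (- Zs R)" using Zs_compact compact_imp_closed by blast
 have "((%_. 0) has_derivative (%_. 0)) (at p)" by simp
 then have "(psi R has_derivative (%_. 0)) (at p)"
  by (rule has_derivative_transform_within_open[OF _ \<open>open (- Zs R)\<close>]) (use False off_Zs(1)[OF R] in auto)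
 moreover have "Dpsi R p = (%_. 0)" using off_Zs(2)[OF R False] by auto
 ultimately show ?thesis by simp
qed

lemma cont_phi: "continuous_on A g ==> continuous_on A (%p. phi (g p))" "continuous_on A g ==> continuous_on A (%p. phi' (g p))"
 unfolding phi_def phi'_def by (intro bump_cont continuous_intros; assumption)+

lemma cont_Dpsi_core:
 shows "continuous_on (core D) (%p. Dpsi R p v)"
proof -
 have cc: "continuous_on (core D) Ch" by (rule continuous_on_subset[OF cont_chart core_region])
 have "continuous_on (core D) (%p. phi' (fst (Ch p)) * bump R (snd (Ch p)) * fst (dC p v)
  + phi (fst (Ch p)) * bump' R (snd (Ch p)) * snd (dC p v))"
  by (intro continuous_intros bump_cont cont_phi cc dC(2))
 then show ?thesis by (rule continuous_on_eq) (simp add: Dpsi_def)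
qed

lemma cont_Dpsi:
 assumes R: "0 < R"
 shows "continuous_on A (%p. Dpsi R p v)"
proof -
 have o: "open (- Zs R)" using Zs_compact compact_imp_closed by blast
 have "continuous_on (- Zs R) (%p. Dpsi R p v)"
  by (rule continuous_on_eq[of _ "%_. 0"]) (use off_Zs(2)[OF R] in auto)
 from continuous_on_open_Un[OF core_open o cont_Dpsi_core this]
 have "continuous_on (core D \<union> - Zs R) (%p. Dpsi R p v)" .
 moreover have "core D \<union> - Zs R = UNIV" using Zs_core by auto
 ultimately show ?thesis by (metis continuous_on_subset subset_UNIV)
qed

lemma cont_psi: "0 < R ==> continuous_on A (psi R)"
 using psi_derivative by (meson continuous_at_imp_continuous_on has_derivative_continuous)

lemma psi_range: "0 < R ==> 0 <= psi R p \<and> psi R p <= 1"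
 using bump_props(1,2)[OF ah(1)] bump_props(1,2)[of R] by (auto simp: psi_def phi_def mult_le_one)

text \<open>Along \<open>u\<close> the coordinate \<open>rho\<close> does not change, so only the
  derivative in \<open>xi\<close> survives. This is why the second bound is of order
  \<open>1 / R\<close> and contains no \<open>1 / ah\<close>.\<close>

lemma Dpsi_bound:
 assumes R: "0 < R"
 shows "\<bar>Dpsi R p v\<bar> <= K * (4 / ah + 4 / R) * norm v" "snd p \<in> Yr ==> \<bar>Dpsi R p (u p)\<bar> <= 4 / R * (K * U)"
proof -
 have 1: "\<bar>Dpsi R p v\<bar> <= K * (4 / ah + 4 / R) * norm v"
 proof (cases "p \<in> core D")
  case True
  have a: "\<bar>phi' (fst (Ch p)) * bump R (snd (Ch p))\<bar> <= 4 / ah * 1"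
   unfolding abs_mult phi'_def using bump_props(5)[OF ah(1)] bump_props(1,2)[OF R, of "snd (Ch p)"] ah by (intro mult_mono) auto
  have b: "\<bar>phi (fst (Ch p)) * bump' R (snd (Ch p))\<bar> <= 1 * (4 / R)"
   unfolding abs_mult phi_def using bump_props(5)[OF R] bump_props(1,2)[OF ah(1), of "fst (Ch p) - ctr D"] by (intro mult_mono) auto
  have "\<bar>Dpsi R p v\<bar> <= \<bar>phi' (fst (Ch p)) * bump R (snd (Ch p))\<bar> * \<bar>fst (dC p v)\<bar> + \<bar>phi (fst (Ch p)) * bump' R (snd (Ch p))\<bar> * \<bar>snd (dC p v)\<bar>"
   unfolding Dpsi_def using True by (simp add: abs_triangle_ineq abs_mult[symmetric])
  also have "... <= (4 / ah * 1) * (K * norm v) + (1 * (4 / R)) * (K * norm v)"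
   using a b dC_bound[OF True, of v] ah R by (intro add_mono mult_mono) auto
  also have "... = K * (4 / ah + 4 / R) * norm v" by (simp add: algebra_simps)
  finally show ?thesis .
 next
  case False then show ?thesis using K ah R by (simp add: Dpsi_def add_nonneg_nonneg)
 qed
 show "\<bar>Dpsi R p v\<bar> <= K * (4 / ah + 4 / R) * norm v" by (rule 1)
 assume Y: "snd p \<in> Yr"
 show "\<bar>Dpsi R p (u p)\<bar> <= 4 / R * (K * U)"
 proof (cases "p \<in> core D")
  case True
  have b: "\<bar>phi (fst (Ch p)) * bump' R (snd (Ch p))\<bar> <= 1 * (4 / R)"
   unfolding abs_mult phi_def using bump_props(5)[OF R] bump_props(1,2)[OF ah(1), of "fst (Ch p) - ctr D"] by (intro mult_mono) auto
  have "norm (u p) <= U" using u_bound[OF Y, of "fst p"] by simp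
  then have "K * norm (u p) <= K * U" using K by (intro mult_left_mono) auto
  then have s: "\<bar>snd (dC p (u p))\<bar> <= K * U" using dC_bound(2)[OF True, of "u p"] by linarith
  have "\<bar>Dpsi R p (u p)\<bar> = \<bar>phi (fst (Ch p)) * bump' R (snd (Ch p))\<bar> * \<bar>snd (dC p (u p))\<bar>"
   using True u_grad_rho[OF True] by (simp add: Dpsi_def abs_mult)
  also have "... <= (1 * (4 / R)) * (K * U)" using b s R by (intro mult_mono) auto
  finally show ?thesis by simp
 next
  case False then show ?thesis using K pos R by (simp add: Dpsi_def)
 qed
qed

lemma Dpsi_linear:
 assumes "0 < R"
 shows "Dpsi R p v = fst v * Dpsi R p (1,0) + snd v * Dpsi R p (0,1)"
proof -
 have l: "linear (Dpsi R p)" using psi_derivative[OF assms] by (rule has_derivative_linear)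
 have "v = fst v *\<^sub>R (1,0) + snd v *\<^sub>R (0,1)" by (simp add: prod_eq_iff)
 then have "Dpsi R p v = Dpsi R p (fst v *\<^sub>R (1,0) + snd v *\<^sub>R (0,1))" by simp
 also have "... = fst v * Dpsi R p (1,0) + snd v * Dpsi R p (0,1)"
  by (simp only: linear_add[OF l] linear_scale[OF l] real_scaleR_def)
 finally show ?thesis .
qed

lemma cont_Dpsi_u:
 assumes R: "0 < R" and A: "!!p. p \<in> A ==> snd p \<in> Yr"
 shows "continuous_on A (%p. Dpsi R p (u p))"
 by (subst Dpsi_linear[OF R]) (intro continuous_intros cont_Dpsi R flow_cont A)

end

section \<open>The flux of a step profile through a tube\<close>

context flow_with_tube
begin

text \<open>The step profile, from which \<open>T\<close> differs by at most the majorant at every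
  time. \<open>Fl R\<close> is the transport term of the tube with \<open>Psi(T)\<close> replaced by
  this step.\<close>

definition "hl (p::plane) = (if fst p < 0 then 1 else 0 :: real)"
definition "Fl R = set_lebesgue_integral lborel (core D) (%p. hl p * Dpsi R p (u p))"

lemma cont_Dpsi_u_UNIV:
 assumes R: "0 < R"
 shows "continuous_on UNIV (%p. Dpsi R p (u p))"
proof -
 have o: "open (- Zs R)" using Zs_compact compact_imp_closed by blast
 have "continuous_on (core D) (%p. Dpsi R p (u p))" by (rule cont_Dpsi_u[OF R core_strip])
 moreover have "continuous_on (- Zs R) (%p. Dpsi R p (u p))"
  by (rule continuous_on_eq[of _ "%_. 0"]) (use off_Zs(2)[OF R] in auto)
 ultimately have "continuous_on (core D \<union> - Zs R) (%p. Dpsi R p (u p))"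
  by (rule continuous_on_open_Un[OF core_open o])
 moreover have "core D \<union> - Zs R = UNIV" using Zs_core by auto
 ultimately show ?thesis by simp
qed

lemma hl_measurable: "hl \<in> borel_measurable borel"
proof -
 have "open {p :: plane. fst p < 0}" by (intro open_Collect_less continuous_intros)
 then have "(indicator {p :: plane. fst p < 0} :: _ => real) \<in> borel_measurable borel" by (intro borel_measurable_indicator borel_open)
 moreover have "indicator {p. fst p < 0} = hl" by (auto simp: hl_def indicator_def fun_eq_iff)
 ultimately show ?thesis by simp
qed

lemma Zs_integrable:
 fixes g :: "plane => real"
 assumes m: "g \<in> borel_measurable borel" and b: "!!p. \<bar>g p\<bar> <= C * indicator Z p" and Z: "compact Z"
 shows "integrable lborel g"
proof (rule Bochner_Integration.integrable_bound[where f="%p. C * indicator Z p"])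
 have "emeasure lborel Z < \<infinity>" by (rule emeasure_compact_finite[OF Z])
 then show "integrable lborel (%p. C * indicator Z p)"
  using compact_imp_closed[OF Z] by (intro integrable_mult_right integrable_real_indicator) auto
 show "AE p in lborel. norm (g p) <= norm (C * indicator Z p)"
 proof (intro AE_I2)
  fix p show "norm (g p) <= norm (C * indicator Z p)" using b[of p] by simp
 qed
qed (use m in simp)

lemma cutoff_flux_integrable:
 assumes R: "0 < R" and h: "h \<in> borel_measurable borel" "!!p. p \<in> core D ==> \<bar>h p\<bar> <= c"
 shows "(%p. h p * Dpsi R p (u p)) \<in> borel_measurable borel" "integrable lborel (%p. h p * Dpsi R p (u p))"
  "set_integrable lborel (core D) (%p. h p * Dpsi R p (u p))"
  "set_lebesgue_integral lborel (core D) (%p. h p * Dpsi R p (u p)) = integral\<^sup>L lborel (%p. h p * Dpsi R p (u p))"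
proof -
 have e: "indicator (core D) p *\<^sub>R (h p * Dpsi R p (u p)) = h p * Dpsi R p (u p)" for p
  by (auto simp: indicator_def Dpsi_def)
 show m: "(%p. h p * Dpsi R p (u p)) \<in> borel_measurable borel"
  by (intro borel_measurable_times h borel_measurable_continuous_onI cont_Dpsi_u_UNIV R)
 show i: "integrable lborel (%p. h p * Dpsi R p (u p))"
 proof (rule Zs_integrable[OF m _ Zs_compact])
  fix p
  show "\<bar>h p * Dpsi R p (u p)\<bar> <= (c * (4 / R * (K * U))) * indicator (Zs R) p"
  proof (cases "p \<in> Zs R")
   case True
   then have pc: "p \<in> core D" using Zs_core by blast
   have "\<bar>h p\<bar> * \<bar>Dpsi R p (u p)\<bar> <= c * (4 / R * (K * U))"
    using h(2)[OF pc] Dpsi_bound(2)[OF R core_strip[OF pc]] by (intro mult_mono) auto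
   then show ?thesis using True by (simp add: abs_mult)
  qed (simp add: off_Zs(2)[OF R])
 qed
 show "set_integrable lborel (core D) (%p. h p * Dpsi R p (u p))" using i unfolding set_integrable_def e .
 show "set_lebesgue_integral lborel (core D) (%p. h p * Dpsi R p (u p)) = integral\<^sup>L lborel (%p. h p * Dpsi R p (u p))"
  unfolding set_lebesgue_integral_def e ..
qed

lemma Dpsi_u_coords:
 assumes z: "z \<in> Wd"
 shows "E1 D z * E2 D z * Dpsi R (P z) (u (P z)) = sgn_tube * speed u D z * (phi (fst z) * bump' R (snd z))"
proof -
 note p = chart_core(3)[OF z]
 have "Dpsi R (P z) (u (P z)) = phi (fst z) * bump' R (snd z) * gx z"
  using p u_grad_rho[OF p] chart_core(4)[OF z] by (simp add: Dpsi_def gx_def)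
 then have "E1 D z * E2 D z * Dpsi R (P z) (u (P z)) = (E1 D z * E2 D z * gx z) * (phi (fst z) * bump' R (snd z))" by simp
 then show ?thesis unfolding gx_speed[OF z] .
qed

lemma Fl_coords:
 assumes R: "0 < R"
 shows "set_integrable lborel Wd (%z. hl (P z) * (sgn_tube * speed u D z * (phi (fst z) * bump' R (snd z))))"
  "Fl R = set_lebesgue_integral lborel Wd (%z. hl (P z) * (sgn_tube * speed u D z * (phi (fst z) * bump' R (snd z))))"
proof -
 have h: "\<bar>hl p\<bar> <= 1" for p by (simp add: hl_def)
 note i = cutoff_flux_integrable[OF R hl_measurable h]
 note c = core_change_of_variables[OF i(3,1)]
 have e: "E1 D z * E2 D z * (hl (P z) * Dpsi R (P z) (u (P z))) = hl (P z) * (sgn_tube * speed u D z * (phi (fst z) * bump' R (snd z)))"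
  if "z \<in> Wd" for z using Dpsi_u_coords[OF that, of R] by (simp add: mult.left_commute)
 show "set_integrable lborel Wd (%z. hl (P z) * (sgn_tube * speed u D z * (phi (fst z) * bump' R (snd z))))"
 proof -
  have "(%z. indicator Wd z *\<^sub>R (E1 D z * E2 D z * (hl (P z) * Dpsi R (P z) (u (P z)))))
   = (%z. indicator Wd z *\<^sub>R (hl (P z) * (sgn_tube * speed u D z * (phi (fst z) * bump' R (snd z)))))"
  proof (rule ext)
   fix z show "indicator Wd z *\<^sub>R (E1 D z * E2 D z * (hl (P z) * Dpsi R (P z) (u (P z))))
    = indicator Wd z *\<^sub>R (hl (P z) * (sgn_tube * speed u D z * (phi (fst z) * bump' R (snd z))))"
   proof (cases "z \<in> Wd")
    case True then show ?thesis by (simp only: e)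
   next
    case False then show ?thesis by (simp add: indicator_simps(2)[OF False])
   qed
  qed
  with c(1) show ?thesis unfolding set_integrable_def by (simp only:)
 qed
 show "Fl R = set_lebesgue_integral lborel Wd (%z. hl (P z) * (sgn_tube * speed u D z * (phi (fst z) * bump' R (snd z))))"
  unfolding Fl_def c(2)[symmetric] using e Wd_open by (intro set_lebesgue_integral_cong) auto
qed

definition "Nreg = {z \<in> Wd. fst (P z) < 0}"
text \<open>Detects where the sign of \<open>x\<close> disagrees with that of
  \<open>ta * xi\<close>. By the orientation of the tube this is 0 for large \<open>|xi|\<close> on
  each good line.\<close>

definition "mis ta z = \<bar>indicator Nreg z - indicator {z. ta * snd z < 0} z :: real\<bar>"
definition "Bz ta R z = phi (fst z) * \<bar>bump' R (snd z)\<bar> * mis ta z"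
text \<open>The contribution of the step if \<open>x < 0\<close> were the same as
  \<open>ta * xi < 0\<close>, which is exactly where \<open>ta * bump'\<close> is allowed to be
  positive.\<close>

definition "Az ta R z = phi (fst z) * max 0 (ta * bump' R (snd z))"

lemma Nreg_open: "open Nreg"
proof -
 have "Nreg = Wd \<inter> P -` {p. fst p < 0}" by (auto simp: Nreg_def)
 moreover have "open {p :: plane. fst p < 0}" by (intro open_Collect_less continuous_intros)
 ultimately show ?thesis by (simp only: continuous_open_preimage[OF cont_P Wd_open])
qed

lemma mis_range: "0 <= mis ta z" "mis ta z <= 1"
 by (auto simp: mis_def indicator_def)

lemma mis_measurable: "mis ta \<in> borel_measurable borel"
proof -
 have "open {z :: plane. ta * snd z < 0}" by (intro open_Collect_less continuous_intros)
 then show ?thesis unfolding mis_def[abs_def] using Nreg_open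
  by (intro borel_measurable_abs borel_measurable_diff borel_measurable_indicator borel_open)
qed

lemma phi_range: "0 <= phi rh" "phi rh <= 1" "ah <= \<bar>rh - ctr D\<bar> ==> phi rh = 0"
 using bump_props(1-3)[OF ah(1)] by (auto simp: phi_def)

lemma off_Zc: "0 < R ==> z \<notin> Zc R ==> phi (fst z) = 0 \<or> bump' R (snd z) = 0"
proof -
 assume R: "0 < R" and z: "z \<notin> Zc R"
 then have "ah <= \<bar>fst z - ctr D\<bar> \<or> R <= \<bar>snd z\<bar>" by (auto simp: Zc_def mem_Times_iff)
 then show ?thesis using bump_props(4)[OF R] phi_range(3) by auto
qed

lemma Zc_compact: "compact (Zc R)" unfolding Zc_def by (intro compact_Times compact_Icc)

lemma Bz_measurable: "Bz ta R \<in> borel_measurable borel"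
 unfolding Bz_def[abs_def]
 by (intro borel_measurable_times mis_measurable borel_measurable_continuous_onI continuous_intros cont_phi bump_cont)

lemma Bz_range: "0 < R ==> 0 <= Bz ta R z" "0 < R ==> Bz ta R z <= 4 / R * indicator (Zc R) z"
proof -
 assume R: "0 < R"
 show "0 <= Bz ta R z" unfolding Bz_def using phi_range mis_range by simp
 show "Bz ta R z <= 4 / R * indicator (Zc R) z"
 proof (cases "z \<in> Zc R")
  case True
  have "phi (fst z) * \<bar>bump' R (snd z)\<bar> * mis ta z <= 1 * (4 / R) * 1"
   using phi_range mis_range bump_props(5)[OF R] R by (intro mult_mono) auto
  then show ?thesis using True by (simp add: Bz_def)
 next
  case False then show ?thesis using off_Zc[OF R False] by (auto simp: Bz_def)
 qed
qed

lemma Bz_integrable: "0 < R ==> integrable lborel (Bz ta R)"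
 by (rule Zs_integrable[OF Bz_measurable _ Zc_compact[of R], where C="4 / R"]) (simp only: abs_of_nonneg[OF Bz_range(1)] Bz_range(2))

lemma Az_integral:
 assumes R: "0 < R" and ta: "ta \<in> {1, - 1}"
 shows "integrable lborel (Az ta R)" "ah / 2 <= integral\<^sup>L lborel (Az ta R)"
proof -
 let ?B = "cbox (ctr D - ah, - R) (ctr D + ah, R)"
 have Z: "Zc R = ?B" by (simp add: Zc_def cbox_Pair_eq)
 have c: "continuous_on A (Az ta R)" for A unfolding Az_def[abs_def] by (intro continuous_intros cont_phi bump_cont)
 have e: "indicator ?B z *\<^sub>R Az ta R z = Az ta R z" for z
  using off_Zc[OF R, of z] unfolding Z by (auto simp: Az_def indicator_def)
 have s: "set_integrable lborel ?B (Az ta R)"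
  using borel_integrable_compact[OF compact_cbox c] by (simp add: set_integrable_def)
 then show "integrable lborel (Az ta R)" unfolding set_integrable_def e .
 have cp: "continuous_on A phi" for A by (rule cont_phi(1)[OF continuous_on_id, unfolded id_def])
 have "integral\<^sup>L lborel (Az ta R) = integral ?B (Az ta R)"
  using set_borel_integral_eq_integral(2)[OF s] unfolding set_lebesgue_integral_def e .
 also have "... = integral {ctr D - ah..ctr D + ah} (%rh. integral {-R..R} (%xi. phi rh * max 0 (ta * bump' R xi)))"
  by (subst integral_box_iterated(1)[OF c]) (simp add: Az_def)
 also have "... = integral {ctr D - ah..ctr D + ah} phi"
  using bump'_positive_part_integral[OF R ta] by simp
 finally have 1: "integral\<^sup>L lborel (Az ta R) = integral {ctr D - ah..ctr D + ah} phi" .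
 \<comment> \<open>On the middle half of its support, of length \<open>ah\<close>,
   \<open>phi\<close> is at least 1/2.\<close>
 have "ah / 2 = integral {ctr D - ah/2..ctr D + ah/2} (%_. 1/2)" using ah by simp
 also have "... <= integral {ctr D - ah/2..ctr D + ah/2} phi"
 proof (rule integral_le)
  fix x assume "x \<in> {ctr D - ah/2..ctr D + ah/2}"
  then have "ctr D - ah/2 <= x" "x <= ctr D + ah/2" by auto
  then have "\<bar>x - ctr D\<bar> <= ah / 2" by linarith
  then show "1/2 <= phi x" unfolding phi_def by (rule bump_props(8)[OF ah(1)])
 qed (auto intro: integrable_continuous_real cp)
 also have "... <= integral {ctr D - ah..ctr D + ah} phi"
  using ah phi_range by (intro integral_subset_le integrable_continuous_real cp) auto
 finally show "ah / 2 <= integral\<^sup>L lborel (Az ta R)" unfolding 1 .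
qed

text \<open>Where the two signs agree, the lower bound \<open>Msp / 2\<close> on the speed gives the
  main term. Where they disagree, the loss is at most a multiple of \<open>Msp * |bump'|\<close>,
  which is charged to \<open>Bz\<close>.\<close>

lemma flux_pointwise:
 assumes R: "0 < R" and ta: "ta \<in> {1, - 1}" and z: "z \<in> Wd"
 shows "Msp / 2 * Az ta R z - 2 * Msp * Bz ta R z <= ta * (hl (P z) * (speed u D z * (phi (fst z) * bump' R (snd z))))"
proof -
 define be where "be = bump' R (snd z)"
 define v where "v = speed u D z"
 have v: "Msp / 2 <= v" "v <= Msp" using speed_bounds[of z] z Wd_coords by (auto simp: v_def)
 note M = Msp_nonneg
 have sgn: "ta * snd z < 0 ==> 0 <= ta * be" "\<not> ta * snd z < 0 ==> ta * be <= 0"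
  using ta bump_props(6,7)[OF R, of "snd z"] by (auto simp: be_def)
 have ab: "\<bar>ta * be\<bar> = \<bar>be\<bar>" using ta by auto
 have hN: "hl (P z) = indicator Nreg z" using z by (simp add: hl_def Nreg_def)
 have "Msp / 2 * max 0 (ta * be) - 2 * Msp * (\<bar>be\<bar> * mis ta z) <= hl (P z) * (v * (ta * be))"
 proof (cases "z \<in> Nreg"; cases "ta * snd z < 0")
  assume a: "z \<in> Nreg" "ta * snd z < 0"
  have "Msp / 2 * (ta * be) <= v * (ta * be)" using v sgn a by (intro mult_right_mono) auto
  then show ?thesis using a sgn hN by (simp add: mis_def max_def)
 next
  assume a: "z \<in> Nreg" "\<not> ta * snd z < 0"
  have "v * \<bar>be\<bar> <= Msp * \<bar>be\<bar>" using v by (intro mult_right_mono) auto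
  moreover have tb: "ta * be = - \<bar>be\<bar>" using sgn(2)[OF a(2)] ab by linarith
  moreover have "v * (ta * be) = - (v * \<bar>be\<bar>)" unfolding tb by simp
  moreover have "0 <= Msp * \<bar>be\<bar>" using M by simp
  moreover have "max 0 (ta * be) = 0" using sgn(2)[OF a(2)] by simp
  moreover have "mis ta z = 1" using a by (simp add: mis_def)
  moreover have "hl (P z) = 1" using hN a by simp
  ultimately show ?thesis by simp
 next
  assume a: "z \<notin> Nreg" "ta * snd z < 0"
  have "max 0 (ta * be) = \<bar>be\<bar>" using sgn(1)[OF a(2)] ab by simp
  moreover have "0 <= Msp * \<bar>be\<bar>" using M by simp
  moreover have "mis ta z = 1" using a by (simp add: mis_def)
  moreover have "0 <= \<bar>be\<bar> * Msp" using M by simp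
  ultimately show ?thesis using hN a by simp
 next
  assume a: "z \<notin> Nreg" "\<not> ta * snd z < 0"
  then show ?thesis using sgn(2)[OF a(2)] hN by (simp add: mis_def)
 qed
 from mult_left_mono[OF this phi_range(1)[of "fst z"]] show ?thesis
  unfolding Az_def Bz_def be_def[symmetric] v_def[symmetric] by (simp add: algebra_simps)
qed

lemma flux_lower:
 assumes R: "0 < R" and ta: "ta \<in> {1, - 1}"
 shows "Msp * ah / 4 - 2 * Msp * integral\<^sup>L lborel (Bz ta R) <= ta * sgn_tube * Fl R"
proof -
 let ?g = "%z. Msp / 2 * Az ta R z - 2 * Msp * Bz ta R z"
 let ?h = "%z. hl (P z) * (sgn_tube * speed u D z * (phi (fst z) * bump' R (snd z)))"
 have ig: "integrable lborel ?g" using Az_integral(1)[OF R ta] Bz_integrable[OF R] by simp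
 have gW: "indicator Wd z *\<^sub>R ?g z = ?g z" for z
 proof (cases "z \<in> Wd")
  case False
  then have "z \<notin> Zc R" using Zc_W by blast
  from off_Zc[OF R this] show ?thesis
  proof
   assume "phi (fst z) = 0" then show ?thesis by (simp add: Az_def Bz_def)
  next
   assume "bump' R (snd z) = 0" then show ?thesis by (simp add: Az_def Bz_def)
  qed
 qed simp
 have ss: "sgn_tube * sgn_tube = 1" by (simp add: sgn_tube_def)
 have "Msp * ah / 4 - 2 * Msp * integral\<^sup>L lborel (Bz ta R) <= Msp / 2 * integral\<^sup>L lborel (Az ta R) - 2 * Msp * integral\<^sup>L lborel (Bz ta R)"
  using mult_left_mono[OF Az_integral(2)[OF R ta], of "Msp / 2"] Msp_nonneg by simp
 also have "... = integral\<^sup>L lborel ?g" using Az_integral(1)[OF R ta] Bz_integrable[OF R] by simp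
 also have "... = set_lebesgue_integral lborel Wd ?g" unfolding set_lebesgue_integral_def gW ..
 also have "... <= set_lebesgue_integral lborel Wd (%z. ta * sgn_tube * ?h z)"
 proof (rule set_integral_mono)
  show "set_integrable lborel Wd ?g" unfolding set_integrable_def gW by (rule ig)
  show "set_integrable lborel Wd (%z. ta * sgn_tube * ?h z)" by (rule set_integrable_mult_right[OF Fl_coords(1)[OF R]])
  fix z assume "z \<in> Wd"
  have "ta * sgn_tube * ?h z = (sgn_tube * sgn_tube) * (ta * (hl (P z) * (speed u D z * (phi (fst z) * bump' R (snd z)))))"
   by (simp add: mult_ac)
  then have e: "ta * sgn_tube * ?h z = ta * (hl (P z) * (speed u D z * (phi (fst z) * bump' R (snd z))))"
   unfolding ss by (simp only: mult_1_left)
  show "?g z <= ta * sgn_tube * ?h z" unfolding e by (rule flux_pointwise[OF R ta \<open>z \<in> Wd\<close>])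
 qed
 also have "... = ta * sgn_tube * Fl R" unfolding Fl_coords(2)[OF R] by (rule set_integral_mult_right)
 finally show ?thesis .
qed

lemma nn_integral_interval_bound:
 assumes "!!xi::real. g xi <= c * indicator {-s..s} xi" "0 <= c" "0 <= s"
 shows "(\<integral>\<^sup>+xi. ennreal (g xi) \<partial>lborel) <= ennreal (c * (2 * s))"
proof -
 have "(\<integral>\<^sup>+xi. ennreal (g xi) \<partial>lborel) <= (\<integral>\<^sup>+xi. ennreal c * indicator {-s..s} xi \<partial>lborel)"
 proof (rule nn_integral_mono)
  fix xi show "ennreal (g xi) <= ennreal c * indicator {-s..s} xi"
  proof (cases "xi \<in> {-s..s}")
   case True then show ?thesis using ennreal_leI[OF assms(1)[of xi]] by simp
  next
   case False
   have "g xi <= 0" using assms(1)[of xi] unfolding indicator_simps(2)[OF False] by simp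
   then show ?thesis by (simp add: ennreal_neg)
  qed
 qed
 also have "... = ennreal (c * (2 * s))" using assms by (simp add: nn_integral_cmult ennreal_mult)
 finally show ?thesis .
qed

text \<open>On one good line the signs disagree only for \<open>|xi| <= s\<close>, with
  \<open>s\<close> depending on the line, while the derivative of the bump is at most
  \<open>4 / (n + 1)\<close>.\<close>

lemma mismatch_vanishes:
 assumes ta: "ta \<in> {1, - 1}"
  and g: "good rh" "\<forall>\<^sub>F xi in at_top. 0 < ta * fst (P (rh,xi))" "\<forall>\<^sub>F xi in at_top. ta * fst (P (rh, - xi)) < 0"
 shows "(%n. \<integral>\<^sup>+xi. ennreal (Bz ta (real (Suc n)) (rh,xi)) \<partial>lborel) \<longlonglongrightarrow> 0"
proof -
 have W: "(rh,xi) \<in> Wd" for xi using g(1) Wd_I by (auto simp: good_def)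
 obtain s where s: "0 < s" "!!xi. s <= xi ==> 0 < ta * fst (P (rh,xi)) \<and> ta * fst (P (rh, - xi)) < 0"
 proof -
  from eventually_conj[OF g(2,3)] obtain s where s: "!!xi. s <= xi ==> 0 < ta * fst (P (rh,xi)) \<and> ta * fst (P (rh, - xi)) < 0"
   unfolding eventually_at_top_linorder by blast
  show ?thesis by (rule that[of "max s 1"]) (use s in auto)
 qed
 have m0: "mis ta (rh,xi) = 0" if "s < \<bar>xi\<bar>" for xi
 proof (cases "0 <= xi")
  case True
  then have "0 < ta * fst (P (rh,xi))" "0 < xi" using s(1) s(2)[of xi] that by auto
  then show ?thesis using ta W by (auto simp: mis_def Nreg_def indicator_def)
 next
  case False
  then have "ta * fst (P (rh, - (- xi))) < 0" "xi < 0" using s(1) s(2)[of "- xi"] that by auto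
  then show ?thesis using ta W by (auto simp: mis_def Nreg_def indicator_def)
 qed
 have le: "(\<integral>\<^sup>+xi. ennreal (Bz ta (real (Suc n)) (rh,xi)) \<partial>lborel) <= ennreal (4 / real (Suc n) * (2 * s))" for n
 proof (rule nn_integral_interval_bound)
  fix xi
  show "Bz ta (real (Suc n)) (rh,xi) <= 4 / real (Suc n) * indicator {-s..s} xi"
  proof (cases "s < \<bar>xi\<bar>")
   case True then show ?thesis using m0 by (simp add: Bz_def)
  next
   case False
   have "Bz ta (real (Suc n)) (rh,xi) <= 4 / real (Suc n) * indicator (Zc (real (Suc n))) (rh,xi)" by (rule Bz_range(2)) simp
   also have "... <= 4 / real (Suc n) * 1" by (intro mult_left_mono) (auto simp: indicator_def)
   finally have "Bz ta (real (Suc n)) (rh,xi) <= 4 / real (Suc n) * 1" .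
   moreover have "xi \<in> {-s..s}" using False by auto
   ultimately show ?thesis by (simp only: indicator_simps(1))
  qed
 qed (use s in auto)
 have "(%n. 4 * (2 * s) * inverse (real (Suc n))) \<longlonglongrightarrow> 4 * (2 * s) * 0" by (intro tendsto_intros LIMSEQ_inverse_real_of_nat)
 then have "(%n. ennreal (4 / real (Suc n) * (2 * s))) \<longlonglongrightarrow> ennreal 0" by (intro tendsto_ennrealI) (simp add: divide_inverse mult_ac)
 from tendsto_sandwich[OF _ _ tendsto_const this] show ?thesis using le by auto
qed

text \<open>The length \<open>s\<close> of the mismatch is not uniform over the lines, so the limit
  is taken by dominated convergence. The bound 8 is the height \<open>4 / R\<close> times the length
  \<open>2 * R\<close> of the support.\<close>

lemma mismatch_integral_vanishes:
 assumes ta: "ta \<in> {1, - 1}"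
  and o: "!!rh. good rh ==> (\<forall>\<^sub>F xi in at_top. 0 < ta * fst (P (rh,xi))) \<and> (\<forall>\<^sub>F xi in at_top. ta * fst (P (rh, - xi)) < 0)"
 shows "(%n. integral\<^sup>L lborel (Bz ta (real n))) \<longlonglongrightarrow> 0"
proof -
 let ?I = "%n rh. \<integral>\<^sup>+xi. ennreal (Bz ta (real (Suc n)) (rh,xi)) \<partial>lborel"
 have mB: "(%z. ennreal (Bz ta R z)) \<in> borel_measurable (lborel \<Otimes>\<^sub>M lborel)" for R
  unfolding lborel_prod using Bz_measurable by simp
 have e: "(\<integral>\<^sup>+rh. ?I n rh \<partial>lborel) = ennreal (integral\<^sup>L lborel (Bz ta (real (Suc n))))" for n
 proof -
  have "(\<integral>\<^sup>+rh. ?I n rh \<partial>lborel) = (\<integral>\<^sup>+z. ennreal (Bz ta (real (Suc n)) z) \<partial>lborel)"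
   using lborel.nn_integral_fst[OF mB] by (simp add: lborel_prod)
  also have "... = ennreal (integral\<^sup>L lborel (Bz ta (real (Suc n))))"
   by (rule nn_integral_eq_integral[OF Bz_integrable]) (simp, intro AE_I2 Bz_range(1), rule of_nat_0_less_iff[THEN iffD2], simp)
  finally show ?thesis .
 qed
 have "(%n. \<integral>\<^sup>+rh. ?I n rh \<partial>lborel) \<longlonglongrightarrow> (\<integral>\<^sup>+rh. 0 \<partial>(lborel :: real measure))"
 proof (rule nn_integral_dominated_convergence[where u="?I" and u'="%_. 0" and w="%rh. 8 * indicator {ctr D - ah..ctr D + ah} rh"])
  show "?I n \<in> borel_measurable lborel" for n using lborel.borel_measurable_nn_integral_fst[OF mB] .
  show "(\<integral>\<^sup>+rh. 8 * indicator {ctr D - ah..ctr D + ah} rh \<partial>lborel) < \<infinity>"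
   using emeasure_compact_finite[OF compact_Icc[of "ctr D - ah" "ctr D + ah"]]
   by (simp add: nn_integral_cmult ennreal_mult_less_top)
  have z: "?I n rh = 0" if "rh \<notin> {ctr D - ah..ctr D + ah}" for rh n
  proof -
   have "phi rh = 0" using that by (intro phi_range(3)) auto
   then show ?thesis by (simp add: Bz_def)
  qed
  show "AE rh in lborel. ?I n rh <= 8 * indicator {ctr D - ah..ctr D + ah} rh" for n
  proof (intro AE_I2)
   fix rh
   have "?I n rh <= ennreal (4 / real (Suc n) * (2 * real (Suc n)))"
   proof (rule nn_integral_interval_bound)
    fix xi
    have "Bz ta (real (Suc n)) (rh,xi) <= 4 / real (Suc n) * indicator (Zc (real (Suc n))) (rh,xi)" by (rule Bz_range(2)) simp
    also have "... <= 4 / real (Suc n) * indicator {- real (Suc n)..real (Suc n)} xi"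
     by (intro mult_left_mono) (auto simp: indicator_def Zc_def)
    finally show "Bz ta (real (Suc n)) (rh,xi) <= 4 / real (Suc n) * indicator {- real (Suc n)..real (Suc n)} xi" .
   qed auto
   also have "4 / real (Suc n) * (2 * real (Suc n)) = 8" by (simp add: divide_simps)
   also have "ennreal 8 = 8" by simp
   finally show "?I n rh <= 8 * indicator {ctr D - ah..ctr D + ah} rh"
    using z[of rh n] by (cases "rh \<in> {ctr D - ah..ctr D + ah}") auto
  qed
  show "AE rh in lborel. (%n. ?I n rh) \<longlonglongrightarrow> 0"
   using good_ae
  proof (rule AE_mp, intro AE_I2 impI)
   fix rh assume g: "rh \<in> Iv --> good rh"
   show "(%n. ?I n rh) \<longlonglongrightarrow> 0"
   proof (cases "rh \<in> {ctr D - ah..ctr D + ah}")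
    case True
    then have "rh \<in> Iv" using ah by (auto simp: Iv_def)
    then have "good rh" using g by blast
    from mismatch_vanishes[OF ta this] o[OF this] show ?thesis by blast
   next
    case False then show ?thesis using z by simp
   qed
  qed
 qed simp_all
 then have "(%n. ennreal (integral\<^sup>L lborel (Bz ta (real (Suc n))))) \<longlonglongrightarrow> ennreal 0" unfolding e by simp
 then have "(%n. integral\<^sup>L lborel (Bz ta (real (Suc n)))) \<longlonglongrightarrow> 0"
  by (rule tendsto_ennrealD) (intro always_eventually allI integral_nonneg_AE AE_I2 Bz_range(1) of_nat_0_less_iff[THEN iffD2] zero_less_Suc order_refl)+
 then show ?thesis by (rule LIMSEQ_imp_Suc)
qed

text \<open>Here \<open>si\<close> is the direction in which the tube carries the step along the
  strip. Up to a vanishing error a fixed fraction of the flux survives in that direction.\<close>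

lemma flux_limit:
 "\<exists>si\<in>{1, - 1}. \<exists>r. r \<longlonglongrightarrow> 0 \<and> (\<forall>n>0. tube_flux u D xi / 16 - r n <= si * Fl (real n))"
proof -
 obtain ta where ta: "ta \<in> {1, - 1}" and o: "!!rh. good rh ==> (\<forall>\<^sub>F xi in at_top. 0 < ta * fst (P (rh,xi))) \<and> (\<forall>\<^sub>F xi in at_top. ta * fst (P (rh, - xi)) < 0)"
  using orientation by blast
 let ?r = "%n. 2 * Msp * integral\<^sup>L lborel (Bz ta (real n))"
 have "?r \<longlonglongrightarrow> 2 * Msp * 0" by (intro tendsto_intros mismatch_integral_vanishes ta o)
 then have r: "?r \<longlonglongrightarrow> 0" by simp
 have "tube_flux u D xi / 16 - ?r n <= ta * sgn_tube * Fl (real n)" if "0 < n" for n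
 proof -
  have "0 <= hw D * Msp" using hw_pos Msp_nonneg by simp
  moreover have "tube_flux u D xi <= 2 * (hw D * Msp)" using tube_flux_le[of xi] by (simp only: mult.assoc)
  moreover have "Msp * ah / 4 = 3 / 16 * (hw D * Msp)" by (simp add: ah_def)
  ultimately have "tube_flux u D xi / 16 <= Msp * ah / 4" by linarith
  then show ?thesis using flux_lower[of "real n", OF _ ta] that by simp
 qed
 moreover have "ta * sgn_tube \<in> {1, - 1}" using ta by (auto simp: sgn_tube_def)
 ultimately show ?thesis using r by blast
qed

end

section \<open>Energy balance in a tube\<close>

context reactive_flow
begin

lemma Yr_closed: "closed Yr" by (cases b) (auto simp: yrange_def)

lemma dom_borel: "UNIV \<times> Yr \<in> sets (borel :: plane measure)"
 by (intro borel_closed closed_Times Yr_closed) simp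

lemma majorant_strip:
 assumes ta: "0 <= ta"
 shows "(\<integral>\<^sup>+p. indicator strip p * ennreal (indicator (UNIV \<times> Yr) p * majorant p ta) \<partial>lborel) <= ennreal (KD ta)"
proof -
 have c: "continuous_on strip (%p. majorant p ta)"
  unfolding majorant_def by (intro continuous_intros flow_cont) (use ta yr in auto)
 have b: "integral (slab (real n)) (%p. majorant p ta) <= KD ta" for n
 proof -
  have "integral (slab (real n)) (%p. majorant p ta) <= integral (slab (real n + 1)) (%p. majorant p ta)"
   by (rule slab_integral_mono[OF cont_majorant[OF ta]]) (auto simp: majorant_nonneg)
  also have "... <= KD ta" by (rule majorant_integral[OF ta]) simp
  finally show ?thesis .
 qed
 have i: "set_integrable lborel strip (%p. majorant p ta)"
  by (rule strip_integrable[OF c, where M="KD ta"]) (simp only: abs_of_nonneg[OF majorant_nonneg] b)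
 have "(%n. integral (slab (real n)) (%p. 1 * majorant p ta)) \<longlonglongrightarrow> set_lebesgue_integral lborel strip (%p. majorant p ta)"
  by (rule strip_limit[OF c i]) auto
 then have "set_lebesgue_integral lborel strip (%p. majorant p ta) <= KD ta"
  by (rule LIMSEQ_le_const2) (use b in auto)
 moreover have "(\<integral>\<^sup>+p. ennreal (indicator strip p *\<^sub>R majorant p ta) \<partial>lborel) = ennreal (set_lebesgue_integral lborel strip (%p. majorant p ta))"
  unfolding set_lebesgue_integral_def
  by (rule nn_integral_eq_integral[OF i[unfolded set_integrable_def]]) (intro AE_I2, simp add: majorant_nonneg)
 moreover have "indicator strip p * ennreal (indicator (UNIV \<times> Yr) p * majorant p ta) = ennreal (indicator strip p *\<^sub>R majorant p ta)" for p
 proof (cases "p \<in> strip")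
  case True
  then have "p \<in> UNIV \<times> Yr" using yr by auto
  with True show ?thesis by simp
 qed simp
 ultimately show ?thesis by (simp add: ennreal_leI)
qed

text \<open>The vertical range of the box on which tubes are integrated: the strip itself between
  walls, and \<open>[-m, m]\<close> on the universal cover, where a tube may pass through several
  periods.\<close>

definition "ya m = (if b = Neumann then 0 else - m :: real)"
definition "yb m = (if b = Neumann then H else m :: real)"
abbreviation "ybox m \<equiv> cbox (- m, ya m) (m, yb m)"

lemma ybox:
 assumes m: "0 < m"
 shows "{ya m..yb m} \<subseteq> Yr" "ya m <= yb m" "p \<in> ybox m ==> snd p \<in> Yr" "p \<in> ybox m ==> \<bar>fst p\<bar> <= m"
proof -
 show 1: "{ya m..yb m} \<subseteq> Yr" "ya m <= yb m" using pos(1) m by (simp_all add: ya_def yb_def yrange_def split: bdry.splits)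
 assume "p \<in> ybox m"
 then have "fst p \<in> {-m..m}" "snd p \<in> {ya m..yb m}" unfolding cbox_Pair_eq mem_Times_iff by (simp_all add: box_real)
 then show "snd p \<in> Yr" "\<bar>fst p\<bar> <= m" using 1 by auto
qed

text \<open>Truncating \<open>G\<close> to \<open>|x| <= m\<close> keeps its period in
  \<open>y\<close>, so the comparison of disjoint sets with the strip applies to it and leaves the
  slab of half-width \<open>m\<close> on the right.\<close>

lemma cores_integral_le:
 fixes A :: "'j => plane set" and B :: "'j => plane => real"
 assumes J: "finite J" and A: "!!j. open (A j)" "!!j. A j \<subseteq> UNIV \<times> Yr" and m: "0 < m"
  and disj: "!!i j (k::int). i \<in> J ==> j \<in> J ==> i ~= j \<or> k ~= 0 ==> disjnt (A i) ((+) (0, of_int k * H) ` A j)"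
  and G: "continuous_on (UNIV \<times> Yr) G" "!!p. snd p \<in> Yr ==> 0 <= G p"
  and per: "!!p. b = Periodic ==> G (fst p, snd p + H) = G p"
  and B: "!!j. j \<in> J ==> continuous_on (ybox m) (B j)" "!!j p. j \<in> J ==> p \<in> ybox m ==> 0 <= B j p"
   "!!j p. j \<in> J ==> p \<in> ybox m ==> B j p <= indicator (A j) p * G p"
 shows "(\<Sum>j\<in>J. integral (ybox m) (B j)) <= integral (slab m) G"
proof -
 let ?S = "{-m..m} \<times> Yr"
 let ?g = "%p. ennreal (indicator ?S p * G p)"
 have S: "?S \<in> sets borel" by (intro borel_closed closed_Times Yr_closed) simp
 have g: "?g \<in> borel_measurable borel"
 proof -
  have "?S \<subseteq> UNIV \<times> Yr" by (rule Sigma_mono) auto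
  from borel_measurable_continuous_on_indicator[OF S continuous_on_subset[OF G(1) this]] show ?thesis by simp
 qed
 have gp: "?g (fst p, snd p + H) = ?g p" if "b = Periodic" for p
  using per[OF that, of p] that by (simp add: yrange_def indicator_def mem_Times_iff)
 have cs: "continuous_on (slab m) G"
  by (rule continuous_on_subset[OF G(1)]) (use box_mem(1) in \<open>auto simp: mem_Times_iff\<close>)
 have "ennreal (\<Sum>j\<in>J. integral (ybox m) (B j)) = (\<Sum>j\<in>J. ennreal (integral (ybox m) (B j)))"
  using B by (intro sum_ennreal[symmetric] integral_nonneg_box) auto
 also have "... = (\<Sum>j\<in>J. \<integral>\<^sup>+p. ennreal (indicator (ybox m) p * B j p) \<partial>lborel)"
  using nn_integral_continuous_box[OF B(1,2)] by (intro sum.cong) auto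
 also have "... <= (\<Sum>j\<in>J. \<integral>\<^sup>+p. indicator (A j) p * ?g p \<partial>lborel)"
 proof (intro sum_mono nn_integral_mono)
  fix j p assume j: "j \<in> J"
  show "ennreal (indicator (ybox m) p * B j p) <= indicator (A j) p * ?g p"
  proof (cases "p \<in> ybox m")
   case True
   have "\<bar>fst p\<bar> <= m" "snd p \<in> Yr" using ybox(3,4)[OF m True] by auto
   then have pS: "p \<in> ?S" by (auto simp: mem_Times_iff abs_le_iff)
   have "ennreal (B j p) <= ennreal (indicator (A j) p * G p)" by (rule ennreal_leI[OF B(3)[OF j True]])
   also have "... = indicator (A j) p * ?g p" using pS by (cases "p \<in> A j") auto
   finally show ?thesis using True by simp
  qed simp
 qed
 also have "... <= (\<integral>\<^sup>+p. indicator strip p * ?g p \<partial>lborel)"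
 proof (rule cores_nn_integral_le[where A=A and g="?g" and J=J])
  show "finite J" by (rule J)
  show "open (A j)" "A j \<subseteq> UNIV \<times> Yr" for j by (rule A(1), rule A(2))
  show "?g \<in> borel_measurable borel" by (rule g)
  show "?g (fst p, snd p + H) = ?g p" if "b = Periodic" for p by (rule gp[OF that])
  show "disjnt (A i) ((+) (0, of_int k * H) ` A j)" if "i \<in> J" "j \<in> J" "i ~= j \<or> k ~= 0" for i j and k :: int
   by (rule disj[OF that])
 qed
 also have "... = (\<integral>\<^sup>+p. ennreal (indicator (slab m) p * G p) \<partial>lborel)"
 proof (intro nn_integral_cong)
  fix p :: "plane"
  have "p \<in> slab m \<longleftrightarrow> p \<in> strip \<and> p \<in> ?S" using yr(2)[of "snd p"]
   unfolding cbox_Pair_eq mem_Times_iff by (auto simp: box_real)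
  then show "indicator strip p * ?g p = ennreal (indicator (slab m) p * G p)"
   by (cases "p \<in> strip"; cases "p \<in> ?S") simp_all
 qed
 also have "... = ennreal (integral (slab m) G)"
  by (rule nn_integral_continuous_box[OF cs]) (use G(2) box_mem(1) in blast)
 finally show ?thesis
  using integral_nonneg_box[OF cs] G(2) box_mem(1) by (subst (asm) ennreal_le_iff) blast+
qed

text \<open>On \<open>|x| <= m\<close> the cutoff of radius \<open>2 * m\<close> is at least 9/16,
  hence at least one half.\<close>

lemma slab_le_cutoff:
 assumes m: "0 < m" and c: "continuous_on (slab (2 * m)) h" and h: "!!p. p \<in> slab (2 * m) ==> 0 <= h p"
 shows "integral (slab m) h <= 2 * integral (slab (2 * m)) (%p. cutoff (2 * m) (fst p) * h p)"
proof -
 note s = slab_subset[of m "2 * m"]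
 have cc: "continuous_on (slab (2 * m)) (%p. cutoff (2 * m) (fst p) * h p)" by (intro continuous_intros c)
 have "integral (slab m) h <= integral (slab m) (%p. 2 * (cutoff (2 * m) (fst p) * h p))"
 proof (rule integral_mono_box)
  fix p assume p: "p \<in> slab m"
  have "\<bar>fst p / (2 * m)\<bar> <= 1/2" using box_mem(2)[OF p] m by (simp add: abs_divide pos_divide_le_eq)
  then have "\<bar>fst p / (2 * m)\<bar>\<^sup>2 <= (1/2)^2" by (intro power_mono) auto
  then have "3/4 <= 1 - (fst p / (2 * m))\<^sup>2" unfolding power2_abs by (simp add: power2_eq_square)
  then have "(3/4)^2 <= (1 - (fst p / (2 * m))\<^sup>2)^2" by (intro power_mono) auto
  moreover have "(3/4)^2 = (9/16::real)" by (simp add: power2_eq_square)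
  ultimately have "1 <= 2 * cutoff (2 * m) (fst p)" unfolding cutoff_def by linarith
  from mult_right_mono[OF this, of "h p"] show "h p <= 2 * (cutoff (2 * m) (fst p) * h p)"
   using h[of p] p s m by auto
 qed (use m s in \<open>auto intro!: continuous_on_subset[OF c] continuous_on_subset[OF cc] continuous_on_mult_left\<close>)
 also have "... = 2 * integral (slab m) (%p. cutoff (2 * m) (fst p) * h p)" by simp
 also have "... <= 2 * integral (slab (2 * m)) (%p. cutoff (2 * m) (fst p) * h p)"
  using m h cutoff_slab[of "2 * m"] by (intro mult_left_mono slab_integral_mono[OF cc]) auto
 finally show ?thesis .
qed

end

context flow_with_tube
begin

lemma Zs_ybox: "\<exists>m0>0. \<forall>m\<ge>m0. Zs R \<subseteq> ybox m \<and> (\<forall>p\<in>Zs R. \<bar>fst p\<bar> < m \<and> (b = Periodic --> \<bar>snd p\<bar> < m))"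
proof -
 obtain B where B: "!!p. p \<in> Zs R ==> norm p <= B" using compact_imp_bounded[OF Zs_compact] unfolding bounded_iff by blast
 have 1: "\<bar>fst p\<bar> < m" "\<bar>snd p\<bar> < m" if "p \<in> Zs R" "max 1 (B + 1) <= m" for p m
  using B[OF that(1)] that(2) norm_fst_le[of "fst p" "snd p"] norm_snd_le[of "snd p" "fst p"] by auto
 have 2: "p \<in> ybox m" if p: "p \<in> Zs R" and m: "max 1 (B + 1) <= m" for p m
 proof -
  have "snd p \<in> Yr" using core_strip Zs_core p by blast
  moreover have "b = Neumann \<or> b = Periodic" using bdry.exhaust by blast
  ultimately have "ya m <= snd p" "snd p <= yb m" using 1(2)[OF p m] by (auto simp: ya_def yb_def yrange_def)
  then show ?thesis using 1(1)[OF p m] unfolding cbox_Pair_eq mem_Times_iff abs_less_iff by (auto simp: box_real)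
 qed
 show ?thesis by (rule exI[of _ "max 1 (B + 1)"]) (use 1 2 in auto)
qed

text \<open>The diffusion and reaction terms of the weak form for \<open>G = Psi\<close> with
  reversed sign: everything on its right-hand side except transport.\<close>

definition "edens R ta p = ka * psi R p * (2 * f (T p ta) * f' (T p ta)) * gsq p ta
 + ka * (f (T p ta))^2 * Dpsi R p (Tx p ta, Ty p ta) - q * psi R p * (f (T p ta))^2 * f (T p ta)"

lemma Psi_bounds:
 assumes "s \<in> {0..1}"
 shows "\<bar>Psi s - Psi 0\<bar> <= F^2 * s \<and> \<bar>Psi s - Psi 1\<bar> <= F^2 * (1 - s) \<and> \<bar>Psi s\<bar> <= F^2"
proof (rule C2fun_transport_bounds[OF C2fun_Psi _ Psi_0 assms])
 fix s :: real assume "s \<in> {0..1}"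
 from f_unit[OF this] show "\<bar>(f s)^2\<bar> <= F^2" by (simp add: power_mono)
qed

text \<open>Replacing \<open>Psi(T)\<close> by \<open>Psi 1\<close> times the step costs at most
  \<open>F^2\<close> times the majorant, and the derivative of the test function along
  \<open>u\<close> contributes the factor \<open>1 / R\<close>.\<close>

lemma flux_error:
 assumes R: "0 < R" and ta: "0 < ta"
 shows "integrable lborel (%p. (indicator (core D) p * Psi (T p ta)) * Dpsi R p (u p))"
  "\<bar>integral\<^sup>L lborel (%p. (indicator (core D) p * Psi (T p ta)) * Dpsi R p (u p)) - Psi 1 * Fl R\<bar> <= 4 * F^2 * K * U / R * KD ta"
proof -
 have ta0: "0 <= ta" using ta by simp
 let ?h = "%p. indicator (core D) p * Psi (T p ta)"
 let ?c = "F^2 * (4 / R * (K * U))"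
 have c0: "0 <= ?c" using K pos R by simp
 have "continuous_on (core D) (%p. Psi (T p ta))"
  by (intro cont_compose_unit[OF C2funD(1)[OF C2fun_Psi]] flow_cont continuous_intros core_strip T_unit ta0) (use ta0 in auto)
 from borel_measurable_continuous_on_indicator[OF borel_open[OF core_open] this]
 have hm: "?h \<in> borel_measurable borel" by simp
 have hb: "\<bar>?h p\<bar> <= F^2" if "p \<in> core D" for p
  using Psi_bounds[OF T_unit[OF core_strip[OF that] ta0]] that by simp
 have h1: "\<bar>hl p\<bar> <= 1" for p by (simp add: hl_def)
 note i = cutoff_flux_integrable(2)[OF R hm hb] cutoff_flux_integrable(2)[OF R hl_measurable h1]
 show "integrable lborel (%p. ?h p * Dpsi R p (u p))" by (rule i(1))
 have FlL: "Fl R = integral\<^sup>L lborel (%p. hl p * Dpsi R p (u p))"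
  unfolding Fl_def by (rule cutoff_flux_integrable(4)[OF R hl_measurable h1])
 let ?d = "%p. ?h p * Dpsi R p (u p) - Psi 1 * (hl p * Dpsi R p (u p))"
 have id: "integrable lborel ?d" using i by simp
 have e: "integral\<^sup>L lborel (%p. ?h p * Dpsi R p (u p)) - Psi 1 * Fl R = integral\<^sup>L lborel ?d"
  unfolding FlL using i by simp
 let ?g = "%p. ennreal (indicator (UNIV \<times> Yr) p * majorant p ta)"
 have cm: "continuous_on (UNIV \<times> Yr) (%p. majorant p ta)"
  unfolding majorant_def by (intro continuous_intros flow_cont) (use ta in auto)
 have gm: "?g \<in> borel_measurable borel"
  using borel_measurable_continuous_on_indicator[OF dom_borel cm] by simp
 have gp: "?g (fst p, snd p + H) = ?g p" if "b = Periodic" for p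
  using bc_Periodic[OF that ta, of "fst p" "snd p"] that by (simp add: yrange_def majorant_def)
 have "\<bar>integral\<^sup>L lborel ?d\<bar> <= integral\<^sup>L lborel (%p. \<bar>?d p\<bar>)"
  using integral_norm_bound[of lborel ?d] by simp
 also have "... <= ?c * KD ta"
 proof (rule integral_real_bounded)
  show "0 <= ?c * KD ta" by (rule mult_nonneg_nonneg[OF c0 KD_nonneg])
  have "(\<integral>\<^sup>+p. ennreal \<bar>?d p\<bar> \<partial>lborel) <= (\<integral>\<^sup>+p. ennreal ?c * (indicator (core D) p * ?g p) \<partial>lborel)"
  proof (rule nn_integral_mono)
   fix p
   show "ennreal \<bar>?d p\<bar> <= ennreal ?c * (indicator (core D) p * ?g p)"
   proof (cases "p \<in> core D")
    case True
    note Y = core_strip[OF True]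
    have pS: "p \<in> UNIV \<times> Yr" using Y by (simp add: mem_Times_iff)
    have Y': "snd (fst p, snd p) \<in> Yr" using Y by simp
    note Pb = Psi_bounds[OF T_unit[OF Y ta0]]
    have "\<bar>Psi (T p ta) - Psi 1 * hl p\<bar> <= F^2 * majorant p ta"
    proof (cases "fst p < 0")
     case True
     have "F^2 * (1 - T p ta) <= F^2 * majorant p ta" using majorant_bounds(1)[OF Y ta0] True by (intro mult_left_mono) auto
     then show ?thesis using Pb True by (simp add: hl_def)
    next
     case False
     have "F^2 * T p ta <= F^2 * majorant p ta" using majorant_bounds(2)[OF Y ta0] False by (intro mult_left_mono) auto
     then show ?thesis using Pb False by (simp add: hl_def Psi_0)
    qed
    then have "\<bar>Psi (T p ta) - Psi 1 * hl p\<bar> * \<bar>Dpsi R p (u p)\<bar> <= (F^2 * majorant p ta) * (4 / R * (K * U))"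
     using Dpsi_bound(2)[OF R Y] majorant_nonneg by (intro mult_mono) auto
    moreover have "?d p = (Psi (T p ta) - Psi 1 * hl p) * Dpsi R p (u p)" using True by (simp add: algebra_simps)
    ultimately have "\<bar>?d p\<bar> <= ?c * majorant p ta" by (simp add: abs_mult mult_ac)
    from ennreal_leI[OF this] have "ennreal \<bar>?d p\<bar> <= ennreal ?c * ennreal (majorant p ta)"
     by (simp only: ennreal_mult'[OF c0])
    moreover have "indicator (core D) p * ?g p = ennreal (majorant p ta)" using True pS by simp
    ultimately show ?thesis by (simp only:)
   next
    case False then show ?thesis by (simp add: Dpsi_def)
   qed
  qed
  also have "... = ennreal ?c * (\<integral>\<^sup>+p. indicator (core D) p * ?g p \<partial>lborel)"
   using gm core_open by (intro nn_integral_cmult) (simp add: borel_open)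
  also have "... <= ennreal ?c * ennreal (KD ta)"
  proof (intro mult_left_mono)
   have "(\<integral>\<^sup>+p. indicator (core D) p * ?g p \<partial>lborel) <= (\<integral>\<^sup>+p. indicator strip p * ?g p \<partial>lborel)"
   proof (rule core_nn_integral_le[where g="?g"])
    show "?g \<in> borel_measurable borel" by (rule gm)
    show "?g (fst p, snd p + H) = ?g p" if "b = Periodic" for p by (rule gp[OF that])
   qed
   also note majorant_strip[OF ta0]
   finally show "(\<integral>\<^sup>+p. indicator (core D) p * ?g p \<partial>lborel) <= ennreal (KD ta)" .
  qed simp
  also have "... = ennreal (?c * KD ta)" by (rule ennreal_mult[OF c0 KD_nonneg, symmetric])
  finally show "(\<integral>\<^sup>+p. ennreal \<bar>?d p\<bar> \<partial>lborel) <= ennreal (?c * KD ta)" .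
 qed
 finally show "\<bar>integral\<^sup>L lborel (%p. ?h p * Dpsi R p (u p)) - Psi 1 * Fl R\<bar> <= 4 * F^2 * K * U / R * KD ta"
  unfolding e by (simp add: mult_ac)
qed

lemma psi_partial:
 assumes R: "0 < R"
 shows "((%x. psi R (x,y)) has_real_derivative Dpsi R (x,y) (1,0)) (at x within A)"
  "((%y. psi R (x,y)) has_real_derivative Dpsi R (x,y) (0,1)) (at y within A)"
proof -
 have "((%x. (x,y)) has_derivative (%h. (h,0))) (at x)" "((%y. (x,y)) has_derivative (%h. (0,h))) (at y)"
  by (intro has_derivative_Pair has_derivative_ident has_derivative_const)+
 from has_derivative_compose[OF this(1) psi_derivative[OF R]] has_derivative_compose[OF this(2) psi_derivative[OF R]]
 have "((%x. psi R (x,y)) has_derivative (%h. Dpsi R (x,y) (h,0))) (at x)"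
  "((%y. psi R (x,y)) has_derivative (%h. Dpsi R (x,y) (0,h))) (at y)" .
 moreover have "(%h. Dpsi R (x,y) (h,0)) = (*) (Dpsi R (x,y) (1,0))" "(%h. Dpsi R (x,y) (0,h)) = (*) (Dpsi R (x,y) (0,1))"
 proof -
  have e: "Dpsi R (x,y) (h,0) = Dpsi R (x,y) (1,0) * h" "Dpsi R (x,y) (0,h) = Dpsi R (x,y) (0,1) * h" for h
   using Dpsi_linear[OF R, of "(x,y)" "(h,0)"] Dpsi_linear[OF R, of "(x,y)" "(0,h)"] by (simp_all only: fst_conv snd_conv mult_zero_left add_0_right add_0_left mult.commute[of h])
  show "(%h. Dpsi R (x,y) (h,0)) = (*) (Dpsi R (x,y) (1,0))" by (rule ext, rule e(1))
  show "(%h. Dpsi R (x,y) (0,h)) = (*) (Dpsi R (x,y) (0,1))" by (rule ext, rule e(2))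
 qed
 ultimately have "((%x. psi R (x,y)) has_real_derivative Dpsi R (x,y) (1,0)) (at x)"
  "((%y. psi R (x,y)) has_real_derivative Dpsi R (x,y) (0,1)) (at y)"
  unfolding has_field_derivative_def by simp_all
 from has_field_derivative_at_within[OF this(1)] has_field_derivative_at_within[OF this(2)]
 show "((%x. psi R (x,y)) has_real_derivative Dpsi R (x,y) (1,0)) (at x within A)"
  "((%y. psi R (x,y)) has_real_derivative Dpsi R (x,y) (0,1)) (at y within A)" .
qed

lemma cont_edens:
 assumes R: "0 < R" and ta: "0 < ta" and m: "0 < m"
 shows "continuous_on (ybox m) (edens R ta)"
proof -
 have ta0: "0 <= ta" "ta \<in> {0<..}" "ta \<in> {0..}" using ta by auto
 have e: "edens R ta p = ka * psi R p * (2 * f (T p ta) * f' (T p ta)) * ((Tx p ta)^2 + (Ty p ta)^2)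
  + ka * (f (T p ta))^2 * (Tx p ta * Dpsi R p (1,0) + Ty p ta * Dpsi R p (0,1)) - q * psi R p * (f (T p ta))^2 * f (T p ta)" for p
  using Dpsi_linear[OF R, of p "(Tx p ta, Ty p ta)"] by (simp add: edens_def)
 show ?thesis unfolding e[abs_def]
  by (intro continuous_intros cont_psi cont_Dpsi R flow_cont T_unit ybox(3)[OF m] ta0) (assumption | rule ta0 | rule T_unit | erule ybox(3)[OF m])+
qed

lemma tube_rate:
 assumes R: "0 < R" and ta: "0 < ta" and m: "0 < m" "Zs R \<subseteq> ybox m" "!!p. p \<in> Zs R ==> \<bar>fst p\<bar> < m \<and> (b = Periodic --> \<bar>snd p\<bar> < m)"
 shows "\<bar>integral (ybox m) (%p. psi R p * (f (T p ta))^2 * Tt p ta) - Psi 1 * Fl R\<bar>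
  <= 4 * F^2 * K * U / R * KD ta + integral (ybox m) (%p. \<bar>edens R ta p\<bar>)"
proof -
 have ta0: "0 <= ta" "ta \<in> {0..}" using ta by auto
 let ?A = "%p. Psi (T p ta) * (fst (u p) * Dpsi R p (1,0) + snd (u p) * Dpsi R p (0,1))"
 have psi0: "psi R (x,y) = 0" if "m <= \<bar>x\<bar> \<or> b = Periodic \<and> m <= \<bar>y\<bar>" for x y
  using m(3)[of "(x,y)"] that by (intro off_Zs(1)[OF R]) auto
 have bd: "bdry_ok (psi R) (ya m) (yb m)"
 proof (cases "b = Neumann")
  case True then show ?thesis using ybox(1,2)[OF m(1)] unfolding bdry_ok_def ya_def yb_def by simp
 next
  case False
  then have "b = Periodic" using bdry.exhaust by blast
  then show ?thesis using ybox(1,2)[OF m(1)] psi0 m(1) unfolding bdry_ok_def ya_def yb_def by simp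
 qed
 have cA: "continuous_on (ybox m) ?A"
  by (intro continuous_intros cont_compose_unit[OF C2funD(1)[OF C2fun_Psi]] flow_cont cont_Dpsi R)
   (assumption | rule ta0 | rule T_unit | erule ybox(3)[OF m(1)])+
 note ce = cont_edens[OF R ta m(1)]
 have "integral (ybox m) (%p. psi R p * (f (T p ta))^2 * Tt p ta) =
  integral (ybox m) (%p. ?A p
   - ka * psi R p * (2 * f (T p ta) * f' (T p ta)) * ((Tx p ta)^2 + (Ty p ta)^2)
   - ka * (f (T p ta))^2 * (Dpsi R p (1,0) * Tx p ta + Dpsi R p (0,1) * Ty p ta) + q * psi R p * (f (T p ta))^2 * f (T p ta))"
  by (rule weak_identity[OF ta C2fun_Psi _ bd]) (use m(1) psi0 in \<open>auto intro!: cont_Dpsi cont_psi psi_partial R\<close>)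
 also have "... = integral (ybox m) (%p. ?A p - edens R ta p)"
 proof (intro integral_cong)
  fix p
  have "Dpsi R p (Tx p ta, Ty p ta) = Tx p ta * Dpsi R p (1,0) + Ty p ta * Dpsi R p (0,1)"
   using Dpsi_linear[OF R, of p "(Tx p ta, Ty p ta)"] by (simp only: fst_conv snd_conv)
  then show "?A p
   - ka * psi R p * (2 * f (T p ta) * f' (T p ta)) * ((Tx p ta)^2 + (Ty p ta)^2)
   - ka * (f (T p ta))^2 * (Dpsi R p (1,0) * Tx p ta + Dpsi R p (0,1) * Ty p ta) + q * psi R p * (f (T p ta))^2 * f (T p ta)
   = ?A p - edens R ta p" unfolding edens_def by (simp add: algebra_simps)
 qed
 also have "... = integral (ybox m) ?A - integral (ybox m) (edens R ta)"
  by (intro integral_diff box_integrable cA ce)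
 finally have 1: "integral (ybox m) (%p. psi R p * (f (T p ta))^2 * Tt p ta) = integral (ybox m) ?A - integral (ybox m) (edens R ta)" .
 have "set_integrable lborel (ybox m) ?A"
  using borel_integrable_compact[OF compact_cbox cA] by (simp add: set_integrable_def)
 from set_borel_integral_eq_integral(2)[OF this]
 have "integral (ybox m) ?A = integral\<^sup>L lborel (%p. indicator (ybox m) p *\<^sub>R ?A p)"
  unfolding set_lebesgue_integral_def by (rule sym)
 \<comment> \<open>The derivative of the test function is supported in \<open>Zs R\<close>, which
   lies in both the box and the core, so one indicator may be exchanged for the other.\<close>
 also have "(%p. indicator (ybox m) p *\<^sub>R ?A p) = (%p. (indicator (core D) p * Psi (T p ta)) * Dpsi R p (u p))"
 proof (rule ext)
  fix p
  have e: "fst (u p) * Dpsi R p (1,0) + snd (u p) * Dpsi R p (0,1) = Dpsi R p (u p)" using Dpsi_linear[OF R, of p "u p"] by simp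
  show "indicator (ybox m) p *\<^sub>R ?A p = (indicator (core D) p * Psi (T p ta)) * Dpsi R p (u p)"
  proof (cases "p \<in> Zs R")
   case True
   then have "p \<in> core D" "p \<in> ybox m" using Zs_core m(2) by auto
   then show ?thesis unfolding e by simp
  next
   case False then show ?thesis unfolding e by (simp add: off_Zs(2)[OF R])
  qed
 qed
 finally have "\<bar>integral (ybox m) ?A - Psi 1 * Fl R\<bar> <= 4 * F^2 * K * U / R * KD ta" using flux_error(2)[OF R ta] by simp
 then show ?thesis unfolding 1 using integral_abs_le_box[OF ce] by linarith
qed

text \<open>The cross term carries \<open>f^2 * |grad T|\<close> with the gradient of the test
  function, of order \<open>1 / h + 1 / R\<close>. Times \<open>ka\<close> and the weight
  \<open>(1 + l/h)^-1\<close> this gradient is at most a multiple of \<open>v0\<close>, and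
  \<open>2 * v0 * |grad T| <= q + ka * |grad T|^2\<close> with one factor \<open>f\<close> left over
  yields fuel and dissipation densities.\<close>

lemma edens_bound:
 assumes R: "0 < R" and ta: "0 < ta" and v0: "0 < v0" "q = v0^2 / ka" "ka / v0 <= R" and Y: "snd p \<in> Yr"
 shows "inverse (1 + ka / v0 / hw D) * \<bar>edens R ta p\<bar>
  <= indicator (core D) p * ((2 * F + 5 * K * F + F^2) * (q * f (T p ta) + ka * f (T p ta) * gsq p ta))"
proof (cases "p \<in> core D")
 case False
 then have "psi R p = 0" "Dpsi R p v = 0" for v by (simp_all add: psi_def Dpsi_def)
 then show ?thesis using False by (simp add: edens_def)
next
 case True
 have ta0: "0 <= ta" using ta by simp
 define s where "s = T p ta"
 have s: "s \<in> {0..1}" unfolding s_def by (rule T_unit[OF Y ta0])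
 define g where "g = gsq p ta"
 have g0: "0 <= g" by (simp add: g_def)
 define w where "w = inverse (1 + ka / v0 / hw D)"
 have l: "0 < ka / v0" "0 < hw D" using pos v0 hw_pos by auto
 have w: "0 < w" "w <= 1"
 proof -
  define z where "z = ka / v0 / hw D"
  have "0 < z" unfolding z_def by (rule divide_pos_pos[OF l])
  then show "0 < w" "w <= 1" unfolding w_def z_def[symmetric] by (simp_all add: inverse_le_1_iff)
 qed
 have f0: "0 <= f s" "f s <= F" "\<bar>f' s\<bar> <= F" using f_unit[OF s] f_bounds[OF s] by auto
 have ps: "0 <= psi R p" "psi R p <= 1" using psi_range[OF R, of p] by auto
 have a1: "\<bar>ka * psi R p * (2 * f s * f' s) * g\<bar> <= 2 * F * (ka * f s * g)"
 proof -
  have "psi R p * \<bar>f' s\<bar> <= 1 * F" using ps f0 by (intro mult_mono) auto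
  then have "(2 * (ka * f s * g)) * (psi R p * \<bar>f' s\<bar>) <= (2 * (ka * f s * g)) * (1 * F)"
   using pos f0 g0 by (intro mult_left_mono) auto
  then show ?thesis using pos f0 g0 ps by (simp add: abs_mult mult_ac)
 qed
 have a3: "\<bar>q * psi R p * (f s)^2 * f s\<bar> <= F^2 * (q * f s)"
 proof -
  have "psi R p * (f s)^2 <= 1 * F^2" using ps f0 by (intro mult_mono power_mono) auto
  then have "(q * f s) * (psi R p * (f s)^2) <= (q * f s) * (1 * F^2)" using pos f0 by (intro mult_left_mono) auto
  then show ?thesis using pos f0 ps by (simp add: abs_mult mult_ac)
 qed
 have a2: "w * \<bar>ka * (f s)^2 * Dpsi R p (Tx p ta, Ty p ta)\<bar> <= 5 * K * F * (q * f s + ka * f s * g)"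
 proof -
  define n where "n = sqrt g"
  have n: "0 <= n" "n^2 = g" "norm (Tx p ta, Ty p ta) = n" using g0 by (simp_all add: n_def g_def norm_prod_def)
  \<comment> \<open>The part with \<open>4 / ah = 16 / (3 * hw D)\<close> gives at most
    \<open>16/3 * v0\<close>, since \<open>w / hw D = 1 / (hw D + ka / v0)\<close>. The part with
    \<open>4 / R\<close> gives at most \<open>4 * v0\<close> because
    \<open>ka / v0 <= R\<close>.\<close>
  have wk: "w * (4 / ah + 4 / R) * ka <= 10 * v0"
  proof -
   have "w * (4 / ah) * ka = 16 / 3 * (ka / (hw D + ka / v0))"
    unfolding w_def ah_def using l v0 by (simp add: divide_simps mult.commute add_pos_pos less_imp_neq[symmetric])
   also have "ka / (hw D + ka / v0) <= ka / (ka / v0)" using l pos(2) by (intro frac_le) linarith+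
   also have "ka / (ka / v0) = v0" using pos v0 by simp
   finally have 1: "w * (4 / ah) * ka <= 16 / 3 * v0" by simp
   have "w * (4 / R * ka) <= 1 * (4 / R * ka)" using w R pos by (intro mult_right_mono) auto
   moreover have "ka / R <= v0" using v0 R pos by (simp add: divide_simps mult.commute)
   ultimately have 2: "w * (4 / R) * ka <= 4 * v0" by simp
   have "w * (4 / ah + 4 / R) * ka = w * (4 / ah) * ka + w * (4 / R) * ka" by (simp only: distrib_left distrib_right)
   then show ?thesis using 1 2 v0(1) by linarith
  qed
  have "w * \<bar>ka * (f s)^2 * Dpsi R p (Tx p ta, Ty p ta)\<bar> <= w * (ka * (f s)^2 * (K * (4 / ah + 4 / R) * n))"
   using Dpsi_bound(1)[OF R, of p "(Tx p ta, Ty p ta)"] w pos n(3) by (simp add: abs_mult mult_left_mono)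
  also have "... = (w * (4 / ah + 4 / R) * ka) * (K * (f s)^2 * n)" by (simp add: mult_ac)
  also have "... <= (10 * v0) * (K * (f s)^2 * n)" using wk K n by (intro mult_right_mono) auto
  also have "... = (5 * K * (f s * f s)) * (2 * v0 * n)" by (simp add: power2_eq_square)
  also have "... <= (5 * K * (F * f s)) * (q + ka * g)"
  proof (intro mult_mono mult_left_mono mult_right_mono)
   have "0 <= (v0 - ka * n)^2 / ka" using pos by simp
   also have "(v0 - ka * n)^2 / ka = q + ka * g - 2 * v0 * n"
    unfolding v0(2) n(2)[symmetric] using pos by (simp add: power2_eq_square field_simps)
   finally show "2 * v0 * n <= q + ka * g" by simp
  qed (use f0 K v0(1) n pos in auto)
  finally show ?thesis by (simp add: algebra_simps)
 qed
 have "\<bar>edens R ta p\<bar> <= \<bar>ka * psi R p * (2 * f s * f' s) * g\<bar> + \<bar>ka * (f s)^2 * Dpsi R p (Tx p ta, Ty p ta)\<bar> + \<bar>q * psi R p * (f s)^2 * f s\<bar>"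
  unfolding edens_def s_def g_def by linarith
 then have "w * \<bar>edens R ta p\<bar> <= w * (\<bar>ka * psi R p * (2 * f s * f' s) * g\<bar> + \<bar>ka * (f s)^2 * Dpsi R p (Tx p ta, Ty p ta)\<bar> + \<bar>q * psi R p * (f s)^2 * f s\<bar>)"
  using w by (intro mult_left_mono) auto
 also have "... = w * \<bar>ka * psi R p * (2 * f s * f' s) * g\<bar> + w * \<bar>ka * (f s)^2 * Dpsi R p (Tx p ta, Ty p ta)\<bar> + w * \<bar>q * psi R p * (f s)^2 * f s\<bar>"
  by (simp only: distrib_left)
 also have "... <= 1 * (2 * F * (ka * f s * g)) + 5 * K * F * (q * f s + ka * f s * g) + 1 * (F^2 * (q * f s))"
  using w by (intro add_mono mult_mono[OF _ a1] mult_mono[OF _ a3] a2) simp_all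
 also have "... <= (2 * F + 5 * K * F + F^2) * (q * f s + ka * f s * g)"
 proof -
  have "0 <= 2 * F * (q * f s)" "0 <= F^2 * (ka * f s * g)" using pos f0 g0 by auto
  then show ?thesis by (simp add: algebra_simps)
 qed
 finally show ?thesis unfolding w_def[symmetric] s_def[symmetric] g_def[symmetric] using True by simp
qed

end

section \<open>Summation over the tubes\<close>

context reactive_flow
begin

text \<open>A density free of the tube that dominates the weighted error terms of each of them. The
  three summands of the constant come from the diffusion, cross and reaction terms.\<close>

definition "rdens K p ta = (2 * F + 5 * K * F + F^2) * (q * f (T p ta) + ka * f (T p ta) * gsq p ta)"

end

context flow_with_tube
begin

text \<open>States what the summation uses, without chart, coordinates or locale parameters of the
  single tube, so that several tubes can be combined. The size \<open>m\<close> of the box is chosen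
  after \<open>n\<close>, since it has to contain the support of the test function;
  \<open>ka / v0 <= real n\<close> is the condition on \<open>R\<close> in the estimate of the error
  density.\<close>

lemma tube_test_functions:
 assumes v0: "0 < v0" "q = v0^2 / ka"
 defines "w \<equiv> inverse (1 + ka / v0 / hw D)"
 shows "\<exists>si r. \<bar>si\<bar> = 1 \<and> r \<longlonglongrightarrow> 0 \<and> (\<forall>n>0. ka / v0 <= real n --> (\<exists>m0>0. \<forall>m\<ge>m0. \<exists>py e.
  continuous_on (ybox m) py \<and> (\<forall>p. 0 <= py p \<and> py p <= indicator (core D) p) \<and>
  (\<forall>ta>0. continuous_on (ybox m) (e ta) \<and> (\<forall>p. 0 <= e ta p) \<and> (\<forall>p. snd p \<in> Yr --> e ta p <= indicator (core D) p * rdens K p ta) \<and>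
   w * (Psi 1 * (tube_flux u D xi / 16 - r n) - 4 * F^2 * K * U / real n * KD ta) - integral (ybox m) (e ta)
    <= w * si * integral (ybox m) (%p. py p * (f (T p ta))^2 * Tt p ta))))"
proof -
 obtain si r where si: "si \<in> {1, - 1}" and r: "r \<longlonglongrightarrow> 0" "!!n. 0 < n ==> tube_flux u D xi / 16 - r n <= si * Fl (real n)"
  using flux_limit[of xi] by blast
 have s1: "\<bar>si\<bar> = 1" using si by auto
 have w0: "0 < w"
 proof -
  have "0 < ka / v0 / hw D" using pos v0 hw_pos by (intro divide_pos_pos)
  then show ?thesis unfolding w_def by simp
 qed
 have P1: "0 <= Psi 1"
 proof -
  have "(%s. (f s)^2) integrable_on {0..1}" by (intro integrable_continuous_real continuous_intros cont_f)
  then show ?thesis unfolding Psi_def by (intro integral_nonneg) auto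
 qed
 have "\<exists>m0>0. \<forall>m\<ge>m0. \<exists>py e.
  continuous_on (ybox m) py \<and> (\<forall>p. 0 <= py p \<and> py p <= indicator (core D) p) \<and>
  (\<forall>ta>0. continuous_on (ybox m) (e ta) \<and> (\<forall>p. 0 <= e ta p) \<and> (\<forall>p. snd p \<in> Yr --> e ta p <= indicator (core D) p * rdens K p ta) \<and>
   w * (Psi 1 * (tube_flux u D xi / 16 - r n) - 4 * F^2 * K * U / real n * KD ta) - integral (ybox m) (e ta)
    <= w * si * integral (ybox m) (%p. py p * (f (T p ta))^2 * Tt p ta))" if n: "0 < n" "ka / v0 <= real n" for n
 proof -
  have R: "0 < real n" using n by simp
  obtain m0 where m0: "0 < m0" "!!m. m0 <= m ==> Zs (real n) \<subseteq> ybox m \<and> (\<forall>p\<in>Zs (real n). \<bar>fst p\<bar> < m \<and> (b = Periodic --> \<bar>snd p\<bar> < m))"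
   using Zs_ybox[of "real n"] by blast
  let ?e = "%ta p. w * \<bar>edens (real n) ta p\<bar>"
  have a: "continuous_on (ybox m) (psi (real n))" for m by (rule cont_psi[OF R])
  have b: "0 <= psi (real n) p \<and> psi (real n) p <= indicator (core D) p" for p
   using psi_range[OF R, of p] by (cases "p \<in> core D") (auto simp: psi_def)
  have c: "continuous_on (ybox m) (?e ta) \<and> (\<forall>p. 0 <= ?e ta p) \<and> (\<forall>p. snd p \<in> Yr --> ?e ta p <= indicator (core D) p * rdens K p ta) \<and>
   w * (Psi 1 * (tube_flux u D xi / 16 - r n) - 4 * F^2 * K * U / real n * KD ta) - integral (ybox m) (?e ta)
    <= w * si * integral (ybox m) (%p. psi (real n) p * (f (T p ta))^2 * Tt p ta)"
   if m: "m0 <= m" and ta: "0 < ta" for m ta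
  proof (intro conjI allI impI)
   have mp: "0 < m" using m m0(1) by linarith
   show "continuous_on (ybox m) (?e ta)" by (intro continuous_intros cont_edens R ta mp)
   show "0 <= ?e ta p" for p using w0 by simp
   show "?e ta p <= indicator (core D) p * rdens K p ta" if "snd p \<in> Yr" for p
    unfolding w_def rdens_def by (rule edens_bound[OF R ta v0 n(2) that])
   let ?i = "integral (ybox m) (%p. psi (real n) p * (f (T p ta))^2 * Tt p ta)"
   have "\<bar>?i - Psi 1 * Fl (real n)\<bar> <= 4 * F^2 * K * U / real n * KD ta + integral (ybox m) (%p. \<bar>edens (real n) ta p\<bar>)"
    by (rule tube_rate[OF R ta mp]) (use m0(2)[OF m] in blast)+
   then have "\<bar>si * (?i - Psi 1 * Fl (real n))\<bar> <= 4 * F^2 * K * U / real n * KD ta + integral (ybox m) (%p. \<bar>edens (real n) ta p\<bar>)"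
    unfolding abs_mult s1 by simp
   moreover have "Psi 1 * (tube_flux u D xi / 16 - r n) <= Psi 1 * (si * Fl (real n))"
    by (rule mult_left_mono[OF r(2)[OF n(1)] P1])
   ultimately have "Psi 1 * (tube_flux u D xi / 16 - r n) - 4 * F^2 * K * U / real n * KD ta - integral (ybox m) (%p. \<bar>edens (real n) ta p\<bar>) <= si * ?i"
    unfolding right_diff_distrib[of si] mult.left_commute[of si] by linarith
   from mult_left_mono[OF this less_imp_le[OF w0]]
   show "w * (Psi 1 * (tube_flux u D xi / 16 - r n) - 4 * F^2 * K * U / real n * KD ta) - integral (ybox m) (?e ta) <= w * si * ?i"
    unfolding integral_mult_right by (simp only: right_diff_distrib mult.assoc)
  qed
  show ?thesis
   by (rule exI[of _ m0], intro conjI allI impI m0(1), rule exI[of _ "psi (real n)"], rule exI[of _ ?e], intro conjI allI impI a b[THEN conjunct1] b[THEN conjunct2]) (use c in blast)+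
 qed
 then show ?thesis using s1 r(1) by blast
qed

end

context reactive_flow
begin

lemma eb_mono: "0 <= Lip ==> 0 < n ==> n <= R ==> eb Lip t R <= eb Lip t n"
 unfolding eb_def using pos KD_nonneg by (intro divide_left_mono) (auto intro!: add_nonneg_nonneg mult_nonneg_nonneg)

lemma rdens_nonneg: "0 < ta ==> 0 < K ==> snd p \<in> Yr ==> 0 <= rdens K p ta"
 unfolding rdens_def using pos f_unit[OF T_unit[of p ta]] by (intro mult_nonneg_nonneg add_nonneg_nonneg) auto

text \<open>The dissipation is available only with a cutoff, so the slab is doubled, at the price of
  the factor 2 in front of it.\<close>

lemma rdens_integral_bound:
 assumes K: "0 < K" and m: "0 < m" and t: "1 <= t"
 shows "continuous_on {1..t} (%ta. integral (slab m) (%p. rdens K p ta))"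
  "integral {1..t} (%ta. integral (slab m) (%p. rdens K p ta)) <= (2 * F + 5 * K * F + F^2) * (fuel (2 * m) t + 2 * dissip (2 * m) t)"
proof -
 let ?C = "2 * F + 5 * K * F + F^2"
 have C: "0 <= ?C" using pos K by simp
 let ?i = "%ta. integral (slab m) (%p. rdens K p ta)"
 let ?j = "%ta. integral (slab (2 * m)) (%p. f (T p ta))"
 let ?k = "%ta. integral (slab (2 * m)) (%p. cutoff (2 * m) (fst p) * f (T p ta) * gsq p ta)"
 note cz = cont_f_slab_time[OF zero_le_one] continuous_grad_slab[OF zero_less_one]
 have cg: "continuous_on ({1..t} \<times> slab R) (%z. gsq (snd z) (fst z))" for R by (intro continuous_intros cz)
 show ci: "continuous_on {1..t} ?i"
  by (rule cont_slab_time) (unfold rdens_def, intro continuous_intros cz)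
 have cj: "continuous_on {1..t} ?j" by (rule cont_slab_time) (intro cz)
 have ck: "continuous_on {1..t} ?k" by (rule cont_slab_time) (intro continuous_intros cz)
 have le: "?i ta <= ?C * (q * ?j ta + 2 * (ka * ?k ta))" if "ta \<in> {1..t}" for ta
 proof -
  have ta: "0 < ta" "0 <= ta" using that by auto
  have c1: "continuous_on (slab R) (%p. f (T p ta))" for R by (rule cont_box_f[OF ta(2)])
  have c2: "continuous_on (slab R) (%p. f (T p ta) * gsq p ta)" for R by (intro continuous_intros c1 cont_box ta)
  have "?i ta = ?C * (q * integral (slab m) (%p. f (T p ta)) + ka * integral (slab m) (%p. f (T p ta) * gsq p ta))"
  proof -
   have "?i ta = ?C * integral (slab m) (%p. q * f (T p ta) + ka * (f (T p ta) * gsq p ta))"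
    unfolding rdens_def integral_mult_right by (simp only: mult.assoc)
   also have "integral (slab m) (%p. q * f (T p ta) + ka * (f (T p ta) * gsq p ta))
    = integral (slab m) (%p. q * f (T p ta)) + integral (slab m) (%p. ka * (f (T p ta) * gsq p ta))"
    by (intro integral_add box_integrable continuous_on_mult_left c1 c2)
   finally show ?thesis unfolding integral_mult_right .
  qed
  also have "... <= ?C * (q * ?j ta + ka * (2 * ?k ta))"
  proof (intro mult_left_mono add_mono C)
   show "integral (slab m) (%p. f (T p ta)) <= ?j ta"
    by (rule slab_integral_mono[OF c1]) (use m f_T_bounds ta in auto)
   have "integral (slab m) (%p. f (T p ta) * gsq p ta) <= 2 * integral (slab (2 * m)) (%p. cutoff (2 * m) (fst p) * (f (T p ta) * gsq p ta))"
    by (rule slab_le_cutoff[OF m c2]) (intro mult_nonneg_nonneg, simp_all add: f_T_bounds ta)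
   then show "integral (slab m) (%p. f (T p ta) * gsq p ta) <= 2 * ?k ta" by (simp only: mult.assoc)
  qed (use pos in auto)
  finally show ?thesis by (simp only: mult.left_commute)
 qed
 have "integral {1..t} ?i <= integral {1..t} (%ta. ?C * (q * ?j ta + 2 * (ka * ?k ta)))"
  by (rule integral_le) (auto intro!: integrable_continuous_real ci cj ck continuous_intros le)
 also have "... = ?C * (integral {1..t} (%ta. q * ?j ta + 2 * (ka * ?k ta)))" by (rule integral_mult_right)
 also have "integral {1..t} (%ta. q * ?j ta + 2 * (ka * ?k ta)) = integral {1..t} (%ta. q * ?j ta) + integral {1..t} (%ta. 2 * (ka * ?k ta))"
  by (intro integral_add integrable_continuous_real continuous_on_mult_left cj ck)
 also have "... = fuel (2 * m) t + 2 * dissip (2 * m) t" unfolding fuel_def dissip_def integral_mult_right ..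
 finally show "integral {1..t} ?i <= ?C * (fuel (2 * m) t + 2 * dissip (2 * m) t)" .
qed

lemma cont_dom_T: "0 <= ta ==> continuous_on (UNIV \<times> Yr) (%p. T p ta)"
 by (intro flow_cont continuous_intros) auto

lemma cont_rdens: "0 < ta ==> continuous_on (UNIV \<times> Yr) (%p. rdens K p ta)"
 unfolding rdens_def by (intro continuous_intros flow_cont) (auto intro!: T_unit[simplified])

text \<open>The rates of all tubes are added and integrated over \<open>[1, t]\<close>. The error
  densities and the changes of \<open>Psi(T)\<close> are supported in disjoint cores, so both sums
  are bounded by single integrals over the slab. The displacement of \<open>T\<close> enters in
  absolute value, so the signs \<open>si\<close> do no harm and fluxes in opposite directions add
  up.\<close>

lemma percolation_bound_step:
 fixes D :: "'j => tube" and sg :: "'j => bool"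
 assumes J: "finite J" and K: "0 < K"
  and tubes: "!!j. j \<in> J ==> open (core (D j)) \<and> core (D j) \<subseteq> UNIV \<times> Yr \<and> 0 < hw (D j)"
  and disj: "!!i j (k::int). i \<in> J ==> j \<in> J ==> i ~= j \<or> k ~= 0 ==> disjnt (core (D i)) ((+) (0, of_int k * H) ` core (D j))"
  and t: "1 <= t" and m: "0 < m"
  and w: "!!j. j \<in> J ==> 0 <= w j \<and> w j <= 1" and si: "!!j. j \<in> J ==> \<bar>si j\<bar> = (1::real)"
  and py: "!!j. j \<in> J ==> continuous_on (ybox m) (py j)" "!!j p. j \<in> J ==> 0 <= py j p \<and> py j p <= indicator (core (D j)) p"
  and e: "!!j ta. j \<in> J ==> 0 < ta ==> continuous_on (ybox m) (e j ta) \<and> (\<forall>p. 0 <= e j ta p) \<and> (\<forall>p. snd p \<in> Yr --> e j ta p <= indicator (core (D j)) p * rdens K p ta)"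
  and rate: "!!j ta. j \<in> J ==> ta \<in> {1..t} ==>
   S j - integral (ybox m) (e j ta) <= w j * si j * integral (ybox m) (%p. py j p * (f (T p ta))^2 * Tt p ta)"
 shows "(t - 1) * (\<Sum>j\<in>J. S j) <= 2 * F^2 * (fuel (2 * m) t + 2 * cool t + (t - 1) * eb 1 t (2 * m))
  + (2 * F + 5 * K * F + F^2) * (fuel (2 * m) t + 2 * dissip (2 * m) t)"
proof -
 \<comment> \<open>The comparison of sets asks for openness at every index, also outside
   \<open>J\<close>.\<close>
 define A where "A j = (if j \<in> J then core (D j) else {})" for j
 have A: "open (A j)" "A j \<subseteq> UNIV \<times> Yr" for j using tubes[of j] by (simp_all add: A_def)
 have Ad: "disjnt (A i) ((+) (0, of_int k * H) ` A j)" if "i \<in> J" "j \<in> J" "i ~= j \<or> k ~= 0" for i j and k :: int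
  using disj[OF that] that by (simp add: A_def)
 have t0: "0 <= t" "0 < t" using t by auto
 let ?I = "%j ta. integral (ybox m) (%p. py j p * Psi (T p ta))"
 let ?I' = "%j ta. integral (ybox m) (%p. py j p * (f (T p ta))^2 * Tt p ta)"
 let ?Y = "%ta. \<Sum>j\<in>J. w j * si j * ?I j ta"
 let ?Y' = "%ta. \<Sum>j\<in>J. w j * si j * ?I' j ta"
 let ?g = "%ta. integral (slab m) (%p. rdens K p ta)"
 note g = rdens_integral_bound[OF K m t]
 have dY: "(?Y has_real_derivative ?Y' ta) (at ta)" if "0 < ta" for ta
  by (intro DERIV_sum DERIV_cmult box_time_derivative[OF that C2fun_Psi ybox(1)[OF m]] py(1))
 have hY: "(?Y' has_integral ?Y t - ?Y 1) {1..t}"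
  by (rule fundamental_theorem_of_calculus[OF t])
   (auto intro!: has_field_derivative_at_within[OF dY] simp: vector_derivative_iff)
 have hg: "((%ta. (\<Sum>j\<in>J. S j) - ?g ta) has_integral ((t - 1) * (\<Sum>j\<in>J. S j) - integral {1..t} ?g)) {1..t}"
  using has_integral_diff[OF has_integral_const_real[of "\<Sum>j\<in>J. S j" 1 t] integrable_integral[OF integrable_continuous_real[OF g(1)]]] t by simp
 have hle: "(\<Sum>j\<in>J. S j) - ?g ta <= ?Y' ta" if "ta \<in> {1..t}" for ta
 proof -
  have ta: "0 < ta" using that by auto
  have "(\<Sum>j\<in>J. integral (ybox m) (e j ta)) <= ?g ta"
  proof (rule cores_integral_le[OF J A m Ad cont_rdens[OF ta] rdens_nonneg[OF ta K]])
   fix p assume "b = Periodic"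
   from bc_Periodic[OF this ta, of "fst p" "snd p"] show "rdens K (fst p, snd p + H) ta = rdens K p ta" by (simp add: rdens_def)
  next
   fix j p assume j: "j \<in> J" and p: "p \<in> ybox m"
   have Y: "snd p \<in> Yr" by (rule ybox(3)[OF m p])
   have "e j ta p <= indicator (core (D j)) p * rdens K p ta" using e[OF j ta] Y by blast
   then show "e j ta p <= indicator (A j) p * rdens K p ta" using j by (simp only: A_def if_True)
   show "0 <= e j ta p" using e[OF j ta] by blast
  qed (use e[OF _ ta] in blast)+
  moreover have "(\<Sum>j\<in>J. S j) - (\<Sum>j\<in>J. integral (ybox m) (e j ta)) <= ?Y' ta"
   unfolding sum_subtractf[symmetric] by (intro sum_mono rate that)
  ultimately show ?thesis by linarith
 qed
 have 1: "(t - 1) * (\<Sum>j\<in>J. S j) - integral {1..t} ?g <= ?Y t - ?Y 1"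
  by (rule has_integral_le[OF hg hY hle])
 let ?B = "%j p. py j p * \<bar>Psi (T p t) - Psi (T p 1)\<bar>"
 let ?G = "%p. F^2 * \<bar>T p t - T p 1\<bar>"
 have cP: "continuous_on (ybox m) (%p. Psi (T p s))" if "0 <= s" for s
  by (intro cont_compose_unit[OF C2funD(1)[OF C2fun_Psi]] flow_cont continuous_intros,
   erule ybox(3)[OF m], simp add: that, rule T_unit[OF ybox(3)[OF m] that])
 have "?Y t - ?Y 1 = (\<Sum>j\<in>J. w j * si j * (?I j t - ?I j 1))" by (simp add: sum_subtractf[symmetric] right_diff_distrib)
 also have "... <= (\<Sum>j\<in>J. integral (ybox m) (?B j))"
 proof (intro sum_mono)
  fix j assume j: "j \<in> J"
  have c: "continuous_on (ybox m) (%p. py j p * Psi (T p s))" if "0 <= s" for s by (intro continuous_on_mult py(1)[OF j] cP that)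
  have "?I j t - ?I j 1 = integral (ybox m) (%p. py j p * Psi (T p t) - py j p * Psi (T p 1))"
   by (intro integral_diff[symmetric] box_integrable c t0 zero_le_one)
  then have "\<bar>?I j t - ?I j 1\<bar> <= integral (ybox m) (%p. \<bar>py j p * Psi (T p t) - py j p * Psi (T p 1)\<bar>)"
   using integral_abs_le_box[OF continuous_on_diff[OF c[OF t0(1)] c[OF zero_le_one]]] by simp
  also have "... = integral (ybox m) (?B j)"
   using py(2)[OF j] by (intro integral_cong) (simp add: right_diff_distrib[symmetric] abs_mult)
  finally have i: "\<bar>?I j t - ?I j 1\<bar> <= integral (ybox m) (?B j)" .
  have "w j * si j * (?I j t - ?I j 1) <= \<bar>w j * si j * (?I j t - ?I j 1)\<bar>" by (rule abs_ge_self)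
  also have "... = w j * \<bar>?I j t - ?I j 1\<bar>" using w[OF j] si[OF j] by (simp add: abs_mult)
  also have "... <= 1 * integral (ybox m) (?B j)" using w[OF j] i by (intro mult_mono) auto
  finally show "w j * si j * (?I j t - ?I j 1) <= integral (ybox m) (?B j)" by simp
 qed
 also have "... <= integral (slab m) ?G"
 proof (rule cores_integral_le[OF J A m Ad])
  show "continuous_on (UNIV \<times> Yr) ?G" by (intro continuous_intros cont_dom_T t0 zero_le_one)
  fix p assume "b = Periodic"
  from bc_Periodic[OF this t0(2), of "fst p" "snd p"] bc_Periodic[OF this zero_less_one, of "fst p" "snd p"]
  show "?G (fst p, snd p + H) = ?G p" by simp
 next
  fix j p assume j: "j \<in> J" and p: "p \<in> ybox m"
  have Y: "snd p \<in> Yr" by (rule ybox(3)[OF m p])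
  have "\<bar>Psi (T p t) - Psi (T p 1)\<bar> <= F^2 * \<bar>T p t - T p 1\<bar>"
  proof (rule unit_lipschitz[OF C2funD(4)[OF C2fun_Psi]])
   fix s :: real assume "s \<in> {0..1}"
   from f_unit[OF this] show "\<bar>(f s)^2\<bar> <= F^2" by (simp add: power_mono)
  qed (use T_unit[OF Y] t0 in auto)
  then have "?B j p <= indicator (core (D j)) p * ?G p" using py(2)[OF j, of p] by (intro mult_mono) auto
  then show "?B j p <= indicator (A j) p * ?G p" using j by (simp only: A_def if_True)
  show "0 <= ?B j p" using py(2)[OF j, of p] by simp
 next
  fix j assume j: "j \<in> J"
  show "continuous_on (ybox m) (?B j)" by (intro continuous_intros py(1)[OF j] cP t0 zero_le_one)
 qed (simp_all)
 also have "... = F^2 * integral (slab m) (%p. \<bar>T p t - T p 1\<bar>)" by (rule integral_mult_right)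
 also have "... <= F^2 * (2 * (fuel (2 * m) t + 2 * cool t + (t - 1) * eb 1 t (2 * m)))"
 proof (rule mult_left_mono)
  have c: "continuous_on (slab (2 * m)) (%p. \<bar>T p t - T p 1\<bar>)" by (intro continuous_intros cont_box_T t0 zero_le_one)
  have A: "integral (slab m) (%p. \<bar>T p t - T p 1\<bar>) <= 2 * integral (slab (2 * m)) (%p. cutoff (2 * m) (fst p) * \<bar>T p t - T p 1\<bar>)"
   by (rule slab_le_cutoff[OF m c]) simp
  have B: "integral (slab (2 * m)) (%p. cutoff (2 * m) (fst p) * \<bar>T p t - T p 1\<bar>) <= fuel (2 * m) t + 2 * cool t + (t - 1) * eb 1 t (2 * m)"
   by (rule displacement_bound[OF t]) (use m in simp)
  show "integral (slab m) (%p. \<bar>T p t - T p 1\<bar>) <= 2 * (fuel (2 * m) t + 2 * cool t + (t - 1) * eb 1 t (2 * m))"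
   by (rule order_trans[OF A mult_left_mono[OF B]]) simp
 qed simp
 finally have "?Y t - ?Y 1 <= 2 * F^2 * (fuel (2 * m) t + 2 * cool t + (t - 1) * eb 1 t (2 * m))" by (simp only: mult_ac)
 then show ?thesis using 1 g(2) by linarith
qed

end

context flow_with_tube
begin

lemma tube_flux_nonneg: "0 <= tube_flux u D xi"
proof (cases "(%rh. norm (u (P (rh, xi))) * E1 D (rh, xi)) integrable_on {ctr D - hw D..ctr D + hw D}")
 case True
 show ?thesis unfolding tube_flux_def
 proof (rule integral_nonneg[OF True])
  fix rh assume "rh \<in> {ctr D - hw D..ctr D + hw D}"
  then have "(rh, xi) \<in> coords D" by (simp add: coords_def)
  from E_lower(3)[OF this] show "0 <= norm (u (P (rh, xi))) * E1 D (rh, xi)" by simp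
 qed
next
 case False then show ?thesis by (simp add: tube_flux_def not_integrable_integral)
qed

end

context reactive_flow
begin

lemma eb_tendsto: "(%n. eb Lip t (real n)) \<longlonglongrightarrow> 0"
 unfolding eb_def by (rule lim_const_over_n)

text \<open>At fixed \<open>t\<close> the parameter \<open>n\<close> of the test functions tends to
  infinity, which removes \<open>r n\<close>, the flux error and the cutoff errors. The larger box
  size \<open>m\<close> depends on \<open>n\<close>, but \<open>X\<close> bounds the fuel for all of
  them and the cutoff errors decrease in the size.\<close>

lemma percolation_bound:
 fixes D :: "'j => tube" and sg :: "'j => bool"
 assumes J: "finite J" and K: "0 < K"
  and tubes: "!!j. j \<in> J ==> flow_with_tube b H ka q U F lam M0 u u1x u2y f f' T Tt Tx Ty Txx Tyy K (D j) (sg j)"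
  and disj: "!!i j (k::int). i \<in> J ==> j \<in> J ==> i ~= j \<or> k ~= 0 ==> disjnt (core (D i)) ((+) (0, of_int k * H) ` core (D j))"
  and v0: "0 < v0" "q = v0^2 / ka" and t: "1 <= t" and X: "!!n. fuel (real n) t <= X"
 shows "(t - 1) * (Psi 1 / 16 * (\<Sum>j\<in>J. inverse (1 + ka / v0 / hw (D j)) * tube_flux u (D j) (xi j)))
  <= 2 * F^2 * (X + 2 * cool t) + (2 * F + 5 * K * F + F^2) * (X + 2 * (Phi 1 * (X + cool t)))"
proof -
 define w where "w j = inverse (1 + ka / v0 / hw (D j))" for j
 define Q where "Q j si r n m py e \<longleftrightarrow> continuous_on (ybox m) py \<and> (\<forall>p. 0 <= py p \<and> py p <= indicator (core (D j)) p) \<and>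
  (\<forall>ta>0. continuous_on (ybox m) (e ta) \<and> (\<forall>p. 0 <= e ta p) \<and> (\<forall>p. snd p \<in> Yr --> e ta p <= indicator (core (D j)) p * rdens K p ta) \<and>
   w j * (Psi 1 * (tube_flux u (D j) (xi j) / 16 - r n) - 4 * F^2 * K * U / real n * KD ta) - integral (ybox m) (e ta)
    <= w j * si * integral (ybox m) (%p. py p * (f (T p ta))^2 * Tt p ta))"
  for j and si :: real and r :: "nat => real" and n :: nat and m :: real and py :: "plane => real" and e :: "real => plane => real"
 define Q' where "Q' j si r \<longleftrightarrow> \<bar>si\<bar> = 1 \<and> r \<longlonglongrightarrow> 0 \<and> (\<forall>n>0. ka / v0 <= real n --> (\<exists>m0>0. \<forall>m\<ge>m0. \<exists>py e. Q j si r n m py e))" for j si r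
 have "\<exists>si r. Q' j si r" if "j \<in> J" for j
  using flow_with_tube.tube_test_functions[OF tubes[OF that] v0, of "xi j"] unfolding Q'_def Q_def w_def .
 then have "\<exists>sir. Q' j (fst sir) (snd sir)" if "j \<in> J" for j using that by fastforce
 then obtain sir where sir: "!!j. j \<in> J ==> Q' j (fst (sir j)) (snd (sir j))" by metis
 define si where "si j = fst (sir j)" for j
 define r where "r j = snd (sir j)" for j
 have si: "\<bar>si j\<bar> = 1" and r: "r j \<longlonglongrightarrow> 0"
  and ex: "!!n. 0 < n ==> ka / v0 <= real n ==> \<exists>m0>0. \<forall>m\<ge>m0. \<exists>py e. Q j (si j) (r j) n m py e" if "j \<in> J" for j
  using sir[OF that] unfolding Q'_def si_def r_def by blast+
 have core: "open (core (D j)) \<and> core (D j) \<subseteq> UNIV \<times> Yr \<and> 0 < hw (D j)" if "j \<in> J" for j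
  using flow_with_tube.core_open[OF tubes[OF that]] flow_with_tube.core_region[OF tubes[OF that]]
   flow_with_tube.region_S[OF tubes[OF that]] flow_with_tube.hw_pos[OF tubes[OF that]] by blast
 have w: "0 <= w j \<and> w j <= 1" if "j \<in> J" for j
 proof -
  define z where "z = ka / v0 / hw (D j)"
  have "0 < z" unfolding z_def using pos(2) v0(1) core[OF that] by (intro divide_pos_pos) auto
  then show ?thesis unfolding w_def z_def[symmetric] by (simp add: inverse_le_1_iff)
 qed
 define S where "S n j = w j * (Psi 1 * (tube_flux u (D j) (xi j) / 16 - r j n) - 4 * F^2 * K * U * KD t / real n)" for n j
 define Rh where "Rh n = 2 * F^2 * (X + 2 * cool t + (t - 1) * eb 1 t (real n))
  + (2 * F + 5 * K * F + F^2) * (X + 2 * (Phi 1 * (X + cool t) + (t - 1) * eb (Phi 1) t (real n)))" for n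
 have C: "0 <= 2 * F + 5 * K * F + F^2" using pos K by simp
 have step: "(t - 1) * (\<Sum>j\<in>J. S n j) <= Rh n" if n: "0 < n" "ka / v0 <= real n" for n
 proof -
  from ex[OF _ n] have "\<exists>m0. 0 < m0 \<and> (\<forall>m\<ge>m0. \<exists>py e. Q j (si j) (r j) n m py e)" if "j \<in> J" for j using that by blast
  then obtain m0 where m0: "!!j. j \<in> J ==> 0 < m0 j" "!!j m. j \<in> J ==> m0 j <= m ==> \<exists>py e. Q j (si j) (r j) n m py e" by metis
  \<comment> \<open>The sum of the positive thresholds exceeds each of them. A natural number is
    taken because \<open>X\<close> bounds the fuel of slabs of integer size.\<close>
  obtain k :: nat where k: "(\<Sum>j\<in>J. m0 j) + real n <= real k" using real_arch_simple by blast
  define m where "m = real k"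
  have s0: "0 <= (\<Sum>j\<in>J. m0 j)" using m0(1) by (intro sum_nonneg) (simp add: less_imp_le)
  have nm: "real n <= m" and m: "0 < m" using k s0 n(1) unfolding m_def by linarith+
  have m0m: "m0 j <= m" if "j \<in> J" for j
  proof -
   have "m0 j <= (\<Sum>j\<in>J. m0 j)" using m0(1) by (intro member_le_sum[OF that _ J]) (simp add: less_imp_le)
   then show ?thesis using k unfolding m_def by linarith
  qed
  from m0(2)[OF _ m0m] have "\<exists>pye. Q j (si j) (r j) n m (fst pye) (snd pye)" if "j \<in> J" for j using that by fastforce
  then obtain pye where pye: "!!j. j \<in> J ==> Q j (si j) (r j) n m (fst (pye j)) (snd (pye j))" by metis
  define py where "py j = fst (pye j)" for j
  define e where "e j = snd (pye j)" for j
  have q1: "continuous_on (ybox m) (py j)" "0 <= py j p \<and> py j p <= indicator (core (D j)) p"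
   and q2: "0 < ta ==> continuous_on (ybox m) (e j ta) \<and> (\<forall>p. 0 <= e j ta p) \<and> (\<forall>p. snd p \<in> Yr --> e j ta p <= indicator (core (D j)) p * rdens K p ta)"
   and q3: "0 < ta ==> w j * (Psi 1 * (tube_flux u (D j) (xi j) / 16 - r j n) - 4 * F^2 * K * U / real n * KD ta) - integral (ybox m) (e j ta)
    <= w j * si j * integral (ybox m) (%p. py j p * (f (T p ta))^2 * Tt p ta)" if "j \<in> J" for j p ta
   using pye[OF that] unfolding Q_def py_def e_def by blast+
  have rate: "S n j - integral (ybox m) (e j ta) <= w j * si j * integral (ybox m) (%p. py j p * (f (T p ta))^2 * Tt p ta)"
   if j: "j \<in> J" and ta: "ta \<in> {1..t}" for j ta
  proof -
   have "4 * F^2 * K * U / real n * KD ta <= 4 * F^2 * K * U / real n * KD t"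
    using ta pos K by (intro mult_left_mono KD_mono) auto
   then have "S n j <= w j * (Psi 1 * (tube_flux u (D j) (xi j) / 16 - r j n) - 4 * F^2 * K * U / real n * KD ta)"
    unfolding S_def using w[OF j] by (intro mult_left_mono) auto
   then show ?thesis using q3[OF j, of ta] ta by auto
  qed
  have "(t - 1) * (\<Sum>j\<in>J. S n j) <= 2 * F^2 * (fuel (2 * m) t + 2 * cool t + (t - 1) * eb 1 t (2 * m))
   + (2 * F + 5 * K * F + F^2) * (fuel (2 * m) t + 2 * dissip (2 * m) t)"
   by (rule percolation_bound_step[where D=D and w=w and si=si and py=py and e=e])
    (fact J K t m | rule core disj w si q1 q2 rate; assumption)+
  also have "... <= Rh n"
  proof -
   have fX: "fuel (2 * m) t <= X" using X[of "2 * k"] by (simp add: m_def)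
   have R: "0 < real n" "real n <= 2 * m" using n nm m by auto
   have P: "0 <= Phi 1" by (rule Phi1_nonneg)
   have e1: "(t - 1) * eb 1 t (2 * m) <= (t - 1) * eb 1 t (real n)" "(t - 1) * eb (Phi 1) t (2 * m) <= (t - 1) * eb (Phi 1) t (real n)"
    using t eb_mono[OF _ R] P by (auto intro!: mult_left_mono)
   have "Phi 1 * (fuel (2 * m) t + cool t) <= Phi 1 * (X + cool t)" using fX P by (intro mult_left_mono) auto
   moreover have "dissip (2 * m) t <= Phi 1 * (fuel (2 * m) t + cool t) + (t - 1) * eb (Phi 1) t (2 * m)"
    by (rule dissip_bound[OF t]) (use m in simp)
   ultimately have d: "dissip (2 * m) t <= Phi 1 * (X + cool t) + (t - 1) * eb (Phi 1) t (real n)"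
    using e1(2) by linarith
   have b: "fuel (2 * m) t + 2 * dissip (2 * m) t <= X + 2 * (Phi 1 * (X + cool t) + (t - 1) * eb (Phi 1) t (real n))"
    by (rule add_mono[OF fX mult_left_mono[OF d]]) simp
   have a: "fuel (2 * m) t + 2 * cool t + (t - 1) * eb 1 t (2 * m) <= X + 2 * cool t + (t - 1) * eb 1 t (real n)"
    using fX e1(1) by linarith
   show ?thesis unfolding Rh_def by (rule add_mono[OF mult_left_mono[OF a] mult_left_mono[OF b C]]) simp
  qed
  finally show ?thesis .
 qed
 have c0: "(%n. c / real n) \<longlonglongrightarrow> 0" for c by (rule lim_const_over_n)
 have "(%n. (t - 1) * (\<Sum>j\<in>J. S n j)) \<longlonglongrightarrow> (t - 1) * (\<Sum>j\<in>J. w j * (Psi 1 * (tube_flux u (D j) (xi j) / 16 - 0) - 0))"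
  unfolding S_def by (intro tendsto_mult tendsto_const tendsto_sum tendsto_diff c0 r)
 moreover have "Rh \<longlonglongrightarrow> 2 * F^2 * (X + 2 * cool t + (t - 1) * 0)
  + (2 * F + 5 * K * F + F^2) * (X + 2 * (Phi 1 * (X + cool t) + (t - 1) * 0))"
  unfolding Rh_def[abs_def] by (intro tendsto_mult tendsto_const tendsto_add eb_tendsto)
 moreover obtain n0 :: nat where "ka / v0 <= real n0" using real_arch_simple by blast
 then have "(t - 1) * (\<Sum>j\<in>J. S n j) <= Rh n" if "Suc n0 <= n" for n
  using that by (intro step) (auto intro: order_trans)
 ultimately have lim: "(t - 1) * (\<Sum>j\<in>J. w j * (Psi 1 * (tube_flux u (D j) (xi j) / 16 - 0) - 0)) <= 2 * F^2 * (X + 2 * cool t + (t - 1) * 0)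
  + (2 * F + 5 * K * F + F^2) * (X + 2 * (Phi 1 * (X + cool t) + (t - 1) * 0))"
  by (intro LIMSEQ_le) blast+
 have e: "(\<Sum>j\<in>J. w j * (Psi 1 * (tube_flux u (D j) (xi j) / 16 - 0) - 0)) = Psi 1 / 16 * (\<Sum>j\<in>J. w j * tube_flux u (D j) (xi j))"
  by (simp add: sum_distrib_left mult_ac)
 from lim show ?thesis unfolding e by (simp only: w_def mult_zero_right add_0_right)
qed

lemma front_bound:
 assumes v0: "0 < v0" "q = v0^2 / ka" and t: "1 <= t" and X: "!!n. fuel (real n) t <= X"
 shows "v0 * Phi 1 * H * (t - 1) <= (X + Phi 1 * (X + cool t)) / 2"
proof -
 have v2: "v0^2 = q * ka" using v0 pos by simp
 have P: "0 <= Phi 1" by (rule Phi1_nonneg)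
 let ?R = "%n. (X + (Phi 1 * (X + cool t) + (t - 1) * eb (Phi 1) t (real n))) / 2 + v0 * (t - 1) * (4 * F * KD t / real n)"
 have le: "v0 * Phi 1 * H * (t - 1) <= ?R n" if n: "1 <= n" for n
 proof -
  have R: "0 < real n" using n by simp
  have "v0 * Phi 1 * H * (t - 1) <= (fuel (real n) t + dissip (real n) t) / 2 + v0 * (t - 1) * (4 * F * KD t / real n)"
   by (rule front_speed_bound) (use v0 v2 t R in auto)
  moreover have "dissip (real n) t <= Phi 1 * (fuel (real n) t + cool t) + (t - 1) * eb (Phi 1) t (real n)" by (rule dissip_bound[OF t R])
  moreover have "Phi 1 * (fuel (real n) t + cool t) <= Phi 1 * (X + cool t)" using X P by (intro mult_left_mono add_right_mono) auto
  ultimately show ?thesis using X[of n] by argo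
 qed
 have "?R \<longlonglongrightarrow> (X + (Phi 1 * (X + cool t) + (t - 1) * 0)) / 2 + v0 * (t - 1) * 0"
  by (intro tendsto_add tendsto_mult tendsto_const tendsto_divide eb_tendsto lim_const_over_n) simp
 from LIMSEQ_le_const[OF this] le show ?thesis by auto
qed

text \<open>The denominator is the total coefficient of the fuel \<open>X\<close> in the sum of the
  percolation bound and the front bound; the numerator is the smaller of the coefficients of the
  flux and of \<open>v0\<close> in it.\<close>

definition "burn_const K = min (Phi 1) (Psi 1 / 16) / (2 * F^2 + (2 * F + 5 * K * F + F^2) * (1 + 2 * Phi 1) + (1 + Phi 1) / 2)"

text \<open>The two bounds are added with \<open>X = H * integral {0..t} V\<close> and divided by
  \<open>B * H * t\<close>. What remains besides the constant is \<open>cool t / t\<close> and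
  \<open>1 / t\<close>, and both vanish in the limit.\<close>

lemma liminf_bound:
 fixes D :: "'j => tube" and sg :: "'j => bool"
 assumes J: "finite J" and K: "0 < K"
  and tubes: "!!j. j \<in> J ==> flow_with_tube b H ka q U F lam M0 u u1x u2y f f' T Tt Tx Ty Txx Tyy K (D j) (sg j)"
  and disj: "!!i j (k::int). i \<in> J ==> j \<in> J ==> i ~= j \<or> k ~= 0 ==> disjnt (core (D i)) ((+) (0, of_int k * H) ` core (D j))"
  and v0: "0 < v0" "q = v0^2 / ka" and V: "!!ta. 0 < ta ==> V ta = set_lebesgue_integral lborel strip (%p. Tt p ta / H)"
  and P: "0 < Phi 1" "0 < Psi 1"
 shows "ereal (burn_const K * (v0 + (\<Sum>j\<in>J. inverse (1 + ka / v0 / hw (D j)) * (tube_flux u (D j) (xi j) / H))))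
  <= Liminf at_top (%t. ereal (time_average V t))"
proof -
 define C where "C = 2 * F + 5 * K * F + F^2"
 define B where "B = 2 * F^2 + C * (1 + 2 * Phi 1) + (1 + Phi 1) / 2"
 define E where "E = 4 * F^2 + C * 2 * Phi 1 + Phi 1 / 2"
 define Sg where "Sg = (\<Sum>j\<in>J. inverse (1 + ka / v0 / hw (D j)) * tube_flux u (D j) (xi j))"
 have C: "0 < C" using pos K unfolding C_def by (intro add_pos_pos) auto
 have B: "0 < B" unfolding B_def using pos C P by (intro add_nonneg_pos add_nonneg_nonneg mult_nonneg_nonneg) auto
 have Sg0: "0 <= Sg" unfolding Sg_def
 proof (intro sum_nonneg mult_nonneg_nonneg)
  fix j assume j: "j \<in> J"
  have "0 < ka / v0 / hw (D j)" using pos(2) v0(1) flow_with_tube.hw_pos[OF tubes[OF j]] by (intro divide_pos_pos) auto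
  then show "0 <= inverse (1 + ka / v0 / hw (D j))" by simp
  show "0 <= tube_flux u (D j) (xi j)" by (rule flow_with_tube.tube_flux_nonneg[OF tubes[OF j]])
 qed
 define L where "L = Phi 1 * v0 + Psi 1 / 16 * (Sg / H)"
 define h where "h t = ((1 - 1 / t) * L - E / H * (cool t / t)) / B" for t
 have hV: "h t <= time_average V t" if t: "1 <= t" for t
 proof -
  define X where "X = H * integral {0..t} V"
  have X: "fuel (real n) t <= X" for n unfolding X_def by (rule burning_rate_facts(2)[OF V t])
  have "(t - 1) * (Psi 1 / 16 * Sg) <= 2 * F^2 * (X + 2 * cool t) + C * (X + 2 * (Phi 1 * (X + cool t)))"
   unfolding Sg_def C_def by (rule percolation_bound[OF J K tubes disj v0 t X])
  moreover have "v0 * Phi 1 * H * (t - 1) <= (X + Phi 1 * (X + cool t)) / 2" by (rule front_bound[OF v0 t X])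
  moreover have "2 * F^2 * (X + 2 * cool t) + C * (X + 2 * (Phi 1 * (X + cool t))) + (X + Phi 1 * (X + cool t)) / 2 = B * X + E * cool t"
   unfolding B_def E_def by (simp add: field_simps)
  moreover have "(t - 1) * (L * H) = (t - 1) * (Psi 1 / 16 * Sg) + v0 * Phi 1 * H * (t - 1)"
   unfolding L_def using pos by (simp add: field_simps)
  ultimately have "(t - 1) * (L * H) - E * cool t <= B * X" by linarith
  then have "((t - 1) * (L * H) - E * cool t) / (B * (H * t)) <= B * X / (B * (H * t))"
   using B pos t by (intro divide_right_mono) auto
  also have "... = time_average V t" unfolding X_def time_average_def using B pos t by simp
  also have "((t - 1) * (L * H) - E * cool t) / (B * (H * t)) = h t"
   unfolding h_def using B pos t by (simp add: field_simps)
  finally show ?thesis .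
 qed
 have "((%t. (1 - 1 / t) * L - E / H * (cool t / t)) \<longlongrightarrow> (1 - 0) * L - E / H * 0) at_top"
  by (intro tendsto_intros cool_sublinear) (rule tendsto_divide_0[OF tendsto_const filterlim_at_top_imp_at_infinity[OF filterlim_ident]])
 then have "(h \<longlongrightarrow> ((1 - 0) * L - E / H * 0) / B) at_top"
  unfolding h_def[abs_def] using B by (intro tendsto_divide tendsto_const) auto
 then have "((%t. ereal (h t)) \<longlongrightarrow> ereal (L / B)) at_top" by (intro tendsto_ereal) simp
 from lim_imp_Liminf[OF _ this] have "ereal (L / B) = Liminf at_top (%t. ereal (h t))" by simp
 also have "... <= Liminf at_top (%t. ereal (time_average V t))"
  by (rule Liminf_mono) (use hV in \<open>auto intro!: eventually_mono[OF eventually_ge_at_top[of 1]]\<close>)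
 finally have 1: "ereal (L / B) <= Liminf at_top (%t. ereal (time_average V t))" .
 have "min (Phi 1) (Psi 1 / 16) * (v0 + Sg / H) <= L"
 proof -
  have "min (Phi 1) (Psi 1 / 16) * v0 <= Phi 1 * v0" using v0 by (intro mult_right_mono) auto
  moreover have "min (Phi 1) (Psi 1 / 16) * (Sg / H) <= Psi 1 / 16 * (Sg / H)" using Sg0 pos by (intro mult_right_mono) auto
  ultimately show ?thesis unfolding L_def distrib_left by linarith
 qed
 then have "min (Phi 1) (Psi 1 / 16) * (v0 + Sg / H) / B <= L / B" using B by (intro divide_right_mono) auto
 moreover have "burn_const K * (v0 + (\<Sum>j\<in>J. inverse (1 + ka / v0 / hw (D j)) * (tube_flux u (D j) (xi j) / H))) = min (Phi 1) (Psi 1 / 16) * (v0 + Sg / H) / B"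
  unfolding burn_const_def B_def C_def Sg_def by (simp add: sum_divide_distrib)
 ultimately have "ereal (burn_const K * (v0 + (\<Sum>j\<in>J. inverse (1 + ka / v0 / hw (D j)) * (tube_flux u (D j) (xi j) / H)))) <= ereal (L / B)"
  by simp
 then show ?thesis using 1 by (rule order_trans)
qed

end

section \<open>Regularity of the data\<close>

lemma dom_of_eq: "dom_of b H = dmn b H"
 by (cases b) (auto simp: dom_of_def yrange_def)

lemma continuous_nonneg_integral_pos:
 fixes g :: "real => real"
 assumes c: "continuous_on {0..1} g" and g: "!!s. s \<in> {0..1} ==> 0 <= g s" and s: "s \<in> {0..1}" "g s ~= 0"
 shows "0 < integral {0..1} g"
proof -
 have i: "g integrable_on {0..1}" using c by (rule integrable_continuous_real)
 have "0 <= integral {0..1} g" by (rule integral_nonneg[OF i g])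
 moreover have "integral {0..1} g ~= 0"
 proof
  assume "integral {0..1} g = 0"
  then have "(g has_integral 0) (cbox 0 1)" using integrable_integral[OF i] by simp
  from has_integral_0_cbox_imp_0[OF _ _ this, of s] c g s show False by auto
 qed
 ultimately show ?thesis by simp
qed

text \<open>As \<open>f\<close> vanishes at 0 and at 1, a bound on \<open>f'\<close> gives the
  linear bounds at both ends. Both integrals are positive since \<open>f\<close> is continuous,
  nonnegative and not identically 0.\<close>

lemma reaction_bounds:
 assumes "reaction f"
 obtains F f' where "0 < F" "continuous_on {0..1} f" "continuous_on {0..1} f'"
  "!!s. s \<in> {0..1} ==> (f has_real_derivative f' s) (at s within {0..1})"
  "!!s. s \<in> {0..1} ==> 0 <= f s \<and> f s <= F * s \<and> f s <= F * (1 - s) \<and> \<bar>f' s\<bar> <= F"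
  "0 < integral {0..1} f" "0 < integral {0..1} (%s. (f s)^2)"
proof -
 obtain g :: "real => real \<Rightarrow>\<^sub>L real" where g: "continuous_on {0..1} g" "!!s. s \<in> {0..1} ==> (f has_derivative blinfun_apply (g s)) (at s within {0..1})"
  using assms unfolding reaction_def C1_on_def by blast
 define f' where "f' s = blinfun_apply (g s) 1" for s
 have d: "(f has_real_derivative f' s) (at s within {0..1})" if "s \<in> {0..1}" for s
 proof -
  have "blinfun_apply (g s) = (*) (f' s)"
  proof (rule ext)
   fix h show "blinfun_apply (g s) h = f' s * h"
    using blinfun.scaleR_right[of "g s" h 1] by (simp add: f'_def)
  qed
  then show ?thesis using g(2)[OF that] unfolding has_field_derivative_def by simp
 qed
 have cf': "continuous_on {0..1} f'" unfolding f'_def by (intro continuous_intros g(1))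
 have cf: "continuous_on {0..1} f" by (rule DERIV_continuous_on[OF d])
 obtain B where B: "!!s. s \<in> {0..1} ==> \<bar>f' s\<bar> <= B"
  using compact_imp_bounded[OF compact_continuous_image[OF cf' compact_Icc]] unfolding bounded_iff by (metis imageI real_norm_def)
 have B0: "0 <= B" using B[of 0] by auto
 \<comment> \<open>The bound \<open>B\<close> of the derivative is only known to be nonnegative;
   adding 1 makes the constant positive.\<close>
 define F where "F = B + 1"
 have F: "0 < F" "!!s. s \<in> {0..1} ==> \<bar>f' s\<bar> <= F" using B0 B unfolding F_def by (auto intro: add_increasing2 order_trans)
 have f01: "f 0 = 0" "f 1 = 0" using assms by (auto simp: reaction_def)
 have f0: "0 <= f s" if "s \<in> {0..1}" for s
 proof (cases "s = 0 \<or> s = 1")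
  case True then show ?thesis using f01 by auto
 next
  case False
  then have "s \<in> {0<..<1}" using that by auto
  then show ?thesis using assms unfolding reaction_def by blast
 qed
 have lip: "\<bar>f r - f s\<bar> <= F * \<bar>r - s\<bar>" if "r \<in> {0..1}" "s \<in> {0..1}" for r s
  using field_differentiable_bound[of "{0..1}" f f' F s r] d F that by (auto simp: convex_real_interval abs_minus_commute)
 have b: "0 <= f s \<and> f s <= F * s \<and> f s <= F * (1 - s) \<and> \<bar>f' s\<bar> <= F" if s: "s \<in> {0..1}" for s
 proof -
  have "f s <= F * s" using lip[of s 0] f0[OF s] s f01 by simp
  moreover have "f s <= F * (1 - s)" using lip[of s 1] f0[OF s] s f01 by (simp add: abs_minus_commute)
  ultimately show ?thesis using f0[OF s] F(2)[OF s] by blast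
 qed
 obtain s where s: "s \<in> {0..1}" "f s ~= 0" using assms unfolding reaction_def by blast
 have "0 < integral {0..1} f" using continuous_nonneg_integral_pos[OF cf f0 s] .
 moreover have "0 < integral {0..1} (%s. (f s)^2)"
  by (rule continuous_nonneg_integral_pos[of _ s]) (use s in \<open>auto intro!: continuous_intros cf\<close>)
 ultimately show ?thesis using that[OF F(1) cf cf' d b] by blast
qed

lemma Basis_real_prod: "(Basis :: plane set) = {(1,0), (0,1)}"
 by (auto simp: Basis_prod_def)

lemma sum_Basis_real_prod: "(\<Sum>i\<in>(Basis :: plane set). g i) = g (1,0) + g (0,1)"
 unfolding Basis_real_prod by simp

text \<open>From every point of the domain, walls included, arbitrarily short steps along each
  coordinate axis stay inside in at least one sense; at the upper wall the step goes down. This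
  determines the derivative within the domain.\<close>

lemma frechet_derivative_dom:
 fixes g :: "plane => 'a::real_normed_vector"
 assumes H: "0 < H" and p: "p \<in> dmn b H" and d: "(g has_derivative g') (at p within dmn b H)"
 shows "frechet_derivative g (at p within dmn b H) = g'"
proof (rule frechet_derivative_unique_within[OF _ d])
 show "(g has_derivative frechet_derivative g (at p within dmn b H)) (at p within dmn b H)"
  using d by (metis differentiableI frechet_derivative_works)
 fix i :: "plane" and e :: real assume i: "i \<in> Basis" and e: "0 < e"
 show "\<exists>d. 0 < \<bar>d\<bar> \<and> \<bar>d\<bar> < e \<and> p + d *\<^sub>R i \<in> dmn b H"
 proof (cases "i = (1,0)")
  case True
  then show ?thesis using p e by (intro exI[of _ "e/2"]) (auto simp: mem_Times_iff)
 next
  case False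
  then have i01: "i = (0,1)" using i by (simp add: Basis_real_prod)
  show ?thesis
  proof (cases "b = Neumann \<and> snd p = H")
   case True
   then show ?thesis using e H i01 by (intro exI[of _ "- min (e/2) H"]) (auto simp: mem_Times_iff yrange_def)
  next
   case F: False
   show ?thesis
   proof (cases "b = Neumann")
    case True
    then have y: "0 <= snd p" "snd p < H" using p F by (auto simp: yrange_def mem_Times_iff)
    then show ?thesis using e i01 True by (intro exI[of _ "min (e/2) (H - snd p)"]) (auto simp: mem_Times_iff yrange_def)
   next
    case False
    then have "b = Periodic" using bdry.exhaust by blast
    then show ?thesis using e by (intro exI[of _ "e/2"]) (simp add: yrange_def)
   qed
  qed
 qed
qed

lemma slice_x:
 fixes g :: "plane => 'a::real_normed_vector"
 assumes d: "(g has_derivative g') (at (x,y) within UNIV \<times> Y)" and y: "y \<in> Y"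
 shows "((%x. g (x,y)) has_derivative (%h. g' (h,0))) (at x)"
proof -
 have "((%x. (x,y)) has_derivative (%h. (h,0))) (at x)" by (intro has_derivative_Pair has_derivative_ident has_derivative_const)
 moreover have "(g has_derivative g') (at (x,y) within (range (%x. (x,y))))"
  by (rule has_derivative_subset[OF d]) (use y in auto)
 ultimately show ?thesis by (rule has_derivative_in_compose)
qed

lemma slice_y:
 fixes g :: "plane => 'a::real_normed_vector"
 assumes d: "(g has_derivative g') (at (x,y) within UNIV \<times> Y)" and y: "y \<in> Y"
 shows "((%y. g (x,y)) has_derivative (%h. g' (0,h))) (at y within Y)"
proof -
 have "((%y. (x,y)) has_derivative (%h. (0,h))) (at y within Y)" by (intro has_derivative_Pair has_derivative_ident has_derivative_const)
 moreover have "(g has_derivative g') (at (x,y) within ((%y. (x,y)) ` Y))"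
  by (rule has_derivative_subset[OF d]) auto
 ultimately show ?thesis by (rule has_derivative_in_compose)
qed

lemma real_derivative_slices:
 fixes g :: "plane => real"
 assumes d: "(g has_derivative g') (at (x,y) within UNIV \<times> Y)" and y: "y \<in> Y"
 shows "((%x. g (x,y)) has_real_derivative g' (1,0)) (at x)" "((%y. g (x,y)) has_real_derivative g' (0,1)) (at y within Y)"
proof -
 have l: "linear g'" using d by (rule has_derivative_linear)
 have e: "g' (h,0) = g' (1,0) * h" "g' (0,h) = g' (0,1) * h" for h
  using linear_scale[OF l, of h "(1,0)"] linear_scale[OF l, of h "(0,1)"] by (simp_all add: mult.commute[of h])
 have "(%h. g' (h,0)) = (*) (g' (1,0))" "(%h. g' (0,h)) = (*) (g' (0,1))"
  by (rule ext, rule e(1)) (rule ext, rule e(2))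
 then show "((%x. g (x,y)) has_real_derivative g' (1,0)) (at x)" "((%y. g (x,y)) has_real_derivative g' (0,1)) (at y within Y)"
  using slice_x[OF d y] slice_y[OF d y] unfolding has_field_derivative_def by simp_all
qed

lemma C1_on_continuous: "C1_on S g ==> continuous_on S g"
 unfolding C1_on_def by (auto simp: continuous_on_eq_continuous_within intro: has_derivative_continuous)

lemma periodic_int:
 fixes g :: "real => 'a"
 assumes "!!x. g (x + L) = g x"
 shows "g (x + of_int k * L) = g x"
proof (induction k rule: int_induct[where k=0])
 case (step1 i)
 have "g (x + of_int (i + 1) * L) = g (x + of_int i * L + L)" by (simp add: algebra_simps)
 then show ?case using assms step1 by simp
next
 case (step2 i)
 have "g (x + of_int i * L) = g (x + of_int (i - 1) * L + L)" by (simp add: algebra_simps)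
 then show ?case using assms step2 by simp
qed simp

lemma period_shift:
 fixes x L :: real
 assumes "0 < L"
 obtains k :: int where "0 <= x + of_int k * L" "x + of_int k * L <= L"
proof -
 have "of_int \<lfloor>x / L\<rfloor> * L <= x" "x <= (of_int \<lfloor>x / L\<rfloor> + 1) * L"
  using floor_divide_lower[OF assms, of x] floor_divide_upper[OF assms, of x] by simp_all
 then show ?thesis using that[of "- \<lfloor>x / L\<rfloor>"] by (simp add: algebra_simps)
qed

text \<open>Periodicity reduces the bound on \<open>u\<close> and the Lipschitz bound for points at
  distance at most 1 to a compact convex cell. Points further apart satisfy the Lipschitz bound by
  boundedness alone.\<close>

lemma flow_regularity:
 fixes u :: "plane => plane"
 assumes H: "0 < H" and u: "C1_on (dmn b H) u"
  and per: "0 < L" "!!p. p \<in> dmn b H ==> u (p + (L,0)) = u p"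
  and pery: "!!x y. b = Periodic ==> u (x, y + H) = u (x, y)"
 obtains U Lip where "0 <= U" "0 < Lip" "!!p. p \<in> dmn b H ==> norm (u p) <= U"
  "!!p p'. p \<in> dmn b H ==> p' \<in> dmn b H ==> norm (u p - u p') <= Lip * norm (p - p')"
proof -
 let ?S = "dmn b H"
 \<comment> \<open>One period cell enlarged by 1, except across walls, so that it also contains the
   second point when the first one has been shifted into the cell.\<close>
 define Q where "Q = cbox (-1, if b = Neumann then 0 else -1) (L + 1, if b = Neumann then H else H + 1)"
 have b: "b = Neumann \<or> b = Periodic" using bdry.exhaust by blast
 have QS: "Q \<subseteq> ?S" using b unfolding Q_def cbox_Pair_eq by (auto simp: yrange_def)
 obtain u' :: "plane => plane \<Rightarrow>\<^sub>L plane" where u': "continuous_on ?S u'"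
  "!!p. p \<in> ?S ==> (u has_derivative blinfun_apply (u' p)) (at p within ?S)"
  using u unfolding C1_on_def by blast
 have cQ: "compact Q" by (simp add: Q_def)
 obtain B where B: "!!p. p \<in> Q ==> norm (u' p) <= B"
  using compact_imp_bounded[OF compact_continuous_image[OF continuous_on_subset[OF u'(1) QS] cQ]] unfolding bounded_iff by blast
 obtain U0 where U0: "!!p. p \<in> Q ==> norm (u p) <= U0"
  using compact_imp_bounded[OF compact_continuous_image[OF continuous_on_subset[OF C1_on_continuous[OF u] QS] cQ]] unfolding bounded_iff by blast
 have lipQ: "norm (u p - u p') <= B * norm (p - p')" if "p \<in> Q" "p' \<in> Q" for p p'
 proof (rule differentiable_bound[of Q u "%p. blinfun_apply (u' p)"])
  show "convex Q" by (simp add: Q_def)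
  fix x assume x: "x \<in> Q"
  show "(u has_derivative blinfun_apply (u' x)) (at x within Q)" by (rule has_derivative_subset[OF u'(2) QS]) (use x QS in blast)
  show "onorm (blinfun_apply (u' x)) <= B" using B[OF x] by (simp add: norm_blinfun.rep_eq)
 qed (use that in auto)
 have shift: "\<exists>v. p + v \<in> cbox (0,0) (L,H) \<and> (\<forall>p'\<in>?S. p' + v \<in> ?S \<and> u (p' + v) = u p')" if p: "p \<in> ?S" for p
 proof -
  obtain k :: int where k: "0 <= fst p + of_int k * L" "fst p + of_int k * L <= L" using period_shift[OF per(1)] by blast
  have kx: "u (x + of_int k * L, y) = u (x, y)" if "y \<in> yrange b H" for x y
   by (rule periodic_int[of "%x. u (x, y)"]) (use per(2)[of "(_, y)"] that in auto)
  show ?thesis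
  proof (cases "b = Neumann")
   case True
   have "0 <= snd p" "snd p <= H" using p True by (auto simp: yrange_def)
   then have "p + (of_int k * L, 0) \<in> cbox (0,0) (L,H)" using k by (cases p) (simp add: cbox_Pair_eq)
   moreover have "p' + (of_int k * L, 0) \<in> ?S \<and> u (p' + (of_int k * L, 0)) = u p'" if "p' \<in> ?S" for p'
    using kx[of "snd p'" "fst p'"] that by (cases p') simp
   ultimately show ?thesis by blast
  next
   case False
   then have bP: "b = Periodic" using b by blast
   obtain j :: int where j: "0 <= snd p + of_int j * H" "snd p + of_int j * H <= H" using period_shift[OF H] by blast
   have jy: "u (x, y + of_int j * H) = u (x, y)" for x y
    by (rule periodic_int[of "%y. u (x, y)"]) (rule pery[OF bP])
   have "p + (of_int k * L, of_int j * H) \<in> cbox (0,0) (L,H)" using k j by (cases p) (simp add: cbox_Pair_eq)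
   moreover have "p' + (of_int k * L, of_int j * H) \<in> ?S \<and> u (p' + (of_int k * L, of_int j * H)) = u p'" if "p' \<in> ?S" for p'
    using kx[of "snd p' + of_int j * H" "fst p'"] jy[of "fst p'" "snd p'"] bP by (cases p') (simp add: yrange_def)
   ultimately show ?thesis by blast
  qed
 qed
 have base: "cbox (0,0) (L,H) \<subseteq> Q" unfolding Q_def cbox_Pair_eq by auto
 have bd: "norm (u p) <= U0" if "p \<in> ?S" for p
  using shift[OF that] U0 base that by (metis subsetD)
 have "(0,0) \<in> ?S" using H b by (auto simp: yrange_def)
 from bd[OF this] have U00: "0 <= U0" using norm_ge_zero order_trans by blast
 have lip: "norm (u p - u p') <= (max B (2 * U0) + 1) * norm (p - p')" if p: "p \<in> ?S" "p' \<in> ?S" for p p'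
 proof -
  have "norm (u p - u p') <= max B (2 * U0) * norm (p - p')"
  proof (cases "norm (p - p') <= 1")
   case True
   obtain v where v: "p + v \<in> cbox (0,0) (L,H)" "!!p'. p' \<in> ?S ==> p' + v \<in> ?S \<and> u (p' + v) = u p'" using shift[OF p(1)] by blast
   define z where "z = p + v"
   define z' where "z' = p' + v"
   have zz: "norm (z - z') <= 1" using True by (simp add: z_def z'_def)
   have "\<bar>fst (z - z')\<bar> <= norm (z - z')" "\<bar>snd (z - z')\<bar> <= norm (z - z')"
    using norm_fst_le[of "fst (z - z')" "snd (z - z')"] norm_snd_le[of "snd (z - z')" "fst (z - z')"] unfolding prod.collapse real_norm_def .
   then have "\<bar>fst z - fst z'\<bar> <= 1" "\<bar>snd z - snd z'\<bar> <= 1" using zz unfolding fst_diff snd_diff by linarith+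
   moreover have "0 <= fst z" "fst z <= L" "0 <= snd z" "snd z <= H"
    using v(1) unfolding z_def[symmetric] cbox_Pair_eq mem_Times_iff by (simp_all add: box_real)
   moreover have "z' \<in> ?S" using v(2)[OF p(2)] by (simp add: z'_def)
   ultimately have "z' \<in> Q" using b unfolding Q_def cbox_Pair_eq mem_Times_iff
    by (auto simp: box_real yrange_def abs_le_iff)
   moreover have "z \<in> Q" using v(1) base by (auto simp: z_def)
   ultimately have "norm (u z - u z') <= B * norm (z - z')" using lipQ by blast
   then have "norm (u p - u p') <= B * norm (p - p')" using v(2)[OF p(1)] v(2)[OF p(2)] by (simp add: z_def z'_def)
   also have "... <= max B (2 * U0) * norm (p - p')" by (intro mult_right_mono) auto
   finally show ?thesis .
  next
   case False
   have "norm (u p - u p') <= U0 + U0" using bd[OF p(1)] bd[OF p(2)] norm_triangle_ineq4[of "u p" "u p'"] by linarith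
   also have "... = 2 * U0 * 1" by simp
   also have "... <= max B (2 * U0) * norm (p - p')" using False U00 by (intro mult_mono) auto
   finally show ?thesis .
  qed
  then show ?thesis by (simp add: distrib_right add_increasing2)
 qed
 show ?thesis by (rule that[OF U00 _ bd lip]) (use U00 in linarith)+
qed

lemma flow_derivatives:
 fixes u :: "plane => plane"
 assumes H: "0 < H" and u: "C1_on (dmn b H) u"
  and div: "!!p. p \<in> dmn b H ==> divergence (dmn b H) u p = 0"
 obtains u1x u2y where "continuous_on (dmn b H) u1x" "continuous_on (dmn b H) u2y"
  "!!x y. y \<in> yrange b H ==> ((%x. fst (u (x,y))) has_real_derivative u1x (x,y)) (at x)"
  "!!x y. y \<in> yrange b H ==> ((%y. snd (u (x,y))) has_real_derivative u2y (x,y)) (at y within yrange b H)"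
  "!!x y. y \<in> yrange b H ==> u1x (x,y) + u2y (x,y) = 0"
proof -
 let ?S = "dmn b H"
 obtain u' :: "plane => plane \<Rightarrow>\<^sub>L plane" where u': "continuous_on ?S u'"
  "!!p. p \<in> ?S ==> (u has_derivative blinfun_apply (u' p)) (at p within ?S)"
  using u unfolding C1_on_def by blast
 let ?a = "%p. fst (blinfun_apply (u' p) (1,0))"
 let ?c = "%p. snd (blinfun_apply (u' p) (0,1))"
 have c: "continuous_on ?S ?a" "continuous_on ?S ?c" by (intro continuous_intros u'(1))+
 have d: "((%x. fst (u (x,y))) has_real_derivative ?a (x,y)) (at x)"
  "((%y. snd (u (x,y))) has_real_derivative ?c (x,y)) (at y within yrange b H)" if "y \<in> yrange b H" for x y
 proof -
  have p: "(x,y) \<in> ?S" using that by simp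
  from real_derivative_slices(1)[OF has_derivative_fst[OF u'(2)[OF p]] that] real_derivative_slices(2)[OF has_derivative_snd[OF u'(2)[OF p]] that]
  show "((%x. fst (u (x,y))) has_real_derivative ?a (x,y)) (at x)"
   "((%y. snd (u (x,y))) has_real_derivative ?c (x,y)) (at y within yrange b H)" by simp_all
 qed
 have "?a (x,y) + ?c (x,y) = 0" if "y \<in> yrange b H" for x y
 proof -
  have p: "(x,y) \<in> ?S" using that by simp
  show ?thesis using div[OF p] unfolding divergence_def sum_Basis_real_prod ddir_def frechet_derivative_dom[OF H p u'(2)[OF p]]
   by (simp add: inner_prod_def)
 qed
 then show ?thesis using that[OF c d] by blast
qed

text \<open>Regularity identifies the choice operators \<open>deriv\<close> and \<open>ddir\<close>
  with actual derivatives; on the closed strip this rests on uniqueness of derivatives within the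
  domain.\<close>

lemma solution_derivatives:
 assumes H: "0 < H" and reg: "C21_regular (dmn b H) T"
 defines "S \<equiv> dmn b H"
 shows "continuous_on (S \<times> {0<..}) (%(p,t). deriv (T p) t)"
  "continuous_on (S \<times> {0<..}) (%(p,t). ddir S (1,0) (%q. T q t) p)"
  "continuous_on (S \<times> {0<..}) (%(p,t). ddir S (0,1) (%q. T q t) p)"
  "!!x y t. y \<in> yrange b H ==> 0 < t ==> (T (x,y) has_real_derivative deriv (T (x,y)) t) (at t)"
  "!!x y t. y \<in> yrange b H ==> 0 < t ==> ((%x. T (x,y) t) has_real_derivative ddir S (1,0) (%q. T q t) (x,y)) (at x)"
  "!!x y t. y \<in> yrange b H ==> 0 < t ==> ((%y. T (x,y) t) has_real_derivative ddir S (0,1) (%q. T q t) (x,y)) (at y within yrange b H)"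
  "!!x y t. y \<in> yrange b H ==> 0 < t ==> ((%x. ddir S (1,0) (%q. T q t) (x,y)) has_real_derivative ddir S (1,0) (ddir S (1,0) (%q. T q t)) (x,y)) (at x)"
  "!!x y t. y \<in> yrange b H ==> 0 < t ==> ((%y. ddir S (0,1) (%q. T q t) (x,y)) has_real_derivative ddir S (0,1) (ddir S (0,1) (%q. T q t)) (x,y)) (at y within yrange b H)"
proof -
 note fd = frechet_derivative_dom[OF H, of _ b, folded S_def]
 obtain g :: "plane \<times> real => (plane \<times> real) \<Rightarrow>\<^sub>L real" where g: "continuous_on (S \<times> {0<..}) g"
  "!!z. z \<in> S \<times> {0<..} ==> ((%(p,t). T p t) has_derivative blinfun_apply (g z)) (at z within S \<times> {0<..})"
  using reg unfolding C21_regular_def S_def[symmetric] C1_on_def by blast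
 have dp: "((%p. T p t) has_derivative (%h. blinfun_apply (g (p,t)) (h,0))) (at p within S)" if "p \<in> S" "0 < t" for p t
 proof -
  have "((%p. (p,t)) has_derivative (%h. (h,0))) (at p within S)" by (intro has_derivative_Pair has_derivative_ident has_derivative_const)
  moreover have "((%(p,t). T p t) has_derivative blinfun_apply (g (p,t))) (at (p,t) within (%p. (p,t)) ` S)"
   by (rule has_derivative_subset[OF g(2)]) (use that in auto)
  ultimately have "((%p. (%(p,t). T p t) (p,t)) has_derivative (%h. blinfun_apply (g (p,t)) (h,0))) (at p within S)"
   by (rule has_derivative_in_compose)
  then show ?thesis by simp
 qed
 have dt: "(T p has_real_derivative blinfun_apply (g (p,t)) (0,1)) (at t)" if "p \<in> S" "0 < t" for p t
 proof -
  have "((%t. (p,t)) has_derivative (%h. (0,h))) (at t within {0<..})" by (intro has_derivative_Pair has_derivative_ident has_derivative_const)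
  moreover have "((%(p,t). T p t) has_derivative blinfun_apply (g (p,t))) (at (p,t) within (%t. (p,t)) ` {0<..})"
   by (rule has_derivative_subset[OF g(2)]) (use that in auto)
  ultimately have "((%t. (%(p,t). T p t) (p,t)) has_derivative (%h. blinfun_apply (g (p,t)) (0,h))) (at t within {0<..})"
   by (rule has_derivative_in_compose)
  moreover have "(%h. blinfun_apply (g (p,t)) (0,h)) = (*) (blinfun_apply (g (p,t)) (0,1))"
  proof (rule ext)
   fix h show "blinfun_apply (g (p,t)) (0,h) = blinfun_apply (g (p,t)) (0,1) * h"
    using blinfun.scaleR_right[of "g (p,t)" h "(0,1)"] by (simp add: mult.commute)
  qed
  ultimately have "(T p has_derivative (*) (blinfun_apply (g (p,t)) (0,1))) (at t within {0<..})" by simp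
  then show ?thesis using that(2) unfolding has_field_derivative_def by (simp add: at_within_open[of t "{0<..}"])
 qed
 have dd: "ddir S v (%q. T q t) p = blinfun_apply (g (p,t)) (v,0)" if "p \<in> S" "0 < t" for p t v
  unfolding ddir_def using fd[OF that(1) dp[OF that]] by simp
 have de: "deriv (T p) t = blinfun_apply (g (p,t)) (0,1)" if "p \<in> S" "0 < t" for p t
  by (rule DERIV_imp_deriv[OF dt[OF that]])
 have cg: "continuous_on (S \<times> {0<..}) (%z. blinfun_apply (g z) v)" for v by (intro continuous_intros g(1))
 show "continuous_on (S \<times> {0<..}) (%(p,t). deriv (T p) t)"
  by (rule continuous_on_eq[OF cg[of "(0,1)"]]) (use de in auto)
 show "continuous_on (S \<times> {0<..}) (%(p,t). ddir S (1,0) (%q. T q t) p)"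
  by (rule continuous_on_eq[OF cg[of "((1,0),0)"]]) (use dd in auto)
 show "continuous_on (S \<times> {0<..}) (%(p,t). ddir S (0,1) (%q. T q t) p)"
  by (rule continuous_on_eq[OF cg[of "((0,1),0)"]]) (use dd in auto)
 fix x y t :: real assume y: "y \<in> yrange b H" and t: "0 < t"
 have p: "(x,y) \<in> S" using y by (simp add: S_def)
 show "(T (x,y) has_real_derivative deriv (T (x,y)) t) (at t)" using dt[OF p t] unfolding de[OF p t] .
 show "((%x. T (x,y) t) has_real_derivative ddir S (1,0) (%q. T q t) (x,y)) (at x)"
  "((%y. T (x,y) t) has_real_derivative ddir S (0,1) (%q. T q t) (x,y)) (at y within yrange b H)"
  using real_derivative_slices[OF dp[OF p t, unfolded S_def] y] unfolding dd[OF p t] by simp_all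
 obtain h :: "plane => plane \<Rightarrow>\<^sub>L real" where h: "C1_on S h" "!!p. p \<in> S ==> ((%q. T q t) has_derivative blinfun_apply (h p)) (at p within S)"
  using reg t unfolding C21_regular_def S_def[symmetric] C2_on_def by blast
 obtain h' :: "plane => plane \<Rightarrow>\<^sub>L (plane \<Rightarrow>\<^sub>L real)" where h': "!!p. p \<in> S ==> (h has_derivative blinfun_apply (h' p)) (at p within S)"
  using h(1) unfolding C1_on_def by blast
 have dh: "ddir S v (%q. T q t) p = blinfun_apply (h p) v" if "p \<in> S" for p v
  unfolding ddir_def using fd[OF that h(2)[OF that]] by simp
 have d2: "(ddir S v (%q. T q t) has_derivative (%w. blinfun_apply (blinfun_apply (h' p) w) v)) (at p within S)" if "p \<in> S" for p v
 proof (rule has_derivative_transform[OF that dh])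
  show "((%p. blinfun_apply (h p) v) has_derivative (%w. blinfun_apply (blinfun_apply (h' p) w) v)) (at p within S)"
   using blinfun.FDERIV[OF h'[OF that] has_derivative_const[of v]] by (simp add: blinfun.zero_right)
 qed
 have dd2: "ddir S w (ddir S v (%q. T q t)) p = blinfun_apply (blinfun_apply (h' p) w) v" if "p \<in> S" for p v w
  unfolding ddir_def[of S w] using fd[OF that d2[OF that]] by simp
 show "((%x. ddir S (1,0) (%q. T q t) (x,y)) has_real_derivative ddir S (1,0) (ddir S (1,0) (%q. T q t)) (x,y)) (at x)"
  using real_derivative_slices(1)[OF d2[OF p, of "(1,0)", unfolded S_def] y] unfolding dd2[OF p] unfolding S_def .
 show "((%y. ddir S (0,1) (%q. T q t) (x,y)) has_real_derivative ddir S (0,1) (ddir S (0,1) (%q. T q t)) (x,y)) (at y within yrange b H)"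
  using real_derivative_slices(2)[OF d2[OF p, of "(0,1)", unfolded S_def] y] unfolding dd2[OF p] unfolding S_def .
qed

text \<open>On the side where the squared difference is weighted by a growing exponential, it decays
  at twice the rate \<open>lam\<close>, which leaves at least the decay claimed. On the other side
  the weight itself decays and the data are bounded by 1.\<close>

lemma initial_decay:
 assumes init: "initial_data (UNIV \<times> Y) lam T0" and lam: "0 < lam" and T0: "!!p. snd p \<in> Y ==> 0 <= T0 p \<and> T0 p <= 1"
 obtains M0 where "0 <= M0" "!!x y. y \<in> Y ==> (T0 (x,y))^2 * exp (lam * x) <= M0 * exp (- lam * \<bar>x\<bar>)"
  "!!al x y. y \<in> Y ==> 0 < al ==> al <= lam ==> (1 - T0 (x,y))^2 * exp (- al * x) <= M0 * exp (- al * \<bar>x\<bar>)"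
proof -
 obtain M where M: "!!x y. y \<in> Y ==> (x < 0 --> \<bar>1 - T0 (x, y)\<bar> <= M * exp (lam * x)) \<and> (x > 0 --> \<bar>T0 (x, y)\<bar> <= M * exp (- lam * x))"
 proof -
  from init obtain M where M: "\<forall>(x, y)\<in>(UNIV :: real set) \<times> Y.
    (x < 0 --> \<bar>1 - T0 (x, y)\<bar> <= M * exp (lam * x)) \<and>
    (x > 0 --> \<bar>T0 (x, y)\<bar> <= M * exp (- lam * x)) \<and>
    norm (grad (UNIV \<times> Y) T0 (x, y)) <= M * exp (- lam * \<bar>x\<bar>)" unfolding initial_data_def by blast
  show ?thesis
  proof (rule that[of M])
   fix x :: real and y assume "y \<in> Y"
   then have "(x,y) \<in> UNIV \<times> Y" by simp
   from bspec[OF M this] show "(x < 0 --> \<bar>1 - T0 (x, y)\<bar> <= M * exp (lam * x)) \<and> (x > 0 --> \<bar>T0 (x, y)\<bar> <= M * exp (- lam * x))"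
    unfolding prod.case by blast
  qed
 qed
 have M0: "1 <= M^2 + 1" "M^2 <= M^2 + 1" by auto
 have one: "s^2 * e <= (M^2 + 1) * e" if "0 <= s" "s <= 1" "0 <= e" for s e :: real
 proof -
  have "s^2 <= 1" using that by (simp add: power_le_one)
  then have "s^2 <= M^2 + 1" using M0(1) by linarith
  then show ?thesis using that(3) by (rule mult_right_mono)
 qed
 have two: "s^2 * exp c <= (M^2 + 1) * exp d" if "\<bar>s\<bar> <= M * exp a" "2 * a + c <= d" for s a c d :: real
 proof -
  have "\<bar>s\<bar>\<^sup>2 <= (M * exp a)^2" using that(1) by (intro power_mono) auto
  also have "... = M^2 * exp (2 * a)" unfolding power_mult_distrib exp_double ..
  finally have "s^2 * exp c <= M^2 * exp (2 * a) * exp c" by (intro mult_right_mono) auto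
  also have "... = M^2 * exp (2 * a + c)" by (simp add: exp_add)
  also have "... <= (M^2 + 1) * exp d" using that(2) by (intro mult_mono) auto
  finally show ?thesis .
 qed
 have "(T0 (x,y))^2 * exp (lam * x) <= (M^2 + 1) * exp (- lam * \<bar>x\<bar>)" if y: "y \<in> Y" for x y
 proof (cases "0 < x")
  case True
  show ?thesis by (rule two[where a="- lam * x"]) (use M[OF y, of x] True in auto)
 next
  case False
  then have "lam * x = - lam * \<bar>x\<bar>" by simp
  then show ?thesis using one[of "T0 (x,y)" "exp (- lam * \<bar>x\<bar>)"] T0[of "(x,y)"] y by simp
 qed
 moreover have "(1 - T0 (x,y))^2 * exp (- al * x) <= (M^2 + 1) * exp (- al * \<bar>x\<bar>)" if y: "y \<in> Y" and al: "0 < al" "al <= lam" for al x y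
 proof (cases "x < 0")
  case True
  have "lam * x <= al * x" using True al by (intro mult_right_mono_neg) auto
  then have "2 * (lam * x) + - al * x <= - al * \<bar>x\<bar>" using True by simp
  then show ?thesis by (intro two[where a="lam * x"]) (use M[OF y, of x] True in auto)
 next
  case False
  then have "\<bar>x\<bar> = x" by simp
  then show ?thesis using one[of "1 - T0 (x,y)" "exp (- al * x)"] T0[of "(x,y)"] y by simp
 qed
 ultimately show ?thesis using that[of "M^2 + 1"] by (auto intro: add_nonneg_nonneg)
qed

section \<open>Assembly of the bound from the hypotheses on flow, data and solution\<close>

context reactive_flow
begin

lemma potential_values: "Phi 1 = integral {0..1} f" "Psi 1 = integral {0..1} (%s. (f s)^2)"
 by (simp_all add: Phi_def Psi_def)

lemma burn_const_eq: "burn_const K = min (integral {0..1} f) (integral {0..1} (%s. (f s)^2) / 16)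
 / (2 * F^2 + (2 * F + 5 * K * F + F^2) * (1 + 2 * integral {0..1} f) + (1 + integral {0..1} f) / 2)"
 unfolding burn_const_def potential_values ..

end

lemma solution_burning_bound:
 fixes T :: "plane => real => real" and D :: "bool => nat => tube"
 assumes K: "0 < K" and F: "0 < F" and cf: "continuous_on {0..1} f" and cf': "continuous_on {0..1} f'"
  and df: "!!s. s \<in> {0..1} ==> (f has_real_derivative f' s) (at s within {0..1})"
  and fb: "!!s. s \<in> {0..1} ==> 0 <= f s \<and> f s <= F * s \<and> f s <= F * (1 - s) \<and> \<bar>f' s\<bar> <= F"
  and P: "0 < integral {0..1} f" "0 < integral {0..1} (%s. (f s)^2)"
  and ka: "0 < ka" and v0: "0 < v0" and H: "0 < H" and lam: "0 < lam"
  and perc: "percolating b H K u N D" and init: "initial_data (dom_of b H) lam T0" and sol: "solves b H ka v0 f u T0 T"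
 shows "ereal (min (integral {0..1} f) (integral {0..1} (%s. (f s)^2) / 16)
   / (2 * F^2 + (2 * F + 5 * K * F + F^2) * (1 + 2 * integral {0..1} f) + (1 + integral {0..1} f) / 2)
   * (v0 + (\<Sum>si\<in>UNIV. \<Sum>j=1..N. inverse (1 + ka / v0 / hw (D si j)) * (tube_flux u (D si j) (xi si j) / H))))
  <= Liminf at_top (%t. ereal (time_average (burning_rate H T) t))"
proof -
 define S where "S = (UNIV :: real set) \<times> yrange b H"
 have dom: "dom_of b H = S" by (simp add: S_def dom_of_eq)
 note perc' = perc[unfolded percolating_def dom S_def]
 note r1 = conjunct2[OF perc'] note r2 = conjunct2[OF r1] note r3 = conjunct2[OF r2]
 note r4 = conjunct2[OF r3] note r5 = conjunct2[OF r4] note r6 = conjunct2[OF r5]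
 note uC1 = conjunct1[OF perc'] and per = conjunct1[OF r3] and bcu = conjunct1[OF r4]
 have udiv: "divergence (dmn b H) u p = 0" if "p \<in> dmn b H" for p
  by (rule bspec[OF conjunct1[OF r1] that])
 have zm: "integral {0..H} (%y. fst (u (x, y))) = 0" for x by (rule spec[OF conjunct1[OF r2]])
 have tb: "flow_tube (dmn b H) K u si (D si j)" if "j \<in> {1..N}" for si j
  by (rule bspec[OF spec[OF conjunct1[OF r5]] that])
 have dj: "disjnt (core (D si i)) ((+) (0, of_int k * H) ` core (D ta j))"
  if "i \<in> {1..N}" "j \<in> {1..N}" "(si, i) ~= (ta, j) \<or> k ~= 0" for si ta i j and k :: int
  by (rule mp[OF spec[OF bspec[OF bspec[OF spec[OF spec[OF r6]] that(1)] that(2)]] that(3)])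
 have wall: "snd (u (x, 0)) = 0 \<and> snd (u (x, H)) = 0" if "b = Neumann" for x using bcu that by simp
 have pery: "u (x, y + H) = u (x, y)" if "b = Periodic" for x y using bcu that by simp
 obtain L where L: "0 < L" "!!p. p \<in> dmn b H ==> u (p + (L,0)) = u p" using per by blast
 obtain U Lip where U: "0 <= U" "0 < Lip" "!!p. p \<in> dmn b H ==> norm (u p) <= U"
  "!!p p'. p \<in> dmn b H ==> p' \<in> dmn b H ==> norm (u p - u p') <= Lip * norm (p - p')"
  using flow_regularity[OF H uC1 L pery] by blast
 have ub: "norm (u (x,y)) <= U" if "y \<in> yrange b H" for x y using U(3)[of "(x,y)"] that by simp
 obtain u1x u2y where u12: "continuous_on (dmn b H) u1x" "continuous_on (dmn b H) u2y"
  "!!x y. y \<in> yrange b H ==> ((%x. fst (u (x,y))) has_real_derivative u1x (x,y)) (at x)"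
  "!!x y. y \<in> yrange b H ==> ((%y. snd (u (x,y))) has_real_derivative u2y (x,y)) (at y within yrange b H)"
  "!!x y. y \<in> yrange b H ==> u1x (x,y) + u2y (x,y) = 0"
  using flow_derivatives[OF H uC1 udiv] by blast
 note sol' = sol[unfolded solves_def Let_def dom]
 note q1 = conjunct2[OF sol'] note q2 = conjunct2[OF q1] note q3 = conjunct2[OF q2]
 note q4 = conjunct2[OF q3] note q5 = conjunct2[OF q4]
 note reg = conjunct1[OF sol']
 have Tr: "0 <= T p t \<and> T p t <= 1" if "p \<in> S" "0 <= t" for p t
  using bspec[OF conjunct1[OF q1] that(1)] that(2) by blast
 have pde: "deriv (T p) t + u p \<bullet> grad S (%q. T q t) p = ka * laplacian S (%q. T q t) p + v0^2 / ka * f (T p t)" if "p \<in> S" "0 < t" for p t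
  using bspec[OF conjunct1[OF q2] that(1)] that(2) by blast
 have Ti: "T p 0 = T0 p" if "p \<in> S" for p by (rule bspec[OF conjunct1[OF q3] that])
 note bcT = q5
 have bcN: "ddir S (0, 1) (%q. T q t) (x, 0) = 0 \<and> ddir S (0, 1) (%q. T q t) (x, H) = 0" if "b = Neumann" "0 < t" for x t
  using bcT that by simp
 note sd = solution_derivatives[OF H reg[unfolded S_def], folded S_def]
 \<comment> \<open>Periodicity is assumed for \<open>T\<close> only; that of the first derivatives
   follows from their uniqueness.\<close>
 have bcP: "T (x,y+H) t = T (x,y) t \<and> ddir S (1,0) (%q. T q t) (x,y+H) = ddir S (1,0) (%q. T q t) (x,y)
  \<and> ddir S (0,1) (%q. T q t) (x,y+H) = ddir S (0,1) (%q. T q t) (x,y)" if b: "b = Periodic" and t: "0 < t" for x y t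
 proof (intro conjI)
  have Y: "y \<in> yrange b H" for y using b by (simp add: yrange_def)
  have Tp: "T (x,y+H) t = T (x,y) t" for x y using bcT b t by simp
  then show "T (x,y+H) t = T (x,y) t" .
  show "ddir S (1,0) (%q. T q t) (x,y+H) = ddir S (1,0) (%q. T q t) (x,y)"
   using sd(5)[OF Y t, of "y + H" x] sd(5)[OF Y t, of y x] unfolding Tp by (rule DERIV_unique)
  have "yrange b H = UNIV" using b by (simp add: yrange_def)
  note sy = sd(6)[OF Y t, unfolded this]
  have "((%y. T (x,y+H) t) has_real_derivative ddir S (0,1) (%q. T q t) (x,y+H)) (at y)"
   using sy[of x "y + H"] by (simp only: DERIV_shift)
  then show "ddir S (0,1) (%q. T q t) (x,y+H) = ddir S (0,1) (%q. T q t) (x,y)"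
   using sy[of x y] unfolding Tp by (rule DERIV_unique)
 qed
 have T01: "0 <= T0 p \<and> T0 p <= 1" if "snd p \<in> yrange b H" for p
  using Tr[of p 0] Ti[of p] that by (simp add: S_def mem_Times_iff)
 obtain M0 where M0: "0 <= M0" "!!x y. y \<in> yrange b H ==> (T0 (x,y))^2 * exp (lam * x) <= M0 * exp (- lam * \<bar>x\<bar>)"
  "!!al x y. y \<in> yrange b H ==> 0 < al ==> al <= lam ==> (1 - T0 (x,y))^2 * exp (- al * x) <= M0 * exp (- al * \<bar>x\<bar>)"
  using initial_decay[OF init[unfolded dom S_def] lam T01] by blast
 have flow: "reactive_flow b H ka (v0^2 / ka) U F lam M0 u u1x u2y f f' T (%p t. deriv (T p) t)
   (%p t. ddir S (1,0) (%q. T q t) p) (%p t. ddir S (0,1) (%q. T q t) p)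
   (%p t. ddir S (1,0) (ddir S (1,0) (%q. T q t)) p) (%p t. ddir S (0,1) (ddir S (0,1) (%q. T q t)) p)"
 proof (unfold_locales, fold S_def)
  show "0 < v0^2 / ka" using v0 ka by simp
  show "continuous_on (S \<times> {0..}) (%(p,t). T p t)" using reg by (simp add: C21_regular_def)
  have "\<forall>i\<in>Basis. \<forall>j\<in>Basis. continuous_on (S \<times> {0<..}) (%(p, t). ddir S i (ddir S j (%q. T q t)) p)"
   using reg unfolding C21_regular_def by blast
  then show "continuous_on (S \<times> {0<..}) (%(p,t). ddir S (1,0) (ddir S (1,0) (%q. T q t)) p)"
   "continuous_on (S \<times> {0<..}) (%(p,t). ddir S (0,1) (ddir S (0,1) (%q. T q t)) p)"
   by (simp_all only: Basis_real_prod ball_simps)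
  show "continuous_on S u" using C1_on_continuous[OF uC1] by (simp add: S_def)
  show "continuous_on S u1x" "continuous_on S u2y" using u12(1,2) by (simp_all add: S_def)
 next
  fix x y t :: real assume "y \<in> yrange b H" "0 < t"
  then have p: "(x,y) \<in> S" "0 < t" by (simp_all add: S_def)
  show "deriv (T (x,y)) t = ka * (ddir S (1,0) (ddir S (1,0) (%q. T q t)) (x,y) + ddir S (0,1) (ddir S (0,1) (%q. T q t)) (x,y))
   - (fst (u (x,y)) * ddir S (1,0) (%q. T q t) (x,y) + snd (u (x,y)) * ddir S (0,1) (%q. T q t) (x,y)) + v0^2 / ka * f (T (x,y) t)"
   using pde[OF p] unfolding grad_def laplacian_def sum_Basis_real_prod by (simp add: inner_prod_def)
 next
  fix x y t :: real assume "y \<in> yrange b H" "0 <= t"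
  then show "0 <= T (x,y) t \<and> T (x,y) t <= 1" by (intro Tr) (simp_all add: S_def)
 next
  fix x y :: real assume "y \<in> yrange b H"
  then show "(T (x,y) 0)^2 * exp (lam * x) <= M0 * exp (- lam * \<bar>x\<bar>)" using M0(2) Ti[of "(x,y)"] by (simp add: S_def)
 next
  fix al x y :: real assume "y \<in> yrange b H" "0 < al" "al <= lam"
  then show "(1 - T (x,y) 0)^2 * exp (- al * x) <= M0 * exp (- al * \<bar>x\<bar>)" using M0(3)[of y al x] Ti[of "(x,y)"] by (simp add: S_def)
 qed ((fact H ka F lam M0 U cf cf' zm sd | rule sd wall bcN bcP pery ub u12 df fb; assumption)+)
 \<comment> \<open>The tubes of both orientations form one family, indexed by
   \<open>UNIV \<times> {1..N}\<close>.\<close>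
 let ?D = "%(si, j). D si j"
 have tubes: "flow_with_tube b H ka (v0^2 / ka) U F lam M0 u u1x u2y f f' T (%p t. deriv (T p) t)
   (%p t. ddir S (1,0) (%q. T q t) p) (%p t. ddir S (0,1) (%q. T q t) p)
   (%p t. ddir S (1,0) (ddir S (1,0) (%q. T q t)) p) (%p t. ddir S (0,1) (ddir S (0,1) (%q. T q t)) p) K (?D i) (fst i)"
  if i: "i \<in> UNIV \<times> {1..N}" for i
 proof (rule flow_with_tube.intro[OF flow], rule flow_with_tube_axioms.intro)
  obtain si j where ij: "i = (si, j)" by (cases i)
  have j: "j \<in> {1..N}" using i ij by simp
  show "0 < K" by (rule K)
  show "flow_tube (dmn b H) K u (fst i) (?D i)" using tb[OF j, of si] ij by simp
  show "disjnt (core (?D i)) ((+) (0, of_int k * H) ` core (?D i))" if "k ~= 0" for k :: int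
   using dj[OF j j, of si si k] that ij by simp
  show "\<exists>ga. streamline (dmn b H) u ga \<and> ga 0 = p" if "p \<in> dmn b H" for p
   by (rule streamline_through[OF H U(2) U(4) wall that])
 qed
 have disj: "disjnt (core (?D i)) ((+) (0, of_int k * H) ` core (?D j))"
  if "i \<in> UNIV \<times> {1..N}" "j \<in> UNIV \<times> {1..N}" "i ~= j \<or> k ~= 0" for i j and k :: int
  using dj[of "snd i" "snd j" "fst i" "fst j" k] that by (simp add: split_beta mem_Times_iff)
 have fin: "finite ((UNIV :: bool set) \<times> {1..N})" by simp
 have V: "burning_rate H T ta = set_lebesgue_integral lborel (UNIV \<times> {0..H}) (%p. deriv (T p) ta / H)" if "0 < ta" for ta
  by (rule burning_rate_def)
 note lb = reactive_flow.liminf_bound[where D="?D" and sg=fst and V="burning_rate H T" and xi="%(si, j). xi si j",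
   OF flow fin K tubes disj v0 refl V P[folded reactive_flow.potential_values[OF flow]]]
 have "(\<Sum>i\<in>UNIV \<times> {1..N}. inverse (1 + ka / v0 / hw (?D i)) * (tube_flux u (?D i) ((%(si, j). xi si j) i) / H))
  = (\<Sum>si\<in>UNIV. \<Sum>j=1..N. inverse (1 + ka / v0 / hw (D si j)) * (tube_flux u (D si j) (xi si j) / H))"
  unfolding sum.cartesian_product by (intro sum.cong refl) (simp add: split_beta)
 with lb show ?thesis unfolding reactive_flow.burn_const_eq[OF flow] by (simp only:)
qed

theorem theorem5:
  fixes f :: "real \<Rightarrow> real" and K :: real
  assumes "reaction f" and "KPP_type f \<or> ignition_type f" and "K > 0"
  shows "\<exists>C::real. C > 0 \<and>
    (\<forall>(\<kappa>::real) (v0::real) (H::real) (lam::real) (b::bdry) (u :: plane \<Rightarrow> plane)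
      (N::nat) (D :: bool \<Rightarrow> nat \<Rightarrow> tube) (T0 :: plane \<Rightarrow> real)
      (T :: plane \<Rightarrow> real \<Rightarrow> real) (\<xi> :: bool \<Rightarrow> nat \<Rightarrow> real).
      \<kappa> > 0 \<longrightarrow> v0 > 0 \<longrightarrow> H > 0 \<longrightarrow> lam > 0 \<longrightarrow>
      percolating b H K u N D \<longrightarrow>
      initial_data (dom_of b H) lam T0 \<longrightarrow>
      solves b H \<kappa> v0 f u T0 T \<longrightarrow>
      (let l = \<kappa> / v0 in
        ereal (C * (v0 + (\<Sum>\<sigma>\<in>UNIV. \<Sum>j=1..N.
          inverse (1 + l / hw (D \<sigma> j)) * (tube_flux u (D \<sigma> j) (\<xi> \<sigma> j) / H))))
        \<le> Liminf at_top (\<lambda>t. ereal (time_average (burning_rate H T) t))))"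
proof -
 obtain F f' where f: "0 < F" "continuous_on {0..1} f" "continuous_on {0..1} f'"
  "!!s. s \<in> {0..1} ==> (f has_real_derivative f' s) (at s within {0..1})"
  "!!s. s \<in> {0..1} ==> 0 <= f s \<and> f s <= F * s \<and> f s <= F * (1 - s) \<and> \<bar>f' s\<bar> <= F"
  "0 < integral {0..1} f" "0 < integral {0..1} (%s. (f s)^2)"
  using reaction_bounds[OF assms(1)] by blast
 define C where "C = min (integral {0..1} f) (integral {0..1} (%s. (f s)^2) / 16)
  / (2 * F^2 + (2 * F + 5 * K * F + F^2) * (1 + 2 * integral {0..1} f) + (1 + integral {0..1} f) / 2)"
 have "0 < C" unfolding C_def using f(1,6,7) assms(3)
  by (intro divide_pos_pos add_nonneg_pos add_nonneg_nonneg mult_nonneg_nonneg) auto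
 then show ?thesis
  unfolding Let_def C_def
  by (intro exI conjI allI impI) (assumption, rule solution_burning_bound[OF assms(3) f])
qed
end
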